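(* Let $V$ be a finite nonempty set with $|V|=d$, and let $(\Gamma,\sigma)$ be a CW-regular subdivision of the simplex $2^V$. Then the local $\gamma$-vector of the barycentric subdivision $\mathrm{sd}(\Gamma)$ (viewed as a subdivision of $2^V$ via the natural map $\sigma'$) is nonnegative, i.e., writing $\ell_V(\mathrm{sd}(\Gamma),x)=\sum_{k=0}^{\lfloor d/2\rfloor}\xi_k x^k(1+x)^{d-2k}$, one has $\xi_k\geq 0$ for all $k$.
   Context: For a simplicial complex $\Delta$ of dimension $e-1$ with $f_{i-1}(\Delta)$ faces of cardinality $i$, $h(\Delta,x)=\sum_{i=0}^{e} f_{i-1}(\Delta)x^i(1-x)^{e-i}$. A CW-regular subdivision of $2^V$ is a pair $(\Gamma,\sigma)$ where $\Gamma$ is a finite regular CW-complex with face poset $P(\Gamma)$ and $\sigma:P(\Gamma)\to 2^V$ is a map such that for every $F\subseteq V$: (i) $\Gamma_F:=\{\tau\in P(\Gamma):\sigma(\tau)\subseteq F\}$ forms a subcomplex of $\Gamma$ homeomorphic to a ball of dimension $|F|-1$; (ii) $\sigma^{-1}(F)$ is exactly the set of interior cells of $\Gamma_F$. The barycentric subdivision $\mathrm{sd}(\Gamma)$ is the simplicial complex whose faces are the chains $\tau_0\lneq\tau_1\lneq\cdots\lneq\tau_i$ of nonempty cells of $\Gamma$; it is a (topological) subdivision of $2^V$ via $\sigma'(\{\tau_0,\ldots,\tau_i\})=\sigma(\max\{\tau_0,\ldots,\tau_i\})$, and then $\mathrm{sd}(\Gamma)_F:=(\sigma')^{-1}(2^F)=\mathrm{sd}(\Gamma_F)$.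 The local $h$-polynomial of $\mathrm{sd}(\Gamma)$ (with respect to this map) is $\ell_V(\mathrm{sd}(\Gamma),x)=\sum_{F\subseteq V}(-1)^{d-|F|}h(\mathrm{sd}(\Gamma_F),x)$. It is a symmetric polynomial with $x^i$ and $x^{d-i}$ having equal coefficients, so it can be written uniquely as $\sum_{k=0}^{\lfloor d/2\rfloor}\xi_k x^k(1+x)^{d-2k}$ with $\xi_k\in\mathbb{Z}$; the vector $(\xi_0,\ldots,\xi_{\lfloor d/2\rfloor})$ is the local $\gamma$-vector. *)

theory Defs
  imports "HOL-Analysis.Analysis" "HOL-Computational_Algebra.Polynomial"
begin

section \<open>Balls\<close>

definition unit_ball :: "nat \<Rightarrow> (nat \<Rightarrow> real) topology" where
  "unit_ball n = subtopology (Euclidean_space n) {x. (\<Sum>i<n. x i ^ 2) \<le> 1}"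

definition unit_ball_interior :: "nat \<Rightarrow> (nat \<Rightarrow> real) set" where
  "unit_ball_interior n = {x \<in> topspace (Euclidean_space n). (\<Sum>i<n. x i ^ 2) < 1}"

definition unit_ball_boundary :: "nat \<Rightarrow> (nat \<Rightarrow> real) set" where
  "unit_ball_boundary n = {x \<in> topspace (Euclidean_space n). (\<Sum>i<n. x i ^ 2) = 1}"

text \<open>The dimension is an integer: the ball of dimension \<open>-1\<close> is the empty space.\<close>

definition is_ball :: "int \<Rightarrow> 'a topology \<Rightarrow> bool" where
  "is_ball m T \<longleftrightarrow>
     (if m = -1 then topspace T = {} else 0 \<le> m \<and> unit_ball (nat m) homeomorphic_space T)"

text \<open>The boundary of a space homeomorphic to the \<open>n\<close>-ball. By invariance of domain, the set
  \<open>h ` unit_ball_boundary n\<close> does not depend on the homeomorphism \<open>h\<close>.\<close>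

definition ball_boundary :: "nat \<Rightarrow> 'a topology \<Rightarrow> 'a set" where
  "ball_boundary n T =
     {x. \<exists>h. homeomorphic_map (unit_ball n) T h \<and> x \<in> h ` unit_ball_boundary n}"

section \<open>Finite regular CW-complexes\<close>

text \<open>A finite regular CW-complex is given by its underlying space \<open>X\<close> and the set \<open>C\<close> of its
  (nonempty) open cells. In the finite case closure-finiteness and the weak topology are
  automatic. Regularity is the requirement that the characteristic maps be embeddings.\<close>

definition characteristic_map ::
    "'a topology \<Rightarrow> nat \<Rightarrow> 'a set \<Rightarrow> ((nat \<Rightarrow> real) \<Rightarrow> 'a) \<Rightarrow> bool" where
  "characteristic_map X n e \<Phi> \<longleftrightarrow>
     embedding_map (unit_ball n) X \<Phi> \<and> \<Phi> ` unit_ball_interior n = e"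

definition finite_regular_CW :: "'a topology \<Rightarrow> 'a set set \<Rightarrow> bool" where
  "finite_regular_CW X C \<longleftrightarrow>
     Hausdorff_space X \<and> finite C \<and> disjoint C \<and> \<Union>C = topspace X \<and>
     (\<forall>e\<in>C. \<exists>n \<Phi>. characteristic_map X n e \<Phi> \<and>
        \<Phi> ` unit_ball_boundary n \<subseteq> \<Union>{c \<in> C. \<exists>m<n. \<exists>\<Psi>. characteristic_map X m c \<Psi>})"

text \<open>The face poset contains the empty cell, represented by the empty set. Cells are ordered by
  inclusion of their closures.\<close>

definition face_poset :: "'a set set \<Rightarrow> 'a set set" where
  "face_poset C = insert {} C"

definition face_less :: "'a topology \<Rightarrow> 'a set \<Rightarrow> 'a set \<Rightarrow> bool" where
  "face_less X \<tau> \<rho> \<longleftrightarrow> X closure_of \<tau> \<subset> X closure_of \<rho>"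

definition subcomplex :: "'a topology \<Rightarrow> 'a set set \<Rightarrow> 'a set set \<Rightarrow> bool" where
  "subcomplex X C S \<longleftrightarrow>
     S \<subseteq> face_poset C \<and> {} \<in> S \<and> (\<forall>\<tau>\<in>S. X closure_of \<tau> \<subseteq> \<Union>S)"

text \<open>The interior cells of a set \<open>S\<close> of cells whose union is a ball of dimension \<open>m\<close> are those not
  contained in its boundary. The ball of dimension \<open>-1\<close> consists of the empty cell only and has
  no boundary cells; for \<open>m \<ge> 0\<close> the empty cell lies on the boundary.\<close>

definition interior_cells :: "'a topology \<Rightarrow> int \<Rightarrow> 'a set set \<Rightarrow> 'a set set" where
  "interior_cells X m S =
     (if m = -1 then S
      else {\<tau> \<in> S. \<not> \<tau> \<subseteq> ball_boundary (nat m) (subtopology X (\<Union>S))})"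

section \<open>CW-regular subdivisions of a simplex\<close>

definition restriction :: "'a set set \<Rightarrow> ('a set \<Rightarrow> 'v set) \<Rightarrow> 'v set \<Rightarrow> 'a set set" where
  "restriction C \<sigma> F = {\<tau> \<in> face_poset C. \<sigma> \<tau> \<subseteq> F}"

definition CW_regular_subdivision ::
    "'v set \<Rightarrow> 'a topology \<Rightarrow> 'a set set \<Rightarrow> ('a set \<Rightarrow> 'v set) \<Rightarrow> bool" where
  "CW_regular_subdivision V X C \<sigma> \<longleftrightarrow>
     finite_regular_CW X C \<and> \<sigma> \<in> face_poset C \<rightarrow> Pow V \<and>
     (\<forall>F\<subseteq>V.
        subcomplex X C (restriction C \<sigma> F) \<and>
        is_ball (int (card F) - 1) (subtopology X (\<Union>(restriction C \<sigma> F))) \<and>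
        {\<tau> \<in> face_poset C. \<sigma> \<tau> = F} =
          interior_cells X (int (card F) - 1) (restriction C \<sigma> F))"

section \<open>Barycentric subdivision\<close>

definition sd :: "'a topology \<Rightarrow> 'a set set \<Rightarrow> 'a set set set" where
  "sd X S =
     {c. c \<subseteq> S - {{}} \<and> finite c \<and> pairwise (\<lambda>\<tau> \<rho>. face_less X \<tau> \<rho> \<or> face_less X \<rho> \<tau>) c}"

text \<open>The map \<open>\<sigma>'\<close>, sending a chain to the carrier of its maximum; the maximum of the empty chain
  is the empty cell.\<close>

definition chain_max :: "'a topology \<Rightarrow> 'a set set \<Rightarrow> 'a set" where
  "chain_max X c =
     (if c = {} then {} else (THE \<tau>. \<tau> \<in> c \<and> (\<forall>\<rho>\<in>c. \<rho> = \<tau> \<or> face_less X \<rho> \<tau>)))"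

definition sd_carrier :: "'a topology \<Rightarrow> ('a set \<Rightarrow> 'v set) \<Rightarrow> 'a set set \<Rightarrow> 'v set" where
  "sd_carrier X \<sigma> c = \<sigma> (chain_max X c)"

section \<open>\<open>h\<close>-polynomials, local \<open>h\<close>-polynomials and local \<open>\<gamma>\<close>-vectors\<close>

text \<open>Simplicial complexes are given by their finite, nonempty set of faces, including the empty
  face; \<open>e\<close> below is the dimension plus one.\<close>

definition h_poly :: "'b set set \<Rightarrow> int poly" where
  "h_poly \<Delta> =
     (let e = Max (card ` \<Delta>)
      in \<Sum>i=0..e. of_nat (card {G \<in> \<Delta>. card G = i}) * [:0, 1:] ^ i * [:1, -1:] ^ (e - i))"

definition local_h_poly :: "'v set \<Rightarrow> 'b set set \<Rightarrow> ('b set \<Rightarrow> 'v set) \<Rightarrow> int poly" where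
  "local_h_poly V \<Delta> s =
     (\<Sum>F\<in>Pow V. (-1) ^ (card V - card F) * h_poly {G \<in> \<Delta>. s G \<subseteq> F})"

definition is_local_gamma_vector :: "nat \<Rightarrow> int poly \<Rightarrow> (nat \<Rightarrow> int) \<Rightarrow> bool" where
  "is_local_gamma_vector d p \<xi> \<longleftrightarrow>
     p = (\<Sum>k=0..d div 2. of_int (\<xi> k) * [:0, 1:] ^ k * [:1, 1:] ^ (d - 2 * k))"

section \<open>The restrictions of the barycentric subdivision\<close>

lemma chain_max_works:
  assumes "c \<in> sd X S" "c \<noteq> {}"
  shows "chain_max X c \<in> c \<and> (\<forall>\<rho>\<in>c. \<rho> = chain_max X c \<or> face_less X \<rho> (chain_max X c))"
proof -
  have fin: "finite c" and
    pw: "pairwise (\<lambda>\<tau> \<rho>. face_less X \<tau> \<rho> \<or> face_less X \<rho> \<tau>) c"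
    using assms by (auto simp: sd_def)
  obtain M where M: "M \<in> (\<lambda>\<tau>. X closure_of \<tau>) ` c"
    "\<And>B. B \<in> (\<lambda>\<tau>. X closure_of \<tau>) ` c \<Longrightarrow> M \<subseteq> B \<Longrightarrow> M = B"
    using finite_has_maximal[of "(\<lambda>\<tau>. X closure_of \<tau>) ` c"] fin assms(2) by auto
  then obtain \<tau> where \<tau>: "\<tau> \<in> c" "M = X closure_of \<tau>" by auto
  have max: "\<rho> = \<tau> \<or> face_less X \<rho> \<tau>" if "\<rho> \<in> c" for \<rho>
  proof (rule ccontr)
    assume "\<not> ?thesis"
    then have "face_less X \<tau> \<rho>" using pw \<tau>(1) that by (auto simp: pairwise_def)
    moreover have "X closure_of \<rho> \<in> (\<lambda>\<tau>. X closure_of \<tau>) ` c" using that by simp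
    ultimately show False using M(2) \<tau>(2) by (metis face_less_def psubset_eq)
  qed
  have "\<exists>!\<tau>. \<tau> \<in> c \<and> (\<forall>\<rho>\<in>c. \<rho> = \<tau> \<or> face_less X \<rho> \<tau>)"
  proof (rule ex1I[of _ \<tau>])
    show "\<tau> \<in> c \<and> (\<forall>\<rho>\<in>c. \<rho> = \<tau> \<or> face_less X \<rho> \<tau>)" using \<tau>(1) max by simp
    fix \<tau>' assume a: "\<tau>' \<in> c \<and> (\<forall>\<rho>\<in>c. \<rho> = \<tau>' \<or> face_less X \<rho> \<tau>')"
    show "\<tau>' = \<tau>"
    proof (rule ccontr)
      assume "\<tau>' \<noteq> \<tau>"
      then have "face_less X \<tau> \<tau>'" "face_less X \<tau>' \<tau>" using a \<tau>(1) max by auto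
      then show False by (simp add: face_less_def)
    qed
  qed
  from theI'[OF this] show ?thesis
    using assms(2) by (simp add: chain_max_def)
qed

lemma sd_restriction:
  assumes "CW_regular_subdivision V X C \<sigma>" "F \<subseteq> V"
  shows "{c \<in> sd X (face_poset C). sd_carrier X \<sigma> c \<subseteq> F} = sd X (restriction C \<sigma> F)"
proof -
  let ?R = "restriction C \<sigma> F"
  have sub: "subcomplex X C ?R" and cw: "finite_regular_CW X C"
    using assms by (auto simp: CW_regular_subdivision_def)
  have empty: "{} \<in> ?R" using sub by (simp add: subcomplex_def)
  have disj: "disjoint C" and un: "\<Union>C = topspace X"
    using cw by (auto simp: finite_regular_CW_def)
  have down: "\<rho> \<in> ?R" if "\<tau> \<in> ?R" "\<rho> \<in> C" "\<rho> \<noteq> {}" "face_less X \<rho> \<tau>" for \<rho> \<tau>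
  proof -
    have "\<rho> \<subseteq> X closure_of \<rho>"
      using un that(2) by (intro closure_of_subset) auto
    also have "\<dots> \<subseteq> X closure_of \<tau>" using that(4) by (auto simp: face_less_def)
    also have "\<dots> \<subseteq> \<Union>?R" using sub that(1) by (auto simp: subcomplex_def)
    finally have "\<rho> \<subseteq> \<Union>?R" .
    with \<open>\<rho> \<noteq> {}\<close> obtain x \<tau>' where x: "x \<in> \<rho>" "x \<in> \<tau>'" "\<tau>' \<in> ?R" by blast
    then have "\<tau>' \<in> C" by (auto simp: restriction_def face_poset_def)
    then have "\<tau>' = \<rho>" using disj x that(2) by (auto simp: disjoint_def)
    then show ?thesis using x by simp
  qed
  show ?thesis
  proof (intro set_eqI iffI)
    fix c assume c: "c \<in> {c \<in> sd X (face_poset C). sd_carrier X \<sigma> c \<subseteq> F}"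
    then have csd: "c \<in> sd X (face_poset C)" by simp
    have "c \<subseteq> ?R"
    proof (cases "c = {}")
      case False
      note m = chain_max_works[OF csd False]
      have max: "chain_max X c \<in> ?R"
        using c m csd by (auto simp: restriction_def sd_carrier_def sd_def)
      show ?thesis
      proof
        fix \<rho> assume \<rho>: "\<rho> \<in> c"
        then have cell: "\<rho> \<in> C" "\<rho> \<noteq> {}" using csd by (auto simp: sd_def face_poset_def)
        from m \<rho> consider "\<rho> = chain_max X c" | "face_less X \<rho> (chain_max X c)" by auto
        then show "\<rho> \<in> ?R"
        proof cases
          case 1 then show ?thesis using max by simp
        next
          case 2 then show ?thesis by (rule down[OF max cell])
        qed
      qed
    qed simp
    then show "c \<in> sd X ?R" using csd by (auto simp: sd_def)
  next
    fix c assume c: "c \<in> sd X ?R"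
    then have "c \<in> sd X (face_poset C)" by (auto simp: sd_def restriction_def)
    moreover have "chain_max X c \<in> ?R"
    proof (cases "c = {}")
      case True then show ?thesis using empty by (simp add: chain_max_def)
    next
      case False
      then show ?thesis using chain_max_works[OF c False] c by (auto simp: sd_def)
    qed
    ultimately show "c \<in> {c \<in> sd X (face_poset C). sd_carrier X \<sigma> c \<subseteq> F}"
      by (auto simp: sd_carrier_def restriction_def)
  qed
qed

lemma local_h_poly_sd:
  assumes "CW_regular_subdivision V X C \<sigma>"
  shows "local_h_poly V (sd X (face_poset C)) (sd_carrier X \<sigma>) =
    (\<Sum>F\<in>Pow V. (-1) ^ (card V - card F) * h_poly (sd X (restriction C \<sigma> F)))"
  unfolding local_h_poly_def using sd_restriction[OF assms] by (intro sum.cong) auto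

end

theory Submission
  imports Defs "HOL-Homology.Homology" "HOL-Library.Function_Algebras"
begin

text \<open>Write \<open>u \<tau>\<close> for the generating polynomial of the chains of cells with maximum \<open>\<tau>\<close>, weighted
  by \<open>x ^ card c * (1 - x) ^ (rk \<tau> - card c)\<close>, and let \<open>I F\<close> be the sum of
  \<open>u \<tau> * (1 - x) ^ (card F - rk \<tau>)\<close> over the cells with carrier \<open>F\<close>. Then the local
  \<open>h\<close>-polynomial is the sum over \<open>F \<subseteq> V\<close> of \<open>\<theta> F * d (card (V - F))\<close>, where \<open>d n\<close> is the
  \<open>n\<close>-th derangement polynomial and
  \<open>\<theta> F = I F - x * (\<Sum>G \<subset> F. I G * (1 - x) ^ (card F - card G - 1))\<close>. Derangement polynomials have
  nonnegative \<open>\<gamma>\<close>-vectors by a convolution recursion with Eulerian polynomials.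

  For \<open>\<theta> F\<close> one follows Karu's proof of the nonnegativity of the cd-index. The constant sheaf on
  the interior cells of the ball \<open>\<Gamma>\<^sub>F\<close> is Cohen--Macaulay: its cellular complexes on the stars of
  all cells are exact below the top degree. Dualising a skeleton and dividing by a generic linear
  map produces Cohen--Macaulay families of smaller dimension, and keeping track of dimensions
  expresses \<open>\<theta> F\<close> as a polynomial in \<open>x\<close> and \<open>1 + x\<close> with nonnegative coefficients.

  The exactness statements come from singular homology: a ball minus a boundary point is contractible
  relative to the ball, a ball minus an interior point retracts to the boundary, and the complement
  of a point of an open cell retracts to the complement of the star of that cell.\<close>

section \<open>Linear algebra\<close>

instantiation "fun" :: (type, real_vector) real_vector
begin

definition scaleR_fun :: "real \<Rightarrow> ('a \<Rightarrow> 'b) \<Rightarrow> 'a \<Rightarrow> 'b" where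
  "scaleR_fun r f = (\<lambda>x. r *\<^sub>R f x)"

instance
  by standard (auto simp: scaleR_fun_def fun_eq_iff algebra_simps)

end

lemma scaleR_fun_apply [simp]: "(r *\<^sub>R f) x = r *\<^sub>R f x"
  by (simp add: scaleR_fun_def)

lemma sum_fun_apply: "(\<Sum>i\<in>A. f i) x = (\<Sum>i\<in>A. f i x)"
  by (induction A rule: infinite_finite_induct) auto

definition fin_dim :: "'v::real_vector set \<Rightarrow> bool" where
  "fin_dim S \<longleftrightarrow> (\<exists>B. finite B \<and> S \<subseteq> span B)"

lemma fin_dim_subset: "fin_dim T \<Longrightarrow> S \<subseteq> T \<Longrightarrow> fin_dim S"
  unfolding fin_dim_def by blast

lemma fin_dim_real: "fin_dim (S :: real set)"
proof -
  have "x \<in> span {1}" for x :: real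
    using real_vector.span_scale[OF real_vector.span_base[of 1 "{1::real}"], of x] by simp
  then show ?thesis unfolding fin_dim_def by (intro exI[of _ "{1}"]) auto
qed

lemma fin_dim_basis:
  fixes S :: "'v::real_vector set"
  assumes "fin_dim S"
  obtains B where "finite B" "B \<subseteq> S" "independent B" "S \<subseteq> span B" "card B = dim S"
proof -
  obtain B0 where B0: "finite B0" "S \<subseteq> span B0" using assms by (auto simp: fin_dim_def)
  obtain B where B: "B \<subseteq> S" "independent B" "S \<subseteq> span B" "card B = dim S"
    using real_vector.basis_exists[of S] by blast
  have "finite B" using real_vector.independent_span_bound[OF B0(1) B(2)] B(1) B0(2) by auto
  with B show ?thesis using that by blast
qed

lemma dim_zero_space: "dim {0::'v::real_vector} = 0"
  using real_vector.dim_unique[of "{}" "{0::'v}" 0] by (simp add: real_vector.independent_empty)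

lemma subspace_eq_if_dim_eq:
  fixes S T :: "'v::real_vector set"
  assumes "subspace S" "S \<subseteq> T" "fin_dim T" "dim S = dim T"
  shows "S = T"
proof (rule ccontr)
  assume "S \<noteq> T"
  then obtain x where x: "x \<in> T" "x \<notin> S" using assms(2) by blast
  obtain B where B: "finite B" "B \<subseteq> S" "independent B" "S \<subseteq> span B" "card B = dim S"
    using fin_dim_subset[OF assms(3,2)] by (rule fin_dim_basis)
  obtain BT where BT: "finite BT" "T \<subseteq> span BT" "card BT = dim T"
    using assms(3) by (rule fin_dim_basis)
  have "span B = S" using B assms(1) by (simp add: real_vector.span_minimal subset_antisym)
  then have "independent (insert x B)" using x B(3) by (simp add: real_vector.independent_insertI)
  moreover have "insert x B \<subseteq> span BT" using x B(2) assms(2) BT(2) by blast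
  ultimately have "card (insert x B) \<le> card BT" using real_vector.independent_span_bound[OF BT(1)] by blast
  moreover have "x \<notin> B" using x B(2) by blast
  ultimately show False using B BT assms(4) by simp
qed

lemma span_kernel_Un_preimages:
  fixes f :: "'v::real_vector \<Rightarrow> 'w::real_vector"
  assumes "linear f" "subspace S" "D \<subseteq> S" "{x \<in> S. f x = 0} \<subseteq> span K" "f ` S \<subseteq> span (f ` D)"
  shows "S \<subseteq> span (K \<union> D)"
proof
  fix x assume x: "x \<in> S"
  obtain y where y: "y \<in> span D" "f x = f y"
    using assms(5) x linear_span_image[OF assms(1), of D] by blast
  have "y \<in> S" using y(1) real_vector.span_minimal[OF assms(3,2)] by blast
  then have "x - y \<in> span K"
    using x y(2) assms(4) subspace_diff[OF assms(2)] by (auto simp: linear_diff[OF assms(1)])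
  then have "(x - y) + y \<in> span (K \<union> D)"
    using y(1) real_vector.span_mono[of K "K \<union> D"] real_vector.span_mono[of D "K \<union> D"]
    by (intro real_vector.span_add) auto
  then show "x \<in> span (K \<union> D)" by simp
qed

lemma fin_dim_kernel_image:
  fixes f :: "'v::real_vector \<Rightarrow> 'w::real_vector"
  assumes "linear f" "subspace S" "fin_dim {x \<in> S. f x = 0}" "fin_dim (f ` S)"
  shows "fin_dim S" and "dim S \<le> dim {x \<in> S. f x = 0} + dim (f ` S)"
proof -
  obtain K where K: "finite K" "{x \<in> S. f x = 0} \<subseteq> span K" "card K = dim {x \<in> S. f x = 0}"
    using assms(3) by (rule fin_dim_basis)
  obtain C where C: "finite C" "C \<subseteq> f ` S" "f ` S \<subseteq> span C" "card C = dim (f ` S)"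
    using assms(4) by (rule fin_dim_basis)
  obtain D where D: "D \<subseteq> S" "inj_on f D" "C = f ` D" using C(2) by (auto simp: subset_image_inj)
  have "finite (K \<union> D)" using K(1) C(1) D by (simp add: finite_image_iff)
  moreover have "S \<subseteq> span (K \<union> D)" using span_kernel_Un_preimages[OF assms(1,2)] K(2) C(3) D by blast
  ultimately show "fin_dim S" "dim S \<le> dim {x \<in> S. f x = 0} + dim (f ` S)"
    using real_vector.dim_le_card[of S "K \<union> D"] card_Un_le[of K D] K(3) C(4) card_image[OF D(2)] D(3)
    by (auto simp: fin_dim_def)
qed

lemma fin_dim_image:
  assumes "fin_dim S" "linear f"
  shows "fin_dim (f ` S)"
proof -
  obtain B where B: "finite B" "S \<subseteq> span B" using assms(1) by (auto simp: fin_dim_def)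
  have "f ` S \<subseteq> span (f ` B)"
    using B(2) linear_span_image[OF assms(2), of B] by auto
  then show ?thesis using B(1) unfolding fin_dim_def by blast
qed

lemma rank_nullity:
  fixes f :: "'v::real_vector \<Rightarrow> 'w::real_vector"
  assumes S: "subspace S" "fin_dim S" and f: "linear f"
  shows "dim S = dim {x \<in> S. f x = 0} + dim (f ` S)"
proof (rule antisym)
  have finK: "fin_dim {x \<in> S. f x = 0}" by (rule fin_dim_subset[OF S(2)]) auto
  then obtain K where K: "finite K" "K \<subseteq> {x \<in> S. f x = 0}" "independent K" "card K = dim {x \<in> S. f x = 0}"
    by (rule fin_dim_basis)
  obtain B where B: "K \<subseteq> B" "B \<subseteq> S" "independent B" "S \<subseteq> span B"
    using real_vector.maximal_independent_subset_extend[of K S] K by auto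
  have cardB: "card B = dim S" using real_vector.dim_unique[OF B(2) B(4) B(3)] by auto
  have finB: "finite B"
    using S(2) real_vector.independent_span_bound[OF _ B(3)] B(2) unfolding fin_dim_def by blast
  have "f ` B \<subseteq> insert 0 (f ` (B - K))" using K(2) by auto
  then have "span (f ` B) \<subseteq> span (f ` (B - K))"
    using real_vector.span_mono[of "f ` B" "insert 0 (f ` (B - K))"] by (simp add: real_vector.span_insert_0)
  then have "f ` S \<subseteq> span (f ` (B - K))" using B(4) linear_span_image[OF f, of B] by blast
  then have "dim (f ` S) \<le> card (f ` (B - K))" using finB by (intro real_vector.dim_le_card) auto
  also have "\<dots> \<le> card B - card K"
    using card_image_le[of "B - K" f] finB B(1) K(1) by (simp add: card_Diff_subset)
  finally show "dim {x \<in> S. f x = 0} + dim (f ` S) \<le> dim S" using cardB K(4) card_mono[OF finB B(1)] by simp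
  show "dim S \<le> dim {x \<in> S. f x = 0} + dim (f ` S)"
    by (rule fin_dim_kernel_image[OF f S(1) finK fin_dim_image[OF S(2) f]])
qed

lemma dim_image_inj:
  fixes f :: "'v::real_vector \<Rightarrow> 'w::real_vector"
  assumes S: "subspace S" "fin_dim S" and f: "linear f" "\<And>x. x \<in> S \<Longrightarrow> f x = 0 \<Longrightarrow> x = 0"
  shows "dim (f ` S) = dim S"
proof -
  have "{x \<in> S. f x = 0} = {0}" using f(2) subspace_0[OF S(1)] linear_0[OF f(1)] by auto
  then show ?thesis using rank_nullity[OF S f(1)] by (simp add: dim_zero_space)
qed

definition Pi0 :: "'i set \<Rightarrow> ('i \<Rightarrow> 'v::zero set) \<Rightarrow> ('i \<Rightarrow> 'v) set" where
  "Pi0 A S = {z. \<forall>a. (a \<in> A \<longrightarrow> z a \<in> S a) \<and> (a \<notin> A \<longrightarrow> z a = 0)}"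

lemma Pi0_I: "(\<And>a. a \<in> A \<Longrightarrow> z a \<in> S a) \<Longrightarrow> (\<And>a. a \<notin> A \<Longrightarrow> z a = 0) \<Longrightarrow> z \<in> Pi0 A S"
  unfolding Pi0_def by blast

lemma Pi0_zero: "z \<in> Pi0 A S \<Longrightarrow> a \<notin> A \<Longrightarrow> z a = 0"
  by (auto simp: Pi0_def)

lemma Pi0_mem:
  assumes "z \<in> Pi0 A S" "subspace (S a)"
  shows "z a \<in> S a"
  using assms subspace_0[of "S a"] by (cases "a \<in> A") (auto simp: Pi0_def)

lemma Pi0_mono: "(\<And>a. a \<in> A \<Longrightarrow> S a \<subseteq> T a) \<Longrightarrow> Pi0 A S \<subseteq> Pi0 A T"
  by (auto simp: Pi0_def)

lemma subspace_Pi0: "(\<And>a. a \<in> A \<Longrightarrow> subspace (S a)) \<Longrightarrow> subspace (Pi0 A S)"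
  by (rule real_vector.subspaceI) (auto simp: Pi0_def intro: subspace_0 subspace_add subspace_scale)

lemma dim_Pi0:
  fixes S :: "'i \<Rightarrow> 'v::real_vector set"
  assumes "finite A" and "\<And>a. a \<in> A \<Longrightarrow> subspace (S a) \<and> fin_dim (S a)"
  shows fin_dim_Pi0: "fin_dim (Pi0 A S)" and "dim (Pi0 A S) = (\<Sum>a\<in>A. dim (S a))"
proof -
  have "fin_dim (Pi0 A S) \<and> dim (Pi0 A S) = (\<Sum>a\<in>A. dim (S a))" using assms
  proof (induction A rule: finite_induct)
    case empty
    have "Pi0 {} S = {0}" by (auto simp: Pi0_def fun_eq_iff)
    moreover have "fin_dim {0 :: 'i \<Rightarrow> 'v}"
      unfolding fin_dim_def by (intro exI[of _ "{0}"]) (simp add: real_vector.span_superset)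
    ultimately show ?case by (simp add: dim_zero_space)
  next
    case (insert a A)
    have sub: "subspace (Pi0 (insert a A) S)" using insert.prems by (intro subspace_Pi0) blast
    have eval: "linear (\<lambda>z::'i \<Rightarrow> 'v. z a)" by (rule linearI) auto
    have kernel: "{z \<in> Pi0 (insert a A) S. z a = 0} = Pi0 A S"
      using insert.hyps insert.prems[of a] subspace_0[of "S a"] by (auto simp: Pi0_def)
    have image: "(\<lambda>z. z a) ` Pi0 (insert a A) S = S a"
    proof
      show "S a \<subseteq> (\<lambda>z. z a) ` Pi0 (insert a A) S"
      proof
        fix v assume "v \<in> S a"
        then have "(\<lambda>b. if b = a then v else 0) \<in> Pi0 (insert a A) S"
          using insert.prems subspace_0 by (auto simp: Pi0_def)
        then show "v \<in> (\<lambda>z. z a) ` Pi0 (insert a A) S" by (rule rev_image_eqI) simp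
      qed
    qed (auto simp: Pi0_def)
    have "fin_dim (Pi0 (insert a A) S)"
      by (rule fin_dim_kernel_image[OF eval sub]) (use insert kernel image in auto)
    then show ?case using rank_nullity[OF sub _ eval] insert by (simp add: kernel image)
  qed
  then show "fin_dim (Pi0 A S)" "dim (Pi0 A S) = (\<Sum>a\<in>A. dim (S a))" by auto
qed

lemma orthogonal_projection_insert:
  fixes ip :: "'v::real_vector \<Rightarrow> 'v \<Rightarrow> real"
  assumes lin: "\<And>y. linear (\<lambda>x. ip x y)" and sym: "\<And>x y. ip x y = ip y x"
    and C: "subspace C" and pos: "\<And>x. x \<in> C \<Longrightarrow> ip x x = 0 \<Longrightarrow> x = 0"
    and A: "A \<subseteq> C" "a \<in> C" and proj: "\<forall>c\<in>C. \<exists>z\<in>span A. \<forall>w\<in>span A. ip (c - z) w = 0" and c: "c \<in> C"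
  shows "\<exists>z\<in>span (insert a A). \<forall>w\<in>span (insert a A). ip (c - z) w = 0"
proof -
  have diff: "ip (x - y) w = ip x w - ip y w" for x y w by (rule linear_diff[OF lin])
  have scale: "ip (r *\<^sub>R x) w = r * ip x w" for r x w using linear_scale[OF lin, of r x] by simp
  have span_insert: "span A \<subseteq> span (insert a A)" by (rule real_vector.span_mono) auto
  obtain a0 where a0: "a0 \<in> span A" "\<forall>w\<in>span A. ip (a - a0) w = 0" using proj A(2) by blast
  let ?b = "a - a0"
  have "?b \<in> C" using a0 A real_vector.span_minimal[OF A(1) C] C by (auto simp: subspace_diff)
  then have b0: "?b = 0" if "ip ?b ?b = 0" using pos that by blast
  have b_span: "?b \<in> span (insert a A)"
    using a0(1) span_insert by (meson insertI1 real_vector.span_base real_vector.span_diff subset_iff)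
  obtain z where z: "z \<in> span A" "\<forall>w\<in>span A. ip (c - z) w = 0" using proj c by blast
  define t where "t = ip (c - z) ?b / ip ?b ?b"
  let ?z = "z + t *\<^sub>R ?b"
  have ip_z: "ip (c - ?z) w = ip (c - z) w - t * ip ?b w" for w
    by (simp only: diff_diff_eq[symmetric] diff scale)
  have orth_b: "ip (c - ?z) ?b = 0"
  proof (cases "ip ?b ?b = 0")
    case True
    then show ?thesis using b0 linear_0[OF lin] sym by metis
  qed (unfold ip_z, simp add: t_def)
  have "ip (c - ?z) w = 0" if w: "w \<in> span (insert a A)" for w
  proof -
    obtain k where "w - k *\<^sub>R a \<in> span A" using w by (auto simp: real_vector.span_breakdown_eq)
    then have "(w - k *\<^sub>R a) + k *\<^sub>R a0 \<in> span A"
      using a0(1) by (intro real_vector.span_add real_vector.span_scale)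
    then have w_minus: "w - k *\<^sub>R ?b \<in> span A" by (simp add: algebra_simps)
    have "ip (c - ?z) (w - k *\<^sub>R ?b) = 0" using z(2) a0(2) w_minus unfolding ip_z by simp
    then show ?thesis using orth_b unfolding sym[of "c - ?z"] by (simp add: diff scale)
  qed
  moreover have "?z \<in> span (insert a A)"
    using z(1) span_insert b_span by (meson real_vector.span_add real_vector.span_scale subset_iff)
  ultimately show ?thesis by blast
qed

lemma orthogonal_projection_exists:
  fixes ip :: "'v::real_vector \<Rightarrow> 'v \<Rightarrow> real"
  assumes lin: "\<And>y. linear (\<lambda>x. ip x y)" and sym: "\<And>x y. ip x y = ip y x"
    and C: "subspace C" and pos: "\<And>x. x \<in> C \<Longrightarrow> ip x x = 0 \<Longrightarrow> x = 0"
    and Z: "subspace Z" "Z \<subseteq> C" "fin_dim Z" and c: "c \<in> C"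
  shows "\<exists>z\<in>Z. \<forall>w\<in>Z. ip (c - z) w = 0"
proof -
  obtain B where B: "finite B" "B \<subseteq> Z" "Z \<subseteq> span B" by (rule fin_dim_basis[OF Z(3)])
  have "B \<subseteq> C \<Longrightarrow> \<forall>c\<in>C. \<exists>z\<in>span B. \<forall>w\<in>span B. ip (c - z) w = 0" using B(1)
  proof (induction B rule: finite_induct)
    case empty then show ?case using linear_0[OF lin] sym by (auto simp: real_vector.span_zero)
  next
    case (insert a A)
    then show ?case using orthogonal_projection_insert[OF lin sym C pos, of A a] by auto
  qed
  moreover have "span B = Z" using B Z(1) by (simp add: real_vector.span_minimal subset_antisym)
  ultimately show ?thesis using B(2) Z(2) c by blast
qed

lemma finite_if_independent_family:
  fixes v :: "'t \<Rightarrow> 'v::real_vector"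
  assumes "fin_dim S" "\<And>t. t \<in> T \<Longrightarrow> v t \<in> S"
    and independent: "\<And>A a. finite A \<Longrightarrow> A \<subseteq> T \<Longrightarrow> (\<Sum>t\<in>A. a t *\<^sub>R v t) = 0 \<Longrightarrow> \<forall>t\<in>A. a t = 0"
  shows "finite T"
proof -
  obtain B where B: "finite B" "S \<subseteq> span B" using assms(1) by (auto simp: fin_dim_def)
  have "card A \<le> card B" if A: "finite A" "A \<subseteq> T" for A
  proof -
    have inj: "inj_on v A"
    proof (rule inj_onI, rule ccontr)
      fix x y assume "x \<in> A" "y \<in> A" "v x = v y" "x \<noteq> y"
      then show False using independent[of "{x, y}" "\<lambda>t. if t = x then 1 else -1"] A by auto
    qed
    have "independent (v ` A)"
    proof (rule real_vector.independent_if_scalars_zero)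
      fix h x assume h: "(\<Sum>x\<in>v ` A. h x *\<^sub>R x) = 0" and x: "x \<in> v ` A"
      have "(\<Sum>t\<in>A. h (v t) *\<^sub>R v t) = 0" using h inj by (simp add: sum.reindex)
      then show "h x = 0" using independent[OF A, of "\<lambda>t. h (v t)"] x by blast
    qed (use A in auto)
    moreover have "v ` A \<subseteq> span B" using assms(2) A(2) B(2) by blast
    ultimately have "card (v ` A) \<le> card B" using real_vector.independent_span_bound[OF B(1)] by auto
    then show ?thesis using inj by (simp add: card_image)
  qed
  then show ?thesis using finite_if_finite_subsets_card_bdd[of T "card B"] by blast
qed

lemma pencil_kernels_independent:
  fixes f g :: "'v::real_vector \<Rightarrow> 'w::real_vector"
  assumes S: "subspace S" and f: "linear f" "\<And>x. x \<in> S \<Longrightarrow> f x = 0 \<Longrightarrow> x = 0" and g: "linear g"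
    and "finite A" "\<And>t. t \<in> A \<Longrightarrow> v t \<in> S \<and> v t \<noteq> 0 \<and> f (v t) + t *\<^sub>R g (v t) = 0"
    and "(\<Sum>t\<in>A. a t *\<^sub>R v t) = 0"
  shows "\<forall>t\<in>A. a t = 0"
  using assms(5-)
proof (induction A arbitrary: a rule: finite_induct)
  case (insert s A)
  let ?A = "insert s A"
  have nz: "t \<noteq> 0" if "t \<in> ?A" for t using insert.prems(1)[OF that] f(2) by auto
  have fv: "f (v t) = - (t *\<^sub>R g (v t))" if "t \<in> ?A" for t
    using insert.prems(1)[OF that] by (simp add: eq_neg_iff_add_eq_0)
  let ?w = "\<Sum>t\<in>?A. (a t / t) *\<^sub>R v t"
  have "f ?w = (\<Sum>t\<in>?A. - (a t *\<^sub>R g (v t)))"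
    unfolding linear_sum[OF f(1)] by (rule sum.cong) (auto simp: linear_scale[OF f(1)] fv nz)
  also have "\<dots> = - g (\<Sum>t\<in>?A. a t *\<^sub>R v t)"
    by (simp only: linear_sum[OF g] linear_scale[OF g] sum_negf)
  also have "\<dots> = 0" by (simp only: insert.prems(2) linear_0[OF g] minus_zero)
  finally have "?w = 0"
    using insert.prems(1) by (intro f(2) subspace_sum[OF S] subspace_scale[OF S]) auto
  then have "(\<Sum>t\<in>?A. a t *\<^sub>R v t) - s *\<^sub>R ?w = 0" using insert.prems(2) by simp
  then have "(\<Sum>t\<in>?A. (a t - s * (a t / t)) *\<^sub>R v t) = 0"
    by (simp only: scaleR_left_diff_distrib sum_subtractf scaleR_right.sum scaleR_scaleR)
  then have "(\<Sum>t\<in>A. (a t - s * (a t / t)) *\<^sub>R v t) = 0" using insert.hyps nz by simp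
  then have "\<forall>t\<in>A. a t - s * (a t / t) = 0" by (rule insert.IH[rotated]) (use insert.prems in blast)
  then have zero: "a t = 0" if "t \<in> A" for t using that nz[of t] insert.hyps(2) by (auto simp: field_simps)
  then have "a s *\<^sub>R v s = 0" using insert.prems(2) insert.hyps by simp
  then show ?case using zero insert.prems(1)[of s] by auto
qed simp

lemma finite_singular_pencil:
  fixes f g :: "'v::real_vector \<Rightarrow> 'w::real_vector"
  assumes S: "subspace S" "fin_dim S" and f: "linear f" "\<And>x. x \<in> S \<Longrightarrow> f x = 0 \<Longrightarrow> x = 0"
    and g: "linear g"
  shows "finite {t. \<exists>x\<in>S. x \<noteq> 0 \<and> f x + t *\<^sub>R g x = 0}" (is "finite ?T")
proof -
  define v where "v t = (SOME x. x \<in> S \<and> x \<noteq> 0 \<and> f x + t *\<^sub>R g x = 0)" for t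
  have v: "v t \<in> S \<and> v t \<noteq> 0 \<and> f (v t) + t *\<^sub>R g (v t) = 0" if "t \<in> ?T" for t
    unfolding v_def by (rule someI_ex) (use that in blast)
  show ?thesis
  proof (rule finite_if_independent_family[OF S(2), where v = v])
    fix A a assume "finite A" "A \<subseteq> ?T" "(\<Sum>t\<in>A. a t *\<^sub>R v t) = 0"
    then show "\<forall>t\<in>A. a t = 0" using v by (intro pencil_kernels_independent[OF S(1) f g]) blast+
  qed (use v in blast)
qed

lemma generic_combination:
  fixes S :: "'j \<Rightarrow> ('p \<Rightarrow> 'w::real_vector) set" and P :: "'p set"
  defines "comb \<equiv> \<lambda>(c::'p \<Rightarrow> real) (b::'p \<Rightarrow> 'w). \<Sum>a\<in>P. c a *\<^sub>R b a"
  assumes "finite J" "\<And>j. j \<in> J \<Longrightarrow> subspace (S j) \<and> fin_dim (S j)"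
    and "\<And>j. j \<in> J \<Longrightarrow> \<exists>c. \<forall>b\<in>S j. comb c b = 0 \<longrightarrow> b = 0"
  shows "\<exists>c. \<forall>j\<in>J. \<forall>b\<in>S j. comb c b = 0 \<longrightarrow> b = 0"
  using assms(2-)
proof (induction J rule: finite_induct)
  case empty show ?case by simp
next
  case (insert j J)
  have linear: "linear (comb c)" for c
    by (rule linearI) (auto simp: comb_def scaleR_right_distrib sum.distrib scaleR_right.sum mult.commute)
  have comb_add: "comb (\<lambda>a. c a + t * d a) b = comb c b + t *\<^sub>R comb d b" for c d t b
    by (simp add: comb_def scaleR_left_distrib sum.distrib scaleR_right.sum)
  have "\<exists>c. \<forall>j\<in>J. \<forall>b\<in>S j. comb c b = 0 \<longrightarrow> b = 0" by (rule insert.IH) (use insert.prems in simp_all)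
  then obtain c where c: "\<forall>j\<in>J. \<forall>b\<in>S j. comb c b = 0 \<longrightarrow> b = 0" ..
  obtain d where d: "\<forall>b\<in>S j. comb d b = 0 \<longrightarrow> b = 0" using insert.prems(2)[OF insertI1] ..
  let ?A = "\<Union>i\<in>J. {t. \<exists>b\<in>S i. b \<noteq> 0 \<and> comb c b + t *\<^sub>R comb d b = 0}"
  let ?B = "{t. \<exists>b\<in>S j. b \<noteq> 0 \<and> comb d b + t *\<^sub>R comb c b = 0}"
  have "finite ?A"
    using insert.hyps(1) insert.prems(1) c linear by (intro finite_UN_I finite_singular_pencil) auto
  moreover have "finite ?B"
    using insert.prems(1) d linear by (intro finite_singular_pencil) auto
  ultimately have "\<exists>t. t \<notin> ?A \<union> inverse ` ?B \<union> {0}" by (intro ex_new_if_finite[OF infinite_UNIV_char_0]) simp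
  then obtain t where t: "t \<notin> ?A" "t \<notin> inverse ` ?B" "t \<noteq> 0" by auto
  then have tB: "inverse t \<notin> ?B" using imageI[of "inverse t" ?B inverse] by auto
  have "b = 0" if i: "i \<in> insert j J" "b \<in> S i" and vanish: "comb (\<lambda>a. c a + t * d a) b = 0" for i b
  proof (cases "i = j")
    case True
    have "inverse t *\<^sub>R (comb c b + t *\<^sub>R comb d b) = 0" using vanish comb_add by simp
    then have "comb d b + inverse t *\<^sub>R comb c b = 0"
      using t(3) by (simp add: scaleR_right_distrib add.commute)
    then show ?thesis using i(2) True tB by blast
  next
    case False
    then show ?thesis using i t(1) vanish comb_add by auto
  qed
  then show ?case by blast
qed

section \<open>Cellular posets and Cohen--Macaulay families\<close>

definition contraction_below ::
    "nat \<Rightarrow> 'p set \<Rightarrow> ('p \<Rightarrow> nat) \<Rightarrow> ('p \<Rightarrow> 'p \<Rightarrow> 'r::comm_ring_1) \<Rightarrow> ('p \<Rightarrow> 'p \<Rightarrow> 'r) \<Rightarrow> bool" where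
  "contraction_below D Q rk eps s \<longleftrightarrow>
    (\<forall>a b. s a b \<noteq> 0 \<longrightarrow> a \<in> Q \<and> b \<in> Q \<and> rk a = Suc (rk b)) \<and>
    (\<forall>a\<in>Q. \<forall>b\<in>Q. rk b < D \<longrightarrow> (\<Sum>c\<in>Q. s a c * eps c b + eps a c * s c b) = (if a = b then 1 else 0))"

lemma contraction_below_supp: "contraction_below D Q rk eps s \<Longrightarrow> s a b \<noteq> 0 \<Longrightarrow> a \<in> Q \<and> b \<in> Q \<and> rk a = Suc (rk b)"
  and contraction_below_eq: "contraction_below D Q rk eps s \<Longrightarrow> a \<in> Q \<Longrightarrow> b \<in> Q \<Longrightarrow> rk b < D \<Longrightarrow>
    (\<Sum>c\<in>Q. s a c * eps c b + eps a c * s c b) = (if a = b then 1 else 0)"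
  unfolding contraction_below_def by blast+

lemma euler_zero_if_contraction:
  fixes eps :: "'p \<Rightarrow> 'p \<Rightarrow> 'r::{comm_ring_1, ring_char_0}"
  assumes s: "contraction_below D Q rk eps s" and D: "\<And>a. a \<in> Q \<Longrightarrow> rk a < D"
  shows "(\<Sum>a\<in>Q. (-1) ^ rk a) = (0::int)"
proof -
  let ?sgn = "\<lambda>a. (-1) ^ rk a :: 'r"
  have sgn: "?sgn a * (eps a c * s c a) = - (?sgn c * (s c a * eps a c))" for a c
    using contraction_below_supp[OF s, of c a] by (cases "s c a = 0") auto
  have "(\<Sum>a\<in>Q. ?sgn a) = (\<Sum>a\<in>Q. ?sgn a * (\<Sum>c\<in>Q. s a c * eps c a + eps a c * s c a))"
    by (rule sum.cong) (auto simp: contraction_below_eq[OF s] D)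
  also have "\<dots> = (\<Sum>a\<in>Q. \<Sum>c\<in>Q. ?sgn a * (s a c * eps c a)) + (\<Sum>a\<in>Q. \<Sum>c\<in>Q. ?sgn a * (eps a c * s c a))"
    by (simp add: sum_distrib_left distrib_left sum.distrib)
  also have "(\<Sum>a\<in>Q. \<Sum>c\<in>Q. ?sgn a * (eps a c * s c a)) = - (\<Sum>c\<in>Q. \<Sum>a\<in>Q. ?sgn c * (s c a * eps a c))"
    by (subst sum.swap) (simp only: sgn sum_negf)
  finally have "of_int (\<Sum>a\<in>Q. (-1) ^ rk a) = (of_int 0 :: 'r)" by simp
  then show ?thesis by (simp only: of_int_eq_iff)
qed

locale cell_poset =
  fixes P :: "'p set" and le :: "'p \<Rightarrow> 'p \<Rightarrow> bool" (infix "\<sqsubseteq>" 50)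
    and rk :: "'p \<Rightarrow> nat" and eps :: "'p \<Rightarrow> 'p \<Rightarrow> real" and bot :: 'p
  assumes fin: "finite P"
    and le_refl: "x \<in> P \<Longrightarrow> x \<sqsubseteq> x"
    and le_trans: "x \<sqsubseteq> y \<Longrightarrow> y \<sqsubseteq> z \<Longrightarrow> x \<sqsubseteq> z"
    and le_P: "x \<sqsubseteq> y \<Longrightarrow> x \<in> P \<and> y \<in> P"
    and rk_less: "x \<sqsubseteq> y \<Longrightarrow> x \<noteq> y \<Longrightarrow> rk x < rk y"
    and eps_le: "eps x y \<noteq> 0 \<Longrightarrow> x \<sqsubseteq> y \<and> rk y = Suc (rk x)"
    and eps_eps: "(\<Sum>y\<in>P. eps x y * eps y z) = 0"
    and interval_contraction: "x \<sqsubseteq> y \<Longrightarrow> x \<noteq> y \<Longrightarrow>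
      \<exists>s. contraction_below (Suc (rk y)) {c. x \<sqsubseteq> c \<and> c \<sqsubseteq> y} rk eps s"
    and bot_P: "bot \<in> P" and bot_le: "x \<in> P \<Longrightarrow> bot \<sqsubseteq> x" and rk_bot: "rk bot = 0"
begin

abbreviation interval :: "'p \<Rightarrow> 'p \<Rightarrow> 'p set" where
  "interval x y \<equiv> {c. x \<sqsubseteq> c \<and> c \<sqsubseteq> y}"

lemma rk_mono: "x \<sqsubseteq> y \<Longrightarrow> rk x \<le> rk y"
  using rk_less[of x y] by (cases "x = y") auto

lemma P_up: "a \<in> P \<Longrightarrow> a \<sqsubseteq> b \<Longrightarrow> b \<in> P"
  using le_P by blast

lemma finite_filter: "finite {a. x \<sqsubseteq> a \<and> Q a}"
  by (rule finite_subset[OF _ fin]) (auto dest: le_P)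

lemma euler_interval:
  assumes "x \<sqsubseteq> y" "x \<noteq> y"
  shows "(\<Sum>a\<in>interval x y. (-1) ^ rk a) = (0::int)"
proof -
  obtain s where "contraction_below (Suc (rk y)) (interval x y) rk eps s"
    using interval_contraction[OF assms] ..
  then show ?thesis by (rule euler_zero_if_contraction) (simp add: rk_mono less_Suc_eq_le)
qed

definition homotopy :: "'p \<Rightarrow> 'p \<Rightarrow> 'p \<Rightarrow> 'p \<Rightarrow> real" where
  "homotopy x y = (SOME s. contraction_below (Suc (rk y)) (interval x y) rk eps s)"

lemma homotopy: "x \<sqsubseteq> y \<Longrightarrow> x \<noteq> y \<Longrightarrow> contraction_below (Suc (rk y)) (interval x y) rk eps (homotopy x y)"
  unfolding homotopy_def by (rule someI_ex[OF interval_contraction])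

lemma interval_cocycle_exact:
  fixes g :: "'p \<Rightarrow> 'w::real_vector"
  assumes xy: "x \<sqsubseteq> y" "x \<noteq> y" and a: "a \<in> interval x y"
    and cocycle: "\<And>b. b \<in> interval x y \<Longrightarrow> (\<Sum>c\<in>interval x y. eps c b *\<^sub>R g c) = 0"
  shows "(\<Sum>b\<in>interval x y. eps b a *\<^sub>R (\<Sum>c\<in>interval x y. homotopy x y c b *\<^sub>R g c)) = g a"
proof -
  let ?I = "interval x y" and ?s = "homotopy x y"
  have homotopy_eq: "(\<Sum>b\<in>?I. ?s c b * eps b a) = (if c = a then 1 else 0) - (\<Sum>b\<in>?I. eps c b * ?s b a)"
    if "c \<in> ?I" for c
    using contraction_below_eq[OF homotopy[OF xy] that a] rk_mono a
      by (simp add: sum.distrib less_Suc_eq_le eq_diff_eq)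
  have "(\<Sum>b\<in>?I. eps b a *\<^sub>R (\<Sum>c\<in>?I. ?s c b *\<^sub>R g c)) = (\<Sum>c\<in>?I. (\<Sum>b\<in>?I. ?s c b * eps b a) *\<^sub>R g c)"
    by (simp add: scaleR_right.sum scaleR_left.sum mult.commute) (rule sum.swap)
  also have "\<dots> = (\<Sum>c\<in>?I. (if c = a then g c else 0) - (\<Sum>b\<in>?I. ?s b a *\<^sub>R eps c b *\<^sub>R g c))"
    by (rule sum.cong) (simp_all add: homotopy_eq scaleR_left_diff_distrib, simp_all add: scaleR_left.sum mult.commute)
  also have "\<dots> = g a - (\<Sum>c\<in>?I. \<Sum>b\<in>?I. ?s b a *\<^sub>R eps c b *\<^sub>R g c)"
    using a finite_filter by (simp add: sum_subtractf)
  also have "(\<Sum>c\<in>?I. \<Sum>b\<in>?I. ?s b a *\<^sub>R eps c b *\<^sub>R g c) = (\<Sum>b\<in>?I. ?s b a *\<^sub>R (\<Sum>c\<in>?I. eps c b *\<^sub>R g c))"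
    by (subst sum.swap) (simp add: scaleR_right.sum)
  also have "\<dots> = 0" using cocycle by simp
  finally show ?thesis by simp
qed

abbreviation chains :: "('p \<Rightarrow> 'w::real_vector set) \<Rightarrow> nat \<Rightarrow> 'p \<Rightarrow> ('p \<Rightarrow> 'w) set" where
  "chains N k x \<equiv> Pi0 {a. x \<sqsubseteq> a \<and> rk a = k} N"

definition boundary :: "'p set \<Rightarrow> 'p \<Rightarrow> ('p \<Rightarrow> 'w::real_vector) \<Rightarrow> 'p \<Rightarrow> 'w" where
  "boundary U x z = (\<lambda>a. if a \<in> U \<and> x \<sqsubseteq> a then \<Sum>b\<in>P. eps a b *\<^sub>R z b else 0)"

definition restrict_above :: "'p \<Rightarrow> ('p \<Rightarrow> 'w::real_vector) \<Rightarrow> 'p \<Rightarrow> 'w" where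
  "restrict_above x z = (\<lambda>a. if x \<sqsubseteq> a then z a else 0)"

definition row_boundary :: "'p set \<Rightarrow> ('p \<Rightarrow> 'p \<Rightarrow> 'w::real_vector) \<Rightarrow> 'p \<Rightarrow> 'p \<Rightarrow> 'w" where
  "row_boundary U g = (\<lambda>a. boundary U a (g a))"

definition coboundary :: "'p \<Rightarrow> ('p \<Rightarrow> 'p \<Rightarrow> 'w::real_vector) \<Rightarrow> 'p \<Rightarrow> 'p \<Rightarrow> 'w" where
  "coboundary x g = (\<lambda>a c. if x \<sqsubseteq> a \<and> a \<sqsubseteq> c then \<Sum>b\<in>P. eps b a *\<^sub>R g b c else 0)"

lemma chains_zero: "z \<in> chains N k x \<Longrightarrow> \<not> (x \<sqsubseteq> a \<and> rk a = k) \<Longrightarrow> z a = 0"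
  and chains_support: "z \<in> chains N k x \<Longrightarrow> z a \<noteq> 0 \<Longrightarrow> x \<sqsubseteq> a \<and> rk a = k"
  by (auto simp: Pi0_def)

lemma linear_boundary: "linear (boundary U x)"
  by (rule linearI) (auto simp: boundary_def fun_eq_iff scaleR_right_distrib sum.distrib scaleR_right.sum mult.commute)

lemma linear_row_boundary: "linear (row_boundary U)"
  by (rule linearI)
    (auto simp: row_boundary_def fun_eq_iff linear_add[OF linear_boundary] linear_scale[OF linear_boundary])

lemma linear_restrict_above: "linear (restrict_above x)"
  by (rule linearI) (auto simp: restrict_above_def fun_eq_iff)

lemma linear_coboundary: "linear (coboundary x)"
  by (rule linearI)
    (auto simp: coboundary_def fun_eq_iff scaleR_right_distrib sum.distrib scaleR_right.sum mult.commute)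

lemma boundary_chains:
  assumes N: "\<And>a. subspace (N a)" "\<And>a b. a \<in> U \<Longrightarrow> a \<sqsubseteq> b \<Longrightarrow> N b \<subseteq> N a"
    and z: "z \<in> chains N (Suc k) x"
  shows "boundary U x z \<in> chains N k x"
proof (rule Pi0_I)
  fix a
  have "eps a b *\<^sub>R z b \<in> N a" if "a \<in> U" for b
  proof (cases "eps a b = 0")
    case False
    then have "z b \<in> N a" using eps_le[of a b] Pi0_mem[OF z N(1)] N(2)[OF that] by blast
    then show ?thesis using N(1) by (simp add: subspace_scale)
  qed (use N(1) in \<open>simp add: subspace_0\<close>)
  then show "boundary U x z a \<in> N a" using N(1) by (auto simp: boundary_def subspace_0 intro: subspace_sum)
next
  fix a assume a: "a \<notin> {a. x \<sqsubseteq> a \<and> rk a = k}"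
  have "eps a b *\<^sub>R z b = 0" if "x \<sqsubseteq> a" for b
    using eps_le[of a b] chains_zero[OF z, of b] a that by (cases "eps a b = 0") auto
  then show "boundary U x z a = 0" unfolding boundary_def by (simp add: sum.neutral del: scaleR_eq_0_iff)
qed

lemma boundary_chains_0:
  assumes z: "z \<in> chains N k x" "k \<le> rk x"
  shows "boundary U x z = 0"
proof -
  have "eps a b *\<^sub>R z b = 0" if "x \<sqsubseteq> a" for a b
    using eps_le[of a b] rk_mono[OF that] z(2) chains_zero[OF z(1), of b] by (cases "eps a b = 0") auto
  then show ?thesis unfolding boundary_def fun_eq_iff by (simp add: sum.neutral del: scaleR_eq_0_iff)
qed

lemma boundary_boundary:
  assumes U: "\<And>a b. a \<in> U \<Longrightarrow> a \<sqsubseteq> b \<Longrightarrow> b \<in> U"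
  shows "boundary U x (boundary U x z) = 0"
proof
  fix a
  show "boundary U x (boundary U x z) a = 0 a"
  proof (cases "a \<in> U \<and> x \<sqsubseteq> a")
    case True
    have "eps a b *\<^sub>R boundary U x z b = (\<Sum>c\<in>P. (eps a b * eps b c) *\<^sub>R z c)" for b
      using eps_le[of a b] U[of a b] le_trans[of x a b] True
        by (cases "eps a b = 0") (auto simp: boundary_def scaleR_right.sum)
    then have "boundary U x (boundary U x z) a = (\<Sum>b\<in>P. \<Sum>c\<in>P. (eps a b * eps b c) *\<^sub>R z c)"
      using True by (simp add: boundary_def[of U x "boundary U x z"])
    also have "\<dots> = (\<Sum>c\<in>P. (\<Sum>b\<in>P. eps a b * eps b c) *\<^sub>R z c)"
      by (subst sum.swap) (simp add: scaleR_left.sum)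
    finally show ?thesis by (simp add: eps_eps)
  qed (auto simp: boundary_def)
qed

lemma restrict_above_chains:
  assumes "z \<in> chains N k x" "x \<sqsubseteq> y"
  shows "restrict_above y z \<in> chains N k y"
  using assms le_trans by (auto simp: Pi0_def restrict_above_def)

lemma boundary_restrict_above:
  assumes "x \<sqsubseteq> y"
  shows "boundary U y (restrict_above y z) = restrict_above y (boundary U x z)"
proof
  fix a
  have eps_restrict: "eps a b *\<^sub>R restrict_above y z b = eps a b *\<^sub>R z b" if "y \<sqsubseteq> a" for b
    using eps_le[of a b] le_trans[OF that] by (cases "eps a b = 0") (auto simp: restrict_above_def)
  have "boundary U y (restrict_above y z) a = (if y \<sqsubseteq> a then boundary U x z a else 0)"
    using le_trans[OF assms, of a] by (simp add: boundary_def eps_restrict)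
  then show "boundary U y (restrict_above y z) a = restrict_above y (boundary U x z) a"
    by (simp add: restrict_above_def)
qed

lemma row_boundary_coboundary: "row_boundary U (coboundary x g) = coboundary x (row_boundary U g)"
proof (intro ext)
  fix a c
  show "row_boundary U (coboundary x g) a c = coboundary x (row_boundary U g) a c"
  proof (cases "x \<sqsubseteq> a \<and> a \<sqsubseteq> c \<and> c \<in> U")
    case True
    have column: "eps c d *\<^sub>R coboundary x g a d = (\<Sum>b\<in>P. (eps c d * eps b a) *\<^sub>R g b d)" for d
      using eps_le[of c d] le_trans[of a c d] True
        by (cases "eps c d = 0") (auto simp: coboundary_def scaleR_right.sum)
    have row: "eps b a *\<^sub>R row_boundary U g b c = (\<Sum>d\<in>P. (eps c d * eps b a) *\<^sub>R g b d)" for b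
      using eps_le[of b a] le_trans[of b a c] True
      by (cases "eps b a = 0") (auto simp: row_boundary_def boundary_def scaleR_right.sum mult.commute)
    have "row_boundary U (coboundary x g) a c = (\<Sum>d\<in>P. eps c d *\<^sub>R coboundary x g a d)"
      using True by (simp add: row_boundary_def boundary_def)
    also have "\<dots> = (\<Sum>b\<in>P. eps b a *\<^sub>R row_boundary U g b c)" unfolding column row by (rule sum.swap)
    also have "\<dots> = coboundary x (row_boundary U g) a c" using True by (simp add: coboundary_def)
    finally show ?thesis .
  qed (auto simp: row_boundary_def boundary_def coboundary_def)
qed

lemma coboundary_coboundary:
  assumes g: "\<And>b. \<not> x \<sqsubseteq> b \<Longrightarrow> g b = 0"
  shows "coboundary x (coboundary x g) = 0"
proof (intro ext)
  fix a c
  show "coboundary x (coboundary x g) a c = 0 a c"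
  proof (cases "x \<sqsubseteq> a \<and> a \<sqsubseteq> c")
    case True
    have "eps b a *\<^sub>R coboundary x g b c = (\<Sum>d\<in>P. (eps d b * eps b a) *\<^sub>R g d c)" for b
    proof -
      consider "eps b a = 0" | "b \<sqsubseteq> c" "x \<sqsubseteq> b" | "\<not> x \<sqsubseteq> b" using eps_le[of b a] le_trans[of b a c] True by blast
      then show ?thesis
      proof cases
        case 3
        then have "(eps d b * eps b a) *\<^sub>R g d c = 0" for d
          using g[of d] eps_le[of d b] le_trans[of x d b] by (cases "eps d b = 0"; cases "x \<sqsubseteq> d") auto
        then show ?thesis using 3 by (simp add: coboundary_def sum.neutral del: scaleR_eq_0_iff)
      qed (simp_all add: coboundary_def scaleR_right.sum mult.commute)
    qed
    then have "coboundary x (coboundary x g) a c = (\<Sum>b\<in>P. \<Sum>d\<in>P. (eps d b * eps b a) *\<^sub>R g d c)"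
      using True by (simp add: coboundary_def[of x "coboundary x g"])
    also have "\<dots> = (\<Sum>d\<in>P. (\<Sum>b\<in>P. eps d b * eps b a) *\<^sub>R g d c)"
      by (subst sum.swap) (simp add: scaleR_left.sum)
    finally show ?thesis by (simp add: eps_eps)
  qed (auto simp: coboundary_def)
qed

end

text \<open>A Cohen--Macaulay family of dimension \<open>m\<close>: a cosheaf of subspaces on the up-set \<open>U\<close>, extended
  by zero, whose chain complexes on all principal filters are exact below rank \<open>m\<close>.\<close>

locale cm_family = cell_poset P le rk eps bot
  for P :: "'p set" and le (infix "\<sqsubseteq>" 50) and rk eps bot +
  fixes N :: "'p \<Rightarrow> ('q \<Rightarrow> real) set" and U :: "'p set" and m :: nat and L :: "'q set"
  assumes U_P: "U \<subseteq> P" and U_up: "a \<in> U \<Longrightarrow> a \<sqsubseteq> b \<Longrightarrow> b \<in> U"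
    and N_subspace: "subspace (N a)"
    and N_zero: "a \<notin> U \<or> m < rk a \<Longrightarrow> N a = {0}"
    and N_mono: "a \<in> U \<Longrightarrow> a \<sqsubseteq> b \<Longrightarrow> N b \<subseteq> N a"
    and fin_L: "finite L" and N_supp: "f \<in> N a \<Longrightarrow> l \<notin> L \<Longrightarrow> f l = 0"
    and exact: "k < m \<Longrightarrow> z \<in> chains N k x \<Longrightarrow> boundary U x z = 0 \<Longrightarrow> \<exists>y\<in>chains N (Suc k) x. boundary U x y = z"
begin

lemma subspace_chains: "subspace (chains N k x)"
  by (rule subspace_Pi0[OF N_subspace])

text \<open>The double complex of the pairs \<open>a \<sqsubseteq> c\<close>, with \<open>a\<close> of rank \<open>k\<close> and \<open>c\<close> of rank \<open>i\<close>; the case \<open>k = -1\<close> starts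
  the induction along its diagonal.\<close>

abbreviation dchains :: "int \<Rightarrow> nat \<Rightarrow> 'p \<Rightarrow> ('p \<Rightarrow> 'p \<Rightarrow> 'q \<Rightarrow> real) set" where
  "dchains k i x \<equiv> Pi0 {a. x \<sqsubseteq> a \<and> int (rk a) = k} (chains N i)"

lemma subspace_dchains: "subspace (dchains k i x)"
  by (rule subspace_Pi0[OF subspace_chains])

lemma dchains_row: "g \<in> dchains k i x \<Longrightarrow> g a \<in> chains N i a"
  by (rule Pi0_mem[where S = "chains N i", OF _ subspace_chains])

lemma dchains_zero: "g \<in> dchains k i x \<Longrightarrow> \<not> (x \<sqsubseteq> a \<and> int (rk a) = k) \<Longrightarrow> g a = 0"
  and dchains_support: "g \<in> dchains k i x \<Longrightarrow> g a \<noteq> 0 \<Longrightarrow> x \<sqsubseteq> a \<and> int (rk a) = k"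
  by (auto simp: Pi0_def[of _ "chains N i"])

lemma dchains_entry: "g \<in> dchains k i x \<Longrightarrow> g a c \<in> N c"
  by (rule Pi0_mem[where S = N, OF dchains_row N_subspace])

lemma dchains_entry_support:
  assumes g: "g \<in> dchains k i x" and "g a c \<noteq> 0"
  shows "x \<sqsubseteq> a \<and> int (rk a) = k \<and> a \<sqsubseteq> c \<and> rk c = i"
  using chains_support[OF dchains_row[OF g] assms(2)] dchains_support[OF g, where a = a] assms(2)
    by (cases "g a = 0") auto

lemma dchainsI:
  assumes "\<And>a c. e a c \<in> N c" "\<And>a c. \<not> (x \<sqsubseteq> a \<and> int (rk a) = k \<and> a \<sqsubseteq> c \<and> rk c = i) \<Longrightarrow> e a c = 0"
  shows "e \<in> dchains k i x"
  using assms by (intro Pi0_I) (auto simp: fun_eq_iff)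

lemma coboundary_dchains:
  assumes g: "g \<in> dchains k i x"
  shows "coboundary x g \<in> dchains (k + 1) i x"
proof (rule dchainsI)
  fix a c
  show "coboundary x g a c \<in> N c" unfolding coboundary_def
    by (auto intro!: subspace_sum[OF N_subspace] subspace_scale[OF N_subspace] dchains_entry[OF g] subspace_0[OF N_subspace])
  assume no: "\<not> (x \<sqsubseteq> a \<and> int (rk a) = k + 1 \<and> a \<sqsubseteq> c \<and> rk c = i)"
  have "eps b a *\<^sub>R g b c = 0" if "x \<sqsubseteq> a" "a \<sqsubseteq> c" for b
    using no that eps_le[of b a] dchains_entry_support[OF g, of b c]
    by (cases "eps b a = 0"; cases "g b c = 0") auto
  then show "coboundary x g a c = 0" unfolding coboundary_def by (simp add: sum.neutral del: scaleR_eq_0_iff)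
qed

lemma row_boundary_dchains:
  assumes g: "g \<in> dchains k (Suc i) x"
  shows "row_boundary U g \<in> dchains k i x"
proof (rule Pi0_I)
  fix a
  show "row_boundary U g a \<in> chains N i a" unfolding row_boundary_def
    by (rule boundary_chains[OF N_subspace N_mono dchains_row[OF g]])
  show "row_boundary U g a = 0" if "a \<notin> {a. x \<sqsubseteq> a \<and> int (rk a) = k}"
    using dchains_zero[OF g, of a] that by (simp add: row_boundary_def linear_0[OF linear_boundary])
qed

lemma rows_exact:
  assumes "i < m" and g: "g \<in> dchains k i x" "row_boundary U g = 0"
  shows "\<exists>e\<in>dchains k (Suc i) x. row_boundary U e = g"
proof -
  have "boundary U a (g a) = 0" for a using g(2) by (simp add: row_boundary_def fun_eq_iff)
  then have "\<forall>a. \<exists>y. y \<in> chains N (Suc i) a \<and> boundary U a y = g a"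
    using exact[OF assms(1) dchains_row[OF g(1)]] by blast
  then obtain y where y: "y a \<in> chains N (Suc i) a" "boundary U a (y a) = g a" for a by metis
  let ?e = "\<lambda>a. if x \<sqsubseteq> a \<and> int (rk a) = k then y a else 0"
  have "?e \<in> dchains k (Suc i) x" by (rule Pi0_I) (auto simp: y(1))
  moreover have "row_boundary U ?e = g"
    using y(2) dchains_zero[OF g(1)] by (auto simp: row_boundary_def fun_eq_iff linear_0[OF linear_boundary])
  ultimately show ?thesis by blast
qed

lemma sum_interval:
  fixes f :: "'p \<Rightarrow> 'p \<Rightarrow> 'w::real_vector"
  assumes "a \<sqsubseteq> c" and "\<And>b. b \<notin> interval x c \<Longrightarrow> b \<sqsubseteq> c \<Longrightarrow> f b c = 0"
  shows "(\<Sum>b\<in>P. eps b a *\<^sub>R f b c) = (\<Sum>b\<in>interval x c. eps b a *\<^sub>R f b c)"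
proof (rule sum.mono_neutral_right[OF fin])
  show "\<forall>b\<in>P - interval x c. eps b a *\<^sub>R f b c = 0"
  proof
    fix b assume "b \<in> P - interval x c"
    then show "eps b a *\<^sub>R f b c = 0"
      using assms eps_le[of b a] le_trans[of b a c] by (cases "eps b a = 0") auto
  qed
qed (use le_P in blast)

lemma columns_exact:
  assumes g: "g \<in> dchains (int k) i x" and "k < i" and cocycle: "coboundary x g = 0"
  shows "\<exists>e\<in>dchains (int k - 1) i x. coboundary x e = g"
proof -
  define e where "e a c = (if x \<sqsubseteq> c \<and> x \<noteq> c then \<Sum>b\<in>interval x c. homotopy x c b a *\<^sub>R g b c else 0)" for a c
  have "e \<in> dchains (int k - 1) i x"
  proof (rule dchainsI)
    fix a c
    show "e a c \<in> N c" unfolding e_def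
      by (auto intro!: subspace_sum[OF N_subspace] subspace_scale[OF N_subspace] dchains_entry[OF g] subspace_0[OF N_subspace])
    assume no: "\<not> (x \<sqsubseteq> a \<and> int (rk a) = int k - 1 \<and> a \<sqsubseteq> c \<and> rk c = i)"
    have "homotopy x c b a *\<^sub>R g b c = 0" if "x \<sqsubseteq> c" "x \<noteq> c" for b
      using no contraction_below_supp[OF homotopy[OF that], of b a] dchains_entry_support[OF g, of b c]
      by (cases "homotopy x c b a = 0"; cases "g b c = 0") auto
    then show "e a c = 0" unfolding e_def by (simp add: sum.neutral del: scaleR_eq_0_iff)
  qed
  moreover have "coboundary x e a c = g a c" for a c
  proof (cases "x \<sqsubseteq> a \<and> a \<sqsubseteq> c \<and> x \<noteq> c")
    case False
    have "g a c = 0"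
      using False dchains_entry_support[OF g, of a c] rk_mono[of x a] \<open>k < i\<close> by (cases "g a c = 0") auto
    then show ?thesis using False by (auto simp: coboundary_def e_def)
  next
    case True
    then have xc: "x \<sqsubseteq> c" "x \<noteq> c" and a: "a \<in> interval x c" using le_trans by blast+
    have "(\<Sum>b'\<in>interval x c. eps b' b *\<^sub>R g b' c) = 0" if "b \<in> interval x c" for b
      using that fun_cong[OF fun_cong[OF cocycle, of b], of c] sum_interval[of b c x g] dchains_zero[OF g]
        by (auto simp: coboundary_def)
    from interval_cocycle_exact[OF xc a this]
    have "(\<Sum>b\<in>interval x c. eps b a *\<^sub>R e b c) = g a c" using xc by (simp add: e_def)
    moreover have "e b c = 0" if "b \<notin> interval x c" for b
    proof -
      have "homotopy x c b' b = 0" for b' using contraction_below_supp[OF homotopy[OF xc]] that by blast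
      then show ?thesis by (simp add: e_def)
    qed
    ultimately show ?thesis using sum_interval[of a c x e] True by (simp add: coboundary_def)
  qed
  ultimately show ?thesis by blast
qed

lemma cycles_exact:
  assumes "g \<in> dchains (int k) i x" "k < i" "i \<le> m" "row_boundary U g = 0" "coboundary x g = 0"
  shows "\<exists>e\<in>dchains (int k - 1) i x. row_boundary U e = 0 \<and> coboundary x e = g"
  using assms
proof (induction k arbitrary: g i)
  case 0
  then obtain e where e: "e \<in> dchains (int 0 - 1) i x" "coboundary x e = g" using columns_exact by blast
  have "e = 0" using dchains_zero[OF e(1)] by (simp add: fun_eq_iff)
  then have "row_boundary U e = 0" using linear_0[OF linear_row_boundary] by blast
  then show ?case using e by blast
next
  case (Suc k)
  then obtain j where j: "i = Suc j" by (cases i) auto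
  obtain e0 where e0: "e0 \<in> dchains (int k) i x" "coboundary x e0 = g"
    using columns_exact[OF Suc.prems(1,2,5)] by auto
  let ?f = "row_boundary U e0"
  have "?f \<in> dchains (int k) j x" using row_boundary_dchains e0(1) j by blast
  moreover have "row_boundary U ?f = 0" by (simp add: row_boundary_def boundary_boundary[OF U_up] fun_eq_iff)
  moreover have "coboundary x ?f = 0"
    using Suc.prems(4) e0(2) row_boundary_coboundary by metis
  ultimately obtain e1 where e1: "e1 \<in> dchains (int k - 1) j x" "row_boundary U e1 = 0" "coboundary x e1 = ?f"
    using Suc.IH[of ?f j] Suc.prems(2,3)[unfolded j] by (meson Suc_less_eq Suc_leD)
  obtain e2 where e2: "e2 \<in> dchains (int k - 1) i x" "row_boundary U e2 = e1"
    using rows_exact[OF _ e1(1,2)] Suc.prems(3) j by auto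
  have "e0 - coboundary x e2 \<in> dchains (int (Suc k) - 1) i x"
    using subspace_diff[OF subspace_dchains e0(1)] coboundary_dchains[OF e2(1)] by simp
  moreover have "row_boundary U (e0 - coboundary x e2) = 0"
    by (simp add: linear_diff[OF linear_row_boundary] row_boundary_coboundary e2(2) e1(3))
  moreover have "coboundary x (e0 - coboundary x e2) = g"
    using coboundary_coboundary[of x e2] dchains_zero[OF e2(1)] e0(2)
      by (simp add: linear_diff[OF linear_coboundary])
  ultimately show ?case by blast
qed

definition inner :: "('p \<Rightarrow> 'q \<Rightarrow> real) \<Rightarrow> ('p \<Rightarrow> 'q \<Rightarrow> real) \<Rightarrow> real" where
  "inner u v = (\<Sum>a\<in>P. \<Sum>l\<in>L. u a l * v a l)"

lemma inner_sym: "inner u v = inner v u"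
  by (simp add: inner_def mult.commute)

lemma linear_inner_left: "linear (\<lambda>u. inner u v)"
  by (rule linearI) (simp_all add: inner_def distrib_right sum.distrib sum_distrib_left mult.assoc)

lemma linear_inner_right: "linear (inner u)"
  by (rule linearI) (simp_all add: inner_def distrib_left sum.distrib sum_distrib_left ac_simps)

lemma inner_nonneg: "0 \<le> inner u u"
  unfolding inner_def by (intro sum_nonneg) auto

lemma inner_definite:
  assumes z: "z \<in> chains N k x" and "inner z z = 0"
  shows "z = 0"
proof (intro ext)
  fix a l
  have "\<forall>a\<in>P. \<forall>l\<in>L. z a l * z a l = 0"
    using assms(2) fin fin_L unfolding inner_def by (simp add: sum_nonneg_eq_0_iff sum_nonneg)
  then show "z a l = 0 a l"
    using chains_support[OF z, of a] le_P[of x a] N_supp[OF Pi0_mem[OF z N_subspace], of l a]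
    by (cases "z a = 0") auto
qed

lemma fin_dim_N: "fin_dim (N a)"
proof (rule fin_dim_subset)
  show "fin_dim (Pi0 L (\<lambda>_. UNIV :: real set))"
    by (rule fin_dim_Pi0[OF fin_L]) (simp add: fin_dim_real real_vector.subspace_UNIV)
qed (auto simp: Pi0_def N_supp)

lemma fin_dim_chains: "fin_dim (chains N k x)"
  by (rule fin_dim_Pi0) (simp_all add: finite_filter N_subspace fin_dim_N)

lemma dim_chains: "dim (chains N k x) = (\<Sum>a | x \<sqsubseteq> a \<and> rk a = k. dim (N a))"
  by (rule dim_Pi0) (simp_all add: finite_filter N_subspace fin_dim_N)

lemma point_chain: "a \<in> P \<Longrightarrow> v \<in> N a \<Longrightarrow> 0(a := v) \<in> chains N (rk a) a"
  by (auto simp: Pi0_def le_refl dest: rk_less)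

definition cycles :: "nat \<Rightarrow> 'p \<Rightarrow> ('p \<Rightarrow> 'q \<Rightarrow> real) set" where
  "cycles k x = {z \<in> chains N k x. boundary U x z = 0}"

lemma subspace_cycles: "subspace (cycles k x)"
  unfolding cycles_def using subspace_chains[of x k]
  by (auto simp: subspace_def linear_add[OF linear_boundary] linear_scale[OF linear_boundary] linear_0[OF linear_boundary])

lemma fin_dim_cycles: "fin_dim (cycles k x)"
  by (rule fin_dim_subset[OF fin_dim_chains]) (auto simp: cycles_def)

lemma cycles_rk_le: "k \<le> rk x \<Longrightarrow> cycles k x = chains N k x"
  using boundary_chains_0[where N = N and x = x] by (auto simp: cycles_def)

lemma boundary_image: "k < m \<Longrightarrow> boundary U x ` chains N (Suc k) x = cycles k x"
proof
  show "boundary U x ` chains N (Suc k) x \<subseteq> cycles k x"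
    using boundary_chains[OF N_subspace N_mono] boundary_boundary[OF U_up] by (auto simp: cycles_def)
  show "cycles k x \<subseteq> boundary U x ` chains N (Suc k) x" if "k < m"
    using exact[OF that] by (fastforce simp: cycles_def)
qed

lemma dim_cycles:
  "k \<le> m \<Longrightarrow> int (dim (cycles k x)) = (\<Sum>a | x \<sqsubseteq> a \<and> rk a \<le> k. (-1) ^ (k - rk a) * int (dim (N a)))"
proof (induction k)
  case 0
  then show ?case by (simp add: cycles_rk_le dim_chains)
next
  case (Suc k)
  have "dim (chains N (Suc k) x) = dim (cycles (Suc k) x) + dim (cycles k x)"
    using rank_nullity[OF subspace_chains fin_dim_chains linear_boundary, of x "Suc k" U x] boundary_image[of k x] Suc.prems
    by (simp add: cycles_def)
  then have "int (dim (cycles (Suc k) x)) = int (dim (chains N (Suc k) x)) - int (dim (cycles k x))" by simp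
  also have "\<dots> = (\<Sum>a | x \<sqsubseteq> a \<and> rk a = Suc k. (-1) ^ (Suc k - rk a) * int (dim (N a))) +
      (\<Sum>a | x \<sqsubseteq> a \<and> rk a \<le> k. (-1) ^ (Suc k - rk a) * int (dim (N a)))"
    using Suc by (simp add: dim_chains Suc_diff_le sum_negf)
  also have "\<dots> = (\<Sum>a\<in>{a. x \<sqsubseteq> a \<and> rk a = Suc k} \<union> {a. x \<sqsubseteq> a \<and> rk a \<le> k}.
      (-1) ^ (Suc k - rk a) * int (dim (N a)))"
    by (rule sum.union_disjoint[symmetric]) (auto simp: finite_filter)
  also have "{a. x \<sqsubseteq> a \<and> rk a = Suc k} \<union> {a. x \<sqsubseteq> a \<and> rk a \<le> k} = {a. x \<sqsubseteq> a \<and> rk a \<le> Suc k}" by auto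
  finally show ?case .
qed

text \<open>The dual of the canonical sheaf of the \<open>i\<close>-skeleton, realised by orthogonal complements.\<close>

definition canonical :: "nat \<Rightarrow> 'p \<Rightarrow> ('p \<Rightarrow> 'q \<Rightarrow> real) set" where
  "canonical i x = {b \<in> chains N (Suc i) x. \<forall>z\<in>cycles (Suc i) x. inner b z = 0}"

lemma canonical_chain: "b \<in> canonical i x \<Longrightarrow> b \<in> chains N (Suc i) x"
  by (simp add: canonical_def)

lemma subspace_canonical: "subspace (canonical i x)"
  unfolding canonical_def using subspace_chains[of x "Suc i"]
  by (auto simp: subspace_def linear_add[OF linear_inner_left] linear_scale[OF linear_inner_left] linear_0[OF linear_inner_left])

lemma fin_dim_canonical: "fin_dim (canonical i x)"
  by (rule fin_dim_subset[OF fin_dim_chains]) (auto simp: canonical_def)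

lemma canonical_mono:
  assumes "x \<sqsubseteq> y" shows "canonical i y \<subseteq> canonical i x"
proof
  fix b assume b: "b \<in> canonical i y"
  note chain = canonical_chain[OF b]
  have "b \<in> chains N (Suc i) x"  
    using Pi0_mem[OF chain N_subspace] chains_zero[OF chain] le_trans[OF assms] by (intro Pi0_I) blast+
  moreover have "inner b z = 0" if z: "z \<in> cycles (Suc i) x" for z
  proof -
    have "restrict_above y z \<in> cycles (Suc i) y"
      using z restrict_above_chains[OF _ assms] boundary_restrict_above[OF assms, of U z] linear_0[OF linear_restrict_above, of y]
      by (auto simp: cycles_def)
    then have "inner b (restrict_above y z) = 0" using b by (simp add: canonical_def)
    moreover have "inner b (restrict_above y z) = inner b z"
      unfolding inner_def restrict_above_def using chains_zero[OF chain] by (intro sum.cong refl) auto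
    ultimately show ?thesis by simp
  qed
  ultimately show "b \<in> canonical i x" by (simp add: canonical_def)
qed

lemma canonical_boundary_inj:
  assumes "b \<in> canonical i x" "boundary U x b = 0" shows "b = 0"
proof -
  have "inner b b = 0" using assms by (simp add: canonical_def cycles_def)
  then show ?thesis using inner_definite canonical_chain[OF assms(1)] by blast
qed

lemma chains_cycles_plus_canonical:
  assumes "c \<in> chains N (Suc i) x"
  obtains z b where "z \<in> cycles (Suc i) x" "b \<in> canonical i x" "c = z + b"
proof -
  have "\<exists>z\<in>cycles (Suc i) x. \<forall>w\<in>cycles (Suc i) x. inner (c - z) w = 0"
  proof (rule orthogonal_projection_exists[OF linear_inner_left inner_sym subspace_chains _ subspace_cycles _ fin_dim_cycles assms])
    show "cycles (Suc i) x \<subseteq> chains N (Suc i) x" by (auto simp: cycles_def)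
  qed (rule inner_definite)
  then obtain z where z: "z \<in> cycles (Suc i) x" "\<forall>w\<in>cycles (Suc i) x. inner (c - z) w = 0" ..
  then have "c - z \<in> canonical i x"
    using subspace_diff[OF subspace_chains assms] by (simp add: canonical_def cycles_def)
  then show ?thesis using that[of z "c - z"] z by simp
qed

lemma boundary_canonical:
  assumes "i < m" shows "boundary U x ` canonical i x = cycles i x"
proof -
  have "boundary U x c \<in> boundary U x ` canonical i x" if c: "c \<in> chains N (Suc i) x" for c
  proof -
    obtain z b where zb: "z \<in> cycles (Suc i) x" "b \<in> canonical i x" "c = z + b"
      using chains_cycles_plus_canonical[OF c] .
    then have "boundary U x c = boundary U x b" by (simp add: linear_add[OF linear_boundary] cycles_def)
    then show ?thesis using zb(2) by blast
  qed
  then have "boundary U x ` canonical i x = boundary U x ` chains N (Suc i) x" using canonical_chain by blast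
  then show ?thesis using boundary_image[OF assms] by simp
qed

lemma dim_canonical:
  assumes "i < m" shows "dim (canonical i x) = dim (cycles i x)"
proof -
  have "dim (boundary U x ` canonical i x) = dim (canonical i x)"
    by (rule dim_image_inj[OF subspace_canonical fin_dim_canonical linear_boundary canonical_boundary_inj])
  then show ?thesis by (simp add: boundary_canonical[OF assms])
qed

lemma canonical_zero_if:
  assumes "\<And>b a. b \<in> canonical i x \<Longrightarrow> x \<sqsubseteq> a \<Longrightarrow> rk a = i \<Longrightarrow> boundary U x b a = 0" "b \<in> canonical i x"
  shows "b = 0"
proof (rule canonical_boundary_inj[OF assms(2)])
  have "boundary U x b \<in> chains N i x"
    by (rule boundary_chains[OF N_subspace N_mono canonical_chain[OF assms(2)]])
  then show "boundary U x b = 0" using chains_zero assms by (fastforce simp: fun_eq_iff)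
qed

lemma canonical_zero:
  assumes "i < rk x \<or> i = rk x \<and> x \<notin> U"
  shows "canonical i x = {0}"
proof -
  have "boundary U x b a = 0" if "x \<sqsubseteq> a" "rk a = i" for b :: "'p \<Rightarrow> 'q \<Rightarrow> real" and a
    using rk_less[OF that(1)] that(2) assms by (cases "x = a") (auto simp: boundary_def)
  then show ?thesis using canonical_zero_if subspace_0[OF subspace_canonical] by blast
qed

lemma inner_coboundary:
  assumes "x \<sqsubseteq> a" and v: "v \<in> chains N i a"
  shows "inner (coboundary x g a) v = (\<Sum>d\<in>P. eps d a * inner (g d) v)"
proof -
  have "inner (coboundary x g a) v = inner (\<Sum>d\<in>P. eps d a *\<^sub>R g d) v"
  proof (unfold inner_def, intro sum.cong refl)
    fix c l
    show "coboundary x g a c l * v c l = (\<Sum>d\<in>P. eps d a *\<^sub>R g d) c l * v c l"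
      using assms(1) chains_zero[OF v, of c] by (cases "a \<sqsubseteq> c") (auto simp: coboundary_def sum_fun_apply)
  qed
  then show ?thesis by (simp add: linear_sum[OF linear_inner_left] linear_scale[OF linear_inner_left])
qed

definition total_inner :: "('p \<Rightarrow> 'p \<Rightarrow> 'q \<Rightarrow> real) \<Rightarrow> ('p \<Rightarrow> 'p \<Rightarrow> 'q \<Rightarrow> real) \<Rightarrow> real" where
  "total_inner u v = (\<Sum>a\<in>P. inner (u a) (v a))"

lemma linear_total_inner: "linear (\<lambda>u. total_inner u v)"
  by (rule linearI)
    (simp_all add: total_inner_def linear_add[OF linear_inner_left] linear_scale[OF linear_inner_left] sum.distrib sum_distrib_left)

lemma total_inner_sym: "total_inner u v = total_inner v u"
  unfolding total_inner_def by (rule sum.cong[OF refl inner_sym])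

abbreviation canonical_chains :: "nat \<Rightarrow> nat \<Rightarrow> 'p \<Rightarrow> ('p \<Rightarrow> 'p \<Rightarrow> 'q \<Rightarrow> real) set" where
  "canonical_chains i \<equiv> chains (canonical i)"

lemma subspace_canonical_chains: "subspace (canonical_chains i k x)"
  by (rule subspace_Pi0[OF subspace_canonical])

lemma fin_dim_canonical_chains: "fin_dim (canonical_chains i k x)"
  by (rule fin_dim_Pi0) (simp_all add: finite_filter subspace_canonical fin_dim_canonical)

lemma canonical_chains_boundary: "y \<in> canonical_chains i (Suc k) x \<Longrightarrow> boundary P x y \<in> canonical_chains i k x"
  by (rule boundary_chains[OF subspace_canonical canonical_mono])

lemma canonical_chains_dchains: "canonical_chains i k x \<subseteq> dchains (int k) (Suc i) x"
  using canonical_chain by (auto simp: Pi0_def[of _ "canonical i"] Pi0_def[of _ "chains N (Suc i)"])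

lemma total_inner_definite:
  assumes u: "u \<in> canonical_chains i k x" and "total_inner u u = 0"
  shows "u = 0"
proof
  fix a
  have "\<forall>a\<in>P. inner (u a) (u a) = 0"
    using assms(2) fin inner_nonneg unfolding total_inner_def by (simp add: sum_nonneg_eq_0_iff)
  then show "u a = 0 a"
    using inner_definite[OF canonical_chain[OF Pi0_mem[OF u subspace_canonical]], of a] chains_zero[OF u, of a] le_P[of x a] by auto
qed

lemma orthogonal_coboundary:
  assumes c: "c \<in> canonical_chains i k x"
    and orth: "\<And>y. y \<in> canonical_chains i (Suc k) x \<Longrightarrow> total_inner c (boundary P x y) = 0"
  shows "row_boundary U (coboundary x c) = 0"
proof
  fix a
  let ?w = "coboundary x c"
  have w: "?w \<in> dchains (int k + 1) (Suc i) x" using coboundary_dchains canonical_chains_dchains c by blast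
  show "row_boundary U ?w a = 0 a"
  proof (cases "x \<sqsubseteq> a \<and> rk a = Suc k")
    case True
    obtain z v where zv: "z \<in> cycles (Suc i) a" "v \<in> canonical i a" "?w a = z + v"
      using chains_cycles_plus_canonical[OF dchains_row[OF w]] .
    have "0(a := v) \<in> canonical_chains i (Suc k) x"
      using zv(2) True subspace_0[OF subspace_canonical] by (auto simp: Pi0_def[of _ "canonical i"])
    note orth[OF this]
    moreover have "boundary P x (0(a := v)) d = (if x \<sqsubseteq> d then eps d a *\<^sub>R v else 0)" for d
    proof -
      have "eps d b *\<^sub>R (0(a := v)) b = (if b = a then eps d a *\<^sub>R v else 0)" for b by simp
      then show ?thesis using True le_P[of x a] le_P[of x d] fin by (simp add: boundary_def)
    qed
    ultimately have "0 = (\<Sum>d\<in>P. inner (c d) (if x \<sqsubseteq> d then eps d a *\<^sub>R v else 0))"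
      by (simp add: total_inner_def)
    also have "\<dots> = (\<Sum>d\<in>P. eps d a * inner (c d) v)"
      using chains_zero[OF c] by (intro sum.cong refl)
        (auto simp: linear_scale[OF linear_inner_right] linear_0[OF linear_inner_left] linear_0[OF linear_inner_right])
    also have "\<dots> = inner (?w a) v"
      using inner_coboundary[OF _ canonical_chain[OF zv(2)]] True by simp
    also have "\<dots> = inner v v"
      using zv inner_sym[of z v] by (simp add: linear_add[OF linear_inner_left] canonical_def)
    finally have "v = 0" using inner_definite[OF canonical_chain[OF zv(2)]] by simp
    then show ?thesis using zv by (simp add: cycles_def row_boundary_def)
  next
    case False
    then have "?w a = 0" using dchains_zero[OF w, of a] by auto
    then show ?thesis by (simp add: row_boundary_def linear_0[OF linear_boundary])
  qed
qed

lemma row_boundary_lift: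
  assumes "c \<in> dchains (int k) (Suc i) x" "row_boundary U (coboundary x c) = 0" "k < i" "i < m"
  shows "\<exists>h\<in>dchains (int k - 1) (Suc i) x. row_boundary U (coboundary x h) = row_boundary U c"
proof -
  let ?g = "row_boundary U c"
  have "?g \<in> dchains (int k) i x" by (rule row_boundary_dchains[OF assms(1)])
  moreover have "row_boundary U ?g = 0" by (simp add: row_boundary_def boundary_boundary[OF U_up] fun_eq_iff)
  moreover have "coboundary x ?g = 0" using assms(2) by (simp add: row_boundary_coboundary)
  ultimately obtain e where e: "e \<in> dchains (int k - 1) i x" "row_boundary U e = 0" "coboundary x e = ?g"
    using cycles_exact[OF _ assms(3)] assms(4) by (meson less_imp_le)
  obtain h where "h \<in> dchains (int k - 1) (Suc i) x" "row_boundary U h = e"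
    using rows_exact[OF assms(4) e(1,2)] ..
  then show ?thesis using e(3) by (auto simp: row_boundary_coboundary)
qed

lemma total_inner_lift:
  assumes c: "c \<in> canonical_chains i k x" "boundary P x c = 0"
    and h: "h \<in> dchains (int k - 1) (Suc i) x" "row_boundary U (coboundary x h) = row_boundary U c"
  shows "total_inner c c = 0"
proof -
  have c_canonical: "c a \<in> canonical i a" for a by (rule Pi0_mem[OF c(1) subspace_canonical])
  have c_chain: "c a \<in> chains N (Suc i) a" for a by (rule canonical_chain[OF c_canonical])
  have h_chain: "coboundary x h a \<in> chains N (Suc i) a" for a
    using dchains_row[OF coboundary_dchains[OF h(1)]] .
  have diag: "inner (c a) (c a) = (\<Sum>d\<in>P. eps d a * inner (c a) (h d))" for a
  proof (cases "x \<sqsubseteq> a")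
    case True
    have "c a - coboundary x h a \<in> cycles (Suc i) a"
      using subspace_diff[OF subspace_chains c_chain h_chain] fun_cong[OF h(2), of a]
      by (simp add: cycles_def linear_diff[OF linear_boundary] row_boundary_def)
    then have "inner (c a) (c a - coboundary x h a) = 0" using c_canonical by (simp add: canonical_def)
    then have "inner (c a) (c a) = inner (coboundary x h a) (c a)"
      by (simp add: linear_diff[OF linear_inner_right] inner_sym)
    also have "\<dots> = (\<Sum>d\<in>P. eps d a * inner (c a) (h d))"
      unfolding inner_coboundary[OF True c_chain] inner_sym[of "c a"] ..
    finally show ?thesis .
  next
    case False
    then show ?thesis using chains_zero[OF c(1), of a] by (simp add: linear_0[OF linear_inner_left])
  qed
  have "total_inner c c = (\<Sum>d\<in>P. inner (\<Sum>a\<in>P. eps d a *\<^sub>R c a) (h d))"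
    unfolding total_inner_def diag
      by (subst sum.swap) (simp add: linear_sum[OF linear_inner_left] linear_scale[OF linear_inner_left])
  also have "\<dots> = 0"
  proof (rule sum.neutral, intro ballI)
    fix d assume d: "d \<in> P"
    show "inner (\<Sum>a\<in>P. eps d a *\<^sub>R c a) (h d) = 0"
    proof (cases "x \<sqsubseteq> d")
      case True
      then show ?thesis
        using fun_cong[OF c(2), of d] d by (simp add: boundary_def linear_0[OF linear_inner_left])
    next
      case False
      then show ?thesis using dchains_zero[OF h(1), of d] by (simp add: linear_0[OF linear_inner_right])
    qed
  qed
  finally show ?thesis .
qed

text \<open>The linear dual of \<open>cycles_exact\<close>: the component of a cycle orthogonal to the boundaries vanishes.\<close>

lemma canonical_exact:
  assumes "k < i" "i < m" and b: "b \<in> canonical_chains i k x" "boundary P x b = 0"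
  shows "\<exists>y\<in>canonical_chains i (Suc k) x. boundary P x y = b"
proof -
  let ?S = "boundary P x ` canonical_chains i (Suc k) x"
  have "\<exists>s\<in>?S. \<forall>w\<in>?S. total_inner (b - s) w = 0"
  proof (rule orthogonal_projection_exists[OF linear_total_inner total_inner_sym subspace_canonical_chains _ _ _ _ b(1)])
    show "subspace ?S" by (rule linear_subspace_image[OF linear_boundary subspace_canonical_chains])
    show "?S \<subseteq> canonical_chains i k x" using canonical_chains_boundary by blast
    show "fin_dim ?S" by (rule fin_dim_image[OF fin_dim_canonical_chains linear_boundary])
  qed (rule total_inner_definite)
  then obtain y where y: "y \<in> canonical_chains i (Suc k) x" "\<forall>w\<in>?S. total_inner (b - boundary P x y) w = 0"
    by blast
  let ?c = "b - boundary P x y"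
  have c: "?c \<in> canonical_chains i k x" "boundary P x ?c = 0"
    using subspace_diff[OF subspace_canonical_chains b(1) canonical_chains_boundary[OF y(1)]] b(2) boundary_boundary[of P, OF P_up]
    by (simp_all add: linear_diff[OF linear_boundary])
  have "row_boundary U (coboundary x ?c) = 0" by (rule orthogonal_coboundary[OF c(1)]) (use y(2) in blast)
  then obtain h where "h \<in> dchains (int k - 1) (Suc i) x" "row_boundary U (coboundary x h) = row_boundary U ?c"
    using row_boundary_lift assms(1,2) c(1) canonical_chains_dchains by blast
  then have "?c = 0" by (rule total_inner_definite[OF c(1) total_inner_lift[OF c]])
  then show ?thesis using y(1) by auto
qed

definition lin_comb :: "('p \<Rightarrow> real) \<Rightarrow> ('p \<Rightarrow> 'q \<Rightarrow> real) \<Rightarrow> 'q \<Rightarrow> real" where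
  "lin_comb c b = (\<Sum>d\<in>P. c d *\<^sub>R b d)"

lemma linear_lin_comb: "linear (lin_comb c)"
  by (rule linearI) (auto simp: lin_comb_def scaleR_right_distrib sum.distrib scaleR_right.sum mult.commute)

definition generic :: "('p \<Rightarrow> real) \<Rightarrow> nat \<Rightarrow> bool" where
  "generic c i \<longleftrightarrow> (\<forall>a\<in>{a \<in> U. rk a = i}. \<forall>b\<in>canonical i a. lin_comb c b = 0 \<longrightarrow> b = 0)"

lemma genericD: "generic c i \<Longrightarrow> a \<in> U \<Longrightarrow> rk a = i \<Longrightarrow> b \<in> canonical i a \<Longrightarrow> lin_comb c b = 0 \<Longrightarrow> b = 0"
  unfolding generic_def by blast

lemma ex_generic: "\<exists>c. generic c i"
  unfolding generic_def lin_comb_def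
proof (rule generic_combination)
  show "finite {a \<in> U. rk a = i}" using finite_subset[OF U_P fin] by simp
  show "subspace (canonical i a) \<and> fin_dim (canonical i a)" for a
    using subspace_canonical fin_dim_canonical by blast
  fix a assume a: "a \<in> {a \<in> U. rk a = i}"
  have "b = 0" if b: "b \<in> canonical i a" and vanish: "(\<Sum>d\<in>P. eps a d *\<^sub>R b d) = 0" for b
  proof (rule canonical_boundary_inj[OF b])
    have chain: "boundary U a b \<in> chains N i a"
      by (rule boundary_chains[OF N_subspace N_mono canonical_chain[OF b]])
    show "boundary U a b = 0"
    proof
      fix d
      show "boundary U a b d = 0 d"
        using chains_zero[OF chain, of d] rk_less[of a d] a vanish
          by (cases "a = d") (auto simp: boundary_def)
    qed
  qed
  then show "\<exists>c. \<forall>b\<in>canonical i a. (\<Sum>d\<in>P. c d *\<^sub>R b d) = 0 \<longrightarrow> b = 0" by blast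
qed

lemma lin_comb_in:
  assumes "a \<in> U" "b \<in> canonical i a" shows "lin_comb c b \<in> N a"
  unfolding lin_comb_def
proof (intro subspace_sum[OF N_subspace] subspace_scale[OF N_subspace])
  fix d
  note b = canonical_chain[OF assms(2)]
  show "b d \<in> N a"
    using Pi0_mem[OF b N_subspace, of d] N_mono[OF assms(1), of d] chains_zero[OF b, of d] subspace_0[OF N_subspace, of a]
    by (cases "a \<sqsubseteq> d") auto
qed

lemma lin_comb_surj_top:
  assumes i: "i < m" and c: "generic c i" and a: "a \<in> U" "rk a = i"
  shows "lin_comb c ` canonical i a = N a"
proof (rule subspace_eq_if_dim_eq[OF linear_subspace_image[OF linear_lin_comb subspace_canonical] _ fin_dim_N])
  show "lin_comb c ` canonical i a \<subseteq> N a" using lin_comb_in a by blast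
  have "d = a" if "a \<sqsubseteq> d" "rk d = i" for d using rk_less[OF that(1)] that(2) a by (cases "a = d") auto
  then have "{d. a \<sqsubseteq> d \<and> rk d = i} = {a}" using a le_refl U_P by auto
  then have "dim (canonical i a) = dim (N a)"
    using dim_canonical[OF i] dim_chains[of a i] cycles_rk_le[of i a] a by simp
  moreover have "dim (lin_comb c ` canonical i a) = dim (canonical i a)"
    by (rule dim_image_inj[OF subspace_canonical fin_dim_canonical linear_lin_comb genericD[OF c a]])
  ultimately show "dim (lin_comb c ` canonical i a) = dim (N a)" by simp
qed

lemma lin_comb_surj:
  assumes i: "i < m" and c: "generic c i" and a: "a \<in> U" "rk a \<le> i"
  shows "lin_comb c ` canonical i a = N a"
  using a
proof (induction "i - rk a" arbitrary: a)
  case 0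
  then show ?case using lin_comb_surj_top[OF i c] by simp
next
  case (Suc n)
  have aP: "a \<in> P" using Suc U_P by blast
  have subspace: "subspace (lin_comb c ` canonical i a)"
    by (rule linear_subspace_image[OF linear_lin_comb subspace_canonical])
  have "w \<in> lin_comb c ` canonical i a" if w: "w \<in> N a" for w
  proof -
    note chain = point_chain[OF aP w]
    have "rk a < m" using Suc i by simp
    from exact[OF this chain] boundary_chains_0[OF chain]
    obtain y where y: "y \<in> chains N (Suc (rk a)) a" "boundary U a y = 0(a := w)" by auto
    have "y b \<in> lin_comb c ` canonical i a" for b
    proof (cases "a \<sqsubseteq> b \<and> rk b = Suc (rk a)")
      case True
      then have "lin_comb c ` canonical i b = N b" using Suc U_up[of a b] by (intro Suc.hyps(1)) auto
      then show ?thesis using Pi0_mem[OF y(1) N_subspace, of b] canonical_mono[of a b] True by blast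
    next
      case False
      then show ?thesis using chains_zero[OF y(1)] subspace_0[OF subspace] by metis
    qed
    then have "(\<Sum>b\<in>P. eps a b *\<^sub>R y b) \<in> lin_comb c ` canonical i a"
      by (intro subspace_sum[OF subspace] subspace_scale[OF subspace])
    then show ?thesis using fun_cong[OF y(2), of a] Suc.prems le_refl[OF aP] by (simp add: boundary_def)
  qed
  then show ?case using lin_comb_in Suc.prems by blast
qed

text \<open>Applying \<open>lin_comb c\<close> entrywise is a chain map from the canonical family to \<open>N\<close>.\<close>

definition push :: "('p \<Rightarrow> real) \<Rightarrow> ('p \<Rightarrow> 'p \<Rightarrow> 'q \<Rightarrow> real) \<Rightarrow> 'p \<Rightarrow> 'q \<Rightarrow> real" where
  "push c y = (\<lambda>a. if a \<in> U then lin_comb c (y a) else 0)"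

lemma push_diff: "push c (y - z) = push c y - push c z"
  by (auto simp: push_def linear_diff[OF linear_lin_comb] fun_eq_iff)

lemma push_chains:
  assumes "y \<in> canonical_chains i k x" shows "push c y \<in> chains N k x"
proof (rule Pi0_I)
  fix a
  show "push c y a \<in> N a"
    using lin_comb_in[OF _ Pi0_mem[OF assms subspace_canonical]] subspace_0[OF N_subspace]
      by (auto simp: push_def)
  show "push c y a = 0" if "a \<notin> {a. x \<sqsubseteq> a \<and> rk a = k}"
    using Pi0_zero[OF assms that] by (simp add: push_def linear_0[OF linear_lin_comb])
qed

lemma boundary_push: "boundary U x (push c y) = push c (boundary P x y)"
proof
  fix a
  show "boundary U x (push c y) a = push c (boundary P x y) a"
  proof (cases "a \<in> U \<and> x \<sqsubseteq> a")
    case True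
    have "eps a b *\<^sub>R push c y b = lin_comb c (eps a b *\<^sub>R y b)" for b
      using True U_up[of a b] eps_le[of a b]
      by (cases "eps a b = 0") (auto simp: push_def linear_scale[OF linear_lin_comb] linear_0[OF linear_lin_comb])
    then show ?thesis
      using True U_P
      by (auto simp: boundary_def push_def[of c "\<lambda>a. if _ a then _ a else _ a"] linear_sum[OF linear_lin_comb])
  qed (auto simp: boundary_def push_def linear_0[OF linear_lin_comb])
qed

lemma push_surj:
  assumes "i < m" "generic c i" "k \<le> i" and w: "w \<in> chains N k x"
  shows "\<exists>v\<in>canonical_chains i k x. push c v = w"
proof -
  have "\<exists>v. v \<in> canonical i a \<and> (a \<in> U \<longrightarrow> lin_comb c v = w a)" if a: "rk a = k" for a
  proof (cases "a \<in> U")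
    case True
    then have "w a \<in> lin_comb c ` canonical i a"
      using lin_comb_surj[OF assms(1,2)] assms(3) a Pi0_mem[OF w N_subspace] by simp
    then show ?thesis by auto
  qed (use subspace_0[OF subspace_canonical] in auto)
  then obtain v where v: "v a \<in> canonical i a" "a \<in> U \<Longrightarrow> lin_comb c (v a) = w a" if "rk a = k" for a by metis
  let ?v = "\<lambda>a. if x \<sqsubseteq> a \<and> rk a = k then v a else 0"
  have "?v \<in> canonical_chains i k x" by (rule Pi0_I) (auto simp: v(1))
  moreover have "push c ?v a = w a" for a
  proof (cases "a \<in> U \<and> x \<sqsubseteq> a \<and> rk a = k")
    case False
    then have "w a = 0" using chains_zero[OF w, of a] Pi0_mem[OF w N_subspace, of a] N_zero[of a] by auto
    then show ?thesis using False by (auto simp: push_def linear_0[OF linear_lin_comb])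
  qed (simp add: push_def v(2))
  ultimately show ?thesis by blast
qed

definition generic_kernel :: "('p \<Rightarrow> real) \<Rightarrow> nat \<Rightarrow> 'p \<Rightarrow> ('p \<Rightarrow> 'q \<Rightarrow> real) set" where
  "generic_kernel c i a = {b \<in> canonical i a. a \<in> U \<longrightarrow> lin_comb c b = 0}"

lemma subspace_generic_kernel: "subspace (generic_kernel c i a)"
  unfolding generic_kernel_def using subspace_canonical[of i a]
  by (auto simp: subspace_def linear_add[OF linear_lin_comb] linear_scale[OF linear_lin_comb] linear_0[OF linear_lin_comb])

lemma generic_kernel_mono:
  assumes "a \<sqsubseteq> b" shows "generic_kernel c i b \<subseteq> generic_kernel c i a"
  using canonical_mono[OF assms, of i] U_up[OF _ assms] unfolding generic_kernel_def by blast

lemma generic_kernel_chains_iff: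
  "z \<in> chains (generic_kernel c i) k x \<longleftrightarrow> z \<in> canonical_chains i k x \<and> push c z = 0"
proof
  assume z: "z \<in> chains (generic_kernel c i) k x"
  then have "z \<in> canonical_chains i k x"
    using Pi0_mono[of _ "generic_kernel c i" "canonical i"] by (auto simp: generic_kernel_def)
  moreover have "push c z = 0"
    using Pi0_mem[OF z subspace_generic_kernel] by (auto simp: push_def generic_kernel_def fun_eq_iff)
  ultimately show "z \<in> canonical_chains i k x \<and> push c z = 0" ..
next
  assume z: "z \<in> canonical_chains i k x \<and> push c z = 0"
  show "z \<in> chains (generic_kernel c i) k x"
  proof (rule Pi0_I)
    fix a
    have "push c z a = 0" using z by simp
    then show "z a \<in> generic_kernel c i a"
      using Pi0_mem[of z _ "canonical i" a, OF _ subspace_canonical] z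
        by (auto simp: generic_kernel_def push_def)
  qed (rule Pi0_zero[OF conjunct1[OF z]])
qed

lemma generic_kernel_exact:
  assumes i: "i < m" and c: "generic c i"
    and k: "Suc k < i" and z: "z \<in> chains (generic_kernel c i) k x" "boundary P x z = 0"
  shows "\<exists>y\<in>chains (generic_kernel c i) (Suc k) x. boundary P x y = z"
proof -
  have z': "z \<in> canonical_chains i k x" "push c z = 0" using z(1) generic_kernel_chains_iff by auto
  obtain y where y: "y \<in> canonical_chains i (Suc k) x" "boundary P x y = z"
    using canonical_exact[OF _ i z'(1) z(2)] k by auto
  have "boundary U x (push c y) = 0" using y(2) z'(2) by (simp add: boundary_push)
  then obtain w where w: "w \<in> chains N (Suc (Suc k)) x" "boundary U x w = push c y"
    using exact[of "Suc k"] push_chains[OF y(1)] k i by (meson less_trans)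
  obtain v where v: "v \<in> canonical_chains i (Suc (Suc k)) x" "push c v = w"
    using push_surj[OF i c _ w(1)] k by auto
  let ?y = "y - boundary P x v"
  have "?y \<in> canonical_chains i (Suc k) x"
    by (rule subspace_diff[OF subspace_canonical_chains y(1) canonical_chains_boundary[OF v(1)]])
  moreover have "push c ?y = 0" by (simp add: push_diff boundary_push[symmetric] v(2) w(2))
  moreover have "boundary P x ?y = z"
    using boundary_boundary[of P, OF P_up] y(2) by (simp add: linear_diff[OF linear_boundary])
  ultimately show ?thesis using generic_kernel_chains_iff by blast
qed

lemma dim_generic_kernel:
  assumes i: "i < m" and c: "generic c i" and a: "rk a \<le> i"
  shows "int (dim (generic_kernel c i a)) =
    (\<Sum>b | a \<sqsubseteq> b \<and> rk b \<le> i. (-1) ^ (i - rk b) * int (dim (N b))) - int (dim (N a))"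
proof -
  have "dim (canonical i a) = dim (generic_kernel c i a) + dim (N a)"
  proof (cases "a \<in> U")
    case True
    then show ?thesis
      using rank_nullity[OF subspace_canonical fin_dim_canonical linear_lin_comb, of i a c] lin_comb_surj[OF i c True a]
      by (simp add: generic_kernel_def)
  next
    case False
    then show ?thesis using N_zero[of a] by (simp add: generic_kernel_def dim_zero_space)
  qed
  then show ?thesis using dim_canonical[OF i, of a] dim_cycles[of i a] i by simp
qed

lemma generic_kernel_zero:
  assumes c: "generic c i" and a: "a \<notin> P \<or> i \<le> rk a"
  shows "generic_kernel c i a = {0}"
proof -
  have "b = 0" if b: "b \<in> generic_kernel c i a" for b
  proof (cases "a \<in> U \<and> rk a = i")
    case True
    then show ?thesis using genericD[OF c, of a] b unfolding generic_kernel_def by blast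
  next
    case False
    have "canonical i a = {0}" if "a \<in> P" using a False that by (intro canonical_zero) auto
    moreover have "b d = 0" if "a \<notin> P" for d
      using b chains_zero[OF canonical_chain, of b i a d] le_P that by (auto simp: generic_kernel_def)
    ultimately show ?thesis using b by (cases "a \<in> P") (auto simp: generic_kernel_def fun_eq_iff)
  qed
  then show ?thesis using subspace_0[OF subspace_generic_kernel] by blast
qed

end

lemma (in cell_poset) cm_family_image:
  fixes f :: "'w::real_vector \<Rightarrow> 'q \<Rightarrow> real"
  assumes f: "linear f" "\<And>v. f v = 0 \<Longrightarrow> v = 0"
    and M: "\<And>a. subspace (M a)" "\<And>a b. a \<sqsubseteq> b \<Longrightarrow> M b \<subseteq> M a" "\<And>a. a \<notin> P \<or> m < rk a \<Longrightarrow> M a = {0}"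
    and L: "finite L" "\<And>a v l. v \<in> M a \<Longrightarrow> l \<notin> L \<Longrightarrow> f v l = 0"
    and exact: "\<And>k z x. k < m \<Longrightarrow> z \<in> chains M k x \<Longrightarrow> boundary P x z = 0 \<Longrightarrow> \<exists>y\<in>chains M (Suc k) x. boundary P x y = z"
  shows "cm_family P le rk eps bot (\<lambda>a. f ` M a) P m L"
proof
  fix a b
  show "a \<in> P \<Longrightarrow> a \<sqsubseteq> b \<Longrightarrow> b \<in> P" by (rule P_up)
  show "subspace (f ` M a)" by (rule linear_subspace_image[OF f(1) M(1)])
  show "a \<notin> P \<or> m < rk a \<Longrightarrow> f ` M a = {0}" using M(3) by (auto simp: linear_0[OF f(1)])
  show "a \<sqsubseteq> b \<Longrightarrow> f ` M b \<subseteq> f ` M a" using M(2) by blast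
  show "h \<in> f ` M a \<Longrightarrow> l \<notin> L \<Longrightarrow> h l = 0" for h l using L(2) by blast
next
  fix k x and z :: "'p \<Rightarrow> 'q \<Rightarrow> real"
  assume k: "k < m" and z: "z \<in> chains (\<lambda>a. f ` M a) k x" "boundary P x z = 0"
  have "\<forall>a. \<exists>u. u \<in> M a \<and> z a = f u"
    using Pi0_mem[OF z(1) linear_subspace_image[OF f(1) M(1)]] by blast
  then obtain u where u: "u a \<in> M a" "z a = f (u a)" for a by metis
  have boundary_f: "boundary P x (\<lambda>a. f (v a)) a = f (boundary P x v a)" for v a
    by (simp add: boundary_def linear_sum[OF f(1)] linear_scale[OF f(1)] linear_0[OF f(1)])
  have "u \<in> chains M k x"
  proof (rule Pi0_I)
    show "u a = 0" if "a \<notin> {a. x \<sqsubseteq> a \<and> rk a = k}" for a using Pi0_zero[OF z(1) that] u(2) f(2) by simp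
  qed (rule u(1))
  moreover have "boundary P x u = 0"
  proof
    fix a
    have "z = (\<lambda>a. f (u a))" using u(2) by blast
    then have "f (boundary P x u a) = 0" using boundary_f[of u a] fun_cong[OF z(2), of a] by simp
    then show "boundary P x u a = 0 a" using f(2) by simp
  qed
  ultimately obtain y where y: "y \<in> chains M (Suc k) x" "boundary P x y = u" using exact[OF k] by blast
  have "(\<lambda>a. f (y a)) \<in> chains (\<lambda>a. f ` M a) (Suc k) x"
    using y(1) linear_0[OF f(1)] by (auto simp: Pi0_def)
  moreover have "boundary P x (\<lambda>a. f (y a)) = z" using boundary_f[of y] y(2) u(2) by (simp add: fun_eq_iff)
  ultimately show "\<exists>y\<in>chains (\<lambda>a. f ` M a) (Suc k) x. boundary P x y = z" by blast
qed (use L(1) in simp_all)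

text \<open>Iterating the construction would change the type of the values, which \<open>flat\<close> avoids.\<close>

definition flat :: "('p \<Rightarrow> 'p list \<Rightarrow> real) \<Rightarrow> 'p list \<Rightarrow> real" where
  "flat z = (\<lambda>l. case l of [] \<Rightarrow> 0 | a # l' \<Rightarrow> z a l')"

lemma linear_flat: "linear flat"
  by (rule linearI) (auto simp: flat_def fun_eq_iff split: list.split)

lemma flat_eq_0: "flat z = 0 \<Longrightarrow> z = 0"
proof (intro ext)
  fix a l assume "flat z = 0"
  from fun_cong[OF this, of "a # l"] show "z a l = 0 a l" by (simp add: flat_def)
qed

lemma cm_family_step:
  fixes N :: "'p \<Rightarrow> ('p list \<Rightarrow> real) set" and bt :: 'p and le :: "'p \<Rightarrow> 'p \<Rightarrow> bool"
  assumes "cm_family P le rk eps bt N U m L" and j: "Suc j < m"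
  shows "\<exists>N' L'. cm_family P le rk eps bt N' P j (L' :: 'p list set) \<and>
    (\<forall>a. rk a \<le> Suc j \<longrightarrow> int (dim (N' a)) =
      (\<Sum>b | le a b \<and> rk b \<le> Suc j. (-1) ^ (Suc j - rk b) * int (dim (N b))) - int (dim (N a)))"
proof -
  interpret cm_family P le rk eps bt N U m L by fact
  obtain c where c: "generic c (Suc j)" using ex_generic by blast
  let ?K = "generic_kernel c (Suc j)" and ?L = "(\<lambda>(a, l). a # l) ` (P \<times> L)"
  have supp: "flat z l = 0" if z: "z \<in> ?K a" and "l \<notin> ?L" for z l a
  proof (cases l)
    case (Cons d l')
    have chain: "z \<in> chains N (Suc (Suc j)) a" using z by (simp add: generic_kernel_def canonical_chain)
    have "d \<notin> P \<or> l' \<notin> L" using that(2) Cons by force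
    then have "z d l' = 0"
      using chains_support[OF chain, of d] le_P[of a d] N_supp[OF Pi0_mem[OF chain N_subspace], of l' d]
        by (cases "z d = 0") auto
    then show ?thesis using Cons by (simp add: flat_def)
  qed (simp add: flat_def)
  have "cm_family P le rk eps bt (\<lambda>a. flat ` ?K a) P j ?L"
  proof (rule cm_family_image[OF linear_flat flat_eq_0 subspace_generic_kernel generic_kernel_mono _ _ supp])
    show "a \<notin> P \<or> j < rk a \<Longrightarrow> ?K a = {0}" for a using generic_kernel_zero[OF c] by auto
    show "\<exists>y\<in>chains ?K (Suc k) x. boundary P x y = z" if "k < j" "z \<in> chains ?K k x" "boundary P x z = 0"
      for k z x
      using generic_kernel_exact[OF j c _ that(2,3)] that(1) by simp
  qed (use fin fin_L in auto)
  moreover have "dim (flat ` ?K a) = dim (?K a)" for a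
  proof (rule dim_image_inj[OF subspace_generic_kernel _ linear_flat flat_eq_0])
    show "fin_dim (?K a)" by (rule fin_dim_subset[OF fin_dim_canonical]) (auto simp: generic_kernel_def)
  qed
  ultimately show ?thesis
    by (intro exI[of _ "\<lambda>a. flat ` ?K a"] exI[of _ ?L] conjI allI impI) (simp_all only: dim_generic_kernel[OF j c])
qed

section \<open>Polynomials with nonnegative \<open>\<gamma>\<close>-vector\<close>

abbreviation pX :: "int poly" where "pX \<equiv> [:0, 1:]"
abbreviation pY :: "int poly" where "pY \<equiv> [:1, -1:]"
abbreviation pZ :: "int poly" where "pZ \<equiv> [:1, 1:]"

inductive gamma_nonneg :: "nat \<Rightarrow> int poly \<Rightarrow> bool" where
  gamma_nonneg_0: "gamma_nonneg n 0"
| gamma_nonneg_step: "gamma_nonneg n p \<Longrightarrow> 2 * k \<le> n \<Longrightarrow> gamma_nonneg n (p + pX ^ k * pZ ^ (n - 2 * k))"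

lemma gamma_nonneg_base: "2 * k \<le> n \<Longrightarrow> gamma_nonneg n (pX ^ k * pZ ^ (n - 2 * k))"
  using gamma_nonneg_step[OF gamma_nonneg_0] by simp

lemma gamma_nonneg_add: "gamma_nonneg n p \<Longrightarrow> gamma_nonneg n q \<Longrightarrow> gamma_nonneg n (p + q)"
proof (induction rule: gamma_nonneg.induct)
  case (gamma_nonneg_step n p k)
  have "gamma_nonneg n (p + q + pX ^ k * pZ ^ (n - 2 * k))"
    using gamma_nonneg_step by (intro gamma_nonneg.gamma_nonneg_step) auto
  also have "p + q + pX ^ k * pZ ^ (n - 2 * k) = p + pX ^ k * pZ ^ (n - 2 * k) + q" by (simp only: ac_simps)
  finally show ?case .
qed simp

lemma gamma_nonneg_mult:
  assumes "gamma_nonneg a p" "gamma_nonneg b q"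
  shows "gamma_nonneg (a + b) (p * q)"
  using assms(1)
proof (induction rule: gamma_nonneg.induct)
  case (gamma_nonneg_step a p k)
  have "gamma_nonneg (a + b) (pX ^ k * pZ ^ (a - 2 * k) * q)"
    using assms(2)
  proof (induction rule: gamma_nonneg.induct)
    case (gamma_nonneg_step b q l)
    have "pX ^ k * pZ ^ (a - 2 * k) * (pX ^ l * pZ ^ (b - 2 * l))
      = pX ^ (k + l) * (pZ ^ (a - 2 * k) * pZ ^ (b - 2 * l))"
      by (simp only: power_add ac_simps)
    also have "pZ ^ (a - 2 * k) * pZ ^ (b - 2 * l) = pZ ^ (a + b - 2 * (k + l))"
      using gamma_nonneg_step.hyps \<open>2 * k \<le> a\<close> by (simp flip: power_add)
    finally have "pX ^ k * pZ ^ (a - 2 * k) * (q + pX ^ l * pZ ^ (b - 2 * l)) =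
      pX ^ k * pZ ^ (a - 2 * k) * q + pX ^ (k + l) * pZ ^ (a + b - 2 * (k + l))"
      by (simp only: distrib_left)
    moreover have "2 * (k + l) \<le> a + b" using gamma_nonneg_step.hyps \<open>2 * k \<le> a\<close> by simp
    ultimately show ?case by (simp only: gamma_nonneg.gamma_nonneg_step[OF gamma_nonneg_step.IH])
  qed (simp add: gamma_nonneg_0)
  then show ?case using gamma_nonneg_step.IH by (simp only: distrib_right gamma_nonneg_add)
qed (simp add: gamma_nonneg_0)

lemma gamma_nonneg_1: "gamma_nonneg 0 1"
  using gamma_nonneg_base[of 0 0] by simp

lemma gamma_nonneg_pZ: "gamma_nonneg n p \<Longrightarrow> gamma_nonneg (Suc n) (pZ * p)"
  using gamma_nonneg_mult[OF gamma_nonneg_base[of 0 1]] by simp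

lemma gamma_nonneg_pX: "gamma_nonneg n p \<Longrightarrow> gamma_nonneg (Suc (Suc n)) (pX * p)"
  using gamma_nonneg_mult[OF gamma_nonneg_base[of 1 2]] by simp

lemma gamma_nonneg_of_nat: "gamma_nonneg n p \<Longrightarrow> gamma_nonneg n (of_nat k * p)"
  by (induction k) (auto simp: algebra_simps gamma_nonneg_0 gamma_nonneg_add)

lemma gamma_nonneg_sum: "(\<And>i. i \<in> A \<Longrightarrow> gamma_nonneg n (p i)) \<Longrightarrow> gamma_nonneg n (\<Sum>i\<in>A. p i)"
  by (induction A rule: infinite_finite_induct) (auto simp: gamma_nonneg_0 gamma_nonneg_add)

lemma gamma_nonneg_pX_sum:
  assumes "\<And>i. i \<in> A \<Longrightarrow> 2 \<le> n \<and> gamma_nonneg (n - 2) (p i)"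
  shows "gamma_nonneg n (pX * (\<Sum>i\<in>A. p i))"
proof (cases "A = {}")
  case False
  then have "n = Suc (Suc (n - 2))" using assms by force
  then show ?thesis using gamma_nonneg_pX[OF gamma_nonneg_sum, of A "n - 2" p] assms by simp
qed (simp add: gamma_nonneg_0)

lemma gamma_nonneg_imp_coeffs:
  assumes "gamma_nonneg n p"
  shows "\<exists>c. (\<forall>k. 0 \<le> c k) \<and> p = (\<Sum>k=0..n div 2. of_int (c k) * pX ^ k * pZ ^ (n - 2 * k))"
  using assms
proof (induction rule: gamma_nonneg.induct)
  case (gamma_nonneg_0 n)
  show ?case by (intro exI[of _ "\<lambda>_. 0"]) simp
next
  case (gamma_nonneg_step n p k)
  then obtain c where c: "\<forall>k. 0 \<le> c k" "p = (\<Sum>k=0..n div 2. of_int (c k) * pX ^ k * pZ ^ (n - 2 * k))"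
    by blast
  let ?c = "\<lambda>j. c j + (if j = k then 1 else 0)"
  have "(\<Sum>j=0..n div 2. of_int (?c j) * pX ^ j * pZ ^ (n - 2 * j)) =
    p + (\<Sum>j=0..n div 2. if j = k then pX ^ j * pZ ^ (n - 2 * j) else 0)"
    unfolding c(2) sum.distrib[symmetric] by (intro sum.cong refl) (auto simp: distrib_right)
  also have "(\<Sum>j=0..n div 2. if j = k then pX ^ j * pZ ^ (n - 2 * j) else 0) = pX ^ k * pZ ^ (n - 2 * k)"
    using gamma_nonneg_step.hyps by (subst sum.delta) auto
  finally have "p + pX ^ k * pZ ^ (n - 2 * k) = (\<Sum>j=0..n div 2. of_int (?c j) * pX ^ j * pZ ^ (n - 2 * j))" ..
  moreover have "\<forall>j. 0 \<le> ?c j" using c(1) by auto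
  ultimately show ?case by (intro exI[of _ ?c] conjI)
qed

text \<open>The basis polynomials have pairwise different orders of vanishing at \<open>0\<close>.\<close>

lemma gamma_coeffs_unique:
  fixes c e :: "nat \<Rightarrow> int"
  assumes "(\<Sum>k=0..n div 2. of_int (c k) * pX ^ k * pZ ^ (n - 2 * k)) =
      (\<Sum>k=0..n div 2. of_int (e k) * pX ^ k * pZ ^ (n - 2 * k))"
    and "j \<le> n div 2"
  shows "c j = e j"
  using assms(2)
proof (induction j rule: less_induct)
  case (less j)
  define a where "a = (\<lambda>k. c k - e k)"
  let ?t = "\<lambda>k. of_int (a k) * pX ^ k * pZ ^ (n - 2 * k)"
  define S where "S = (\<Sum>k=j..n div 2. of_int (a k) * pX ^ (k - j) * pZ ^ (n - 2 * k))"
  have a0: "a k = 0" if "k < j" for k using less.IH[OF that] that less.prems by (simp add: a_def)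
  have "pX ^ j * S = (\<Sum>k=j..n div 2. ?t k)"
    unfolding S_def sum_distrib_left
  proof (rule sum.cong[OF refl])
    fix k assume "k \<in> {j..n div 2}"
    then have "pX ^ k = pX ^ j * pX ^ (k - j)" unfolding power_add[symmetric] by simp
    then show "pX ^ j * (of_int (a k) * pX ^ (k - j) * pZ ^ (n - 2 * k)) = ?t k" by (simp only: ac_simps)
  qed
  also have "\<dots> = (\<Sum>k=0..n div 2. ?t k)"
    by (rule sum.mono_neutral_left) (auto simp: a0)
  also have "\<dots> = 0"
    unfolding a_def of_int_diff left_diff_distrib sum_subtractf assms(1) by (rule diff_self)
  finally have "pX ^ j * S = 0" .
  moreover have "pX \<noteq> 0" by simp
  then have "pX ^ j \<noteq> 0" by (rule power_not_zero)
  ultimately have "S = 0" by (metis mult_eq_0_iff)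
  then have "poly S 0 = 0" by (simp only: poly_0)
  moreover have "poly S 0 = (\<Sum>k=j..n div 2. if k = j then a k else 0)"
    unfolding S_def poly_sum by (rule sum.cong) (auto simp: of_int_poly power_0_left)
  moreover have "\<dots> = a j" using less.prems by (simp add: sum.delta)
  ultimately show ?case by (simp add: a_def)
qed

locale flag_poset = cell_poset P le rk eps bot
  for P :: "'p set" and le (infix "\<sqsubseteq>" 50) and rk eps bot +
  fixes u :: "'p \<Rightarrow> int poly"
  assumes u_bot: "u bot = 1"
    and u_rec: "a \<in> P \<Longrightarrow> a \<noteq> bot \<Longrightarrow> u a = pX * (\<Sum>b | b \<sqsubseteq> a \<and> b \<noteq> a. u b * pY ^ (rk a - 1 - rk b))"
begin

definition flag_sum :: "('p \<Rightarrow> int) \<Rightarrow> nat \<Rightarrow> int poly" where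
  "flag_sum q j = (\<Sum>a | a \<in> P \<and> rk a \<le> j. of_int (q a) * u a * pY ^ (j - rk a))"

definition dual :: "('p \<Rightarrow> int) \<Rightarrow> nat \<Rightarrow> 'p \<Rightarrow> int" where
  "dual q j a = (\<Sum>b | a \<sqsubseteq> b \<and> rk b \<le> j. (-1) ^ (j - rk b) * q b)"

definition defect :: "('p \<Rightarrow> int) \<Rightarrow> nat \<Rightarrow> int poly" where
  "defect q j = (\<Sum>a | a \<in> P \<and> rk a < j. of_int (dual q j a - q a) * u a * pY ^ (j - 1 - rk a))"

definition theta :: "('p \<Rightarrow> int) \<Rightarrow> nat \<Rightarrow> int poly" where
  "theta q j = flag_sum q j - pX * defect q j"

definition boundary_sum :: "'p \<Rightarrow> int poly" where
  "boundary_sum a = (if a = bot then 1 else \<Sum>b | b \<sqsubseteq> a \<and> b \<noteq> a. u b * pY ^ (rk a - 1 - rk b))"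

lemma finite_P: "finite {a. a \<in> P \<and> Q a}"
  using fin by simp

lemma finite_below: "finite {b. b \<sqsubseteq> a \<and> Q b}"
  by (rule finite_subset[OF _ fin]) (auto dest: le_P)

lemma rk_0: "a \<in> P \<Longrightarrow> rk a = 0 \<longleftrightarrow> a = bot"
  using rk_less[OF bot_le, of a] rk_bot by (cases "a = bot") auto

lemma poset_antisym: "a \<sqsubseteq> b \<Longrightarrow> b \<sqsubseteq> a \<Longrightarrow> a = b"
  using rk_less[of a b] rk_mono[of b a] by (cases "a = b") auto

lemma sum_closed_interval:
  assumes "b \<in> P"
  shows "(\<Sum>a | a \<sqsubseteq> b. u a * pY ^ (rk b - rk a)) = boundary_sum b"
proof (cases "b = bot")
  case True
  have "{a. a \<sqsubseteq> bot} = {bot}" using poset_antisym bot_le le_P le_refl[OF bot_P] by blast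
  then show ?thesis using True by (simp add: boundary_sum_def u_bot)
next
  case False
  have "{a. a \<sqsubseteq> b} = insert b {a. a \<sqsubseteq> b \<and> a \<noteq> b}" using le_refl[OF assms] by auto
  then have "(\<Sum>a | a \<sqsubseteq> b. u a * pY ^ (rk b - rk a)) = u b + (\<Sum>a | a \<sqsubseteq> b \<and> a \<noteq> b. u a * pY ^ (rk b - rk a))"
    using finite_below by simp
  also have "(\<Sum>a | a \<sqsubseteq> b \<and> a \<noteq> b. u a * pY ^ (rk b - rk a)) =
      (\<Sum>a | a \<sqsubseteq> b \<and> a \<noteq> b. pY * (u a * pY ^ (rk b - 1 - rk a)))"
  proof (rule sum.cong[OF refl])
    fix a assume "a \<in> {a. a \<sqsubseteq> b \<and> a \<noteq> b}"
    then have "rk b - rk a = Suc (rk b - 1 - rk a)" using rk_less[of a b] by force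
    then show "u a * pY ^ (rk b - rk a) = pY * (u a * pY ^ (rk b - 1 - rk a))"
      by (simp only: power_Suc ac_simps)
  qed
  also have "\<dots> = pY * boundary_sum b" using False by (simp only: boundary_sum_def if_False sum_distrib_left)
  also have "u b = pX * boundary_sum b" using u_rec[OF assms False] False by (simp add: boundary_sum_def)
  also have "pX * boundary_sum b + pY * boundary_sum b = boundary_sum b" by (simp flip: distrib_right)
  finally show ?thesis .
qed

lemma sum_swap_above:
  fixes f :: "'p \<Rightarrow> 'p \<Rightarrow> 'b::comm_monoid_add"
  shows "(\<Sum>b | a \<sqsubseteq> b \<and> rk b \<le> j. \<Sum>c | b \<sqsubseteq> c \<and> rk c \<le> j. f b c) =
    (\<Sum>c | a \<sqsubseteq> c \<and> rk c \<le> j. \<Sum>b\<in>interval a c. f b c)"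
proof -
  let ?A = "{b. a \<sqsubseteq> b \<and> rk b \<le> j}"
  have "{c. b \<sqsubseteq> c \<and> rk c \<le> j} = {c \<in> ?A. b \<sqsubseteq> c}" if "b \<in> ?A" for b using that le_trans by blast
  moreover have "interval a c = {b \<in> ?A. b \<sqsubseteq> c}" if "c \<in> ?A" for c using that rk_mono[of _ c] by force
  ultimately show ?thesis
    using sum.swap_restrict[of ?A ?A f "(\<sqsubseteq>)"] finite_filter by simp
qed

lemma dual_top:
  assumes "a \<in> P" "rk a = j" shows "dual q j a = q a"
proof -
  have "b = a" if "a \<sqsubseteq> b" "rk b \<le> j" for b using rk_less[OF that(1)] that(2) assms by (cases "a = b") auto
  then have "{b. a \<sqsubseteq> b \<and> rk b \<le> j} = {a}" using le_refl assms by auto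
  then show ?thesis using assms by (simp add: dual_def)
qed

lemma flag_sum_dual:
  "flag_sum (dual q j) j = (\<Sum>a | a \<in> P \<and> rk a \<le> j. of_int (q a) * (- pY) ^ (j - rk a) * boundary_sum a)"
proof -
  have P_bot: "a \<in> P \<longleftrightarrow> bot \<sqsubseteq> a" for a using bot_le le_P by blast
  have "flag_sum (dual q j) j =
      (\<Sum>a | bot \<sqsubseteq> a \<and> rk a \<le> j. \<Sum>b | a \<sqsubseteq> b \<and> rk b \<le> j. of_int ((-1) ^ (j - rk b) * q b) * (u a * pY ^ (j - rk a)))"
    unfolding flag_sum_def dual_def of_int_sum sum_distrib_right P_bot by (simp only: mult.assoc)
  also have "\<dots> = (\<Sum>b | bot \<sqsubseteq> b \<and> rk b \<le> j. \<Sum>a\<in>interval bot b. of_int ((-1) ^ (j - rk b) * q b) * (u a * pY ^ (j - rk a)))"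
    by (rule sum_swap_above)
  also have "\<dots> = (\<Sum>b | bot \<sqsubseteq> b \<and> rk b \<le> j. of_int (q b) * (- pY) ^ (j - rk b) * boundary_sum b)"
  proof (rule sum.cong[OF refl])
    fix b assume b: "b \<in> {b. bot \<sqsubseteq> b \<and> rk b \<le> j}"
    have sign: "of_int ((-1) ^ (j - rk b) * q b) * (u a * pY ^ (j - rk a)) =
        of_int (q b) * (- pY) ^ (j - rk b) * (u a * pY ^ (rk b - rk a))" if "a \<in> {a. a \<sqsubseteq> b}" for a
    proof -
      have "j - rk a = (j - rk b) + (rk b - rk a)" using rk_mono[of a b] that b by simp
      then have "pY ^ (j - rk a) = pY ^ (j - rk b) * pY ^ (rk b - rk a)" by (simp only: power_add)
      then show ?thesis
        by (simp only: power_minus[of pY] of_int_mult of_int_power of_int_minus of_int_1 ac_simps)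
    qed
    have "interval bot b = {a. a \<sqsubseteq> b}" using P_bot le_P by blast
    then have "(\<Sum>a\<in>interval bot b. of_int ((-1) ^ (j - rk b) * q b) * (u a * pY ^ (j - rk a))) =
        (\<Sum>a | a \<sqsubseteq> b. of_int (q b) * (- pY) ^ (j - rk b) * (u a * pY ^ (rk b - rk a)))" by (rule sum.cong[OF _ sign])
    also have "\<dots> = of_int (q b) * (- pY) ^ (j - rk b) * boundary_sum b"
      using sum_closed_interval[of b] b P_bot by (simp only: sum_distrib_left[symmetric]) simp
    finally show "(\<Sum>a\<in>interval bot b. of_int ((-1) ^ (j - rk b) * q b) * (u a * pY ^ (j - rk a))) = \<dots>" .
  qed
  finally show ?thesis unfolding P_bot .
qed

lemma pY_defect: "pY * defect q j = flag_sum (dual q j) j - flag_sum q j"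
proof -
  have "pY * defect q j = (\<Sum>a | a \<in> P \<and> rk a < j. of_int (dual q j a - q a) * u a * pY ^ (j - rk a))"
    unfolding defect_def sum_distrib_left
  proof (rule sum.cong[OF refl])
    fix a assume "a \<in> {a. a \<in> P \<and> rk a < j}"
    then have "j - rk a = Suc (j - 1 - rk a)" by auto
    then show "pY * (of_int (dual q j a - q a) * u a * pY ^ (j - 1 - rk a)) =
      of_int (dual q j a - q a) * u a * pY ^ (j - rk a)" by (simp only: power_Suc ac_simps)
  qed
  also have "\<dots> = (\<Sum>a | a \<in> P \<and> rk a \<le> j. of_int (dual q j a - q a) * u a * pY ^ (j - rk a))"
    by (rule sum.mono_neutral_left[OF finite_P]) (auto simp: dual_top less_le)
  also have "\<dots> = flag_sum (dual q j) j - flag_sum q j"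
    unfolding flag_sum_def sum_subtractf[symmetric]
      by (intro sum.cong refl) (simp only: of_int_diff left_diff_distrib)
  finally show ?thesis .
qed

definition top_layer :: "('p \<Rightarrow> int) \<Rightarrow> nat \<Rightarrow> int poly" where
  "top_layer q j = (\<Sum>a | a \<in> P \<and> rk a = j. of_int (q a) * boundary_sum a)"

lemma sum_rk_Suc:
  "(\<Sum>a | a \<in> P \<and> rk a \<le> Suc j. F a) = (\<Sum>a | a \<in> P \<and> rk a \<le> j. F a) + (\<Sum>a | a \<in> P \<and> rk a = Suc j. F a :: int poly)"
proof -
  have "{a. a \<in> P \<and> rk a \<le> Suc j} = {a. a \<in> P \<and> rk a \<le> j} \<union> {a. a \<in> P \<and> rk a = Suc j}" by auto
  then show ?thesis by (simp only:) (rule sum.union_disjoint; auto simp: finite_P)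
qed

lemma flag_sum_Suc: "flag_sum q (Suc j) = pY * flag_sum q j + pX * top_layer q (Suc j)"
proof -
  have "(\<Sum>a | a \<in> P \<and> rk a = Suc j. of_int (q a) * u a * pY ^ (Suc j - rk a)) = pX * top_layer q (Suc j)"
    unfolding top_layer_def sum_distrib_left
  proof (rule sum.cong[OF refl])
    fix a assume a: "a \<in> {a. a \<in> P \<and> rk a = Suc j}"
    then have "a \<noteq> bot" using rk_bot by auto
    then have "u a = pX * boundary_sum a" using u_rec[of a] a by (simp add: boundary_sum_def)
    then show "of_int (q a) * u a * pY ^ (Suc j - rk a) = pX * (of_int (q a) * boundary_sum a)"
      using a by (simp add: ac_simps)
  qed
  moreover have "(\<Sum>a | a \<in> P \<and> rk a \<le> j. of_int (q a) * u a * pY ^ (Suc j - rk a)) = pY * flag_sum q j"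
    unfolding flag_sum_def sum_distrib_left
    by (intro sum.cong refl) (auto simp: Suc_diff_le simp del: mult_pCons_left mult_pCons_right)
  ultimately show ?thesis unfolding flag_sum_def[of q "Suc j"] sum_rk_Suc by simp
qed

lemma flag_sum_dual_Suc: "flag_sum (dual q (Suc j)) (Suc j) = top_layer q (Suc j) - pY * flag_sum (dual q j) j"
proof -
  have "(\<Sum>a | a \<in> P \<and> rk a = Suc j. of_int (q a) * (- pY) ^ (Suc j - rk a) * boundary_sum a) = top_layer q (Suc j)"
    unfolding top_layer_def by (intro sum.cong refl) auto
  moreover have "(\<Sum>a | a \<in> P \<and> rk a \<le> j. of_int (q a) * (- pY) ^ (Suc j - rk a) * boundary_sum a)
    = - pY * flag_sum (dual q j) j"
    unfolding flag_sum_dual sum_distrib_left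
    by (intro sum.cong refl) (auto simp: Suc_diff_le simp del: mult_pCons_left mult_pCons_right)
  ultimately show ?thesis unfolding flag_sum_dual[of q "Suc j"] sum_rk_Suc by simp
qed

lemma theta_Suc: "theta q (Suc j) = pZ * theta q j + 2 * (pX * defect q j)"
proof -
  define x y d where "x = pX" and "y = pY" and "d = flag_sum (dual q j) j"
  have xy: "x = 1 - y" "pZ = 2 - y" by (simp_all add: x_def y_def numeral_poly one_pCons)
  have defects: "y * defect q j = d - flag_sum q j"
    "y * defect q (Suc j) = top_layer q (Suc j) - y * d - flag_sum q (Suc j)"
    using pY_defect[of q j] pY_defect[of q "Suc j"] unfolding y_def d_def flag_sum_dual_Suc by simp_all
  have "y * theta q (Suc j) = y * flag_sum q (Suc j) - x * (y * defect q (Suc j))"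
    unfolding theta_def x_def[symmetric] by (simp only: right_diff_distrib ac_simps)
  also have "\<dots> = pZ * (y * flag_sum q j - x * (y * defect q j)) + 2 * x * (y * defect q j)"
    unfolding defects flag_sum_Suc x_def[symmetric] y_def[symmetric] xy by (simp add: algebra_simps)
  also have "\<dots> = y * (pZ * theta q j + 2 * (pX * defect q j))"
    unfolding theta_def x_def[symmetric] by (simp add: algebra_simps)
  finally have "y * theta q (Suc j) = y * (pZ * theta q j + 2 * (pX * defect q j))" .
  moreover have "y \<noteq> 0" by (simp add: y_def)
  ultimately show ?thesis using mult_left_cancel by blast
qed

lemma dual_dual:
  assumes a: "a \<in> P" "rk a \<le> j"
  shows "dual (dual q j) j a = q a"
proof -
  let ?S = "{b. a \<sqsubseteq> b \<and> rk b \<le> j}"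
  have "dual (dual q j) j a = (\<Sum>c\<in>?S. \<Sum>b\<in>interval a c. (-1) ^ (j - rk b) * ((-1) ^ (j - rk c) * q c))"
    unfolding dual_def sum_distrib_left by (rule sum_swap_above)
  also have "\<dots> = (\<Sum>c\<in>?S. if c = a then q a else 0)"
  proof (rule sum.cong[OF refl])
    fix c assume c: "c \<in> ?S"
    have "(-1) ^ (j - rk b) * ((-1) ^ (j - rk c) * q c) = (-1) ^ rk b * ((-1) ^ rk c * q c)"
      if "b \<in> interval a c" for b
      using that c rk_mono[of b c] by (simp add: minus_one_power_iff)
    then have "(\<Sum>b\<in>interval a c. (-1) ^ (j - rk b) * ((-1) ^ (j - rk c) * q c)) =
      (\<Sum>b\<in>interval a c. (-1) ^ rk b) * ((-1) ^ rk c * q c)" unfolding sum_distrib_right by (rule sum.cong[OF refl])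
    also have "\<dots> = (if c = a then q a else 0)"
    proof (cases "c = a")
      case True
      have "interval a a = {a}" using poset_antisym le_refl[OF a(1)] by blast
      then show ?thesis using True by (simp add: minus_one_power_iff)
    next
      case False
      then show ?thesis using euler_interval[of a c] c by simp
    qed
    finally show "(\<Sum>b\<in>interval a c. (-1) ^ (j - rk b) * ((-1) ^ (j - rk c) * q c)) = (if c = a then q a else 0)" .
  qed
  also have "\<dots> = q a" using finite_filter a le_refl by simp
  finally show ?thesis .
qed

lemma defect_self_dual:
  assumes q': "\<And>a. a \<in> P \<Longrightarrow> rk a \<le> Suc i \<Longrightarrow> q' a = dual q (Suc i) a - q a"
  shows "defect q' i = 0"
proof -
  have "dual q' i a = q' a" if a: "a \<in> P" "rk a < i" for a
  proof -
    have "dual q' i a = (\<Sum>b | a \<sqsubseteq> b \<and> rk b \<le> Suc i. - ((-1) ^ (Suc i - rk b) * q' b))"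
      unfolding dual_def
    proof (rule sum.mono_neutral_cong_left[OF finite_filter])
      show "{b. a \<sqsubseteq> b \<and> rk b \<le> i} \<subseteq> {b. a \<sqsubseteq> b \<and> rk b \<le> Suc i}" by auto
      show "\<forall>b\<in>{b. a \<sqsubseteq> b \<and> rk b \<le> Suc i} - {b. a \<sqsubseteq> b \<and> rk b \<le> i}. - ((-1) ^ (Suc i - rk b) * q' b) = 0"
        using q' dual_top le_P by (auto simp: le_Suc_eq)
      show "(-1) ^ (i - rk b) * q' b = - ((-1) ^ (Suc i - rk b) * q' b)" if "b \<in> {b. a \<sqsubseteq> b \<and> rk b \<le> i}" for b
        using that by (simp add: Suc_diff_le)
    qed
    also have "\<dots> = (\<Sum>b | a \<sqsubseteq> b \<and> rk b \<le> Suc i. (-1) ^ (Suc i - rk b) * q b - (-1) ^ (Suc i - rk b) * dual q (Suc i) b)"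
      using q' le_P by (intro sum.cong refl) (auto simp: right_diff_distrib)
    also have "\<dots> = dual q (Suc i) a - dual (dual q (Suc i)) (Suc i) a"
      unfolding sum_subtractf dual_def ..
    also have "\<dots> = q' a" using dual_dual[of a "Suc i" q] q'[of a] a by simp
    finally show ?thesis .
  qed
  then show ?thesis unfolding defect_def by (intro sum.neutral) auto
qed

lemma defect_Suc_eq_theta:
  assumes q': "\<And>a. rk a \<le> Suc i \<Longrightarrow> q' a = dual q (Suc i) a - q a"
  shows "defect q (Suc i) = theta q' i"
proof -
  have "theta q' i = flag_sum q' i" using defect_self_dual[of i q' q] q' by (simp add: theta_def)
  also have "\<dots> = defect q (Suc i)" unfolding flag_sum_def defect_def using q' by (intro sum.cong) auto
  finally show ?thesis ..
qed

theorem theta_gamma_nonneg: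
  fixes N :: "'p \<Rightarrow> ('p list \<Rightarrow> real) set"
  assumes "cm_family P le rk eps bot N U m L"
  shows "gamma_nonneg m (theta (\<lambda>a. int (dim (N a))) m)"
  using assms
proof (induction m arbitrary: N U L rule: less_induct)
  case (less m)
  let ?q = "\<lambda>a. int (dim (N a))"
  have "gamma_nonneg j (theta ?q j)" if "j \<le> m" for j
    using that
  proof (induction j)
    case 0
    have "{a. a \<in> P \<and> rk a \<le> 0} = {bot}" using rk_0 bot_P rk_bot by auto
    then have "theta ?q 0 = of_nat (dim (N bot)) * 1"
      by (simp add: theta_def flag_sum_def defect_def u_bot rk_bot)
    then show ?case using gamma_nonneg_of_nat[OF gamma_nonneg_1, of "dim (N bot)"] by (simp only:)
  next
    case (Suc j)
    have defect: "gamma_nonneg (Suc j) (pX * defect ?q j)"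
    proof (cases j)
      case 0
      then show ?thesis by (simp add: defect_def gamma_nonneg_0)
    next
      case (Suc i)
      then have i: "Suc i < m" using \<open>Suc j \<le> m\<close> by simp
      obtain N' L' where N': "cm_family P le rk eps bot N' P i (L' :: 'p list set)"
        "\<forall>a. rk a \<le> Suc i \<longrightarrow> int (dim (N' a)) =
          (\<Sum>b | a \<sqsubseteq> b \<and> rk b \<le> Suc i. (-1) ^ (Suc i - rk b) * int (dim (N b))) - int (dim (N a))"
        using cm_family_step[OF less.prems i] by blast
      have "defect ?q (Suc i) = theta (\<lambda>a. int (dim (N' a))) i"
        using N'(2) by (intro defect_Suc_eq_theta) (simp add: dual_def)
      then show ?thesis using gamma_nonneg_pX[OF less.IH[OF _ N'(1)]] i Suc by simp
    qed
    have "gamma_nonneg (Suc j) (pZ * theta ?q j)" using Suc by (intro gamma_nonneg_pZ) simp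
    moreover have "theta ?q (Suc j) = pZ * theta ?q j + (pX * defect ?q j + pX * defect ?q j)"
      unfolding theta_Suc by (simp only: mult_2)
    ultimately show ?case using gamma_nonneg_add[OF _ gamma_nonneg_add[OF defect defect]] by (simp only:)
  qed
  then show ?case by simp
qed

end

section \<open>Eulerian and derangement polynomials\<close>

lemma fps_linear_ode_zero:
  fixes Z :: "'a::field_char_0 fps"
  assumes "fps_deriv Z = G * Z" "fps_nth Z 0 = 0"
  shows "Z = 0"
proof -
  have "fps_nth Z n = 0" for n
  proof (induction n rule: less_induct)
    case (less n)
    show ?case
    proof (cases n)
      case 0 then show ?thesis using assms(2) by simp
    next
      case (Suc m)
      have "of_nat (Suc m) * fps_nth Z (Suc m) = fps_nth (G * Z) m"
        unfolding assms(1)[symmetric] by (simp add: fps_deriv_def)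
      also have "\<dots> = 0" unfolding fps_mult_nth using less Suc by (intro sum.neutral) auto
      finally show ?thesis using Suc by (simp del: of_nat_Suc)
    qed
  qed
  then show ?thesis by (simp add: fps_eq_iff)
qed

definition egf :: "(nat \<Rightarrow> 'a::field_char_0) \<Rightarrow> 'a fps" where
  "egf f = Abs_fps (\<lambda>n. f n / fact n)"

lemma egf_nth_0: "fps_nth (egf f) 0 = f 0"
  by (simp add: egf_def)

lemma egf_mult: "egf f * egf g = egf (\<lambda>n. \<Sum>k\<le>n. of_nat (n choose k) * f k * g (n - k))"
proof (rule fps_ext)
  fix n
  have "(\<Sum>k=0..n. f k / fact k * (g (n - k) / fact (n - k))) =
    (\<Sum>k\<le>n. of_nat (n choose k) * f k * g (n - k)) / fact n"
    unfolding sum_divide_distrib atMost_atLeast0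
    by (rule sum.cong) (auto simp: binomial_fact field_simps)
  then show "fps_nth (egf f * egf g) n = fps_nth (egf (\<lambda>n. \<Sum>k\<le>n. of_nat (n choose k) * f k * g (n - k))) n"
    by (simp add: egf_def fps_mult_nth)
qed

lemma egf_deriv: "fps_deriv (egf f) = egf (\<lambda>n. f (Suc n))"
  by (rule fps_ext) (simp add: egf_def del: of_nat_Suc)

lemma egf_add: "egf f + egf g = egf (\<lambda>n. f n + g n)" and egf_diff: "egf f - egf g = egf (\<lambda>n. f n - g n)"
  by (rule fps_ext, simp add: egf_def add_divide_distrib diff_divide_distrib)+

lemma egf_const: "fps_const c * egf f = egf (\<lambda>n. c * f n)"
  by (rule fps_ext) (simp add: egf_def)

lemma egf_one: "1 = egf (\<lambda>n. if n = 0 then 1 else 0)"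
  by (rule fps_ext) (simp add: egf_def)

lemma egf_inj: "egf f = egf g \<Longrightarrow> f n = g n"
  by (simp add: egf_def fps_eq_iff)

fun eulerian :: "nat \<Rightarrow> int poly" where
  "eulerian 0 = 0"
| "eulerian (Suc n) = (if n = 0 then 1 else pZ * eulerian n) +
      pX * (\<Sum>k\<in>{1..<n}. of_nat (n choose k) * eulerian k * eulerian (n - k))"

fun derangement :: "nat \<Rightarrow> int poly" where
  "derangement 0 = 1"
| "derangement (Suc n) = pX * (\<Sum>k<n. of_nat (n choose k) * derangement k * eulerian (n - k))"

declare eulerian.simps(2)[simp del] derangement.simps(2)[simp del]

lemma gamma_nonneg_of_nat_mult:
  assumes "gamma_nonneg a p" "gamma_nonneg b q" "a + b = n"
  shows "gamma_nonneg n (of_nat c * p * q)"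
  using gamma_nonneg_of_nat[OF gamma_nonneg_mult[OF assms(1,2)]] assms(3) by (simp add: mult.assoc)

lemma eulerian_gamma_nonneg: "gamma_nonneg n (eulerian (Suc n))"
proof (induction n rule: less_induct)
  case (less n)
  have gamma_pred: "gamma_nonneg (k - 1) (eulerian k)" if "0 < k" "k \<le> n" for k
    using less[of "k - 1"] that by simp
  have "gamma_nonneg n (pX * (\<Sum>k\<in>{1..<n}. of_nat (n choose k) * eulerian k * eulerian (n - k)))"
  proof (rule gamma_nonneg_pX_sum)
    fix k assume "k \<in> {1..<n}"
    then show "2 \<le> n \<and> gamma_nonneg (n - 2) (of_nat (n choose k) * eulerian k * eulerian (n - k))"
      using gamma_nonneg_of_nat_mult[OF gamma_pred[of k] gamma_pred[of "n - k"]] by auto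
  qed
  moreover have "gamma_nonneg n (if n = 0 then 1 else pZ * eulerian n)"
    using gamma_nonneg_pZ[OF gamma_pred[of n]] gamma_nonneg_1 by auto
  ultimately show ?case unfolding eulerian.simps(2) by (intro gamma_nonneg_add)
qed

lemma derangement_gamma_nonneg: "gamma_nonneg n (derangement n)"
proof (induction n rule: less_induct)
  case (less n)
  show ?case
  proof (cases n)
    case (Suc m)
    have "gamma_nonneg (m - k - 1) (eulerian (m - k))" if "k < m" for k
      using eulerian_gamma_nonneg[of "m - Suc k"] that Suc_diff_Suc[of k m] by simp
    from gamma_nonneg_of_nat_mult[OF less this]
    have "gamma_nonneg n (pX * (\<Sum>k<m. of_nat (m choose k) * derangement k * eulerian (m - k)))"
      using Suc by (intro gamma_nonneg_pX_sum) auto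
    then show ?thesis using Suc by (simp add: derangement.simps)
  qed (simp add: gamma_nonneg_1)
qed

definition eulerian_egf :: "int \<Rightarrow> real fps" where
  "eulerian_egf x = egf (\<lambda>n. of_int (poly (eulerian n) x))"

definition derangement_egf :: "int \<Rightarrow> real fps" where
  "derangement_egf x = egf (\<lambda>n. of_int (poly (derangement n) x))"

text \<open>The power series of \<open>(exp (y * t) - 1) / y\<close>, which is \<open>t\<close> for \<open>y = 0\<close>.\<close>

definition expm1_egf :: "'a::field_char_0 \<Rightarrow> 'a fps" where
  "expm1_egf y = egf (\<lambda>n. if n = 0 then 0 else y ^ (n - 1))"

lemma eulerian_egf_deriv:
  fixes x :: int
  defines "A \<equiv> eulerian_egf x" and "c \<equiv> fps_const (real_of_int x)"
  shows "fps_deriv A = (1 + A) * (1 + c * A)"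
proof -
  define a where "a n = real_of_int (poly (eulerian n) x)" for n
  have a0: "a 0 = 0" by (simp add: a_def)
  have "a (Suc n) = (if n = 0 then 1 else 0) + (1 + x) * a n + x * (\<Sum>k\<le>n. of_nat (n choose k) * a k * a (n - k))" for n
  proof -
    have "(\<Sum>k\<le>n. of_nat (n choose k) * a k * a (n - k)) = (\<Sum>k\<in>{1..<n}. of_nat (n choose k) * a k * a (n - k))"
    proof (rule sum.mono_neutral_right)
      show "\<forall>k\<in>{..n} - {1..<n}. of_nat (n choose k) * a k * a (n - k) = 0"
      proof
        fix k assume "k \<in> {..n} - {1..<n}"
        then have "k = 0 \<or> k = n" by auto
        then show "of_nat (n choose k) * a k * a (n - k) = 0" using a0 by auto
      qed
    qed auto
    then show ?thesis using a0 by (auto simp: a_def eulerian.simps poly_sum of_nat_poly algebra_simps)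
  qed
  then have "fps_deriv A = 1 + A + c * A + c * (A * A)"
    unfolding A_def eulerian_egf_def a_def[symmetric] c_def egf_deriv egf_one egf_mult egf_const egf_add
    by (simp add: algebra_simps)
  then show ?thesis by (simp add: algebra_simps)
qed

lemma derangement_egf_deriv: "fps_deriv (derangement_egf x)
  = fps_const (of_int x) * (derangement_egf x * eulerian_egf x)"
proof -
  define a d where "a n = real_of_int (poly (eulerian n) x)" and "d n = real_of_int (poly (derangement n) x)" for n
  have "d (Suc n) = x * (\<Sum>k\<le>n. of_nat (n choose k) * d k * a (n - k))" for n
  proof -
    have "(\<Sum>k\<le>n. of_nat (n choose k) * d k * a (n - k)) = (\<Sum>k<n. of_nat (n choose k) * d k * a (n - k))"
      by (simp add: lessThan_Suc_atMost[symmetric] a_def)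
    then show ?thesis by (simp add: d_def a_def derangement.simps poly_sum of_nat_poly mult.assoc)
  qed
  then show ?thesis
    unfolding derangement_egf_def eulerian_egf_def a_def[symmetric] d_def[symmetric] egf_deriv egf_mult egf_const by simp
qed

lemma expm1_egf_deriv: "fps_deriv (expm1_egf y) = 1 + fps_const y * expm1_egf y"
  unfolding expm1_egf_def egf_deriv egf_one egf_const egf_add
    by (rule arg_cong[of _ _ egf]) (auto simp: power_eq_if)

text \<open>Both sides of the next two identities solve the same linear differential equation.\<close>

lemma eulerian_egf_eq:
  fixes x :: int
  defines "A \<equiv> eulerian_egf x" and "c \<equiv> fps_const (real_of_int x)" and "Q \<equiv> expm1_egf (1 - real_of_int x)"
  shows "A = (1 + c * A) * Q"
proof -
  have Q: "fps_deriv Q = 1 + (1 - c) * Q"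
    unfolding Q_def c_def expm1_egf_deriv fps_const_sub[symmetric] by simp
  have A: "fps_deriv A = (1 + A) * (1 + c * A)" unfolding A_def c_def by (rule eulerian_egf_deriv)
  define Z where "Z = A - (1 + c * A) * Q"
  have "fps_deriv Z = (1 + c * A) * Z"
    unfolding Z_def by (simp add: A Q) (simp add: c_def algebra_simps)
  moreover have "fps_nth Z 0 = 0"
    by (simp add: Z_def A_def Q_def eulerian_egf_def expm1_egf_def egf_nth_0)
  ultimately have "Z = 0" by (rule fps_linear_ode_zero)
  then show ?thesis by (simp add: Z_def)
qed

lemma derangement_egf_eq:
  fixes x :: int
  defines "D \<equiv> derangement_egf x" and "c \<equiv> fps_const (real_of_int x)" and "Q \<equiv> expm1_egf (1 - real_of_int x)"
  shows "D * (1 - c * Q) = egf (\<lambda>n. (- real_of_int x) ^ n)"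
proof -
  define A E where "A = eulerian_egf x" and "E = egf (\<lambda>n. (- real_of_int x) ^ n)"
  have Q: "fps_deriv Q = 1 + (1 - c) * Q"
    unfolding Q_def c_def expm1_egf_deriv fps_const_sub[symmetric] by simp
  have D: "fps_deriv D = c * (D * A)" unfolding D_def c_def A_def by (rule derangement_egf_deriv)
  have E: "fps_deriv E = - (c * E)"
    unfolding E_def c_def egf_deriv egf_const by (rule fps_ext) (simp add: egf_def)
  have "A - c * A * Q = Q"
    using eulerian_egf_eq[of x] unfolding A_def c_def Q_def by (simp add: algebra_simps)
  moreover have "fps_deriv (D * (1 - c * Q)) = c * D * ((A - c * A * Q) - 1 - Q + c * Q)"
    by (simp add: D Q) (simp add: c_def algebra_simps)
  ultimately have "fps_deriv (D * (1 - c * Q) - E) = (- c) * (D * (1 - c * Q) - E)"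
    unfolding fps_deriv_sub E by (simp add: algebra_simps)
  moreover have "fps_nth (D * (1 - c * Q) - E) 0 = 0"
    by (simp add: D_def E_def Q_def derangement_egf_def expm1_egf_def egf_nth_0)
  ultimately have "D * (1 - c * Q) - E = 0" by (rule fps_linear_ode_zero)
  then show ?thesis by (simp add: E_def)
qed

lemma derangement_identity:
  "derangement m - pX * (\<Sum>k<m. of_nat (m choose k) * derangement k * pY ^ (m - k - 1)) = (- pX) ^ m"
  (is "?p = _")
proof -
  have "poly ?p x = (- x) ^ m" for x
  proof -
    define d where "d n = real_of_int (poly (derangement n) x)" for n
    define q where "q n = (if n = 0 then 0 else (1 - real_of_int x) ^ (n - 1))" for n
    have "derangement_egf x - fps_const (of_int x) * (derangement_egf x * expm1_egf (1 - of_int x))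
      = egf (\<lambda>n. (- real_of_int x) ^ n)"
      using derangement_egf_eq[of x] by (simp add: algebra_simps)
    then have "d m - x * (\<Sum>k\<le>m. of_nat (m choose k) * d k * q (m - k)) = (- x) ^ m"
      unfolding derangement_egf_def expm1_egf_def d_def[symmetric] q_def[symmetric] egf_mult egf_const egf_diff
      by (drule_tac n = m in egf_inj) simp
    moreover have "(\<Sum>k\<le>m. of_nat (m choose k) * d k * q (m - k)) =
        (\<Sum>k<m. of_nat (m choose k) * d k * (1 - real_of_int x) ^ (m - k - 1))"
      by (simp add: lessThan_Suc_atMost[symmetric] q_def)
    ultimately have "real_of_int (poly ?p x) = real_of_int ((- x) ^ m)"
      by (simp add: d_def poly_sum of_nat_poly mult.assoc)
    then show ?thesis by (simp only: of_int_eq_iff)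
  qed
  then show ?thesis unfolding poly_eq_poly_eq_iff[symmetric] by (intro ext) simp
qed

lemma sum_subsets_card:
  assumes "finite A"
  shows "(\<Sum>B\<in>Pow A. f (card B)) = (\<Sum>k\<le>card A. of_nat (card A choose k) * (f k :: 'b::comm_ring_1))"
proof -
  have "(\<Sum>B\<in>Pow A. f (card B)) = (\<Sum>k\<le>card A. \<Sum>B | B \<in> Pow A \<and> card B = k. f (card B))"
    using assms by (intro sum.group[symmetric]) (auto simp: card_mono)
  also have "\<dots> = (\<Sum>k\<le>card A. of_nat (card A choose k) * f k)"
    using n_subsets[OF assms] by (intro sum.cong) auto
  finally show ?thesis .
qed

lemma sum_supersets:
  fixes g :: "nat \<Rightarrow> nat \<Rightarrow> 'b::comm_ring_1"
  assumes "finite V" "G \<subseteq> V"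
  shows "(\<Sum>F | G \<subseteq> F \<and> F \<subseteq> V. g (card (V - F)) (card (F - G))) =
    (\<Sum>k\<le>card (V - G). of_nat (card (V - G) choose k) * g k (card (V - G) - k))"
proof -
  have "(\<Sum>F | G \<subseteq> F \<and> F \<subseteq> V. g (card (V - F)) (card (F - G))) =
    (\<Sum>B\<in>Pow (V - G). g (card B) (card (V - G) - card B))"
  proof (rule sum.reindex_bij_witness[of _ "\<lambda>B. V - B" "\<lambda>F. V - F"])
    fix F assume F: "F \<in> {F. G \<subseteq> F \<and> F \<subseteq> V}"
    then have "F - G = (V - G) - (V - F)" by auto
    moreover have "card ((V - G) - (V - F)) = card (V - G) - card (V - F)"
      using F assms by (intro card_Diff_subset) (auto intro: finite_subset[of _ V])
    ultimately show "g (card (V - F)) (card (V - G) - card (V - F)) = g (card (V - F)) (card (F - G))" by simp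
  qed (use assms in auto)
  also have "\<dots> = (\<Sum>k\<le>card (V - G). of_nat (card (V - G) choose k) * g k (card (V - G) - k))"
    using sum_subsets_card[of "V - G" "\<lambda>k. g k (card (V - G) - k)"] assms by simp
  finally show ?thesis .
qed

lemma sum_strict_supersets:
  fixes g :: "nat \<Rightarrow> nat \<Rightarrow> 'b::comm_ring_1"
  assumes V: "finite V" "G \<subseteq> V"
  shows "(\<Sum>F | G \<subset> F \<and> F \<subseteq> V. g (card (V - F)) (card (F - G))) =
    (\<Sum>k<card (V - G). of_nat (card (V - G) choose k) * g k (card (V - G) - k))"
proof -
  have "{F. G \<subseteq> F \<and> F \<subseteq> V} = insert G {F. G \<subset> F \<and> F \<subseteq> V}" using V by auto
  then show ?thesis using sum_supersets[OF V, of g] V(1) by (simp add: lessThan_Suc_atMost[symmetric])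
qed

lemma alternating_sum_subsets:
  fixes I :: "'v set \<Rightarrow> int poly"
  assumes V: "finite V"
  shows "(\<Sum>F\<in>Pow V. (-1) ^ (card V - card F) * (\<Sum>G\<in>Pow F. I G * pY ^ (card F - card G))) =
    (\<Sum>G\<in>Pow V. I G * (- pX) ^ card (V - G))"
proof -
  have card_diff: "card (F - G) = card F - card G" if "G \<subseteq> F" "F \<subseteq> V" for F G
    using that V by (intro card_Diff_subset) (auto intro: finite_subset)
  let ?h = "\<lambda>F G. (-1) ^ card (V - F) * (I G * pY ^ card (F - G))"
  have "(\<Sum>F\<in>Pow V. (-1) ^ (card V - card F) * (\<Sum>G\<in>Pow F. I G * pY ^ (card F - card G))) =
      (\<Sum>F\<in>Pow V. \<Sum>G | G \<in> Pow V \<and> G \<subseteq> F. ?h F G)"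
    unfolding sum_distrib_left using card_diff by (intro sum.cong) auto
  also have "\<dots> = (\<Sum>G\<in>Pow V. \<Sum>F | F \<in> Pow V \<and> G \<subseteq> F. ?h F G)"
    using V by (intro sum.swap_restrict) auto
  also have "\<dots> = (\<Sum>G\<in>Pow V. I G * (- pX) ^ card (V - G))"
  proof (rule sum.cong[OF refl])
    fix G assume "G \<in> Pow V"
    then have G: "G \<subseteq> V" by simp
    have "(\<Sum>F | F \<in> Pow V \<and> G \<subseteq> F. ?h F G) = I G * (\<Sum>F | G \<subseteq> F \<and> F \<subseteq> V. (-1) ^ card (V - F) * pY ^ card (F - G))"
      unfolding sum_distrib_left by (intro sum.cong) (auto simp: mult_ac)
    also have "(\<Sum>F | G \<subseteq> F \<and> F \<subseteq> V. (-1) ^ card (V - F) * pY ^ card (F - G)) =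
      (\<Sum>k\<le>card (V - G). of_nat (card (V - G) choose k) * ((-1) ^ k * pY ^ (card (V - G) - k)))"
      by (rule sum_supersets[OF V G, of "\<lambda>a b. (-1) ^ a * pY ^ b"])
    also have "\<dots> = ((-1) + pY) ^ card (V - G)" unfolding binomial_ring mult.assoc ..
    also have "(-1) + pY = - pX" by (simp add: one_pCons)
    finally show "(\<Sum>F | F \<in> Pow V \<and> G \<subseteq> F. ?h F G) = I G * (- pX) ^ card (V - G)" .
  qed
  finally show ?thesis .
qed

lemma sum_derangement:
  fixes I :: "'v set \<Rightarrow> int poly"
  assumes V: "finite V"
  shows "(\<Sum>F\<in>Pow V. (I F - pX * (\<Sum>G | G \<subset> F. I G * pY ^ (card F - card G - 1))) * derangement (card (V - F))) =
    (\<Sum>G\<in>Pow V. I G * (- pX) ^ card (V - G))"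
proof -
  let ?h = "\<lambda>F G. I G * (pX * (derangement (card (V - F)) * pY ^ (card (F - G) - 1)))"
  have "(I F - pX * (\<Sum>G | G \<subset> F. I G * pY ^ (card F - card G - 1))) * derangement (card (V - F)) =
      I F * derangement (card (V - F)) - (\<Sum>G | G \<in> Pow V \<and> G \<subset> F. ?h F G)" if F: "F \<in> Pow V" for F
  proof -
    have card_diff: "card (F - G) = card F - card G" if "G \<subset> F" for G
      using that F finite_subset[OF _ V, of G] by (intro card_Diff_subset) blast+
    have "(\<Sum>G | G \<in> Pow V \<and> G \<subset> F. ?h F G) = pX * (\<Sum>G | G \<subset> F. I G * pY ^ (card F - card G - 1)) * derangement (card (V - F))"
      unfolding sum_distrib_left sum_distrib_right
    proof (rule sum.cong)
      show "{G. G \<in> Pow V \<and> G \<subset> F} = {G. G \<subset> F}" using F by blast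
    qed (simp only: mem_Collect_eq card_diff mult_ac)
    then show ?thesis by (simp only: left_diff_distrib)
  qed
  then have "(\<Sum>F\<in>Pow V. (I F - pX * (\<Sum>G | G \<subset> F. I G * pY ^ (card F - card G - 1))) * derangement (card (V - F))) =
      (\<Sum>F\<in>Pow V. I F * derangement (card (V - F))) - (\<Sum>F\<in>Pow V. \<Sum>G | G \<in> Pow V \<and> G \<subset> F. ?h F G)"
    by (simp only: sum_subtractf cong: sum.cong)
  also have "(\<Sum>F\<in>Pow V. \<Sum>G | G \<in> Pow V \<and> G \<subset> F. ?h F G) = (\<Sum>G\<in>Pow V. \<Sum>F | F \<in> Pow V \<and> G \<subset> F. ?h F G)"
    using V by (intro sum.swap_restrict) auto
  also have "(\<Sum>F\<in>Pow V. I F * derangement (card (V - F))) - \<dots> = (\<Sum>G\<in>Pow V. I G * (- pX) ^ card (V - G))"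
    unfolding sum_subtractf[symmetric]
  proof (rule sum.cong[OF refl])
    fix G assume G: "G \<in> Pow V"
    let ?m = "card (V - G)"
    have "(\<Sum>F | F \<in> Pow V \<and> G \<subset> F. ?h F G) = (\<Sum>F | G \<subset> F \<and> F \<subseteq> V. ?h F G)"
      by (intro sum.cong) auto
    also have "\<dots> = (\<Sum>k<?m. of_nat (?m choose k) * (I G * (pX * (derangement k * pY ^ (?m - k - 1)))))"
      using G by (intro sum_strict_supersets[OF V, of G "\<lambda>a b. I G * (pX * (derangement a * pY ^ (b - 1)))"]) simp
    also have "\<dots> = I G * (pX * (\<Sum>k<?m. of_nat (?m choose k) * derangement k * pY ^ (?m - k - 1)))"
      by (simp only: sum_distrib_left mult_ac)
    finally show "I G * derangement ?m - (\<Sum>F | F \<in> Pow V \<and> G \<subset> F. ?h F G) = I G * (- pX) ^ ?m"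
      by (simp only: right_diff_distrib[symmetric] derangement_identity)
  qed
  finally show ?thesis .
qed

lemma alternating_sum_gamma_nonneg:
  fixes I :: "'v set \<Rightarrow> int poly"
  assumes V: "finite V"
    and theta: "\<And>F. F \<subseteq> V \<Longrightarrow> gamma_nonneg (card F) (I F - pX * (\<Sum>G | G \<subset> F. I G * pY ^ (card F - card G - 1)))"
  shows "gamma_nonneg (card V) (\<Sum>F\<in>Pow V. (-1) ^ (card V - card F) * (\<Sum>G\<in>Pow F. I G * pY ^ (card F - card G)))"
  unfolding alternating_sum_subsets[OF V] sum_derangement[OF V, symmetric]
proof (rule gamma_nonneg_sum)
  fix F assume F: "F \<in> Pow V"
  have "card F + card (V - F) = card V"
    using F V card_Diff_subset[of F V] card_mono[OF V, of F] finite_subset[of F V] by auto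
  then show "gamma_nonneg (card V) ((I F - pX * (\<Sum>G | G \<subset> F. I G * pY ^ (card F - card G - 1))) * derangement (card (V - F)))"
    using gamma_nonneg_mult[OF theta derangement_gamma_nonneg, of F "card (V - F)"] F by simp
qed

section \<open>Relative singular homology on the chain level\<close>

abbreviation chain_in :: "'a topology \<Rightarrow> nat \<Rightarrow> 'a set \<Rightarrow> 'a chain \<Rightarrow> bool" where
  "chain_in X p A \<equiv> singular_chain p (subtopology X A)"

definition relcycle :: "'a topology \<Rightarrow> nat \<Rightarrow> 'a set \<Rightarrow> 'a set \<Rightarrow> 'a chain \<Rightarrow> bool" where
  "relcycle X p A B c \<longleftrightarrow> chain_in X p A c \<and> chain_in X (p - 1) B (chain_boundary p c)"

definition relboundary :: "'a topology \<Rightarrow> nat \<Rightarrow> 'a set \<Rightarrow> 'a set \<Rightarrow> 'a chain \<Rightarrow> bool" where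
  "relboundary X p A B c \<longleftrightarrow> (\<exists>d e. chain_in X (Suc p) A d \<and> chain_in X p B e \<and> c = chain_boundary (Suc p) d + e)"

definition rel_acyclic :: "'a topology \<Rightarrow> 'a set \<Rightarrow> 'a set \<Rightarrow> bool" where
  "rel_acyclic X A B \<longleftrightarrow> (\<forall>p c. relcycle X p A B c \<longrightarrow> relboundary X p A B c)"

lemma singular_relcycle_eq: "B \<subseteq> A \<Longrightarrow> singular_relcycle p (subtopology X A) B = relcycle X p A B"
  by (intro ext) (simp add: singular_relcycle relcycle_def subtopology_subtopology inf.absorb2)

lemma singular_relboundary_eq: "B \<subseteq> A \<Longrightarrow> singular_relboundary p (subtopology X A) B = relboundary X p A B"
  by (intro ext) (auto simp: singular_relboundary relboundary_def subtopology_subtopology inf.absorb2)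

lemma relcycle_mono: "relcycle X p A B c \<Longrightarrow> A \<subseteq> A' \<Longrightarrow> B \<subseteq> B' \<Longrightarrow> relcycle X p A' B' c"
  unfolding relcycle_def using singular_chain_mono by blast

lemma relboundary_mono: "relboundary X p A B c \<Longrightarrow> A \<subseteq> A' \<Longrightarrow> B \<subseteq> B' \<Longrightarrow> relboundary X p A' B' c"
  unfolding relboundary_def using singular_chain_mono by blast

lemma relcycle_cmul: "relcycle X p A B c \<Longrightarrow> relcycle X p A B (frag_cmul n c)"
  by (simp add: relcycle_def chain_boundary_cmul singular_chain_cmul)

lemma relcycle_diff: "relcycle X p A B c \<Longrightarrow> relcycle X p A B d \<Longrightarrow> relcycle X p A B (c - d)"
  by (simp add: relcycle_def chain_boundary_diff singular_chain_diff)

lemma relboundary_add: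
  assumes "relboundary X p A B c" "relboundary X p A B c'" shows "relboundary X p A B (c + c')"
proof -
  obtain d e d' e' where "chain_in X (Suc p) A d" "chain_in X p B e" "c = chain_boundary (Suc p) d + e"
    "chain_in X (Suc p) A d'" "chain_in X p B e'" "c' = chain_boundary (Suc p) d' + e'"
    using assms unfolding relboundary_def by auto
  then show ?thesis unfolding relboundary_def
    by (intro exI[of _ "d + d'"] exI[of _ "e + e'"])
      (auto simp: chain_boundary_add intro: singular_chain_add)
qed

lemma relboundary_cmul:
  assumes "relboundary X p A B c" shows "relboundary X p A B (frag_cmul n c)"
proof -
  obtain d e where "chain_in X (Suc p) A d" "chain_in X p B e" "c = chain_boundary (Suc p) d + e"
    using assms unfolding relboundary_def by auto
  then show ?thesis unfolding relboundary_def
    by (intro exI[of _ "frag_cmul n d"] exI[of _ "frag_cmul n e"])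
      (auto simp: chain_boundary_cmul frag_cmul_distrib2 intro: singular_chain_cmul)
qed

lemma relboundary_minus: "relboundary X p A B c \<Longrightarrow> relboundary X p A B (- c)"
  using relboundary_cmul[where n="-1" and c=c] by simp

lemma relboundary_diff: "relboundary X p A B c \<Longrightarrow> relboundary X p A B c' \<Longrightarrow> relboundary X p A B (c - c')"
  using relboundary_add[of X p A B c "- c'"] relboundary_minus[of X p A B c'] by simp

lemma relboundary_chain_in: "chain_in X p B c \<Longrightarrow> relboundary X p A B c"
  unfolding relboundary_def by (intro exI[of _ 0] exI[of _ c]) auto

lemma relboundary_boundary: "chain_in X (Suc p) A d \<Longrightarrow> relboundary X p A B (chain_boundary (Suc p) d)"
  unfolding relboundary_def by (intro exI[of _ d] exI[of _ 0]) auto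

lemma relboundary_sum: "(\<And>i. i \<in> I \<Longrightarrow> relboundary X p A B (f i)) \<Longrightarrow> relboundary X p A B (sum f I)"
proof (induction I rule: infinite_finite_induct)
  case (insert i I) then show ?case using relboundary_add by (metis insertCI sum.insert)
qed (auto intro: relboundary_chain_in)

lemma rel_acyclicD: "rel_acyclic X A B \<Longrightarrow> relcycle X p A B c \<Longrightarrow> relboundary X p A B c"
  unfolding rel_acyclic_def by blast

lemma relboundaryE:
  assumes "relboundary X p A B c"
  obtains d e where "chain_in X (Suc p) A d" "chain_in X p B e" "c = chain_boundary (Suc p) d + e" "chain_boundary p c = chain_boundary p e"
proof -
  obtain d e where de: "chain_in X (Suc p) A d" "chain_in X p B e" "c = chain_boundary (Suc p) d + e"
    using assms unfolding relboundary_def by blast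
  then have "chain_boundary p c = chain_boundary p e"
    using chain_boundary_boundary_alt[OF de(1)] by (simp add: chain_boundary_add)
  with de show ?thesis by (rule that)
qed

lemma relboundary_imp_chain_in:
  assumes "relboundary X p A B c" "B \<subseteq> A" shows "chain_in X p A c"
proof -
  obtain d e where "chain_in X (Suc p) A d" "chain_in X p B e" "c = chain_boundary (Suc p) d + e"
    using assms(1) unfolding relboundary_def by blast
  then show ?thesis
    using singular_chain_boundary[of "Suc p" _ d] singular_chain_mono[OF _ assms(2)]
    by (auto intro: singular_chain_add)
qed

lemma relcycle_reduce:
  assumes "relcycle X p A C c" "relboundary X p A B c"
  obtains e where "relcycle X p B C e" "relboundary X p A C (c - e)"
proof -
  obtain d e where de: "chain_in X (Suc p) A d" "chain_in X p B e" "c = chain_boundary (Suc p) d + e"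
    "chain_boundary p c = chain_boundary p e"
    using assms(2) by (rule relboundaryE)
  then have "relcycle X p B C e" using assms(1) by (simp add: relcycle_def)
  moreover have "relboundary X p A C (c - e)" using relboundary_boundary[OF de(1)] de(3) by simp
  ultimately show ?thesis by (rule that)
qed

lemma relboundary_lift:
  assumes "\<And>e. relcycle X p B C e \<Longrightarrow> relboundary X p B C e" "B \<subseteq> A" "relcycle X p A C c" "relboundary X p A B c"
  shows "relboundary X p A C c"
proof -
  obtain e where e: "relcycle X p B C e" "relboundary X p A C (c - e)"
    using assms(3,4) by (rule relcycle_reduce)
  have "relboundary X p A C e" using relboundary_mono[OF assms(1)[OF e(1)] assms(2)] by blast
  from relboundary_add[OF e(2) this] show ?thesis by simp
qed

lemma relboundary_restrict:
  assumes "\<And>d. relcycle X (Suc p) A B d \<Longrightarrow> relboundary X (Suc p) A B d" "C \<subseteq> B"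
    and c: "chain_in X p B c" "relboundary X p A C c"
  shows "relboundary X p B C c"
proof -
  obtain d e where de: "chain_in X (Suc p) A d" "chain_in X p C e" "c = chain_boundary (Suc p) d + e"
    using c(2) unfolding relboundary_def by blast
  have "chain_in X p B (c - e)"
    using c(1) singular_chain_mono[OF de(2) assms(2)] by (rule singular_chain_diff)
  then have "relcycle X (Suc p) A B d" using de by (simp add: relcycle_def)
  then obtain g where g: "chain_in X (Suc p) B g" "chain_boundary (Suc p) d = chain_boundary (Suc p) g"
    using assms(1) relboundaryE by metis
  then show ?thesis
    unfolding de(3) g(2)
    using relboundary_boundary[OF g(1)] relboundary_chain_in[OF de(2)] by (intro relboundary_add)
qed

lemma relcycle_lift:
  assumes "rel_acyclic X B C" "C \<subseteq> B" "B \<subseteq> A" "relcycle X p A B c"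
  obtains c' where "relcycle X p A C c'" "relboundary X p A B (c - c')"
proof (cases p)
  case 0
  then have "relcycle X p A C c" using assms(4) by (simp add: relcycle_def chain_boundary_def)
  moreover have "relboundary X p A B (c - c)" using relboundary_chain_in[of _ X B 0 A] by simp
  ultimately show ?thesis using that by blast
next
  case (Suc q)
  have "relcycle X q B C (chain_boundary p c)"
    using assms(4) Suc chain_boundary_boundary_alt[of q "subtopology X A" c] by (simp add: relcycle_def)
  then obtain d e where de: "chain_in X p B d" "chain_in X q C e" "chain_boundary p c = chain_boundary p d + e"
    using rel_acyclicD[OF assms(1)] Suc unfolding relboundary_def by blast
  have "relcycle X p A C (c - d)"
    using assms(4) de singular_chain_mono[OF de(1) assms(3)] Suc
    by (auto simp: relcycle_def chain_boundary_diff intro: singular_chain_diff)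
  moreover have "relboundary X p A B (c - (c - d))" using relboundary_chain_in[OF de(1)] by simp
  ultimately show ?thesis using that by blast
qed

lemma rel_acyclic_trans:
  assumes "rel_acyclic X A B" "rel_acyclic X B C" "C \<subseteq> B" "B \<subseteq> A"
  shows "rel_acyclic X A C"
  unfolding rel_acyclic_def
proof (intro allI impI)
  fix p c assume c: "relcycle X p A C c"
  show "relboundary X p A C c"
    by (rule relboundary_lift[OF rel_acyclicD[OF assms(2)] assms(4) c rel_acyclicD[OF assms(1) relcycle_mono[OF c subset_refl assms(3)]]])
qed

lemma rel_acyclic_left:
  assumes "rel_acyclic X A C" "rel_acyclic X B C" "C \<subseteq> B" "B \<subseteq> A"
  shows "rel_acyclic X A B"
  unfolding rel_acyclic_def
proof (intro allI impI)
  fix p c assume "relcycle X p A B c"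
  then obtain c' where c': "relcycle X p A C c'" "relboundary X p A B (c - c')"
    by (rule relcycle_lift[OF assms(2-4)])
  from relboundary_add[OF c'(2) relboundary_mono[OF rel_acyclicD[OF assms(1) c'(1)] subset_refl assms(3)]]
  show "relboundary X p A B c" by simp
qed

lemma rel_acyclic_right:
  assumes "rel_acyclic X A B" "rel_acyclic X A C" "C \<subseteq> B" "B \<subseteq> A"
  shows "rel_acyclic X B C"
  unfolding rel_acyclic_def
proof (intro allI impI)
  fix p c assume c: "relcycle X p B C c"
  then have "chain_in X p B c" by (simp add: relcycle_def)
  then show "relboundary X p B C c"
    using relboundary_restrict[OF rel_acyclicD[OF assms(1)] assms(3)] rel_acyclicD[OF assms(2) relcycle_mono[OF c assms(4) subset_refl]] by blast
qed

lemma rel_acyclic_homotopy: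
  assumes BA: "B \<subseteq> A"
    and h: "continuous_map (prod_topology (top_of_set {0..1::real}) (subtopology X A)) (subtopology X A) h"
    and h0: "\<And>x. x \<in> A \<Longrightarrow> h (0, x) = x" and h1: "\<And>x. x \<in> A \<Longrightarrow> h (1, x) \<in> B"
    and hB: "\<And>t x. 0 \<le> t \<Longrightarrow> t \<le> 1 \<Longrightarrow> x \<in> B \<Longrightarrow> h (t, x) \<in> B"
  shows "rel_acyclic X A B"
  unfolding rel_acyclic_def
proof (intro allI impI)
  fix p c assume c: "relcycle X p A B c"
  let ?T = "subtopology X A"
  let ?g = "\<lambda>x. h (1, x)"
  have "homotopic_with (\<lambda>f. f \<in> B \<rightarrow> B) ?T ?T (\<lambda>x. h (0, x)) ?g"
    unfolding homotopic_with_def using h hB by (intro exI[of _ h]) auto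
  from homotopic_imp_homologous_rel_chain_maps[OF this] c
  have "homologous_rel p ?T B (chain_map p (\<lambda>x. h (0, x)) c) (chain_map p ?g c)"
    by (simp add: singular_relcycle_eq[OF BA])
  moreover have "chain_map p (\<lambda>x. h (0, x)) c = c"
    using c h0 by (intro chain_map_id_gen[of p ?T]) (auto simp: relcycle_def)
  ultimately have "relboundary X p A B (c - chain_map p ?g c)"
    by (simp add: homologous_rel_def singular_relboundary_eq[OF BA])
  moreover have "chain_in X p B (chain_map p ?g c)"
  proof (rule singular_chain_chain_map)
    show "chain_in X p A c" using c by (simp add: relcycle_def)
    have "continuous_map ?T (prod_topology (top_of_set {0..1::real}) ?T) (\<lambda>x. (1, x))"
      by (intro continuous_map_pairedI) (simp_all add: continuous_map_const)
    from continuous_map_compose[OF this h] have "continuous_map ?T ?T ?g" by (simp add: o_def)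
    then show "continuous_map ?T (subtopology X B) ?g"
      using h1 by (auto simp: continuous_map_in_subtopology)
  qed
  ultimately show "relboundary X p A B c"
    using relboundary_add relboundary_chain_in by (metis diff_add_cancel)
qed

lemma excision_surj:
  assumes U: "closedin (subtopology X A) U" and T: "openin (subtopology X A) T" and "U \<subseteq> T" "A \<subseteq> topspace X"
    and c: "relcycle X p A T c"
  obtains c' where "relcycle X p (A - U) (T - U) c'" "relboundary X p A T (c - c')"
proof -
  let ?Y = "subtopology X A"
  have TA: "T \<subseteq> A" using openin_subset[OF T] by auto
  have cl: "?Y closure_of U \<subseteq> ?Y interior_of T"
    using U T assms(3) by (simp add: closure_of_closedin interior_of_openin)
  have s: "subtopology ?Y A = ?Y" "subtopology ?Y (A - U) = subtopology X (A - U)"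
    by (simp_all add: subtopology_subtopology Int_absorb1 inf.absorb2 Diff_subset)
  from excised_relcycle_exists[OF cl TA, of p c] c TA
  obtain c' where "singular_relcycle p (subtopology ?Y (A - U)) (T - U) c'" "homologous_rel p (subtopology ?Y A) T c c'"
    by (auto simp: s singular_relcycle_eq)
  moreover have "T - U \<subseteq> A - U" using TA by auto
  ultimately show ?thesis using that[of c'] TA
    by (simp add: s singular_relcycle_eq homologous_rel_def singular_relboundary_eq)
qed

lemma excision_inj:
  assumes U: "closedin (subtopology X A) U" and T: "openin (subtopology X A) T" and "U \<subseteq> T" "A \<subseteq> topspace X"
    and c: "relcycle X p (A - U) (T - U) c" "relboundary X p A T c"
  shows "relboundary X p (A - U) (T - U) c"
proof -
  let ?Y = "subtopology X A"
  have TA: "T \<subseteq> A" using openin_subset[OF T] by auto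
  have TU: "T - U \<subseteq> A - U" using TA by auto
  have cl: "?Y closure_of U \<subseteq> ?Y interior_of T"
    using U T assms(3) by (simp add: closure_of_closedin interior_of_openin)
  have s: "subtopology ?Y A = ?Y" "subtopology ?Y (A - U) = subtopology X (A - U)"
    by (simp_all add: subtopology_subtopology Int_absorb1 inf.absorb2 Diff_subset)
  let ?X1 = "subtopology X (A - U)"
  let ?f = "hom_induced (int p) ?X1 (T - U) ?Y T id"
  have iso: "?f \<in> iso (relative_homology_group (int p) ?X1 (T - U)) (relative_homology_group (int p) ?Y T)"
    using homology_excision_axiom[OF cl TA, of "int p"] by (simp add: s)
  have rel: "singular_relcycle p ?X1 (T - U) c" using c(1) by (simp add: singular_relcycle_eq[OF TU])
  have cont: "continuous_map ?X1 ?Y id"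
    using continuous_map_from_subtopology_mono[of X A X id "A - U"]
    by (auto simp: continuous_map_in_subtopology continuous_map_from_subtopology)
  have "?f (homologous_rel_set p ?X1 (T - U) c) = homologous_rel_set p ?Y T (chain_map p id c)"
    by (rule hom_induced_chain_map[OF cont _ rel]) auto
  also have "chain_map p id c = c" using c(1) by (intro chain_map_id_gen[of p ?X1]) (auto simp: relcycle_def)
  also have "homologous_rel_set p ?Y T c = singular_relboundary_set p ?Y T"
    using c(2) homologous_rel_set_eq_relboundary[of p ?Y T c]
      unfolding singular_relboundary_eq[OF TA] by blast
  finally have zero: "?f (homologous_rel_set p ?X1 (T - U) c) = \<one>\<^bsub>relative_homology_group (int p) ?Y T\<^esub>"
    by (simp only: one_relative_homology_group)
  have car: "homologous_rel_set p ?X1 (T - U) c \<in> carrier (relative_homology_group (int p) ?X1 (T - U))"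
    using rel by (auto simp: carrier_relative_homology_group)
  interpret group_hom "relative_homology_group (int p) ?X1 (T - U)" "relative_homology_group (int p) ?Y T" ?f
    using iso by (simp add: group_hom_def group_hom_axioms_def iso_def)
  have inj: "inj_on ?f (carrier (relative_homology_group (int p) ?X1 (T - U)))"
    using iso by (simp add: iso_def bij_betw_def)
  have "homologous_rel_set p ?X1 (T - U) c = \<one>\<^bsub>relative_homology_group (int p) ?X1 (T - U)\<^esub>"
    by (rule inj_onD[OF inj _ car])
      (simp_all only: zero hom_one group.is_monoid[OF group_relative_homology_group, THEN monoid.one_closed])
  then show ?thesis using homologous_rel_set_eq_relboundary[of p ?X1 "T - U" c]
    unfolding one_relative_homology_group singular_relboundary_eq[OF TU] by blast
qed

lemma rel_acyclic_excision:
  assumes U: "closedin (subtopology X A) U" and T: "openin (subtopology X A) T" and "U \<subseteq> T" "A \<subseteq> topspace X"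
    and van: "rel_acyclic X (A - U) (T - U)"
  shows "rel_acyclic X A T"
  unfolding rel_acyclic_def
proof (intro allI impI)
  fix p c assume "relcycle X p A T c"
  then obtain c' where c': "relcycle X p (A - U) (T - U) c'" "relboundary X p A T (c - c')"
    using excision_surj[OF assms(1-4)] by blast
  have "relboundary X p A T c'" using relboundary_mono[OF rel_acyclicD[OF van c'(1)]] by blast
  from relboundary_add[OF c'(2) this] show "relboundary X p A T c" by simp
qed

definition rel_generator :: "'a topology \<Rightarrow> nat \<Rightarrow> 'a set \<Rightarrow> 'a set \<Rightarrow> 'a chain \<Rightarrow> bool" where
  "rel_generator X p A B z \<longleftrightarrow> relcycle X p A B z \<and> (\<forall>c. relcycle X p A B c \<longrightarrow> (\<exists>n. relboundary X p A B (c - frag_cmul n z))) \<and>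
    (\<forall>n. relboundary X p A B (frag_cmul n z) \<longrightarrow> n = 0)"

lemma rel_generator_relcycle: "rel_generator X p A B z \<Longrightarrow> relcycle X p A B z"
  by (simp add: rel_generator_def)

lemma rel_generator_not_relboundary:
  assumes "rel_generator X p A B z" shows "\<not> relboundary X p A B z"
proof
  assume "relboundary X p A B z"
  then have "relboundary X p A B (frag_cmul 1 z)" by simp
  then have "1 = (0::int)" using assms unfolding rel_generator_def by blast
  then show False by simp
qed

lemma class_hom: "homologous_rel_set p Y S \<in> hom (relcycle_group p Y S) (relative_homology_group (int p) Y S)"
  using normal.r_coset_hom_Mod[OF normal_subgroup_singular_relboundary_relcycle[of p Y S]]
  by (simp add: right_coset_singular_relboundary nontrivial_relative_homology_group)

lemma int_pow_relcycle_group: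
  assumes "c \<in> carrier (relcycle_group p Y S)"
  shows "c [^]\<^bsub>relcycle_group p Y S\<^esub> (n::int) = frag_cmul n c"
proof -
  have "singular_chain p Y c" using assms by (simp add: singular_relcycle)
  then show ?thesis
    using group.int_pow_subgroup_generated[OF group_chain_group assms[unfolded relcycle_group_def], of n]
    by (simp add: relcycle_group_def chain_group_def singular_chain_def)
qed

lemma rel_generator_exists:
  assumes BA: "B \<subseteq> A" and iso: "relative_homology_group (int p) (subtopology X A) B \<cong> integer_group"
  shows "\<exists>z. rel_generator X p A B z"
proof -
  let ?Y = "subtopology X A" and ?cls = "homologous_rel_set p (subtopology X A) B"
  let ?G = "relative_homology_group (int p) ?Y B" and ?Z = "relcycle_group p ?Y B"
  obtain f where f: "f \<in> iso ?G integer_group" using iso by (auto simp: is_iso_def)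
  define \<phi> where "\<phi> = f \<circ> ?cls"
  have "\<phi> \<in> hom ?Z integer_group"
    unfolding \<phi>_def by (rule hom_compose[OF class_hom iso_imp_homomorphism[OF f]])
  then interpret \<phi>: group_hom ?Z integer_group \<phi> by (simp add: group_hom_def group_hom_axioms_def)
  interpret f: group_hom ?G integer_group f
    using f by (simp add: group_hom_def group_hom_axioms_def iso_def)
  have cycle: "c \<in> carrier ?Z \<longleftrightarrow> relcycle X p A B c" for c by (simp add: singular_relcycle_eq[OF BA])
  have carrier: "?cls c \<in> carrier ?G" if "relcycle X p A B c" for c
    using that by (auto simp: carrier_relative_homology_group singular_relcycle_eq[OF BA])
  have scale: "\<phi> (frag_cmul n c) = n * \<phi> c" if "relcycle X p A B c" for n c
    using \<phi>.hom_int_pow[of c n] int_pow_relcycle_group[of c p ?Y B n] that unfolding cycle by simp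
  have kernel: "relboundary X p A B c \<longleftrightarrow> \<phi> c = 0" if c: "relcycle X p A B c" for c
  proof -
    have "\<phi> c = 0 \<longleftrightarrow> ?cls c = \<one>\<^bsub>?G\<^esub>"
      using inj_on_eq_iff[of f "carrier ?G" "?cls c" "\<one>\<^bsub>?G\<^esub>"] carrier[OF c] f f.hom_one
      by (simp add: \<phi>_def iso_iff del: one_relative_homology_group)
    then show ?thesis using homologous_rel_set_eq_relboundary[of p ?Y B c]
      unfolding one_relative_homology_group singular_relboundary_eq[OF BA] by blast
  qed
  have "(1::int) \<in> f ` carrier ?G" using f by (simp add: iso_iff)
  then obtain z where z: "relcycle X p A B z" "\<phi> z = 1"
    by (auto simp: carrier_relative_homology_group singular_relcycle_eq[OF BA] \<phi>_def)
  show ?thesis unfolding rel_generator_def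
  proof (intro exI[of _ z] conjI allI impI)
    fix c assume c: "relcycle X p A B c"
    have "relcycle X p A B (c - frag_cmul (\<phi> c) z)" by (rule relcycle_diff[OF c relcycle_cmul[OF z(1)]])
    moreover from this have "\<phi> (c - frag_cmul (\<phi> c) z) = 0"
      using \<phi>.hom_mult[of "c - frag_cmul (\<phi> c) z" "frag_cmul (\<phi> c) z"] relcycle_cmul[OF z(1)] scale[OF z(1)] z(2)
      unfolding cycle by simp
    ultimately show "\<exists>n. relboundary X p A B (c - frag_cmul n z)" using kernel by blast
  next
    fix n assume "relboundary X p A B (frag_cmul n z)"
    then show "n = 0" using kernel[OF relcycle_cmul[OF z(1)]] scale[OF z(1)] z(2) by simp
  qed (rule z(1))
qed

lemma relboundary_if_trivial_homology:
  assumes BA: "B \<subseteq> A" and "trivial_group (relative_homology_group (int p) (subtopology X A) B)"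
    and c: "relcycle X p A B c"
  shows "relboundary X p A B c"
proof -
  let ?Y = "subtopology X A"
  have "homologous_rel_set p ?Y B c \<in> carrier (relative_homology_group (int p) ?Y B)"
    using c by (auto simp: carrier_relative_homology_group singular_relcycle_eq[OF BA])
  then have "homologous_rel_set p ?Y B c = singular_relboundary_set p ?Y B"
    using assms(2) by (simp add: trivial_group_def)
  then show ?thesis using homologous_rel_set_eq_relboundary[of p ?Y B c]
    unfolding singular_relboundary_eq[OF BA] by blast
qed

section \<open>Closed cells\<close>

definition norm_sq :: "nat \<Rightarrow> (nat \<Rightarrow> real) \<Rightarrow> real" where
  "norm_sq n x = (\<Sum>i<n. x i ^ 2)"

definition ball_set :: "nat \<Rightarrow> (nat \<Rightarrow> real) set" where
  "ball_set n = {x. (\<forall>i\<ge>n. x i = 0) \<and> norm_sq n x \<le> 1}"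

lemma Euclidean_top_of_set: "Euclidean_space n = top_of_set {x. \<forall>i\<ge>n. x i = 0}"
  by (simp add: Euclidean_space_def euclidean_product_topology)

lemma unit_ball_top_of_set: "unit_ball n = top_of_set (ball_set n)"
  unfolding unit_ball_def Euclidean_top_of_set subtopology_subtopology
  by (rule arg_cong[of _ _ "subtopology _"]) (auto simp: ball_set_def norm_sq_def)

lemma topspace_unit_ball [simp]: "topspace (unit_ball n) = ball_set n"
  by (simp add: unit_ball_top_of_set)

lemma unit_ball_interior_eq: "unit_ball_interior n = {x \<in> ball_set n. norm_sq n x < 1}"
  by (auto simp: unit_ball_interior_def ball_set_def norm_sq_def topspace_Euclidean_space)

lemma unit_ball_boundary_eq: "unit_ball_boundary n = {x \<in> ball_set n. norm_sq n x = 1}"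
  by (auto simp: unit_ball_boundary_def ball_set_def norm_sq_def topspace_Euclidean_space)

lemma norm_sq_nonneg: "0 \<le> norm_sq n x"
  by (simp add: norm_sq_def sum_nonneg)

lemma norm_sq_scale: "norm_sq n (\<lambda>i. c * x i) = c ^ 2 * norm_sq n x"
  by (simp add: norm_sq_def power_mult_distrib sum_distrib_left)

lemma norm_sq_eq_0: "x \<in> ball_set n \<Longrightarrow> norm_sq n x = 0 \<longleftrightarrow> x = (\<lambda>i. 0)"
proof
  assume x: "x \<in> ball_set n" and zero: "norm_sq n x = 0"
  have "x i = 0" for i
  proof (cases "i < n")
    case True
    then show ?thesis using zero by (simp add: norm_sq_def sum_nonneg_eq_0_iff)
  qed (use x in \<open>simp add: ball_set_def\<close>)
  then show "x = (\<lambda>i. 0)" by blast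
qed (simp add: norm_sq_def)

lemma norm_sq_convex:
  assumes "0 \<le> t" "t \<le> 1"
  shows "norm_sq n (\<lambda>i. (1 - t) * y i + t * w i) \<le> (1 - t) * norm_sq n y + t * norm_sq n w"
proof -
  have "((1 - t) * a + t * b)\<^sup>2 \<le> (1 - t) * a\<^sup>2 + t * b\<^sup>2" for a b :: real
  proof -
    have "(1 - t) * a\<^sup>2 + t * b\<^sup>2 - ((1 - t) * a + t * b)\<^sup>2 = t * (1 - t) * (a - b)\<^sup>2"
      by (simp add: power2_eq_square algebra_simps)
    moreover have "0 \<le> t * (1 - t) * (a - b)\<^sup>2" using assms by simp
    ultimately show ?thesis by linarith
  qed
  then have "norm_sq n (\<lambda>i. (1 - t) * y i + t * w i) \<le> (\<Sum>i<n. (1 - t) * (y i)\<^sup>2 + t * (w i)\<^sup>2)"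
    unfolding norm_sq_def by (intro sum_mono)
  then show ?thesis by (simp only: norm_sq_def sum.distrib sum_distrib_left)
qed

definition line_to :: "(nat \<Rightarrow> real) \<Rightarrow> real \<times> (nat \<Rightarrow> real) \<Rightarrow> nat \<Rightarrow> real" where
  "line_to w = (\<lambda>(t, y) i. (1 - t) * y i + t * w i)"

lemma line_to_endpoints [simp]: "line_to w (0, y) = y" "line_to w (1, y) = w" "line_to w (t, w) = w"
  by (auto simp: line_to_def algebra_simps)

lemma norm_sq_line_to_less:
  assumes "norm_sq n y \<le> 1" "norm_sq n w < 1" "0 \<le> t" "t \<le> 1" "0 < t \<or> norm_sq n y < 1"
  shows "norm_sq n (line_to w (t, y)) < 1"
proof -
  have "(1 - t) * norm_sq n y + t * norm_sq n w < (1 - t) * 1 + t * 1"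
  proof (cases "0 < t")
    case True
    then show ?thesis using assms by (intro add_le_less_mono mult_left_mono mult_strict_left_mono) auto
  qed (use assms in auto)
  then show ?thesis using norm_sq_convex[OF assms(3,4), of n y w] by (simp add: line_to_def)
qed

lemma line_to_ball_set:
  assumes "y \<in> ball_set n" "w \<in> ball_set n" "0 \<le> t" "t \<le> 1"
  shows "line_to w (t, y) \<in> ball_set n"
proof -
  have "(1 - t) * norm_sq n y + t * norm_sq n w \<le> (1 - t) * 1 + t * 1"
    using assms by (intro add_mono mult_left_mono) (auto simp: ball_set_def)
  then show ?thesis
    using norm_sq_convex[OF assms(3,4), of n y w] assms(1,2) by (auto simp: line_to_def ball_set_def)
qed

lemma continuous_coord: "continuous_on S f \<Longrightarrow> continuous_on S (\<lambda>x. f x (i::nat) :: real)"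
  using continuous_on_compose2[OF continuous_on_product_coordinates[of i], of S f] by simp

lemma continuous_norm_sq: "continuous_on S f \<Longrightarrow> continuous_on S (\<lambda>x. norm_sq n (f x))"
  unfolding norm_sq_def by (intro continuous_on_sum continuous_on_power continuous_coord)

lemma continuous_line_to: "continuous_on S (line_to w)"
  unfolding line_to_def split_beta
  by (rule continuous_on_coordinatewise_then_product)
    (intro continuous_on_add continuous_on_mult continuous_on_diff continuous_on_const continuous_on_fst continuous_on_snd
      continuous_coord continuous_on_id)

lemma compact_unit_ball: "compact_space (unit_ball n)"
proof -
  have "compact (PiE UNIV (\<lambda>i. if i < n then {-1..1} else {0::real}))"
  proof -
    have "compactin (product_topology (\<lambda>i. euclideanreal) UNIV) (PiE UNIV (\<lambda>i. if i < n then {-1..1} else {0::real}))"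
      by (subst compactin_PiE) auto
    then show ?thesis by (simp add: euclidean_product_topology)
  qed
  moreover have "ball_set n \<subseteq> PiE UNIV (\<lambda>i. if i < n then {-1..1} else {0::real})"
  proof
    fix x assume x: "x \<in> ball_set n"
    have "x i \<in> {-1..1}" if "i < n" for i
    proof -
      have "(x i)\<^sup>2 \<le> norm_sq n x" unfolding norm_sq_def by (rule member_le_sum) (use that in auto)
      then have "(x i)\<^sup>2 \<le> 1" using x by (simp add: ball_set_def)
      then show ?thesis by (simp add: abs_square_le_1 abs_le_iff)
    qed
    then show "x \<in> PiE UNIV (\<lambda>i. if i < n then {-1..1} else {0::real})"
      using x by (auto simp: ball_set_def)
  qed
  moreover have "closed (ball_set n)"
  proof -
    have "ball_set n = (\<Inter>i\<in>{n..}. {x. x i = 0}) \<inter> {x. norm_sq n x \<le> 1}" by (auto simp: ball_set_def)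
    moreover have "closed {x::nat \<Rightarrow> real. x i = 0}" for i
      by (intro closed_Collect_eq continuous_coord continuous_intros)
    moreover have "closed {x. norm_sq n x \<le> 1}"
      by (intro closed_Collect_le continuous_norm_sq continuous_intros)
    ultimately show ?thesis by (simp add: closed_INT closed_Int)
  qed
  ultimately have "compact (ball_set n)" by (metis compact_Int_closed inf.absorb2)
  then show ?thesis by (simp add: unit_ball_top_of_set compact_space_subtopology)
qed

lemma contractible_unit_ball: "contractible_space (unit_ball n)"
proof -
  have zero: "(\<lambda>i. 0) \<in> ball_set n" by (simp add: ball_set_def norm_sq_def)
  have "homotopic_with (\<lambda>x. True) (unit_ball n) (unit_ball n) id (\<lambda>x i. 0)"
    unfolding homotopic_with_def
  proof (intro exI[of _ "line_to (\<lambda>i. 0)"] conjI ballI allI)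
    show "continuous_map (prod_topology (top_of_set {0..1}) (unit_ball n)) (unit_ball n) (line_to (\<lambda>i. 0))"
      using continuous_line_to line_to_ball_set[OF _ zero] by (auto simp: unit_ball_top_of_set)
  qed auto
  then show ?thesis unfolding contractible_space_def by blast
qed

lemma nonempty_unit_ball_boundary:
  assumes "0 < n" shows "unit_ball_boundary n \<noteq> {}"
proof -
  have "(\<lambda>i. if i = 0 then 1 else 0) \<in> unit_ball_boundary n"
    using assms
      by (auto simp: unit_ball_boundary_eq ball_set_def norm_sq_def if_distrib[of "\<lambda>x. x ^ 2"] cong: if_cong)
  then show ?thesis by blast
qed

lemma subtopology_boundary: "subtopology (unit_ball (Suc k)) (unit_ball_boundary (Suc k)) = nsphere k"
proof -
  have "ball_set (Suc k) \<inter> unit_ball_boundary (Suc k) = {x. \<forall>i\<ge>Suc k. x i = 0} \<inter> {x. (\<Sum>i\<le>k. (x i)\<^sup>2) = 1}"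
    by (auto simp: unit_ball_boundary_eq ball_set_def norm_sq_def lessThan_Suc_atMost)
  then show ?thesis
    unfolding nsphere_def unit_ball_top_of_set Euclidean_top_of_set subtopology_subtopology by simp
qed

lemma unit_ball_homology:
  "relative_homology_group (int n) (unit_ball n) (unit_ball_boundary n) \<cong> integer_group"
  "p \<noteq> int n \<Longrightarrow> trivial_group (relative_homology_group p (unit_ball n) (unit_ball_boundary n))"
proof -
  have "relative_homology_group (int n) (unit_ball n) (unit_ball_boundary n) \<cong> integer_group \<and>
    (p \<noteq> int n \<longrightarrow> trivial_group (relative_homology_group p (unit_ball n) (unit_ball_boundary n)))"
  proof (cases n)
    case 0
    have b: "unit_ball_boundary 0 = {}" by (auto simp: unit_ball_boundary_eq norm_sq_def)
    have t: "topspace (unit_ball 0) = {\<lambda>i. 0}" by (auto simp: ball_set_def norm_sq_def)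
    have "homology_group 0 (unit_ball 0) \<cong> integer_group"
      by (rule isomorphic_integer_zeroth_homology_group[OF contractible_imp_path_connected_space[OF contractible_unit_ball]])
        (simp only: t insert_not_empty not_False_eq_True)
    then show ?thesis using 0 b homology_dimension_axiom[OF t, of p] by simp
  next
    case (Suc k)
    have ne: "topspace (unit_ball n) \<inter> unit_ball_boundary n \<noteq> {}"
      using nonempty_unit_ball_boundary[of n] Suc by (auto simp: unit_ball_boundary_eq)
    have iso: "relative_homology_group q (unit_ball n) (unit_ball_boundary n) \<cong> reduced_homology_group (q - 1) (nsphere k)" for q
      using isomorphic_group_relative_homology_of_contractible[OF contractible_unit_ball ne, of q]
      unfolding Suc subtopology_boundary .
    have "relative_homology_group (int n) (unit_ball n) (unit_ball_boundary n) \<cong> integer_group"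
      using iso_trans[OF iso[of "int n"]] reduced_homology_group_nsphere(1)[of k] Suc by simp
    moreover have "trivial_group (relative_homology_group p (unit_ball n) (unit_ball_boundary n))"
      if "p \<noteq> int n"
      using isomorphic_group_triviality[OF iso[of p]] reduced_homology_group_nsphere(2)[of "p - 1" k] that Suc
        by simp
    ultimately show ?thesis by blast
  qed
  then show "relative_homology_group (int n) (unit_ball n) (unit_ball_boundary n) \<cong> integer_group"
    "p \<noteq> int n \<Longrightarrow> trivial_group (relative_homology_group p (unit_ball n) (unit_ball_boundary n))" by blast+
qed

locale cell =
  fixes X :: "'a topology" and n :: nat and e :: "'a set" and \<Phi> :: "(nat \<Rightarrow> real) \<Rightarrow> 'a"
  assumes hausdorff: "Hausdorff_space X" and char: "characteristic_map X n e \<Phi>"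
begin

definition cl :: "'a set" where "cl = \<Phi> ` ball_set n"
definition fr :: "'a set" where "fr = \<Phi> ` unit_ball_boundary n"
definition inv\<Phi> :: "'a \<Rightarrow> nat \<Rightarrow> real" where "inv\<Phi> = inv_into (ball_set n) \<Phi>"

lemma emb: "embedding_map (unit_ball n) X \<Phi>"
  using char by (simp add: characteristic_map_def)

lemma e_eq: "e = \<Phi> ` unit_ball_interior n"
  using char by (simp add: characteristic_map_def)

lemma homeo: "homeomorphic_map (unit_ball n) (subtopology X cl) \<Phi>"
  using emb by (simp add: embedding_map_def cl_def)

lemma inj: "inj_on \<Phi> (ball_set n)"
  using homeo homeomorphic_imp_injective_map by fastforce

lemma cl_topspace: "cl \<subseteq> topspace X"
proof -
  have "\<Phi> ` ball_set n = topspace X \<inter> cl" using homeomorphic_imp_surjective_map[OF homeo] by simp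
  then show ?thesis unfolding cl_def by blast
qed

lemma cont\<Phi>: "continuous_map (unit_ball n) X \<Phi>"
  using homeomorphic_imp_continuous_map[OF homeo] by (simp add: continuous_map_in_subtopology)

lemma continuous_on_subset_ball: "S \<subseteq> ball_set n \<Longrightarrow> continuous_map (top_of_set S) X \<Phi>"
  using continuous_map_from_subtopology[OF cont\<Phi>, of S]
  by (simp add: unit_ball_top_of_set subtopology_subtopology inf.absorb2)

lemma inv\<Phi>_in: "x \<in> cl \<Longrightarrow> inv\<Phi> x \<in> ball_set n" and \<Phi>_inv: "x \<in> cl \<Longrightarrow> \<Phi> (inv\<Phi> x) = x"
  and inv_\<Phi>: "y \<in> ball_set n \<Longrightarrow> inv\<Phi> (\<Phi> y) = y"
  unfolding cl_def inv\<Phi>_def by (auto simp: inv_into_into f_inv_into_f inv_into_f_f inj)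

lemma continv: "continuous_map (subtopology X cl) (unit_ball n) inv\<Phi>"
proof -
  obtain g where g: "homeomorphic_maps (unit_ball n) (subtopology X cl) \<Phi> g"
    using homeo homeomorphic_map_maps by blast
  have "continuous_map (subtopology X cl) (unit_ball n) g" using g by (simp add: homeomorphic_maps_def)
  moreover have "inv\<Phi> x = g x" if "x \<in> topspace (subtopology X cl)" for x
  proof -
    have x: "x \<in> cl" using that by simp
    have "g (\<Phi> (inv\<Phi> x)) = inv\<Phi> x" using g inv\<Phi>_in[OF x] by (auto simp: homeomorphic_maps_def)
    then show ?thesis using \<Phi>_inv[OF x] by simp
  qed
  ultimately show ?thesis using continuous_map_eq by metis
qed

lemma cl_eq: "cl = e \<union> fr"
proof -
  have "ball_set n = unit_ball_interior n \<union> unit_ball_boundary n"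
    by (auto simp: unit_ball_interior_eq unit_ball_boundary_eq) (auto simp: ball_set_def)
  then show ?thesis unfolding cl_def fr_def e_eq by (simp add: image_Un)
qed

lemma fr_cl: "fr \<subseteq> cl" using cl_eq by blast
lemma e_cl: "e \<subseteq> cl" using cl_eq by blast

lemma e_fr: "e \<inter> fr = {}"
proof -
  have "\<Phi> ` (unit_ball_interior n \<inter> unit_ball_boundary n) = e \<inter> fr"
    unfolding e_eq fr_def
    by (rule inj_on_image_Int[OF inj]) (auto simp: unit_ball_interior_eq unit_ball_boundary_eq)
  moreover have "unit_ball_interior n \<inter> unit_ball_boundary n = {}"
    by (auto simp: unit_ball_interior_eq unit_ball_boundary_eq)
  ultimately show ?thesis by simp
qed

lemma zero_ball_set: "(\<lambda>i. 0) \<in> ball_set n"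
  by (simp add: ball_set_def norm_sq_def)

definition center :: 'a where "center = \<Phi> (\<lambda>i. 0)"

lemma center_e: "center \<in> e"
  unfolding center_def e_eq using zero_ball_set by (auto simp: unit_ball_interior_eq norm_sq_def)

lemma e_nonempty: "e \<noteq> {}"
  using center_e by blast

lemma inv_e: "inv\<Phi> ` e = unit_ball_interior n" and inv_cl: "inv\<Phi> ` cl = ball_set n"
  unfolding e_eq cl_def by (force simp: inv_\<Phi> image_image unit_ball_interior_eq)+

lemma inv_fr: "x \<in> cl \<Longrightarrow> x \<in> fr \<longleftrightarrow> norm_sq n (inv\<Phi> x) = 1"
  unfolding fr_def cl_def by (auto simp: unit_ball_boundary_eq inv_\<Phi>)

lemma fr_nonempty: "0 < n \<Longrightarrow> fr \<noteq> {}"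
  using nonempty_unit_ball_boundary by (auto simp: fr_def)

lemma compact_image: "closedin (unit_ball n) K \<Longrightarrow> closedin X (\<Phi> ` K)"
  using compactin_imp_closedin[OF hausdorff image_compactin[OF closedin_compact_space[OF compact_unit_ball] cont\<Phi>]] .

lemma closed_cl: "closedin X cl"
  unfolding cl_def using compact_image[OF closedin_topspace[of "unit_ball n"]] by simp

lemma closed_fr: "closedin X fr"
  unfolding fr_def
proof (rule compact_image)
  have "closedin (unit_ball n) {x \<in> topspace (unit_ball n). norm_sq n x \<in> {1}}"
    unfolding unit_ball_top_of_set
    by (rule closedin_continuous_map_preimage[of _ euclideanreal])
      (auto intro: continuous_norm_sq continuous_intros)
  then show "closedin (unit_ball n) (unit_ball_boundary n)" by (simp add: unit_ball_boundary_eq)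
qed

lemma closure_e: "X closure_of e = cl"
proof
  show "X closure_of e \<subseteq> cl" using closed_cl e_cl by (simp add: closure_of_minimal)
  have "x \<in> closure (unit_ball_interior n)" if x: "x \<in> ball_set n" for x
  proof -
    let ?f = "\<lambda>t. line_to (\<lambda>i. 0) (t, x)"
    have im: "?f ` {0<..<1} \<subseteq> unit_ball_interior n"
      using norm_sq_line_to_less[of n x "\<lambda>i. 0"] line_to_ball_set[OF x zero_ball_set] x
      by (auto simp: unit_ball_interior_eq ball_set_def norm_sq_def)
    have "continuous_on {0..1} ?f"
      by (rule continuous_on_compose2[OF continuous_line_to]) (auto intro: continuous_intros)
    then have closure: "?f ` closure {0<..<1} \<subseteq> closure (?f ` {0<..<1})"
      by (intro image_closure_subset) (auto intro: closure_subset[THEN subsetD])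
    have "?f 0 \<in> ?f ` closure {0<..<1}" by (rule imageI) simp
    then have "?f 0 \<in> closure (?f ` {0<..<1})" by (rule subsetD[OF closure])
    then show ?thesis using closure_mono[OF im] by auto
  qed
  then have "ball_set n \<subseteq> unit_ball n closure_of unit_ball_interior n"
    unfolding unit_ball_top_of_set closure_of_subtopology
    by (auto simp: unit_ball_interior_eq Int_absorb1 inf.absorb2 subset_iff)
  then have "cl \<subseteq> \<Phi> ` (unit_ball n closure_of unit_ball_interior n)" unfolding cl_def by blast
  also have "\<dots> \<subseteq> X closure_of e"
    unfolding e_eq using continuous_map_image_closure_subset[OF cont\<Phi>] by blast
  finally show "cl \<subseteq> X closure_of e" .
qed

lemma group_iso:
  "relative_homology_group p (unit_ball n) (unit_ball_boundary n) \<cong> relative_homology_group p (subtopology X cl) fr"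
  by (rule is_isoI, rule homeomorphic_map_relative_homology_iso[OF homeo])
    (auto simp: fr_def unit_ball_boundary_eq)

lemma rel_generator_cl: "\<exists>z. rel_generator X n cl fr z"
proof (rule rel_generator_exists[OF fr_cl])
  have "relative_homology_group (int n) (subtopology X cl) fr \<cong> relative_homology_group (int n) (unit_ball n) (unit_ball_boundary n)"
    using group.iso_sym[OF group_relative_homology_group group_iso] .
  from iso_trans[OF this unit_ball_homology(1)]
  show "relative_homology_group (int n) (subtopology X cl) fr \<cong> integer_group" .
qed

lemma relboundary_cl: "p \<noteq> n \<Longrightarrow> relcycle X p cl fr c \<Longrightarrow> relboundary X p cl fr c"
  by (rule relboundary_if_trivial_homology[OF fr_cl])
    (use isomorphic_group_triviality[OF group_iso[of "int p"]] unit_ball_homology(2)[of "int p" n] in auto)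

lemma cell_continuous:
  assumes "C \<subseteq> cl" and cont: "continuous_on ({0..1::real} \<times> inv\<Phi> ` C) h"
    and h: "\<And>t y. 0 \<le> t \<Longrightarrow> t \<le> 1 \<Longrightarrow> y \<in> inv\<Phi> ` C \<Longrightarrow> h (t, y) \<in> ball_set n"
  shows "continuous_map (prod_topology (top_of_set {0..1}) (subtopology X C)) X (\<lambda>(t, x). \<Phi> (h (t, inv\<Phi> x)))"
proof -
  let ?I = "top_of_set {0..1::real}"
  let ?S = "inv\<Phi> ` C"
  have Sb: "?S \<subseteq> ball_set n" using inv\<Phi>_in assms(1) by blast
  have c1: "continuous_map (subtopology X C) (top_of_set ?S) inv\<Phi>"
  proof -
    have "continuous_map (subtopology X C) (unit_ball n) inv\<Phi>"
      by (rule continuous_map_from_subtopology_mono[OF continv assms(1)])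
    then have "continuous_map (subtopology X C) (subtopology (unit_ball n) ?S) inv\<Phi>"
      by (auto simp: continuous_map_in_subtopology)
    then show ?thesis using Sb by (simp add: unit_ball_top_of_set subtopology_subtopology inf.absorb2)
  qed
  have "continuous_map (prod_topology ?I (subtopology X C)) (prod_topology ?I (top_of_set ?S)) (\<lambda>(t, x). (t, inv\<Phi> x))"
    unfolding split_beta
    by (intro continuous_map_pairedI continuous_map_fst continuous_map_compose[OF continuous_map_snd c1, unfolded o_def])
  moreover have "continuous_map (prod_topology ?I (top_of_set ?S)) (unit_ball n) h"
    using cont h by (auto simp: unit_ball_top_of_set)
  ultimately have "continuous_map (prod_topology ?I (subtopology X C)) X (\<Phi> \<circ> (h \<circ> (\<lambda>(t, x). (t, inv\<Phi> x))))"
    using cont\<Phi> by (meson continuous_map_compose)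
  moreover have "\<Phi> \<circ> (h \<circ> (\<lambda>(t, x). (t, inv\<Phi> x))) = (\<lambda>(t, x). \<Phi> (h (t, inv\<Phi> x)))" by auto
  ultimately show ?thesis by simp
qed

lemma rel_acyclic_line_to:
  assumes BA: "B \<subseteq> A" "A \<subseteq> cl" and w: "w \<in> inv\<Phi> ` B"
    and stay: "\<And>t y. 0 \<le> t \<Longrightarrow> t \<le> 1 \<Longrightarrow> y \<in> inv\<Phi> ` A \<Longrightarrow> line_to w (t, y) \<in> inv\<Phi> ` A"
      "\<And>t y. 0 \<le> t \<Longrightarrow> t \<le> 1 \<Longrightarrow> y \<in> inv\<Phi> ` B \<Longrightarrow> line_to w (t, y) \<in> inv\<Phi> ` B"
  shows "rel_acyclic X A B"
proof (rule rel_acyclic_homotopy[OF BA(1), where h="\<lambda>(t, x). \<Phi> (line_to w (t, inv\<Phi> x))"])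
  have im: "\<Phi> ` (inv\<Phi> ` S) = S" if "S \<subseteq> cl" for S
    using \<Phi>_inv that by (force simp: image_image)
  have "inv\<Phi> ` A \<subseteq> ball_set n" using inv\<Phi>_in BA(2) by blast
  then have "continuous_map (prod_topology (top_of_set {0..1}) (subtopology X A)) X (\<lambda>(t, x). \<Phi> (line_to w (t, inv\<Phi> x)))"
    by (intro cell_continuous[OF BA(2) continuous_line_to] subsetD[OF _ stay(1)])
  moreover have stay_A: "\<Phi> (line_to w (t, inv\<Phi> x)) \<in> A" if "0 \<le> t" "t \<le> 1" "x \<in> A" for t x
    using imageI[OF stay(1)[OF that(1,2) imageI[OF that(3)]], of \<Phi>] unfolding im[OF BA(2)] .
  ultimately show "continuous_map (prod_topology (top_of_set {0..1}) (subtopology X A)) (subtopology X A)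
      (\<lambda>(t, x). \<Phi> (line_to w (t, inv\<Phi> x)))"
    unfolding continuous_map_in_subtopology by (intro conjI Pi_I) (auto intro!: stay_A)
  have "B \<subseteq> cl" using BA by blast
  note imB = im[OF this]
  fix x
  show "x \<in> A \<Longrightarrow> (case (0, x) of (t, x) \<Rightarrow> \<Phi> (line_to w (t, inv\<Phi> x))) = x" using \<Phi>_inv BA(2) by auto
  show "(case (1, x) of (t, x) \<Rightarrow> \<Phi> (line_to w (t, inv\<Phi> x))) \<in> B"
    using imageI[OF w, of \<Phi>] unfolding imB by simp
  show "(case (t, x) of (t, x) \<Rightarrow> \<Phi> (line_to w (t, inv\<Phi> x))) \<in> B" if "0 \<le> t" "t \<le> 1" "x \<in> B" for t
    using imageI[OF stay(2)[OF that(1,2) imageI[OF that(3)]], of \<Phi>] unfolding imB by simp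
qed

lemma inv_cl_minus:
  assumes "K \<subseteq> ball_set n" shows "inv\<Phi> ` (cl - \<Phi> ` K) = ball_set n - K" "inv\<Phi> ` (e - \<Phi> ` K) = unit_ball_interior n - K"
proof -
  have "cl - \<Phi> ` K = \<Phi> ` (ball_set n - K)" "e - \<Phi> ` K = \<Phi> ` (unit_ball_interior n - K)"
    unfolding cl_def e_eq using inj_on_image_set_diff[OF inj] assms by (auto simp: unit_ball_interior_eq)
  then show "inv\<Phi> ` (cl - \<Phi> ` K) = ball_set n - K" "inv\<Phi> ` (e - \<Phi> ` K) = unit_ball_interior n - K"
    by (force simp: image_image inv_\<Phi> unit_ball_interior_eq)+
qed

lemma rel_acyclic_cl_minus:
  assumes "x \<in> fr" shows "rel_acyclic X cl (cl - {x})"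
proof -
  obtain w where w: "w \<in> ball_set n" "norm_sq n w = 1" "x = \<Phi> w"
    using assms by (auto simp: fr_def unit_ball_boundary_eq)
  have inv: "inv\<Phi> ` (cl - {x}) = ball_set n - {w}" using inv_cl_minus(1)[of "{w}"] w by simp
  show ?thesis
  proof (rule rel_acyclic_line_to[where w="\<lambda>i. 0"])
    show "(\<lambda>i. 0) \<in> inv\<Phi> ` (cl - {x})" using w(2) zero_ball_set unfolding inv by (auto simp: norm_sq_def)
    show "line_to (\<lambda>i. 0) (t, y) \<in> inv\<Phi> ` cl" if "0 \<le> t" "t \<le> 1" "y \<in> inv\<Phi> ` cl" for t y
      using that line_to_ball_set[OF _ zero_ball_set] unfolding inv_cl by blast
    fix t :: real and y assume t: "0 \<le> t" "t \<le> 1" and "y \<in> inv\<Phi> ` (cl - {x})"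
    then have y: "y \<in> ball_set n" "y \<noteq> w" unfolding inv by auto
    have "line_to (\<lambda>i. 0) (t, y) \<noteq> w"
      using norm_sq_line_to_less[of n y "\<lambda>i. 0" t] t y w(2)
        by (cases "t = 0") (auto simp: ball_set_def norm_sq_def)
    then show "line_to (\<lambda>i. 0) (t, y) \<in> inv\<Phi> ` (cl - {x})"
      using line_to_ball_set[OF y(1) zero_ball_set t] unfolding inv by blast
  qed auto
qed

lemma rel_acyclic_point: "x \<in> cl \<Longrightarrow> rel_acyclic X cl {x}"
  by (rule rel_acyclic_line_to[where w="inv\<Phi> x"]) (auto simp: inv_cl inv\<Phi>_in line_to_ball_set)

end

lemma continuous_map_cases_closed:
  assumes ST: "closedin Y S" "closedin Y T"
    and cover: "\<And>x. x \<in> topspace Y \<Longrightarrow> P x \<Longrightarrow> x \<in> S" "\<And>x. x \<in> topspace Y \<Longrightarrow> \<not> P x \<Longrightarrow> x \<in> T"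
    and cont: "continuous_map (subtopology Y S) Z f" "continuous_map (subtopology Y T) Z g"
    and agree: "\<And>x. x \<in> S \<Longrightarrow> x \<in> T \<Longrightarrow> f x = g x"
  shows "continuous_map Y Z (\<lambda>x. if P x then f x else g x)"
proof -
  have closure: "Y closure_of {x. P x} \<subseteq> S" "Y closure_of {x. \<not> P x} \<subseteq> T"
    using closure_of_minimal[OF _ ST(1), of "topspace Y \<inter> {x. P x}"] closure_of_minimal[OF _ ST(2), of "topspace Y \<inter> {x. \<not> P x}"] cover
    unfolding closure_of_restrict[of Y "{x. P x}"] closure_of_restrict[of Y "{x. \<not> P x}"] by blast+
  show ?thesis
  proof (rule continuous_map_cases)
    show "continuous_map (subtopology Y (Y closure_of {x. P x})) Z f"
      by (rule continuous_map_from_subtopology_mono[OF cont(1) closure(1)])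
    show "continuous_map (subtopology Y (Y closure_of {x. \<not> P x})) Z g"
      by (rule continuous_map_from_subtopology_mono[OF cont(2) closure(2)])
    have "{x. \<not> P x} = - {x. P x}" by blast
    then show "f x = g x" if "x \<in> Y frontier_of {x. P x}" for x
      using that closure agree
        by (auto simp: frontier_of_closures closure_of_restrict[of Y "- {x. P x}"] Diff_eq)
  qed
qed

definition radial :: "nat \<Rightarrow> real \<times> (nat \<Rightarrow> real) \<Rightarrow> nat \<Rightarrow> real" where
  "radial n = (\<lambda>(t, y) i. ((1 - t) + t / sqrt (norm_sq n y)) * y i)"

lemma radial_0 [simp]: "radial n (0, y) = y"
  by (simp add: radial_def)

lemma
  assumes "y \<in> ball_set n" "y \<noteq> (\<lambda>i. 0)" "0 \<le> t" "t \<le> 1"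
  shows radial_ball_set: "radial n (t, y) \<in> ball_set n"
    and norm_sq_radial_1: "t = 1 \<Longrightarrow> norm_sq n (radial n (t, y)) = 1"
    and radial_fixed: "norm_sq n y = 1 \<Longrightarrow> radial n (t, y) = y"
      and radial_factor_pos: "0 < (1 - t) + t / sqrt (norm_sq n y)"
proof -
  define s where "s = sqrt (norm_sq n y)"
  have "0 < norm_sq n y" using norm_sq_eq_0[OF assms(1)] assms(2) norm_sq_nonneg[of n y] by linarith
  then have s: "0 < s" "s \<le> 1" "s\<^sup>2 = norm_sq n y" using assms(1) by (auto simp: s_def ball_set_def)
  have "norm_sq n (radial n (t, y)) = ((1 - t) + t / s)\<^sup>2 * s\<^sup>2"
    unfolding s(3) by (simp add: radial_def norm_sq_scale s_def)
  also have "\<dots> = (((1 - t) + t / s) * s)\<^sup>2" by (simp add: power_mult_distrib)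
  also have "((1 - t) + t / s) * s = (1 - t) * s + t" using s by (simp add: field_simps)
  finally have eq: "norm_sq n (radial n (t, y)) = ((1 - t) * s + t)\<^sup>2" .
  have "(1 - t) * s \<le> (1 - t) * 1" using assms s by (intro mult_left_mono) auto
  then have "(1 - t) * s + t \<le> 1" by simp
  moreover have "0 \<le> (1 - t) * s + t" using assms s by simp
  ultimately have "norm_sq n (radial n (t, y)) \<le> 1" unfolding eq by (simp add: power_le_one)
  then show "radial n (t, y) \<in> ball_set n" using assms(1) by (auto simp: ball_set_def radial_def)
  show "t = 1 \<Longrightarrow> norm_sq n (radial n (t, y)) = 1" unfolding eq by simp
  show "norm_sq n y = 1 \<Longrightarrow> radial n (t, y) = y" by (simp add: radial_def)
  have "0 \<le> t / s" using s assms by simp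
  moreover have "t = 1 \<Longrightarrow> 0 < t / s" using s by simp
  ultimately show "0 < (1 - t) + t / sqrt (norm_sq n y)" unfolding s_def[symmetric] using assms(4)
    by (cases "t = 1") (auto intro: add_pos_nonneg)
qed

lemma continuous_radial:
  assumes "\<And>y. y \<in> S \<Longrightarrow> norm_sq n y \<noteq> 0" shows "continuous_on (I \<times> S) (radial n)"
  unfolding radial_def split_beta
  by (rule continuous_on_coordinatewise_then_product)
    (intro continuous_on_mult continuous_on_add continuous_on_diff continuous_on_divide continuous_on_real_sqrt continuous_norm_sq
      continuous_on_const continuous_on_fst continuous_on_snd continuous_coord continuous_on_id; use assms in auto)

definition ray :: "(nat \<Rightarrow> real) \<Rightarrow> (nat \<Rightarrow> real) set" where
  "ray w = (\<lambda>s i. s * w i) ` {0..1}"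

lemma ray_endpoints: "w \<in> ray w" "(\<lambda>i. 0) \<in> ray w"
  unfolding ray_def by (rule image_eqI[of _ _ 1], auto) (rule image_eqI[of _ _ 0], auto)

lemma ray_subset: "w \<in> ball_set n \<Longrightarrow> ray w \<subseteq> ball_set n"
  by (auto simp: ray_def ball_set_def norm_sq_scale mult_le_one power_le_one norm_sq_nonneg)

lemma ray_norm_sq_1:
  assumes "y \<in> ray w" "norm_sq n w = 1" "norm_sq n y = 1" shows "y = w"
proof -
  obtain s where s: "0 \<le> s" "y = (\<lambda>i. s * w i)" using assms(1) by (auto simp: ray_def)
  then have "s\<^sup>2 = 1" using assms(2,3) by (simp add: norm_sq_scale)
  with s show ?thesis by (simp add: power2_eq_1_iff)
qed

lemma in_ray_if_proportional:
  assumes "y \<in> ball_set n" "norm_sq n w = 1" "0 < a" "0 \<le> b" "\<And>i. a * y i = b * w i"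
  shows "y \<in> ray w"
proof -
  have y: "y = (\<lambda>i. (b / a) * w i)" using assms(3,5) by (auto simp: field_simps)
  have "(b / a)\<^sup>2 \<le> 1" using assms(1,2) norm_sq_scale[of n "b / a" w] unfolding y by (simp add: ball_set_def)
  then have "b / a \<le> 1" using assms(3,4) by (simp add: abs_square_le_1)
  then show ?thesis unfolding ray_def y using assms(3,4) by (intro imageI) simp
qed

lemma radial_notin_ray:
  assumes y: "y \<in> ball_set n" "y \<notin> ray w" and w: "norm_sq n w = 1" and t: "0 \<le> t" "t \<le> 1"
  shows "radial n (t, y) \<notin> ray w"
proof
  assume "radial n (t, y) \<in> ray w"
  then obtain s where s: "0 \<le> s" "radial n (t, y) = (\<lambda>i. s * w i)" by (auto simp: ray_def)
  have "y \<noteq> (\<lambda>i. 0)" using y(2) ray_endpoints(2) by blast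
  from radial_factor_pos[OF y(1) this t] have "y \<in> ray w"
    using in_ray_if_proportional[OF y(1) w _ s(1)] fun_cong[OF s(2)] by (auto simp: radial_def)
  with y(2) show False by blast
qed

lemma line_to_notin_ray:
  assumes y: "y \<in> ball_set n" "t < 1 \<Longrightarrow> y \<notin> ray w" and w: "norm_sq n w = 1" and t: "0 \<le> t" "t \<le> 1"
  shows "line_to (\<lambda>i. - w i / 2) (t, y) \<notin> ray w"
proof
  assume "line_to (\<lambda>i. - w i / 2) (t, y) \<in> ray w"
  then obtain s where s: "0 \<le> s" "line_to (\<lambda>i. - w i / 2) (t, y) = (\<lambda>i. s * w i)" by (auto simp: ray_def)
  have proportional: "(1 - t) * y i = (s + t / 2) * w i" for i
    using fun_cong[OF s(2), of i] by (simp add: line_to_def field_simps)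
  show False
  proof (cases "t = 1")
    case True
    then have "w i = 0" for i using proportional[of i] s(1) by simp
    with w show False by (simp add: norm_sq_def)
  next
    case False
    then show False using in_ray_if_proportional[OF y(1) w _ _ proportional] y(2) t s(1) by simp
  qed
qed

lemma closedin_ray:
  assumes "w \<in> ball_set n" shows "closedin (unit_ball n) (ray w)"
proof -
  have "continuous_on {0..1} (\<lambda>s i. s * w i)"
    by (rule continuous_on_coordinatewise_then_product) (intro continuous_on_mult continuous_on_const continuous_on_id)
  then have "compact (ray w)" unfolding ray_def by (rule compact_continuous_image) simp
  then show ?thesis
    using ray_subset[OF assms] by (simp add: unit_ball_top_of_set compact_imp_closed closed_subset)
qed

context cell
begin

lemma
  assumes K: "K \<subseteq> ball_set n" "(\<lambda>i. 0) \<in> K" "\<And>t y. y \<in> ball_set n \<Longrightarrow> y \<notin> K \<Longrightarrow> 0 \<le> t \<Longrightarrow> t \<le> 1 \<Longrightarrow> radial n (t, y) \<notin> K"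
    and x: "x \<in> cl - \<Phi> ` K" and t: "0 \<le> t" "t \<le> 1"
  shows radial_cl: "\<Phi> (radial n (t, inv\<Phi> x)) \<in> cl - \<Phi> ` K"
    and radial_fr: "t = 1 \<Longrightarrow> \<Phi> (radial n (t, inv\<Phi> x)) \<in> fr"
    and radial_fixes_fr: "x \<in> fr \<Longrightarrow> \<Phi> (radial n (t, inv\<Phi> x)) = x"
proof -
  have y: "inv\<Phi> x \<in> ball_set n" "inv\<Phi> x \<notin> K" using inv_cl_minus(1)[OF K(1)] x by auto
  with K(2) have "inv\<Phi> x \<noteq> (\<lambda>i. 0)" by auto
  note radial = radial_ball_set[OF y(1) this t] norm_sq_radial_1[OF y(1) this t] radial_fixed[OF y(1) this t]
  show "\<Phi> (radial n (t, inv\<Phi> x)) \<in> cl - \<Phi> ` K"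
    using radial(1) K(3)[OF y t] inj_on_image_mem_iff[OF inj radial(1) K(1)] by (simp add: cl_def)
  then show "t = 1 \<Longrightarrow> \<Phi> (radial n (t, inv\<Phi> x)) \<in> fr" using inv_fr radial(1,2) by (simp add: inv_\<Phi>)
  show "x \<in> fr \<Longrightarrow> \<Phi> (radial n (t, inv\<Phi> x)) = x" using x radial(3) inv_fr \<Phi>_inv by simp
qed

lemma continuous_radial_cl:
  assumes K: "K \<subseteq> ball_set n" "(\<lambda>i. 0) \<in> K"
  shows "continuous_map (prod_topology (top_of_set {0..1}) (subtopology X (cl - \<Phi> ` K))) X (\<lambda>(t, x). \<Phi> (radial n (t, inv\<Phi> x)))"
proof (rule cell_continuous)
  have y: "y \<in> ball_set n \<and> y \<noteq> (\<lambda>i. 0)" if "y \<in> inv\<Phi> ` (cl - \<Phi> ` K)" for y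
    using that K(2) unfolding inv_cl_minus(1)[OF K(1)] by blast
  show "continuous_on ({0..1} \<times> inv\<Phi> ` (cl - \<Phi> ` K)) (radial n)"
    using y norm_sq_eq_0 by (intro continuous_radial) blast
  show "radial n (t, y) \<in> ball_set n" if "0 \<le> t" "t \<le> 1" "y \<in> inv\<Phi> ` (cl - \<Phi> ` K)" for t y
    using radial_ball_set y that by blast
qed auto

lemma attach_topspace: "closedin X Z \<Longrightarrow> Z \<union> e \<subseteq> topspace X"
  using closedin_subset cl_topspace e_cl by blast

lemma rel_acyclic_radial:
  assumes Z: "closedin X Z" "fr \<subseteq> Z" "Z \<inter> e = {}"
    and K: "K \<subseteq> ball_set n" "(\<lambda>i. 0) \<in> K" "\<And>t y. y \<in> ball_set n \<Longrightarrow> y \<notin> K \<Longrightarrow> 0 \<le> t \<Longrightarrow> t \<le> 1 \<Longrightarrow> radial n (t, y) \<notin> K"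
  shows "rel_acyclic X (Z \<union> e - \<Phi> ` K) (Z - \<Phi> ` K)"
proof -
  let ?A = "Z \<union> e - \<Phi> ` K" and ?C = "cl - \<Phi> ` K" and ?I = "top_of_set {0..1::real}"
  let ?r = "\<lambda>(t, x). \<Phi> (radial n (t, inv\<Phi> x))"
  have CA: "?C \<subseteq> ?A" "?A \<inter> cl = ?C" "Z \<inter> cl = fr" using cl_eq Z by blast+
  note r = radial_cl[OF K] radial_fr[OF K] radial_fixes_fr[OF K]
  show ?thesis
  proof (rule rel_acyclic_homotopy[where h="\<lambda>p. if snd p \<in> Z then snd p else ?r p"])
    show "continuous_map (prod_topology ?I (subtopology X ?A)) (subtopology X ?A) (\<lambda>p. if snd p \<in> Z then snd p else ?r p)"
    proof (rule continuous_map_cases_closed)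
      have closed: "closedin (prod_topology ?I (subtopology X ?A)) ({0..1} \<times> (?A \<inter> S))" if "closedin X S"
        for S
        using closedin_subtopology_Int_closed[OF that, of ?A] by (auto simp: closedin_prod_Times_iff)
      show "closedin (prod_topology ?I (subtopology X ?A)) ({0..1} \<times> (?A \<inter> Z))" by (rule closed[OF Z(1)])
      show "closedin (prod_topology ?I (subtopology X ?A)) ({0..1} \<times> ?C)"
        using closed[OF closed_cl] unfolding CA(2) .
      show "p \<in> {0..1} \<times> ?C" if "p \<in> topspace (prod_topology ?I (subtopology X ?A))" "snd p \<notin> Z" for p
        using that e_cl by auto
      show "continuous_map (subtopology (prod_topology ?I (subtopology X ?A)) ({0..1} \<times> (?A \<inter> Z))) (subtopology X ?A) snd"
        by (rule continuous_map_from_subtopology) (rule continuous_map_snd)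
      have restrict: "subtopology (prod_topology ?I (subtopology X ?A)) ({0..1} \<times> ?C)
        = prod_topology ?I (subtopology X ?C)"
        using CA(1) by (simp add: subtopology_Times subtopology_subtopology inf.absorb2)
      have "?r p \<in> ?A" if p: "p \<in> topspace (prod_topology ?I (subtopology X ?C))" for p
      proof -
        obtain t x where "p = (t, x)" "0 \<le> t" "t \<le> 1" "x \<in> ?C" using p by auto
        then show ?thesis using subsetD[OF CA(1) r(1)[of x t]] by simp
      qed
      then show "continuous_map (subtopology (prod_topology ?I (subtopology X ?A)) ({0..1} \<times> ?C)) (subtopology X ?A) ?r"
        unfolding restrict continuous_map_in_subtopology by (intro conjI continuous_radial_cl[OF K(1,2)] Pi_I)
      show "snd p = ?r p" if "p \<in> {0..1} \<times> (?A \<inter> Z)" "p \<in> {0..1} \<times> ?C" for p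
        using that r(3)[of "snd p" "fst p"] CA(3)[symmetric] by (auto simp: split_beta)
    qed auto
    show "(if snd (0::real, x) \<in> Z then snd (0::real, x) else ?r (0, x)) = x" if "x \<in> ?A" for x
      using that e_cl \<Phi>_inv by auto
    show "(if snd (1::real, x) \<in> Z then snd (1::real, x) else ?r (1, x)) \<in> Z - \<Phi> ` K" if "x \<in> ?A" for x
      using that r(1,2)[of x 1] e_cl Z(2) by auto
  qed auto
qed

lemma rel_acyclic_minus_center:
  assumes Z: "closedin X Z" "fr \<subseteq> Z" "Z \<inter> e = {}"
  shows "rel_acyclic X (Z \<union> e - {center}) Z"
proof -
  have "radial n (t, y) \<notin> {\<lambda>i. 0}" if y: "y \<in> ball_set n" "y \<notin> {\<lambda>i. 0}" and t: "0 \<le> t" "t \<le> 1" for t y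
  proof -
    obtain i where "y i \<noteq> 0" using y(2) by auto
    then have "radial n (t, y) i \<noteq> 0" using radial_factor_pos[OF y(1) _ t] y(2) by (auto simp: radial_def)
    then show ?thesis by auto
  qed
  then have "rel_acyclic X (Z \<union> e - \<Phi> ` {\<lambda>i. 0}) (Z - \<Phi> ` {\<lambda>i. 0})"
    using zero_ball_set by (intro rel_acyclic_radial[OF Z]) auto
  moreover have "Z - \<Phi> ` {\<lambda>i. 0} = Z" using center_e Z(3) by (auto simp: center_def)
  ultimately show ?thesis by (simp add: center_def)
qed

lemma rel_acyclic_minus_ray:
  assumes w: "w \<in> ball_set n" "norm_sq n w = 1"
  shows "rel_acyclic X e (e - \<Phi> ` ray w)"
proof -
  let ?v = "\<lambda>i. - w i / 2"
  have v: "norm_sq n ?v < 1" using norm_sq_scale[of n "-1/2" w] w(2) by (simp add: power2_eq_square)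
  have v_ball_set: "?v \<in> ball_set n" using w(1) v by (auto simp: ball_set_def)
  have inv: "inv\<Phi> ` (e - \<Phi> ` ray w) = unit_ball_interior n - ray w"
    by (rule inv_cl_minus(2)[OF ray_subset[OF w(1)]])
  have stay: "line_to ?v (t, y) \<in> unit_ball_interior n" if "y \<in> unit_ball_interior n" "0 \<le> t" "t \<le> 1" for t y
    using that line_to_ball_set[OF _ v_ball_set] norm_sq_line_to_less[OF _ v, of y t]
      by (auto simp: unit_ball_interior_eq)
  show ?thesis
  proof (rule rel_acyclic_line_to[OF _ e_cl, where w="?v"])
    show "?v \<in> inv\<Phi> ` (e - \<Phi> ` ray w)"
      using line_to_notin_ray[OF v_ball_set _ w(2), of 1] v v_ball_set
        unfolding inv by (simp add: unit_ball_interior_eq)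
    show "line_to ?v (t, y) \<in> inv\<Phi> ` (e - \<Phi> ` ray w)"
      if "0 \<le> t" "t \<le> 1" "y \<in> inv\<Phi> ` (e - \<Phi> ` ray w)" for t y
      using that stay line_to_notin_ray[OF _ _ w(2), of y t]
        unfolding inv by (auto simp: unit_ball_interior_eq)
  qed (use stay inv_e in auto)
qed

lemma rel_acyclic_minus_fr:
  assumes Z: "closedin X Z" "fr \<subseteq> Z" "Z \<inter> e = {}" and x: "x \<in> fr"
  shows "rel_acyclic X (Z \<union> e - {x}) (Z - {x})"
proof -
  obtain w where w: "w \<in> ball_set n" "norm_sq n w = 1" "x = \<Phi> w"
    using x by (auto simp: fr_def unit_ball_boundary_eq)
  let ?K = "\<Phi> ` ray w" and ?A = "Z \<union> e - {x}"
  let ?T = "Z \<union> e - ?K"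
  have "\<Phi> y = x" if y: "y \<in> ray w" and "\<Phi> y \<in> Z" for y
  proof -
    have y_ball_set: "y \<in> ball_set n" using y ray_subset[OF w(1)] by blast
    then have "\<Phi> y \<in> fr" using that(2) Z cl_eq by (auto simp: cl_def)
    then have "norm_sq n y = 1" using inv_fr fr_cl inv_\<Phi>[OF y_ball_set] by auto
    then show ?thesis using ray_norm_sq_1[OF y w(2)] w(3) by simp
  qed
  then have K: "x \<in> ?K" "Z - ?K = Z - {x}" using ray_endpoints(1) w(3) by blast+
  have closed: "closedin X ?K" by (rule compact_image[OF closedin_ray[OF w(1)]])
  have A: "?A \<subseteq> topspace X" using attach_topspace[OF Z(1)] by blast
  have T: "?T = ?A - ?K" using K(1) by blast
  have "rel_acyclic X ?T (Z - {x})"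
    unfolding K(2)[symmetric]
    by (intro rel_acyclic_radial[OF Z ray_subset[OF w(1)] ray_endpoints(2)] radial_notin_ray w(2)) assumption+
  moreover have "rel_acyclic X ?A ?T"
  proof (rule rel_acyclic_excision[where U="Z - {x}"])
    have "?A \<inter> Z = Z - {x}" by blast
    then show "closedin (subtopology X ?A) (Z - {x})"
      using closedin_subtopology_Int_closed[OF Z(1), of ?A] by simp
    show "openin (subtopology X ?A) ?T" unfolding T by (rule openin_subtopology_diff_closed[OF A closed])
    have "?A - (Z - {x}) = e" "?T - (Z - {x}) = e - ?K" using Z(3) x e_fr K(1) by blast+
    then show "rel_acyclic X (?A - (Z - {x})) (?T - (Z - {x}))" using rel_acyclic_minus_ray[OF w(1,2)] by simp
  qed (use A K(2) in auto)
  ultimately show ?thesis using rel_acyclic_trans[of X ?A ?T "Z - {x}"] K T by blast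
qed

lemma attach_center_pair:
  assumes Z: "closedin X Z" "Z \<inter> e = {}"
  shows "closedin (subtopology X (Z \<union> e)) Z" "openin (subtopology X (Z \<union> e)) (Z \<union> e - {center})"
    "Z \<subseteq> Z \<union> e - {center}" "Z \<union> e \<subseteq> topspace X" "Z \<union> e - Z = e" "Z \<union> e - {center} - Z = e - {center}"
proof -
  show A: "Z \<union> e \<subseteq> topspace X" by (rule attach_topspace[OF Z(1)])
  show "closedin (subtopology X (Z \<union> e)) Z"
    using closedin_subtopology_Int_closed[OF Z(1), of "Z \<union> e"] by (simp add: Int_absorb1)
  have "closedin X {center}" using A center_e hausdorff by (intro closedin_Hausdorff_singleton) auto
  then show "openin (subtopology X (Z \<union> e)) (Z \<union> e - {center})" by (rule openin_subtopology_diff_closed[OF A])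
qed (use center_e Z(2) in blast)+

lemmas fr_attach = closed_fr e_fr[unfolded Int_commute[of e]]

lemma fr_Un_e: "fr \<union> e = cl"
  using cl_eq by blast

lemma attach_cycle_reduce:
  assumes Z: "closedin X Z" "fr \<subseteq> Z" "Z \<inter> e = {}" and c: "relcycle X p (Z \<union> e) Z c"
  obtains c' where "relcycle X p cl fr c'" "relboundary X p (Z \<union> e) Z (c - c')"
proof -
  let ?A = "Z \<union> e" and ?T = "Z \<union> e - {center}"
  note pair = attach_center_pair[OF Z(1,3)]
  have cl: "cl \<subseteq> ?A" "cl - {center} \<subseteq> ?T" using cl_eq Z(2) by blast+
  have "relcycle X p ?A ?T c" by (rule relcycle_mono[OF c subset_refl pair(3)])
  from excision_surj[OF pair(1-4) this]
  obtain b where b: "relcycle X p e (e - {center}) b" "relboundary X p ?A ?T (c - b)" unfolding pair(5,6) .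
  have "relcycle X p cl (cl - {center}) b" using relcycle_mono[OF b(1)] e_cl by blast
  moreover have "rel_acyclic X (cl - {center}) fr" "fr \<subseteq> cl - {center}"
    using rel_acyclic_minus_center[OF closed_fr subset_refl] attach_center_pair(3)[OF fr_attach] e_fr
      unfolding fr_Un_e by blast+
  ultimately obtain c' where c': "relcycle X p cl fr c'" "relboundary X p cl (cl - {center}) (b - c')"
    using relcycle_lift[of X "cl - {center}" fr cl p b] by blast
  have "relboundary X p ?A ?T (c - c')" using relboundary_add[OF b(2) relboundary_mono[OF c'(2) cl]] by simp
  moreover have "relcycle X p ?A Z (c - c')" by (rule relcycle_diff[OF c relcycle_mono[OF c'(1) cl(1) Z(2)]])
  ultimately have "relboundary X p ?A Z (c - c')"
    using relboundary_lift[OF rel_acyclicD[OF rel_acyclic_minus_center[OF Z]]] by blast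
  with c'(1) show ?thesis by (rule that)
qed

lemma attach_boundary_restrict:
  assumes Z: "closedin X Z" "fr \<subseteq> Z" "Z \<inter> e = {}" and c: "relcycle X p cl fr c" "relboundary X p (Z \<union> e) Z c"
  shows "relboundary X p cl fr c"
proof -
  let ?A = "Z \<union> e" and ?T = "Z \<union> e - {center}"
  note pair = attach_center_pair[OF Z(1,3)] and fr_pair = attach_center_pair[OF fr_attach, unfolded fr_Un_e]
  have cl: "cl \<subseteq> ?A" "cl - {center} \<subseteq> ?T" using cl_eq Z(2) by blast+
  have "relcycle X p cl (cl - {center}) c" by (rule relcycle_mono[OF c(1) subset_refl fr_pair(3)])
  from excision_surj[OF fr_pair(1-4) this]
  obtain b where b: "relcycle X p e (e - {center}) b" "relboundary X p cl (cl - {center}) (c - b)"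
    unfolding fr_pair(5,6) .
  have "relboundary X p ?A ?T b"
    using relboundary_diff[OF relboundary_mono[OF c(2) subset_refl pair(3)] relboundary_mono[OF b(2) cl]]
      by simp
  with b(1) have "relboundary X p e (e - {center}) b"
    using excision_inj[OF pair(1-4), unfolded pair(5,6)] by blast
  then have "relboundary X p cl (cl - {center}) b" using relboundary_mono e_cl by blast
  from relboundary_add[OF this b(2)] have "relboundary X p cl (cl - {center}) c" by simp
  moreover have "rel_acyclic X (cl - {center}) fr"
    using rel_acyclic_minus_center[OF closed_fr subset_refl] e_fr unfolding fr_Un_e by blast
  ultimately show ?thesis using relboundary_lift[OF rel_acyclicD _ c(1)] by blast
qed

lemma attach_relboundary:
  assumes Z: "closedin X Z" "fr \<subseteq> Z" "Z \<inter> e = {}" and "p \<noteq> n" and c: "relcycle X p (Z \<union> e) Z c"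
  shows "relboundary X p (Z \<union> e) Z c"
proof -
  obtain c' where c': "relcycle X p cl fr c'" "relboundary X p (Z \<union> e) Z (c - c')"
    using attach_cycle_reduce[OF Z c] .
  have "relboundary X p (Z \<union> e) Z c'"
    using relboundary_mono[OF relboundary_cl[OF \<open>p \<noteq> n\<close> c'(1)] _ Z(2)] cl_eq Z(2) by blast
  from relboundary_add[OF c'(2) this] show ?thesis by simp
qed

lemma attach_rel_generator:
  assumes Z: "closedin X Z" "fr \<subseteq> Z" "Z \<inter> e = {}" and z: "rel_generator X n cl fr z"
  shows "rel_generator X n (Z \<union> e) Z z"
proof -
  have cl: "cl \<subseteq> Z \<union> e" using cl_eq Z(2) by blast
  have cycle: "relcycle X n cl fr z" using z by (simp add: rel_generator_def)
  show ?thesis unfolding rel_generator_def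
  proof (intro conjI allI impI)
    show "relcycle X n (Z \<union> e) Z z" by (rule relcycle_mono[OF cycle cl Z(2)])
    fix c assume "relcycle X n (Z \<union> e) Z c"
    then obtain c' where c': "relcycle X n cl fr c'" "relboundary X n (Z \<union> e) Z (c - c')"
      using attach_cycle_reduce[OF Z] by blast
    obtain k where "relboundary X n cl fr (c' - frag_cmul k z)"
      using z c'(1) unfolding rel_generator_def by blast
    from relboundary_add[OF c'(2) relboundary_mono[OF this cl Z(2)]]
    show "\<exists>k. relboundary X n (Z \<union> e) Z (c - frag_cmul k z)" unfolding add_diff_eq diff_add_cancel by blast
  next
    fix k assume "relboundary X n (Z \<union> e) Z (frag_cmul k z)"
    then have "relboundary X n cl fr (frag_cmul k z)"
      by (rule attach_boundary_restrict[OF Z relcycle_cmul[OF cycle]])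
    then show "k = 0" using z unfolding rel_generator_def by blast
  qed
qed

end

section \<open>Regular CW-complexes\<close>

lemma finite_max_ex:
  fixes f :: "'b \<Rightarrow> nat"
  assumes "finite A" "A \<noteq> {}"
  obtains e where "e \<in> A" "\<And>e'. e' \<in> A \<Longrightarrow> f e' \<le> f e"
proof -
  have "Max (f ` A) \<in> f ` A" using assms by (intro Max_in) auto
  then obtain e where "e \<in> A" "f e = Max (f ` A)" by auto
  then show ?thesis using assms that[of e] by simp
qed

lemma norm_sq_L2: "sqrt (norm_sq n x) = L2_set x {..<n}"
  by (simp add: norm_sq_def L2_set_def)

lemma in_ball_set_iff: "x \<in> ball_set n \<longleftrightarrow> (\<forall>i\<ge>n. x i = 0) \<and> L2_set x {..<n} \<le> 1"
  by (simp add: ball_set_def norm_sq_L2[symmetric])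

lemma in_unit_ball_interior_iff: "x \<in> unit_ball_interior n \<longleftrightarrow> (\<forall>i\<ge>n. x i = 0) \<and> L2_set x {..<n} < 1"
  by (auto simp: unit_ball_interior_eq ball_set_def norm_sq_L2[symmetric])

lemma L2_set_scale: "L2_set (\<lambda>i. c * x i) {..<n::nat} = \<bar>c\<bar> * L2_set x {..<n}"
  unfolding norm_sq_L2[symmetric] norm_sq_scale by (simp add: real_sqrt_mult)

lemma L2_set_abs_diff: "\<bar>L2_set x {..<n::nat} - L2_set y {..<n}\<bar> \<le> L2_set (\<lambda>i. x i - y i) {..<n}"
  using L2_set_triangle_ineq[of "\<lambda>i. x i - y i" y "{..<n}"] L2_set_triangle_ineq[of "\<lambda>i. y i - x i" x "{..<n}"]
    L2_set_scale[of "-1" "\<lambda>i. x i - y i" n] by simp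

lemma L2_set_diff_eq_0:
  assumes "x \<in> ball_set n" "y \<in> ball_set n" "L2_set (\<lambda>i. x i - y i) {..<n} = 0" shows "x = y"
proof
  fix i show "x i = y i"
    using assms by (cases "i < n") (auto simp: ball_set_def L2_set_eq_0_iff)
qed

lemma segment_exits_ball:
  assumes a: "a \<in> unit_ball_interior n" and w: "w \<in> ball_set n" "w \<noteq> a"
  obtains s where "1 \<le> s" "L2_set (\<lambda>i. a i + s * (w i - a i)) {..<n} = 1"
proof -
  let ?v = "\<lambda>i. w i - a i" and ?N = "\<lambda>x. L2_set x {..<n}"
  let ?g = "\<lambda>s. ?N (\<lambda>i. a i + s * ?v i)"
  have "?N ?v \<noteq> 0" using L2_set_diff_eq_0[OF w(1)] w(2) a by (auto simp: unit_ball_interior_eq)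
  then have v: "0 < ?N ?v" using L2_set_nonneg[of ?v "{..<n}"] by linarith
  define S where "S = max 1 ((1 + ?N a) / ?N ?v)"
  have "continuous_on {1..S} ?g"
    unfolding norm_sq_L2[symmetric]
    by (intro continuous_on_real_sqrt continuous_norm_sq)
      (rule continuous_on_coordinatewise_then_product, intro continuous_on_add continuous_on_mult continuous_on_const continuous_on_id)
  moreover have "?g 1 \<le> 1" using w(1) by (simp add: in_ball_set_iff)
  moreover have "1 \<le> ?g S"
  proof -
    have "(1 + ?N a) / ?N ?v \<le> S" by (simp add: S_def)
    then have "1 + ?N a \<le> S * ?N ?v" using v by (simp add: pos_divide_le_eq)
    also have "\<dots> = ?N (\<lambda>i. S * ?v i)" using L2_set_scale[of S ?v n] by (simp add: S_def)
    also have "\<dots> \<le> ?g S + ?N a"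
      using L2_set_triangle_ineq[of "\<lambda>i. a i + S * ?v i" "\<lambda>i. - 1 * a i" "{..<n}"] L2_set_scale[of "-1" a n]
        by simp
    finally show ?thesis by simp
  qed
  ultimately show ?thesis using IVT'[of ?g 1 1 S] that by (auto simp: S_def)
qed

definition recenter :: "nat \<Rightarrow> (nat \<Rightarrow> real) \<Rightarrow> (nat \<Rightarrow> real) \<Rightarrow> nat \<Rightarrow> real" where
  "recenter n a y = (\<lambda>i. y i + (1 - L2_set y {..<n}) * a i)"

lemma recenter_zero [simp]: "recenter n a (\<lambda>i. 0) = a"
  by (simp add: recenter_def L2_set_def)

lemma recenter_boundary: "y \<in> unit_ball_boundary n \<Longrightarrow> recenter n a y = y"
  by (simp add: recenter_def norm_sq_L2[symmetric] unit_ball_boundary_eq)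

lemma recenter_ball_set:
  assumes "a \<in> unit_ball_interior n" "y \<in> ball_set n" shows "recenter n a y \<in> ball_set n"
proof -
  let ?N = "\<lambda>x. L2_set x {..<n}"
  have "?N (recenter n a y) \<le> ?N y + \<bar>1 - ?N y\<bar> * ?N a"
    unfolding recenter_def
      using L2_set_triangle_ineq[of y "\<lambda>i. (1 - ?N y) * a i" "{..<n}"] by (simp add: L2_set_scale)
  also have "\<dots> \<le> ?N y + (1 - ?N y) * 1"
    using assms L2_set_nonneg[of a "{..<n}"]
      by (intro add_left_mono mult_mono) (auto simp: in_ball_set_iff in_unit_ball_interior_iff)
  finally show ?thesis using assms by (auto simp: in_ball_set_iff in_unit_ball_interior_iff recenter_def)
qed

lemma inj_on_recenter:
  assumes "a \<in> unit_ball_interior n" shows "inj_on (recenter n a) (ball_set n)"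
proof (rule inj_onI)
  let ?N = "\<lambda>x. L2_set x {..<n}"
  fix y z assume yz: "y \<in> ball_set n" "z \<in> ball_set n" "recenter n a y = recenter n a z"
  let ?d = "?N (\<lambda>i. y i - z i)"
  have "y i - z i = (?N y - ?N z) * a i" for i
    using fun_cong[OF yz(3), of i] by (simp add: recenter_def algebra_simps)
  then have "?d = \<bar>?N y - ?N z\<bar> * ?N a" by (simp add: L2_set_scale)
  also have "\<dots> \<le> ?d * ?N a" by (intro mult_right_mono L2_set_abs_diff L2_set_nonneg)
  finally have "?d * (1 - ?N a) \<le> 0" by (simp add: algebra_simps)
  then have "?d = 0"
    using assms L2_set_nonneg[of "\<lambda>i. y i - z i" "{..<n}"]
    by (auto simp: in_unit_ball_interior_iff mult_le_0_iff)
  then show "y = z" by (rule L2_set_diff_eq_0[OF yz(1,2)])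
qed

lemma recenter_image:
  assumes "a \<in> unit_ball_interior n" shows "recenter n a ` ball_set n = ball_set n"
proof
  show "recenter n a ` ball_set n \<subseteq> ball_set n" using recenter_ball_set[OF assms] by blast
  show "ball_set n \<subseteq> recenter n a ` ball_set n"
  proof
    fix w assume w: "w \<in> ball_set n"
    show "w \<in> recenter n a ` ball_set n"
    proof (cases "w = a")
      case True
      then show ?thesis by (intro image_eqI[of _ _ "\<lambda>i. 0"]) (simp_all add: ball_set_def norm_sq_def)
    next
      case False
      obtain s where s: "1 \<le> s" "L2_set (\<lambda>i. a i + s * (w i - a i)) {..<n} = 1"
        by (rule segment_exits_ball[OF assms w False])
      define y where "y = (\<lambda>i. (1 / s) * (a i + s * (w i - a i)))"
      have norm: "L2_set y {..<n} = 1 / s" unfolding y_def L2_set_scale s(2) using s(1) by simp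
      have "y \<in> ball_set n"
        using norm s(1) w assms by (auto simp: in_ball_set_iff in_unit_ball_interior_iff y_def)
      moreover have "w = recenter n a y"
        unfolding recenter_def norm using s(1) by (simp add: y_def field_simps fun_eq_iff)
      ultimately show ?thesis by blast
    qed
  qed
qed

lemma homeomorphic_map_recenter:
  assumes "a \<in> unit_ball_interior n" shows "homeomorphic_map (unit_ball n) (unit_ball n) (recenter n a)"
proof (rule continuous_imp_homeomorphic_map)
  have "continuous_on (ball_set n) (recenter n a)"
    unfolding recenter_def norm_sq_L2[symmetric]
    by (rule continuous_on_coordinatewise_then_product)
      (intro continuous_on_add continuous_on_mult continuous_on_diff continuous_on_const continuous_on_real_sqrt
        continuous_norm_sq continuous_coord continuous_on_id)
  then show "continuous_map (unit_ball n) (unit_ball n) (recenter n a)"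
    using recenter_ball_set[OF assms] by (auto simp: unit_ball_top_of_set)
  show "Hausdorff_space (unit_ball n)" by (simp add: unit_ball_top_of_set Hausdorff_space_subtopology)
qed (simp_all add: compact_unit_ball recenter_image inj_on_recenter assms)

context cell
begin

lemma cl_closure: "cl = X closure_of e" using closure_e ..
lemma fr_closure: "fr = X closure_of e - e" using closure_e cl_eq e_fr by blast

lemma rel_acyclic_minus_e:
  assumes Z: "closedin X Z" "fr \<subseteq> Z" "Z \<inter> e = {}" and x: "x \<in> e"
  shows "rel_acyclic X (Z \<union> e - {x}) Z"
proof -
  obtain a where a: "a \<in> unit_ball_interior n" "x = \<Phi> a" using x unfolding e_eq by blast
  let ?H = "recenter n a"
  note H_image = recenter_image[OF a(1)]
  have H_boundary: "?H ` unit_ball_boundary n = unit_ball_boundary n"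
    using recenter_boundary by (force simp: image_iff)
  have "unit_ball_interior n = ball_set n - unit_ball_boundary n"
    by (auto simp: unit_ball_interior_eq unit_ball_boundary_eq) (auto simp: ball_set_def)
  then have H_interior: "?H ` unit_ball_interior n = unit_ball_interior n"
    using inj_on_image_set_diff[OF inj_on_recenter[OF a(1)], of "ball_set n" "unit_ball_boundary n"] H_image H_boundary
    by (auto simp: unit_ball_boundary_eq)
  have "homeomorphic_map (unit_ball n) (subtopology X cl) (\<Phi> \<circ> ?H)"
    by (rule homeomorphic_map_compose[OF homeomorphic_map_recenter[OF a(1)] homeo])
  moreover have "(\<Phi> \<circ> ?H) ` ball_set n = cl" unfolding image_comp[symmetric] H_image cl_def ..
  ultimately have "embedding_map (unit_ball n) X (\<Phi> \<circ> ?H)" by (simp add: embedding_map_def)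
  then have "characteristic_map X n e (\<Phi> \<circ> ?H)"
    unfolding characteristic_map_def image_comp[symmetric] H_interior using e_eq by simp
  then interpret recentered: cell X n e "\<Phi> \<circ> ?H" by (simp add: cell_def hausdorff)
  have "recentered.fr = fr" unfolding recentered.fr_closure fr_closure ..
  then show ?thesis
    using recentered.rel_acyclic_minus_center[of Z] Z a(2) by (simp add: recentered.center_def)
qed

lemma not_rel_acyclic_minus_e: assumes "x \<in> e" shows "\<not> rel_acyclic X cl (cl - {x})"
proof
  assume vanish: "rel_acyclic X cl (cl - {x})"
  have "rel_acyclic X (cl - {x}) fr"
    using rel_acyclic_minus_e[OF closed_fr subset_refl _ assms] e_fr unfolding fr_Un_e by blast
  then have "rel_acyclic X cl fr" by (rule rel_acyclic_trans[OF vanish]) (use assms fr_cl e_fr in auto)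
  moreover obtain z where z: "rel_generator X n cl fr z" using rel_generator_cl ..
  ultimately show False using rel_generator_not_relboundary[OF z] rel_acyclicD rel_generator_relcycle by blast
qed

end

locale regular_CW =
  fixes X :: "'a topology" and C :: "'a set set" and cell_dim :: "'a set \<Rightarrow> nat"
  assumes hausdorff: "Hausdorff_space X" and finite_C: "finite C" and disjoint_C: "disjoint C"
    and cells: "e \<in> C \<Longrightarrow> \<exists>\<Phi>. characteristic_map X (cell_dim e) e \<Phi>"
    and bdry: "e \<in> C \<Longrightarrow> \<exists>D\<subseteq>C. X closure_of e - e = \<Union>D \<and> (\<forall>d\<in>D. cell_dim d < cell_dim e)"
begin

definition boundary_cells :: "'a set \<Rightarrow> 'a set set" where
  "boundary_cells e = {d \<in> C. d \<subseteq> X closure_of e - e}"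

definition face_closed :: "'a set set \<Rightarrow> bool" where
  "face_closed S \<longleftrightarrow> S \<subseteq> C \<and> (\<forall>e\<in>S. boundary_cells e \<subseteq> S)"

definition below :: "'a set \<Rightarrow> 'a set \<Rightarrow> bool" where
  "below d e \<longleftrightarrow> d \<in> C \<and> e \<in> C \<and> (d = e \<or> d \<in> boundary_cells e)"

lemma cellI: "e \<in> C \<Longrightarrow> \<exists>\<Phi>. cell X (cell_dim e) e \<Phi>"
  using cells[of e] hausdorff by (simp add: cell_def)

lemma cell_ne: "e \<in> C \<Longrightarrow> e \<noteq> {}"
  using cellI cell.e_nonempty by blast

lemma boundary_cells_subset: "boundary_cells e \<subseteq> C" by (auto simp: boundary_cells_def)

lemma finite_boundary_cells: "finite (boundary_cells e)"
  using finite_subset[OF boundary_cells_subset finite_C] .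

lemma cell_eq: "d \<in> C \<Longrightarrow> e \<in> C \<Longrightarrow> x \<in> d \<Longrightarrow> x \<in> e \<Longrightarrow> d = e"
  using disjoint_C by (auto simp: disjoint_def)

lemma Union_boundary_cells: "e \<in> C \<Longrightarrow> X closure_of e - e = \<Union>(boundary_cells e)"
  and boundary_cells_cell_dim: "e \<in> C \<Longrightarrow> d \<in> boundary_cells e \<Longrightarrow> cell_dim d < cell_dim e"
proof -
  assume e: "e \<in> C"
  obtain D where D: "D \<subseteq> C" "X closure_of e - e = \<Union>D" "\<forall>d\<in>D. cell_dim d < cell_dim e"
    using bdry[OF e] by (elim exE conjE)
  have "boundary_cells e = D"
  proof
    show "D \<subseteq> boundary_cells e" unfolding boundary_cells_def D(2) using D(1) by auto
    show "boundary_cells e \<subseteq> D"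
    proof
      fix d assume d: "d \<in> boundary_cells e"
      have dC: "d \<in> C" using d boundary_cells_subset by (rule rev_subsetD)
      then obtain x where x: "x \<in> d" using cell_ne[OF dC] by auto
      have "d \<subseteq> \<Union>D" using d unfolding boundary_cells_def D(2) by simp
      then obtain d' where d': "d' \<in> D" "x \<in> d'" using x by auto
      have "d' = d" by (rule cell_eq[OF _ dC d'(2) x]) (use d' D(1) in auto)
      then show "d \<in> D" using d' by simp
    qed
  qed
  then show "X closure_of e - e = \<Union>(boundary_cells e)" "d \<in> boundary_cells e \<Longrightarrow> cell_dim d < cell_dim e"
    by (simp_all only: D(2) bspec[OF D(3)])
qed

lemma e_closure: "e \<in> C \<Longrightarrow> e \<subseteq> X closure_of e"
proof -
  assume "e \<in> C"
  then obtain \<Phi> where "cell X (cell_dim e) e \<Phi>" using cellI by blast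
  then interpret c: cell X "cell_dim e" e \<Phi> .
  show ?thesis using c.e_cl unfolding c.cl_closure .
qed

lemma closure_un: "e \<in> C \<Longrightarrow> X closure_of e = e \<union> \<Union>(boundary_cells e)"
  using Union_boundary_cells[of e] e_closure[of e] by blast

lemma boundary_cells_trans: "e \<in> C \<Longrightarrow> d \<in> boundary_cells e \<Longrightarrow> boundary_cells d \<subseteq> boundary_cells e"
proof
  fix c assume e: "e \<in> C" and d: "d \<in> boundary_cells e" and c: "c \<in> boundary_cells d"
  have dC: "d \<in> C" using d boundary_cells_subset by blast
  have "d \<subseteq> X closure_of e" using d by (auto simp: boundary_cells_def)
  then have "X closure_of d \<subseteq> X closure_of e" using closure_of_minimal[of d "X closure_of e" X] by simp
  then have "c \<subseteq> X closure_of e" using c by (auto simp: boundary_cells_def)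
  moreover have "c \<inter> e = {}"
  proof (rule ccontr)
    assume "c \<inter> e \<noteq> {}"
    then obtain x where "x \<in> c" "x \<in> e" by auto
    moreover have "c \<in> C" using c boundary_cells_subset by (rule rev_subsetD)
    ultimately have "c = e" using cell_eq e by simp
    then show False using boundary_cells_cell_dim[OF e d] boundary_cells_cell_dim[OF dC c] by simp
  qed
  ultimately show "c \<in> boundary_cells e" using c by (auto simp: boundary_cells_def)
qed

lemma face_closed_subset: "face_closed S \<Longrightarrow> S \<subseteq> C" by (simp add: face_closed_def)

lemma Union_face_closed: "face_closed S \<Longrightarrow> \<Union>S = (\<Union>e\<in>S. X closure_of e)"
proof -
  assume S: "face_closed S"
  have "e \<subseteq> X closure_of e" "X closure_of e \<subseteq> \<Union>S" if "e \<in> S" for e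
  proof -
    have "e \<in> C" "boundary_cells e \<subseteq> S" using S that by (auto simp: face_closed_def)
    then show "e \<subseteq> X closure_of e" "X closure_of e \<subseteq> \<Union>S"
      using closure_un[of e] that by auto
  qed
  then show ?thesis by blast
qed

lemma closedin_face_closed: "face_closed S \<Longrightarrow> closedin X (\<Union>S)"
  unfolding Union_face_closed
    using finite_subset[OF face_closed_subset finite_C] by (intro closedin_Union) auto

lemma face_closed_mem: "face_closed S \<Longrightarrow> e \<in> C \<Longrightarrow> x \<in> e \<Longrightarrow> x \<in> \<Union>S \<Longrightarrow> e \<in> S"
proof -
  assume S: "face_closed S" and e: "e \<in> C" "x \<in> e" "x \<in> \<Union>S"
  then obtain d where d: "d \<in> S" "x \<in> d" by auto
  then have "d = e" using cell_eq[of d e x] face_closed_subset[OF S] e by auto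
  then show "e \<in> S" using d by simp
qed

lemma face_closed_disjoint: "face_closed S \<Longrightarrow> e \<in> C \<Longrightarrow> e \<notin> S \<Longrightarrow> \<Union>S \<inter> e = {}"
  using face_closed_mem by blast

lemma frontier_face_closed: "face_closed S \<Longrightarrow> e \<in> C \<Longrightarrow> boundary_cells e \<subseteq> S \<Longrightarrow> X closure_of e - e \<subseteq> \<Union>S"
  using Union_boundary_cells by blast

lemma face_closed_topspace: "face_closed S \<Longrightarrow> \<Union>S \<subseteq> topspace X"
  using closedin_subset[OF closedin_face_closed] .

lemma below_refl: "e \<in> C \<Longrightarrow> below e e" by (simp add: below_def)

lemma below_trans: "below c d \<Longrightarrow> below d e \<Longrightarrow> below c e"
  unfolding below_def using boundary_cells_trans[of e d] by auto

lemma below_cell_dim: "below d e \<Longrightarrow> d \<noteq> e \<Longrightarrow> cell_dim d < cell_dim e"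
  unfolding below_def using boundary_cells_cell_dim by blast

lemma below_closure: "d \<in> C \<Longrightarrow> e \<in> C \<Longrightarrow> below d e \<longleftrightarrow> X closure_of d \<subseteq> X closure_of e"
proof
  assume e: "d \<in> C" "e \<in> C"
  assume "below d e"
  then have "d \<subseteq> X closure_of e" using e_closure by (auto simp: below_def boundary_cells_def)
  then show "X closure_of d \<subseteq> X closure_of e" using closure_of_minimal[of d "X closure_of e" X] by simp
next
  assume e: "d \<in> C" "e \<in> C" and face_closed: "X closure_of d \<subseteq> X closure_of e"
  then have de: "d \<subseteq> X closure_of e" using e_closure by blast
  show "below d e"
  proof (cases "d \<inter> e = {}")
    case True
    then have "d \<in> boundary_cells e" using de e by (auto simp: boundary_cells_def)
    then show ?thesis using e by (simp add: below_def)
  next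
    case False
    then obtain x where "x \<in> d" "x \<in> e" by auto
    then have "d = e" using cell_eq e by simp
    then show ?thesis using e by (simp add: below_def)
  qed
qed

lemma face_closed_remove:
  assumes S: "face_closed S" and e: "e \<in> S" and max: "\<And>e'. e' \<in> S \<Longrightarrow> e \<in> boundary_cells e' \<Longrightarrow> False"
  shows "face_closed (S - {e})"
  unfolding face_closed_def
proof (intro conjI ballI subsetI)
  fix d assume "d \<in> S - {e}" then show "d \<in> C" using S by (auto simp: face_closed_def)
next
  fix d c assume dc: "d \<in> S - {e}" "c \<in> boundary_cells d"
  then have "c \<in> S" using S by (auto simp: face_closed_def)
  moreover have "c \<noteq> e" using max[of d] dc by auto
  ultimately show "c \<in> S - {e}" by simp
qed

lemma obtain_top_cell:
  assumes S: "face_closed S" and T: "T \<subseteq> S" "T \<noteq> {}"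
    and up: "\<And>d e. d \<in> T \<Longrightarrow> e \<in> S \<Longrightarrow> d \<in> boundary_cells e \<Longrightarrow> e \<in> T"
  obtains e where "e \<in> T" "face_closed (S - {e})" "boundary_cells e \<subseteq> S - {e}" "\<And>d. d \<in> T \<Longrightarrow> cell_dim d \<le> cell_dim e"
proof -
  have "finite T" using T(1) face_closed_subset[OF S] finite_C by (meson finite_subset)
  then obtain e where e: "e \<in> T" "\<And>d. d \<in> T \<Longrightarrow> cell_dim d \<le> cell_dim e"
    using finite_max_ex[OF _ T(2), of cell_dim] by metis
  have eS: "e \<in> S" "e \<in> C" using e(1) T(1) face_closed_subset[OF S] by blast+
  have "False" if "e' \<in> S" "e \<in> boundary_cells e'" for e'
    using e(2)[OF up[OF e(1) that]] boundary_cells_cell_dim[of e' e] that face_closed_subset[OF S]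
      by fastforce
  then have "face_closed (S - {e})" by (rule face_closed_remove[OF S eS(1)])
  moreover have "boundary_cells e \<subseteq> S - {e}"
    using S eS boundary_cells_cell_dim[OF eS(2)] unfolding face_closed_def by blast
  ultimately show ?thesis using e by (intro that)
qed

lemma face_closed_minus_star: "face_closed S \<Longrightarrow> face_closed {e \<in> S. \<not> below s e}"
proof -
  assume S: "face_closed S"
  show ?thesis unfolding face_closed_def
  proof (intro conjI ballI subsetI)
    fix d assume "d \<in> {e \<in> S. \<not> below s e}" then show "d \<in> C" using S by (auto simp: face_closed_def)
  next
    fix d c assume dc: "d \<in> {e \<in> S. \<not> below s e}" "c \<in> boundary_cells d"
    then have "c \<in> S" "d \<in> C" "c \<in> C" using S by (auto simp: face_closed_def)
    then have "below c d" using dc by (simp add: below_def)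
    then show "c \<in> {e \<in> S. \<not> below s e}" using below_trans[of s c d] dc \<open>c \<in> S\<close> by auto
  qed
qed

lemma
  assumes S: "face_closed S" and e: "e \<in> C" "e \<notin> S" "boundary_cells e \<subseteq> S"
  shows attach_relboundary: "p \<noteq> cell_dim e \<Longrightarrow> relcycle X p (\<Union>S \<union> e) (\<Union>S) c \<Longrightarrow> relboundary X p (\<Union>S \<union> e) (\<Union>S) c"
    and attach_rel_generator: "rel_generator X (cell_dim e) (X closure_of e) (X closure_of e - e) z
      \<Longrightarrow> rel_generator X (cell_dim e) (\<Union>S \<union> e) (\<Union>S) z"
    and rel_acyclic_attach_minus: "x \<in> e \<Longrightarrow> rel_acyclic X (\<Union>S \<union> e - {x}) (\<Union>S)"
    and rel_acyclic_attach_minus_fr: "x \<in> X closure_of e - e \<Longrightarrow> rel_acyclic X (\<Union>S \<union> e - {x}) (\<Union>S - {x})"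
proof -
  obtain \<Phi> where "cell X (cell_dim e) e \<Phi>" using cellI[OF e(1)] by blast
  then interpret c: cell X "cell_dim e" e \<Phi> .
  note Z = closedin_face_closed[OF S] frontier_face_closed[OF S e(1,3), folded c.fr_closure] face_closed_disjoint[OF S e(1,2)]
  show "p \<noteq> cell_dim e \<Longrightarrow> relcycle X p (\<Union>S \<union> e) (\<Union>S) c \<Longrightarrow> relboundary X p (\<Union>S \<union> e) (\<Union>S) c"
    by (rule c.attach_relboundary[OF Z])
  show "rel_generator X (cell_dim e) (X closure_of e) (X closure_of e - e) z
    \<Longrightarrow> rel_generator X (cell_dim e) (\<Union>S \<union> e) (\<Union>S) z"
    using c.attach_rel_generator[OF Z] unfolding c.cl_closure c.fr_closure .
  show "x \<in> e \<Longrightarrow> rel_acyclic X (\<Union>S \<union> e - {x}) (\<Union>S)" by (rule c.rel_acyclic_minus_e[OF Z])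
  show "x \<in> X closure_of e - e \<Longrightarrow> rel_acyclic X (\<Union>S \<union> e - {x}) (\<Union>S - {x})"
    using c.rel_acyclic_minus_fr[OF Z] unfolding c.fr_closure .
qed

lemma rel_acyclic_minus_star:
  assumes "face_closed S" "s \<in> S" "x \<in> s"
  shows "rel_acyclic X (\<Union>S - {x}) (\<Union>{e \<in> S. \<not> below s e})"
  using assms
proof (induction "card S" arbitrary: S rule: less_induct)
  case less
  have finS: "finite S" using finite_subset[OF face_closed_subset[OF less.prems(1)] finite_C] .
  have sC: "s \<in> C" using less.prems face_closed_subset by blast
  let ?star = "{e \<in> S. below s e}" and ?rest = "\<lambda>S. {e \<in> S. \<not> below s e}"
  have star_ne: "?star \<noteq> {}" using less.prems(2) below_refl[OF sC] by blast
  have "e \<in> ?star" if "d \<in> ?star" "e \<in> S" "d \<in> boundary_cells e" for d e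
    using that below_trans[of s d e] face_closed_subset[OF less.prems(1)] by (auto simp: below_def)
  then obtain e where e: "e \<in> ?star" "face_closed (S - {e})" "boundary_cells e \<subseteq> S - {e}"
    "\<And>d. d \<in> ?star \<Longrightarrow> cell_dim d \<le> cell_dim e"
    using obtain_top_cell[OF less.prems(1) _ star_ne] by blast
  have eC: "e \<in> C" "e \<in> S" using e(1) face_closed_subset[OF less.prems(1)] by blast+
  have S_eq: "\<Union>(S - {e}) \<union> e = \<Union>S" using eC by blast
  show ?case
  proof (cases "e = s")
    case True
    have "d = s" if "d \<in> S" "below s d" for d using e(4)[of d] that below_cell_dim[of s d] True by fastforce
    then have "?rest S = S - {e}" using True below_refl[OF sC] by blast
    then show ?thesis
      using rel_acyclic_attach_minus[OF e(2) eC(1) _ e(3), of x] less.prems(3) True unfolding S_eq by simp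
  next
    case False
    have "s \<in> boundary_cells e" using e(1) False by (auto simp: below_def)
    then have "x \<in> X closure_of e - e" using less.prems(3) by (auto simp: boundary_cells_def)
    then have delete_e: "rel_acyclic X (\<Union>S - {x}) (\<Union>(S - {e}) - {x})"
      using rel_acyclic_attach_minus_fr[OF e(2) eC(1) _ e(3)] unfolding S_eq by simp
    have rest: "?rest (S - {e}) = ?rest S" using e(1) by blast
    have "rel_acyclic X (\<Union>(S - {e}) - {x}) (\<Union>(?rest (S - {e})))"
      using less.hyps[OF card_Diff1_less[OF finS eC(2)] e(2)] less.prems(2,3) False by simp
    moreover have "x \<notin> \<Union>(?rest S)"
      using cell_eq[OF sC _ less.prems(3)] face_closed_subset[OF less.prems(1)] below_refl[OF sC] by blast
    then have "\<Union>(?rest S) \<subseteq> \<Union>(S - {e}) - {x}" using rest by blast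
    ultimately show ?thesis unfolding rest by (rule rel_acyclic_trans[OF delete_e]) blast
  qed
qed

end

section \<open>Exactness of incidence matrices\<close>

definition graded_functions :: "'p set \<Rightarrow> ('p \<Rightarrow> nat) \<Rightarrow> nat \<Rightarrow> ('p \<Rightarrow> 'r::zero) set" where
  "graded_functions Q rk k = {z. \<forall>a. z a \<noteq> 0 \<longrightarrow> a \<in> Q \<and> rk a = k}"

definition incidence_boundary :: "'p set \<Rightarrow> ('p \<Rightarrow> 'p \<Rightarrow> 'r) \<Rightarrow> ('p \<Rightarrow> 'r) \<Rightarrow> 'p \<Rightarrow> 'r::comm_ring_1" where
  "incidence_boundary Q eps z a = (if a \<in> Q then \<Sum>b\<in>Q. eps a b * z b else 0)"

definition exact_below :: "nat \<Rightarrow> 'p set \<Rightarrow> ('p \<Rightarrow> nat) \<Rightarrow> ('p \<Rightarrow> 'p \<Rightarrow> 'r::comm_ring_1) \<Rightarrow> bool" where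
  "exact_below D Q rk eps \<longleftrightarrow> (\<forall>k<D. \<forall>z\<in>graded_functions Q rk k. incidence_boundary Q eps z = 0 \<longrightarrow>
    (\<exists>y\<in>graded_functions Q rk (Suc k). incidence_boundary Q eps y = z))"

lemma graded_functions_I: "(\<And>a. z a \<noteq> 0 \<Longrightarrow> a \<in> Q \<and> rk a = k) \<Longrightarrow> z \<in> graded_functions Q rk k"
  by (simp add: graded_functions_def)

lemma graded_functions_D: "z \<in> graded_functions Q rk k \<Longrightarrow> z a \<noteq> 0 \<Longrightarrow> a \<in> Q \<and> rk a = k"
  by (simp add: graded_functions_def)

lemma graded_functions_add: "y \<in> graded_functions Q rk k \<Longrightarrow> z \<in> graded_functions Q rk k
  \<Longrightarrow> y + z \<in> graded_functions Q rk k"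
  and graded_functions_diff: "y' \<in> graded_functions Q rk k \<Longrightarrow> z' \<in> graded_functions Q rk k
    \<Longrightarrow> y' - z' \<in> graded_functions Q rk k"
  for y z :: "'p \<Rightarrow> 'r::monoid_add" and y' z' :: "'p \<Rightarrow> 's::group_add"
  unfolding graded_functions_def by (auto simp: plus_fun_def fun_diff_def) (metis add_0 diff_0_right)+

lemma graded_functions_mono: "A \<subseteq> Q \<Longrightarrow> graded_functions A rk k \<subseteq> graded_functions Q rk k"
  by (auto simp: graded_functions_def)

lemma incidence_boundary_0: "incidence_boundary Q eps 0 = 0"
  and incidence_boundary_add: "incidence_boundary Q eps (y + z)
    = incidence_boundary Q eps y + incidence_boundary Q eps z"
  and incidence_boundary_diff: "incidence_boundary Q eps (y - z)
    = incidence_boundary Q eps y - incidence_boundary Q eps z"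
  by (auto simp: incidence_boundary_def fun_eq_iff algebra_simps sum.distrib sum_subtractf)

lemma exact_below_I:
  assumes "\<And>k z. k < D \<Longrightarrow> z \<in> graded_functions Q rk k \<Longrightarrow> incidence_boundary Q eps z = 0 \<Longrightarrow>
    \<exists>y\<in>graded_functions Q rk (Suc k). incidence_boundary Q eps y = z"
  shows "exact_below D Q rk eps"
  using assms by (simp add: exact_below_def)

lemma exact_below_D:
  assumes "exact_below D Q rk eps" "k < D" "z \<in> graded_functions Q rk k" "incidence_boundary Q eps z = 0"
  obtains y where "y \<in> graded_functions Q rk (Suc k)" "incidence_boundary Q eps y = z"
  using assms unfolding exact_below_def by blast

lemma exact_below_mono: "exact_below D Q rk eps \<Longrightarrow> D' \<le> D \<Longrightarrow> exact_below D' Q rk eps"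
  unfolding exact_below_def by auto

lemma exact_below_shift:
  assumes exact: "exact_below D Q rk eps" and rk': "\<And>a. a \<in> Q \<Longrightarrow> rk' a = Suc (rk a)"
    and eps': "\<And>a b. a \<in> Q \<Longrightarrow> b \<in> Q \<Longrightarrow> eps' a b = eps a b"
  shows "exact_below (Suc D) Q rk' eps'"
proof (rule exact_below_I)
  have boundary: "incidence_boundary Q eps' = incidence_boundary Q eps"
    by (intro ext) (simp add: incidence_boundary_def eps')
  have graded: "graded_functions Q rk' (Suc j) = graded_functions Q rk j" for j
    using rk' by (fastforce simp: graded_functions_def)
  fix k z assume k: "k < Suc D" and z: "z \<in> graded_functions Q rk' k" "incidence_boundary Q eps' z = 0"
  show "\<exists>y\<in>graded_functions Q rk' (Suc k). incidence_boundary Q eps' y = z"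
  proof (cases k)
    case 0
    then have "z = 0" using graded_functions_D[OF z(1)] rk' by fastforce
    then show ?thesis by (intro bexI[of _ 0]) (auto simp: incidence_boundary_0 graded_functions_def)
  next
    case (Suc j)
    then show ?thesis using exact_below_D[OF exact, of j z] k z unfolding boundary graded Suc by blast
  qed
qed

lemma exact_if_contraction:
  assumes fin: "finite Q" and s: "contraction_below D Q rk eps s"
  shows "exact_below D Q rk eps"
proof (rule exact_below_I)
  fix k z assume k: "k < D" and z: "z \<in> graded_functions Q rk k" "incidence_boundary Q eps z = 0"
  define y where "y = (\<lambda>a. \<Sum>b\<in>Q. s a b * z b)"
  have "a \<in> Q \<and> rk a = Suc k" if nz: "y a \<noteq> 0" for a
  proof -
    obtain b where "s a b * z b \<noteq> 0" using nz unfolding y_def by (meson sum.neutral)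
    then have "s a b \<noteq> 0" "z b \<noteq> 0" by auto
    then show ?thesis using contraction_below_supp[OF s, of a b] graded_functions_D[OF z(1), of b] by simp
  qed
  then have "y \<in> graded_functions Q rk (Suc k)" by (rule graded_functions_I)
  moreover have "incidence_boundary Q eps y a = z a" for a
  proof (cases "a \<in> Q")
    case a: True
    have cycle: "(\<Sum>b\<in>Q. eps c b * z b) = 0" if "c \<in> Q" for c
      using fun_cong[OF z(2), of c] that by (simp add: incidence_boundary_def)
    have homotopy: "(\<Sum>c\<in>Q. eps a c * s c b) * z b = (if a = b then z b else 0) - (\<Sum>c\<in>Q. s a c * eps c b) * z b"
      if "b \<in> Q" for b
    proof (cases "z b = 0")
      case False
      then have "rk b < D" using graded_functions_D[OF z(1), of b] k by simp
      from contraction_below_eq[OF s a that this]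
      have "(\<Sum>c\<in>Q. eps a c * s c b) = (if a = b then 1 else 0) - (\<Sum>c\<in>Q. s a c * eps c b)"
        by (simp add: sum.distrib eq_diff_eq add.commute)
      then show ?thesis by (simp add: left_diff_distrib)
    qed simp
    have "incidence_boundary Q eps y a = (\<Sum>b\<in>Q. (\<Sum>c\<in>Q. eps a c * s c b) * z b)"
      unfolding incidence_boundary_def y_def sum_distrib_left sum_distrib_right
        using a by (simp, subst sum.swap) (simp add: mult.assoc)
    also have "\<dots> = z a - (\<Sum>b\<in>Q. (\<Sum>c\<in>Q. s a c * eps c b) * z b)"
      using a fin by (simp add: homotopy sum_subtractf)
    also have "(\<Sum>b\<in>Q. (\<Sum>c\<in>Q. s a c * eps c b) * z b) = (\<Sum>c\<in>Q. s a c * (\<Sum>b\<in>Q. eps c b * z b))"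
      unfolding sum_distrib_left sum_distrib_right by (subst sum.swap) (simp add: mult.assoc)
    finally show ?thesis by (simp add: cycle)
  next
    case False
    then show ?thesis using graded_functions_D[OF z(1), of a] by (auto simp: incidence_boundary_def)
  qed
  ultimately show "\<exists>y\<in>graded_functions Q rk (Suc k). incidence_boundary Q eps y = z" by blast
qed

lemma contraction_below_of_int:
  "contraction_below D Q rk eps s \<Longrightarrow> contraction_below D Q rk (\<lambda>a b. of_int (eps a b)) (\<lambda>a b. of_int (s a b) :: 'r::comm_ring_1)"
  unfolding contraction_below_def
  by (simp flip: of_int_mult of_int_add of_int_sum) (metis of_int_0)

locale incidence =
  fixes Q :: "'p set" and rk :: "'p \<Rightarrow> nat" and eps :: "'p \<Rightarrow> 'p \<Rightarrow> 'r::comm_ring_1"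
  assumes finite_Q: "finite Q" and eps_rk: "a \<in> Q \<Longrightarrow> b \<in> Q \<Longrightarrow> eps a b \<noteq> 0 \<Longrightarrow> rk b = Suc (rk a)"
    and eps_eps: "a \<in> Q \<Longrightarrow> c \<in> Q \<Longrightarrow> (\<Sum>b\<in>Q. eps a b * eps b c) = 0"
begin

lemma boundary_boundary: "incidence_boundary Q eps (incidence_boundary Q eps z) = 0"
proof
  fix a
  have "(\<Sum>b\<in>Q. eps a b * (\<Sum>c\<in>Q. eps b c * z c)) = (\<Sum>c\<in>Q. (\<Sum>b\<in>Q. eps a b * eps b c) * z c)"
    unfolding sum_distrib_left sum_distrib_right by (subst sum.swap) (simp add: mult.assoc)
  then show "incidence_boundary Q eps (incidence_boundary Q eps z) a = 0 a"
    by (simp add: incidence_boundary_def eps_eps)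
qed

lemma boundary_entry:
  assumes "z \<in> graded_functions Q rk k" "incidence_boundary Q eps z a \<noteq> 0" shows "a \<in> Q \<and> k = Suc (rk a)"
proof -
  have a: "a \<in> Q" "(\<Sum>b\<in>Q. eps a b * z b) \<noteq> 0"
    using assms(2) by (auto simp: incidence_boundary_def split: if_splits)
  then obtain b where b: "b \<in> Q" "eps a b * z b \<noteq> 0" by (meson sum.neutral)
  then have "eps a b \<noteq> 0" "z b \<noteq> 0" by auto
  then show ?thesis using eps_rk[OF a(1) b(1)] graded_functions_D[OF assms(1), of b] a(1) by auto
qed

lemma boundary_graded: "z \<in> graded_functions Q rk (Suc k) \<Longrightarrow> incidence_boundary Q eps z \<in> graded_functions Q rk k"
  using boundary_entry by (fastforce intro: graded_functions_I)

lemma boundary_degree_0: "z \<in> graded_functions Q rk 0 \<Longrightarrow> incidence_boundary Q eps z = 0"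
  using boundary_entry by fastforce

definition contraction_defect :: "('p \<Rightarrow> 'p \<Rightarrow> 'r) \<Rightarrow> 'p \<Rightarrow> 'p \<Rightarrow> 'r" where
  "contraction_defect s b = (\<lambda>a. if a \<in> Q then (if a = b then 1 else 0) - (\<Sum>c\<in>Q. s a c * eps c b) else 0)"

lemma contraction_defect_graded:
  assumes s: "contraction_below D Q rk eps s" and b: "b \<in> Q"
  shows "contraction_defect s b \<in> graded_functions Q rk (rk b)"
proof (rule graded_functions_I)
  fix a assume nz: "contraction_defect s b a \<noteq> 0"
  show "a \<in> Q \<and> rk a = rk b"
  proof (cases "a = b")
    case False
    then have "(\<Sum>c\<in>Q. s a c * eps c b) \<noteq> 0" using nz by (auto simp: contraction_defect_def split: if_splits)
    then obtain c where c: "c \<in> Q" "s a c * eps c b \<noteq> 0" by (meson sum.neutral)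
    then have "s a c \<noteq> 0" "eps c b \<noteq> 0" by auto
    then show ?thesis using contraction_below_supp[OF s, of a c] eps_rk[OF c(1) b] by simp
  qed (use b in simp)
qed

lemma contraction_defect_cycle:
  assumes s: "contraction_below (rk b) Q rk eps s" and b: "b \<in> Q"
  shows "incidence_boundary Q eps (contraction_defect s b) = 0"
proof
  fix e
  have homotopy: "(\<Sum>a\<in>Q. eps e a * s a c) * eps c b
    = (if e = c then eps c b else 0) - (\<Sum>a\<in>Q. s e a * eps a c) * eps c b"
    if e: "e \<in> Q" and c: "c \<in> Q" for c
  proof (cases "eps c b = 0")
    case False
    then have "rk c < rk b" using eps_rk[OF c b] by simp
    from contraction_below_eq[OF s e c this]
    have "(\<Sum>a\<in>Q. eps e a * s a c) = (if e = c then 1 else 0) - (\<Sum>a\<in>Q. s e a * eps a c)"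
      by (simp add: sum.distrib eq_diff_eq add.commute)
    then show ?thesis by (simp add: left_diff_distrib)
  qed simp
  have "(\<Sum>a\<in>Q. eps e a * (\<Sum>c\<in>Q. s a c * eps c b)) = eps e b" if e: "e \<in> Q"
  proof -
    have "(\<Sum>a\<in>Q. eps e a * (\<Sum>c\<in>Q. s a c * eps c b)) = (\<Sum>c\<in>Q. (\<Sum>a\<in>Q. eps e a * s a c) * eps c b)"
      unfolding sum_distrib_left sum_distrib_right by (subst sum.swap) (simp add: mult.assoc)
    also have "\<dots> = eps e b - (\<Sum>c\<in>Q. (\<Sum>a\<in>Q. s e a * eps a c) * eps c b)"
      using e finite_Q by (simp add: homotopy sum_subtractf)
    also have "(\<Sum>c\<in>Q. (\<Sum>a\<in>Q. s e a * eps a c) * eps c b) = (\<Sum>a\<in>Q. s e a * (\<Sum>c\<in>Q. eps a c * eps c b))"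
      unfolding sum_distrib_left sum_distrib_right by (subst sum.swap) (simp add: mult.assoc)
    finally show ?thesis by (simp add: eps_eps b)
  qed
  moreover have "(\<Sum>a\<in>Q. eps e a * (if a = b then 1 else 0)) = eps e b"
    using b finite_Q by (simp add: if_distrib cong: if_cong)
  ultimately show "incidence_boundary Q eps (contraction_defect s b) e = 0 e"
    by (simp add: incidence_boundary_def contraction_defect_def right_diff_distrib sum_subtractf)
qed

lemma extend_contraction:
  assumes s: "contraction_below D Q rk eps s" and exact: "exact_below (Suc D) Q rk eps"
  obtains t where "contraction_below (Suc D) Q rk eps t"
proof -
  have "\<exists>y\<in>graded_functions Q rk (Suc D). incidence_boundary Q eps y = contraction_defect s b"
    if "b \<in> Q" "rk b = D" for b
    using exact_below_D[OF exact lessI] contraction_defect_graded[OF s that(1)] contraction_defect_cycle[OF _ that(1)] s that(2) by metis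
  then obtain y where y: "y b \<in> graded_functions Q rk (Suc D)" "incidence_boundary Q eps (y b) = contraction_defect s b"
    if "b \<in> Q" "rk b = D" for b by metis
  define t where "t = (\<lambda>a b. if b \<in> Q \<and> rk b = D then y b a else s a b)"
  have t_eps: "t a c * eps c b = s a c * eps c b" if "b \<in> Q" "c \<in> Q" "rk b \<le> D" for a b c
    using eps_rk[of c b] that by (cases "eps c b = 0") (auto simp: t_def)
  have "(\<Sum>c\<in>Q. t a c * eps c b + eps a c * t c b) = (if a = b then 1 else 0)"
    if ab: "a \<in> Q" "b \<in> Q" "rk b < Suc D" for a b
  proof (cases "rk b = D")
    case True
    have "(\<Sum>c\<in>Q. t a c * eps c b + eps a c * t c b) = (\<Sum>c\<in>Q. s a c * eps c b) + incidence_boundary Q eps (y b) a"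
      using ab True by (simp add: t_eps sum.distrib incidence_boundary_def) (simp add: t_def)
    then show ?thesis using y(2)[OF ab(2) True] ab(1) by (simp add: contraction_defect_def)
  next
    case False
    then have "t c b = s c b" for c by (simp add: t_def)
    then show ?thesis using contraction_below_eq[OF s ab(1,2)] ab False by (simp add: t_eps)
  qed
  moreover have "a \<in> Q \<and> b \<in> Q \<and> rk a = Suc (rk b)" if "t a b \<noteq> 0" for a b
    using that graded_functions_D[OF y(1)[of b], of a] contraction_below_supp[OF s, of a b]
      by (auto simp: t_def split: if_splits)
  ultimately have "contraction_below (Suc D) Q rk eps t" unfolding contraction_below_def by blast
  then show ?thesis by (rule that)
qed

lemma contraction_if_exact: "exact_below D Q rk eps \<Longrightarrow> \<exists>s. contraction_below D Q rk eps s"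
proof (induction D)
  case 0
  then show ?case by (intro exI[of _ "\<lambda>_ _. 0"]) (simp add: contraction_below_def)
next
  case (Suc D)
  then show ?case using exact_below_mono[OF Suc.prems, of D] extend_contraction by (metis le_SucI order_refl)
qed

end

lemma incidence_shift:
  assumes "incidence Q rk eps" and rk': "\<And>a. a \<in> Q \<Longrightarrow> rk' a = Suc (rk a)"
    and eps': "\<And>a b. a \<in> Q \<Longrightarrow> b \<in> Q \<Longrightarrow> eps' a b = eps a b"
  shows "incidence Q rk' eps'"
proof -
  interpret incidence Q rk eps by fact
  show ?thesis by unfold_locales (use finite_Q eps_rk eps_eps rk' eps' in \<open>auto simp: eps'\<close>)
qed

lemma contraction_of_int_if_exact:
  assumes "incidence Q rk eps" "exact_below D Q rk eps"
  shows "\<exists>s. contraction_below D Q rk (\<lambda>a b. of_int (eps a b) :: 'r::comm_ring_1) s"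
  using incidence.contraction_if_exact[OF assms] contraction_below_of_int by blast

lemma exact_below_of_int:
  assumes "incidence Q rk eps" "exact_below D Q rk eps"
  shows "exact_below D Q rk (\<lambda>a b. of_int (eps a b) :: 'r::comm_ring_1)"
  using contraction_of_int_if_exact[OF assms] exact_if_contraction[OF incidence.finite_Q[OF assms(1)]]
    by metis

locale incidence_pair = incidence Q rk eps
  for Q :: "'p set" and rk and eps :: "'p \<Rightarrow> 'p \<Rightarrow> 'r::comm_ring_1" +
  fixes A :: "'p set"
  assumes A_subset: "A \<subseteq> Q" and A_closed: "a \<in> Q - A \<Longrightarrow> b \<in> A \<Longrightarrow> eps a b = 0"
begin

definition restrict_quotient :: "('p \<Rightarrow> 'r) \<Rightarrow> 'p \<Rightarrow> 'r" where
  "restrict_quotient z = (\<lambda>a. if a \<in> Q - A then z a else 0)"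

lemma boundary_sub: "z \<in> graded_functions A rk k \<Longrightarrow> incidence_boundary Q eps z = incidence_boundary A eps z"
proof
  fix a assume z: "z \<in> graded_functions A rk k"
  have "z b = 0" if "b \<notin> A" for b using graded_functions_D[OF z, of b] that by blast
  then have "(\<Sum>b\<in>Q. eps a b * z b) = (\<Sum>b\<in>A. eps a b * z b)"
    using A_subset finite_Q by (intro sum.mono_neutral_right) auto
  moreover have "(\<Sum>b\<in>A. eps a b * z b) = 0" if "a \<in> Q - A" using A_closed[OF that] by simp
  ultimately show "incidence_boundary Q eps z a = incidence_boundary A eps z a"
    using A_subset by (auto simp: incidence_boundary_def)
qed

lemma boundary_quotient: "incidence_boundary (Q - A) eps (restrict_quotient z)
  = restrict_quotient (incidence_boundary Q eps z)"
proof
  fix a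
  have "(\<Sum>b\<in>Q - A. eps a b * z b) = (\<Sum>b\<in>Q. eps a b * z b)" if "a \<in> Q - A"
    using A_closed[OF that] finite_Q by (intro sum.mono_neutral_left) auto
  then show "incidence_boundary (Q - A) eps (restrict_quotient z) a = restrict_quotient (incidence_boundary Q eps z) a"
    by (simp add: incidence_boundary_def restrict_quotient_def)
qed

lemma restrict_quotient_graded: "z \<in> graded_functions Q rk k \<Longrightarrow> restrict_quotient z \<in> graded_functions (Q - A) rk k"
  by (auto simp: graded_functions_def restrict_quotient_def)

lemma restrict_quotient_id: "z \<in> graded_functions (Q - A) rk k \<Longrightarrow> restrict_quotient z = z"
  using graded_functions_D by (fastforce simp: restrict_quotient_def)

lemma restrict_quotient_eq_0:
  "restrict_quotient z = 0 \<Longrightarrow> z \<in> graded_functions Q rk k \<Longrightarrow> z \<in> graded_functions A rk k"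
  by (auto simp: graded_functions_def restrict_quotient_def fun_eq_iff split: if_splits)

lemma exact_extension:
  assumes exact_A: "exact_below D A rk eps" and quotient: "exact_below D (Q - A) rk eps"
  shows "exact_below D Q rk eps"
proof (rule exact_below_I)
  let ?d = "incidence_boundary Q eps"
  fix k z assume k: "k < D" and z: "z \<in> graded_functions Q rk k" "?d z = 0"
  have "incidence_boundary (Q - A) eps (restrict_quotient z) = 0"
    unfolding boundary_quotient z(2) by (auto simp: restrict_quotient_def)
  then obtain y where y: "y \<in> graded_functions (Q - A) rk (Suc k)"
    "incidence_boundary (Q - A) eps y = restrict_quotient z"
    by (rule exact_below_D[OF quotient k restrict_quotient_graded[OF z(1)]])
  have yQ: "y \<in> graded_functions Q rk (Suc k)" using y(1) graded_functions_mono[of "Q - A" Q] by blast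
  define w where "w = z - ?d y"
  have "restrict_quotient (?d y) = restrict_quotient z"
    using boundary_quotient[of y] restrict_quotient_id[OF y(1)] y(2) by simp
  then have "restrict_quotient w = 0" by (auto simp: w_def restrict_quotient_def fun_eq_iff split: if_splits)
  moreover have "w \<in> graded_functions Q rk k"
    unfolding w_def by (rule graded_functions_diff[OF z(1) boundary_graded[OF yQ]])
  ultimately have w: "w \<in> graded_functions A rk k" by (rule restrict_quotient_eq_0)
  have "?d w = 0" unfolding w_def incidence_boundary_diff z(2) boundary_boundary by simp
  then obtain v where v: "v \<in> graded_functions A rk (Suc k)" "incidence_boundary A eps v = w"
    using exact_below_D[OF exact_A k w] unfolding boundary_sub[OF w] by blast
  have "?d (y + v) = z" unfolding incidence_boundary_add boundary_sub[OF v(1)] v(2) w_def by simp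
  moreover have "v \<in> graded_functions Q rk (Suc k)" using v(1) graded_functions_mono[OF A_subset] by blast
  ultimately show "\<exists>y\<in>graded_functions Q rk (Suc k). ?d y = z"
    using graded_functions_add[OF yQ] by blast
qed

lemma exact_quotient:
  assumes total: "exact_below D Q rk eps" and exact_A: "exact_below (D - 1) A rk eps"
  shows "exact_below D (Q - A) rk eps"
proof (rule exact_below_I)
  let ?d = "incidence_boundary Q eps"
  fix k z assume k: "k < D" and z: "z \<in> graded_functions (Q - A) rk k" "incidence_boundary (Q - A) eps z = 0"
  have zQ: "z \<in> graded_functions Q rk k" using z(1) graded_functions_mono[of "Q - A" Q] by blast
  have dz: "restrict_quotient (?d z) = 0"
    using boundary_quotient[of z] restrict_quotient_id[OF z(1)] z(2) by simp
  have "\<exists>w\<in>graded_functions A rk k. incidence_boundary A eps w = ?d z"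
  proof (cases k)
    case 0
    then have "?d z = 0" using zQ boundary_degree_0 by simp
    then show ?thesis by (intro bexI[of _ 0]) (auto simp: graded_functions_def incidence_boundary_0)
  next
    case (Suc j)
    then have dzA: "?d z \<in> graded_functions A rk j"
      using restrict_quotient_eq_0[OF dz boundary_graded] zQ by simp
    have "incidence_boundary A eps (?d z) = 0" using boundary_sub[OF dzA] boundary_boundary[of z] by simp
    moreover have "j < D - 1" using k Suc by simp
    ultimately show ?thesis using exact_below_D[OF exact_A _ dzA] Suc by metis
  qed
  then obtain w where w: "w \<in> graded_functions A rk k" "incidence_boundary A eps w = ?d z" by blast
  have "z - w \<in> graded_functions Q rk k"
    using graded_functions_diff[OF zQ] w(1) graded_functions_mono[OF A_subset] by blast
  moreover have "?d (z - w) = 0" unfolding incidence_boundary_diff boundary_sub[OF w(1)] w(2) by simp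
  ultimately obtain y where y: "y \<in> graded_functions Q rk (Suc k)" "?d y = z - w"
    by (rule exact_below_D[OF total k])
  have "restrict_quotient (z - w) = z"
    using graded_functions_D[OF z(1)] graded_functions_D[OF w(1)]
      by (force simp: restrict_quotient_def fun_eq_iff)
  then show "\<exists>y\<in>graded_functions (Q - A) rk (Suc k). incidence_boundary (Q - A) eps y = z"
    using boundary_quotient[of y] y(2) restrict_quotient_graded[OF y(1)] by metis
qed

end

section \<open>Cellular chains\<close>

lemma frag_cmul_diff_distrib2: "frag_cmul n (a - b) = frag_cmul n a - frag_cmul n b"
  using frag_cmul_distrib2[of n "a - b" b] by simp

context regular_CW
begin

definition cell_gen :: "'a set \<Rightarrow> 'a chain" where
  "cell_gen e = (SOME z. rel_generator X (cell_dim e) (X closure_of e) (X closure_of e - e) z)"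

definition cell_chain :: "'a set set \<Rightarrow> ('a set \<Rightarrow> int) \<Rightarrow> 'a chain" where
  "cell_chain K m = (\<Sum>e\<in>K. frag_cmul (m e) (cell_gen e))"

lemma rel_generator_cell_gen: "e \<in> C \<Longrightarrow> rel_generator X (cell_dim e) (X closure_of e) (X closure_of e - e) (cell_gen e)"
proof -
  assume "e \<in> C"
  then obtain \<Phi> where "cell X (cell_dim e) e \<Phi>" using cellI by blast
  then interpret c: cell X "cell_dim e" e \<Phi> .
  show ?thesis
    unfolding cell_gen_def using c.rel_generator_cl unfolding c.cl_closure c.fr_closure by (rule someI_ex)
qed

lemma relcycle_cell_gen: "e \<in> C \<Longrightarrow> relcycle X (cell_dim e) (X closure_of e) (\<Union>(boundary_cells e)) (cell_gen e)"
  using rel_generator_cell_gen[of e] Union_boundary_cells[of e] by (simp add: rel_generator_def)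

lemma chain_in_cell_gen: "face_closed S \<Longrightarrow> e \<in> S \<Longrightarrow> chain_in X (cell_dim e) (\<Union>S) (cell_gen e)"
proof -
  assume S: "face_closed S" "e \<in> S"
  then have "chain_in X (cell_dim e) (X closure_of e) (cell_gen e)"
    using relcycle_cell_gen[of e] face_closed_subset by (auto simp: relcycle_def)
  moreover have "X closure_of e \<subseteq> \<Union>S" using S Union_face_closed[OF S(1)] by auto
  ultimately show ?thesis by (rule singular_chain_mono)
qed

lemma chain_in_cell_chain: "face_closed S \<Longrightarrow> (\<And>e. e \<in> K \<Longrightarrow> m e \<noteq> 0 \<Longrightarrow> e \<in> S \<and> cell_dim e = k)
  \<Longrightarrow> chain_in X k (\<Union>S) (cell_chain K m)"
proof -
  assume S: "face_closed S" and K: "\<And>e. e \<in> K \<Longrightarrow> m e \<noteq> 0 \<Longrightarrow> e \<in> S \<and> cell_dim e = k"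
  have "chain_in X k (\<Union>S) (frag_cmul (m e) (cell_gen e))" if "e \<in> K" for e
  proof (cases "m e = 0")
    case False
    then show ?thesis
      using chain_in_cell_gen[OF S, of e] K[OF that False] by (auto intro: singular_chain_cmul)
  qed simp
  then show ?thesis unfolding cell_chain_def by (rule singular_chain_sum)
qed

lemma cell_chain_insert: "finite K \<Longrightarrow> e \<notin> K \<Longrightarrow> cell_chain (insert e K) m = frag_cmul (m e) (cell_gen e) + cell_chain K m"
  by (simp add: cell_chain_def)

lemma cell_chain_cong: "(\<And>e. e \<in> K \<Longrightarrow> m e = m' e) \<Longrightarrow> cell_chain K m = cell_chain K m'"
  unfolding cell_chain_def by (rule sum.cong) simp_all

definition attachable :: "'a set set \<Rightarrow> nat \<Rightarrow> 'a set set" where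
  "attachable Z k = {e \<in> C. cell_dim e = k \<and> boundary_cells e \<subseteq> Z \<and> e \<notin> Z}"

lemma face_closed_attach: "face_closed Z \<Longrightarrow> T \<subseteq> attachable Z k \<Longrightarrow> face_closed (Z \<union> T)"
  by (fastforce simp: face_closed_def attachable_def)

lemma attach_next:
  assumes Z: "face_closed Z" and T: "insert t T \<subseteq> attachable Z k" "t \<notin> T"
  shows "rel_generator X k (\<Union>(Z \<union> T) \<union> t) (\<Union>(Z \<union> T)) (cell_gen t)" "relcycle X k (\<Union>(Z \<union> T) \<union> t) (\<Union>Z) (cell_gen t)"
    "\<And>p c. p \<noteq> k \<Longrightarrow> relcycle X p (\<Union>(Z \<union> T) \<union> t) (\<Union>(Z \<union> T)) c \<Longrightarrow> relboundary X p (\<Union>(Z \<union> T) \<union> t) (\<Union>(Z \<union> T)) c"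
proof -
  have S: "face_closed (Z \<union> T)" using face_closed_attach[OF Z] T by blast
  have t: "t \<in> C" "cell_dim t = k" "boundary_cells t \<subseteq> Z" "t \<notin> Z \<union> T" "boundary_cells t \<subseteq> Z \<union> T"
    using T by (auto simp: attachable_def)
  show "rel_generator X k (\<Union>(Z \<union> T) \<union> t) (\<Union>(Z \<union> T)) (cell_gen t)"
    using attach_rel_generator[OF S t(1,4,5) rel_generator_cell_gen[OF t(1)]] t(2) by simp
  show "relcycle X k (\<Union>(Z \<union> T) \<union> t) (\<Union>Z) (cell_gen t)"
    using relcycle_cell_gen[OF t(1)]
      unfolding t(2) by (rule relcycle_mono) (use closure_un[OF t(1)] t(3) in auto)
  show "relboundary X p (\<Union>(Z \<union> T) \<union> t) (\<Union>(Z \<union> T)) c" if "p \<noteq> k" "relcycle X p (\<Union>(Z \<union> T) \<union> t) (\<Union>(Z \<union> T)) c"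
    for p c
    using attach_relboundary[OF S t(1,4,5)] that t(2) by simp
qed

lemma attached_cells_generate:
  assumes Z: "face_closed Z" and "finite T" "T \<subseteq> attachable Z k" "relcycle X k (\<Union>(Z \<union> T)) (\<Union>Z) c"
  shows "\<exists>m. relboundary X k (\<Union>(Z \<union> T)) (\<Union>Z) (c - cell_chain T m)"
  using assms(2-4)
proof (induction T arbitrary: c rule: finite_induct)
  case empty
  then show ?case by (auto simp: relcycle_def cell_chain_def intro: relboundary_chain_in)
next
  case (insert t T)
  let ?S = "\<Union>(Z \<union> T)"
  note t = attach_next[OF Z insert.prems(1) insert.hyps(2)]
  have attach_t: "\<Union>(Z \<union> insert t T) = ?S \<union> t" by auto
  note c = insert.prems(2)[unfolded attach_t]
  have "relcycle X k (?S \<union> t) ?S c" by (rule relcycle_mono[OF c]) auto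
  then obtain n where n: "relboundary X k (?S \<union> t) ?S (c - frag_cmul n (cell_gen t))"
    using t(1) unfolding rel_generator_def by blast
  obtain e where e: "relcycle X k ?S (\<Union>Z) e" "relboundary X k (?S \<union> t) (\<Union>Z) (c - frag_cmul n (cell_gen t) - e)"
    using relcycle_reduce[OF relcycle_diff[OF c relcycle_cmul[OF t(2)]] n] .
  obtain m where "relboundary X k ?S (\<Union>Z) (e - cell_chain T m)"
    using insert.IH[OF _ e(1)] insert.prems(1) by blast
  from relboundary_add[OF e(2) relboundary_mono[OF this Un_upper1 subset_refl]]
  have "relboundary X k (?S \<union> t) (\<Union>Z) (c - frag_cmul n (cell_gen t) - cell_chain T m)"
    by (simp add: add_diff_eq)
  moreover have "cell_chain T (m(t := n)) = cell_chain T m" using insert.hyps by (intro cell_chain_cong) auto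
  ultimately have "relboundary X k (?S \<union> t) (\<Union>Z) (c - cell_chain (insert t T) (m(t := n)))"
    unfolding cell_chain_insert[OF insert.hyps] by (simp add: diff_diff_eq)
  then show ?case unfolding attach_t by blast
qed

lemma attached_cells_independent:
  assumes Z: "face_closed Z"
    and "finite T" "T \<subseteq> attachable Z k" "relboundary X k (\<Union>(Z \<union> T)) (\<Union>Z) (cell_chain T m)"
  shows "\<forall>e\<in>T. m e = 0"
  using assms(2-4)
proof (induction T rule: finite_induct)
  case (insert t T)
  let ?S = "\<Union>(Z \<union> T)"
  note t = attach_next[OF Z insert.prems(1) insert.hyps(2)]
  have attach_t: "\<Union>(Z \<union> insert t T) = ?S \<union> t" by auto
  note bound = insert.prems(2)[unfolded attach_t]
  have "face_closed (Z \<union> T)" using face_closed_attach[OF Z] insert.prems(1) by blast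
  then have zT: "chain_in X k ?S (cell_chain T m)"
    by (rule chain_in_cell_chain) (use insert.prems(1) in \<open>auto simp: attachable_def\<close>)
  have "relboundary X k (?S \<union> t) ?S (cell_chain (insert t T) m)" by (rule relboundary_mono[OF bound]) auto
  from relboundary_diff[OF this relboundary_chain_in[OF zT]]
  have "relboundary X k (?S \<union> t) ?S (frag_cmul (m t) (cell_gen t))"
    unfolding cell_chain_insert[OF insert.hyps] by simp
  then have mt: "m t = 0" using t(1) unfolding rel_generator_def by blast
  then have "relboundary X k (?S \<union> t) (\<Union>Z) (cell_chain T m)"
    using bound unfolding cell_chain_insert[OF insert.hyps] by simp
  then have "relboundary X k ?S (\<Union>Z) (cell_chain T m)"
    by (rule relboundary_restrict[OF t(3) _ zT, rotated 3]) auto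
  then show ?case using insert.IH insert.prems(1) mt by blast
qed simp

lemma relboundary_if_no_cells:
  assumes "face_closed Y" "face_closed Z" "Z \<subseteq> Y" "\<And>e. e \<in> Y \<Longrightarrow> e \<notin> Z \<Longrightarrow> cell_dim e \<noteq> p" "relcycle X p (\<Union>Y) (\<Union>Z) c"
  shows "relboundary X p (\<Union>Y) (\<Union>Z) c"
  using assms
proof (induction "card (Y - Z)" arbitrary: Y c rule: less_induct)
  case less
  have finY: "finite Y" using finite_subset[OF face_closed_subset[OF less.prems(1)] finite_C] .
  show ?case
  proof (cases "Y = Z")
    case True
    then show ?thesis using less.prems(5) by (auto simp: relcycle_def intro: relboundary_chain_in)
  next
    case False
    then have "Y - Z \<noteq> {}" using less.prems(3) by auto
    moreover have "e \<in> Y - Z" if "d \<in> Y - Z" "e \<in> Y" "d \<in> boundary_cells e" for d e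
      using that less.prems(2) by (auto simp: face_closed_def)
    ultimately obtain e where e: "e \<in> Y - Z" "face_closed (Y - {e})" "boundary_cells e \<subseteq> Y - {e}"
      using obtain_top_cell[OF less.prems(1) Diff_subset] by metis
    have eC: "e \<in> C" using e face_closed_subset[OF less.prems(1)] by auto
    have rel_acyclic_attach_minus: "\<Union>(Y - {e}) \<union> e = \<Union>Y" using e by auto
    have Z: "\<Union>Z \<subseteq> \<Union>(Y - {e})" "Z \<subseteq> Y - {e}" using e less.prems(3) by auto
    show ?thesis
    proof (rule relboundary_lift[OF _ _ less.prems(5)])
      fix e' assume e': "relcycle X p (\<Union>(Y - {e})) (\<Union>Z) e'"
      show "relboundary X p (\<Union>(Y - {e})) (\<Union>Z) e'"
      proof (rule less.hyps[OF _ e(2) less.prems(2) Z(2) _ e'])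
        show "card (Y - {e} - Z) < card (Y - Z)" using e finY by (intro psubset_card_mono) auto
      qed (use less.prems(4) in auto)
    next
      have "relcycle X p (\<Union>Y) (\<Union>(Y - {e})) c" by (rule relcycle_mono[OF less.prems(5) subset_refl Z(1)])
      then show "relboundary X p (\<Union>Y) (\<Union>(Y - {e})) c"
        using attach_relboundary[OF e(2) eC _ e(3), of p c] less.prems(4)[of e] e(1)
          unfolding rel_acyclic_attach_minus by auto
    qed auto
  qed
qed

definition cells_of_dim :: "nat \<Rightarrow> 'a set set" where "cells_of_dim k = {e \<in> C. cell_dim e = k}"

definition inc :: "'a set \<Rightarrow> 'a set \<Rightarrow> int" where
  "inc d e = (if e \<in> C \<and> d \<in> boundary_cells e \<and> cell_dim e = Suc (cell_dim d)
      then (SOME m. relboundary X (cell_dim d) (\<Union>(boundary_cells e)) (\<Union>{c \<in> boundary_cells e. cell_dim c < cell_dim d})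
        (chain_boundary (cell_dim e) (cell_gen e) - cell_chain {c \<in> boundary_cells e. cell_dim c = cell_dim d} m)) d else 0)"

lemma inc_nz: "inc d e \<noteq> 0 \<Longrightarrow> d \<in> C \<and> e \<in> C \<and> d \<in> boundary_cells e \<and> cell_dim e = Suc (cell_dim d)"
  using boundary_cells_subset by (auto simp: inc_def split: if_splits)

lemma cell_chain_cells_of_dim:
  assumes "K \<subseteq> cells_of_dim k" "\<And>d. d \<in> cells_of_dim k \<Longrightarrow> d \<notin> K \<Longrightarrow> m d = 0"
  shows "cell_chain (cells_of_dim k) m = cell_chain K m"
  unfolding cell_chain_def
    using assms finite_C by (intro sum.mono_neutral_right) (auto simp: cells_of_dim_def)

lemma boundary_cell_gen:
  assumes e: "e \<in> C" "cell_dim e = Suc j"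
  shows "relboundary X j (\<Union>(boundary_cells e)) (\<Union>{c \<in> boundary_cells e. cell_dim c < j}) (chain_boundary (Suc j) (cell_gen e) - cell_chain (cells_of_dim j) (\<lambda>d. inc d e))"
proof -
  let ?Z = "{c \<in> boundary_cells e. cell_dim c < j}" and ?T = "{c \<in> boundary_cells e. cell_dim c = j}"
  have un: "?Z \<union> ?T = boundary_cells e" using boundary_cells_cell_dim[OF e(1)] e(2) by fastforce
  have boundary: "d \<in> C \<and> boundary_cells d \<subseteq> boundary_cells e
    \<and> (\<forall>c\<in>boundary_cells d. cell_dim c < cell_dim d)" if "d \<in> boundary_cells e" for d
    using that boundary_cells_subset[of e] boundary_cells_trans[OF e(1) that] boundary_cells_cell_dim[of d]
      by blast
  have Z: "face_closed ?Z" unfolding face_closed_def using boundary by fastforce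
  have T: "?T \<subseteq> attachable ?Z j" using boundary by (auto simp: attachable_def)
  have finT: "finite ?T" using finite_boundary_cells by simp
  have "chain_in X (Suc j) (X closure_of e) (cell_gen e)"
    "chain_in X j (\<Union>(boundary_cells e)) (chain_boundary (Suc j) (cell_gen e))"
    using relcycle_cell_gen[OF e(1)] e(2) by (auto simp: relcycle_def)
  then have "relcycle X j (\<Union>(boundary_cells e)) (\<Union>?Z) (chain_boundary (Suc j) (cell_gen e))"
    using chain_boundary_boundary_alt[of j _ "cell_gen e"] by (simp add: relcycle_def)
  then have ex: "\<exists>m. relboundary X j (\<Union>(boundary_cells e)) (\<Union>?Z) (chain_boundary (Suc j) (cell_gen e)
    - cell_chain ?T m)"
    using attached_cells_generate[OF Z finT T, unfolded un] by simp
  have "cell_chain (cells_of_dim j) (\<lambda>d. inc d e) = cell_chain ?T (\<lambda>d. inc d e)"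
    by (rule cell_chain_cells_of_dim) (use inc_nz boundary_cells_subset in \<open>auto simp: cells_of_dim_def\<close>)
  also have "\<dots> = cell_chain ?T (SOME m. relboundary X j (\<Union>(boundary_cells e)) (\<Union>?Z) (chain_boundary (Suc j) (cell_gen e) - cell_chain ?T m))"
    by (rule cell_chain_cong) (auto simp: inc_def e)
  finally show ?thesis using someI_ex[OF ex] by simp
qed

definition skeleton :: "'a set set \<Rightarrow> 'a set set \<Rightarrow> nat \<Rightarrow> 'a set set" where
  "skeleton Y L k = L \<union> {e \<in> Y. cell_dim e < k}"

definition top_cells :: "'a set set \<Rightarrow> 'a set set \<Rightarrow> nat \<Rightarrow> 'a set set" where
  "top_cells Y L k = {e \<in> Y - L. cell_dim e = k}"

context
  fixes Y L
  assumes Y: "face_closed Y" and L: "face_closed L" and LY: "L \<subseteq> Y"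
begin

lemma face_closed_skeleton: "face_closed (skeleton Y L k)"
  unfolding face_closed_def
proof (intro conjI ballI subsetI)
  fix d assume "d \<in> skeleton Y L k" then show "d \<in> C" using face_closed_subset[OF Y] face_closed_subset[OF L] by (auto simp: skeleton_def)
next
  fix d c assume dc: "d \<in> skeleton Y L k" "c \<in> boundary_cells d"
  show "c \<in> skeleton Y L k"
  proof (cases "d \<in> L")
    case True then show ?thesis using dc L by (auto simp: face_closed_def skeleton_def)
  next
    case False
    then have d: "d \<in> Y" "cell_dim d < k" using dc by (auto simp: skeleton_def)
    then have "d \<in> C" using face_closed_subset[OF Y] by auto
    then have "cell_dim c < k" using boundary_cells_cell_dim[of d c] dc d by auto
    then show ?thesis using d dc Y by (auto simp: face_closed_def skeleton_def)
  qed
qed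

lemma skeleton_top: "skeleton Y L k \<union> top_cells Y L k = skeleton Y L (Suc k)"
  by (auto simp: skeleton_def top_cells_def)

lemma skeleton_mono: "j \<le> k \<Longrightarrow> \<Union>(skeleton Y L j) \<subseteq> \<Union>(skeleton Y L k)" "\<Union>L \<subseteq> \<Union>(skeleton Y L k)" "\<Union>(skeleton Y L k) \<subseteq> \<Union>Y"
  using LY by (fastforce simp: skeleton_def)+

lemma skeleton_cells:
  "relcycle X k (\<Union>(skeleton Y L (Suc k))) (\<Union>(skeleton Y L k)) c \<Longrightarrow>
      \<exists>m. relboundary X k (\<Union>(skeleton Y L (Suc k))) (\<Union>(skeleton Y L k)) (c - cell_chain (top_cells Y L k) m)"
  "relboundary X k (\<Union>(skeleton Y L (Suc k))) (\<Union>(skeleton Y L k)) (cell_chain (top_cells Y L k) m) \<Longrightarrow> e \<in> top_cells Y L k \<Longrightarrow> m e = 0"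
proof -
  have fin: "finite (top_cells Y L k)"
    using finite_subset[OF face_closed_subset[OF Y] finite_C] by (simp add: top_cells_def)
  have "boundary_cells e \<subseteq> skeleton Y L k" if e: "e \<in> top_cells Y L k" for e
    using e Y boundary_cells_cell_dim[of e] face_closed_subset[OF Y]
      by (auto simp: top_cells_def skeleton_def face_closed_def)
  then have "top_cells Y L k \<subseteq> attachable (skeleton Y L k) k"
    using face_closed_subset[OF Y] by (auto simp: attachable_def top_cells_def skeleton_def)
  note attached = attached_cells_generate[OF face_closed_skeleton fin this, unfolded skeleton_top] attached_cells_independent[OF face_closed_skeleton fin this, unfolded skeleton_top]
  show "relcycle X k (\<Union>(skeleton Y L (Suc k))) (\<Union>(skeleton Y L k)) c \<Longrightarrow>
      \<exists>m. relboundary X k (\<Union>(skeleton Y L (Suc k))) (\<Union>(skeleton Y L k)) (c - cell_chain (top_cells Y L k) m)"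
    using attached by blast
  show "relboundary X k (\<Union>(skeleton Y L (Suc k))) (\<Union>(skeleton Y L k)) (cell_chain (top_cells Y L k) m)
    \<Longrightarrow> e \<in> top_cells Y L k \<Longrightarrow> m e = 0"
    using attached by blast
qed

lemma boundary_cell_skeleton:
  assumes e: "e \<in> Y" "cell_dim e = Suc j"
  shows "relboundary X j (\<Union>(skeleton Y L (Suc j))) (\<Union>(skeleton Y L j)) (chain_boundary (Suc j) (cell_gen e)
    - cell_chain (cells_of_dim j) (\<lambda>d. inc d e))"
proof -
  have eC: "e \<in> C" using e face_closed_subset[OF Y] by auto
  have "boundary_cells e \<subseteq> Y" using Y e by (auto simp: face_closed_def)
  then show ?thesis
    by (intro relboundary_mono[OF boundary_cell_gen[OF eC e(2)]] Union_mono)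
      (use boundary_cells_cell_dim[OF eC] e(2) in \<open>auto simp: skeleton_def\<close>)
qed

lemma cell_chain_mod_skeleton:
  assumes m: "\<And>d. m d \<noteq> 0 \<Longrightarrow> d \<in> Y"
  shows "relboundary X k (\<Union>(skeleton Y L (Suc k))) (\<Union>(skeleton Y L k)) (cell_chain (cells_of_dim k) m
    - cell_chain (top_cells Y L k) m)"
proof -
  have "cell_chain (cells_of_dim k) m = cell_chain (cells_of_dim k \<inter> Y) m"
    by (rule cell_chain_cells_of_dim) (use m in auto)
  also have "cells_of_dim k \<inter> Y = top_cells Y L k \<union> (cells_of_dim k \<inter> L)"
    using LY face_closed_subset[OF Y] by (auto simp: cells_of_dim_def top_cells_def)
  also have "cell_chain \<dots> m = cell_chain (top_cells Y L k) m + cell_chain (cells_of_dim k \<inter> L) m"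
    unfolding cell_chain_def using finite_subset[OF face_closed_subset[OF Y] finite_C] finite_C
    by (intro sum.union_disjoint) (auto simp: top_cells_def cells_of_dim_def)
  finally have eq: "cell_chain (cells_of_dim k) m - cell_chain (top_cells Y L k) m
    = cell_chain (cells_of_dim k \<inter> L) m" by simp
  have "chain_in X k (\<Union>(skeleton Y L k)) (cell_chain (cells_of_dim k \<inter> L) m)"
    by (rule chain_in_cell_chain[OF face_closed_skeleton]) (auto simp: cells_of_dim_def skeleton_def)
  then show ?thesis unfolding eq by (rule relboundary_chain_in)
qed

lemma boundary_cell_chain:
  assumes K: "\<And>e. e \<in> K \<Longrightarrow> e \<in> Y \<and> cell_dim e = Suc j"
  shows "relboundary X j (\<Union>(skeleton Y L (Suc j))) (\<Union>(skeleton Y L j))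
    (chain_boundary (Suc j) (cell_chain K n) - cell_chain (cells_of_dim j) (\<lambda>d. \<Sum>e\<in>K. inc d e * n e))"
proof -
  have scale: "frag_cmul (sum g K) z = (\<Sum>e\<in>K. frag_cmul (g e) z)" for g :: "'a set \<Rightarrow> int" and z :: "'a chain"
    by (induction K rule: infinite_finite_induct) (auto simp: frag_cmul_distrib)
  have "cell_chain (cells_of_dim j) (\<lambda>d. \<Sum>e\<in>K. inc d e * n e)
    = (\<Sum>e\<in>K. frag_cmul (n e) (cell_chain (cells_of_dim j) (\<lambda>d. inc d e)))"
    unfolding cell_chain_def frag_cmul_sum scale by (subst sum.swap) (simp add: mult.commute)
  then have "chain_boundary (Suc j) (cell_chain K n) - cell_chain (cells_of_dim j) (\<lambda>d. \<Sum>e\<in>K. inc d e * n e) =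
    (\<Sum>e\<in>K. frag_cmul (n e) (chain_boundary (Suc j) (cell_gen e) - cell_chain (cells_of_dim j) (\<lambda>d. inc d e)))"
    unfolding cell_chain_def[of K] chain_boundary_sum chain_boundary_cmul
    by (simp add: sum_subtractf[symmetric] frag_cmul_diff_distrib2 chain_boundary_cmul)
  then show ?thesis using K by (auto intro!: relboundary_sum relboundary_cmul boundary_cell_skeleton)
qed

lemma boundary_top_cells:
  "relboundary X j (\<Union>(skeleton Y L (Suc j))) (\<Union>(skeleton Y L j))
    (chain_boundary (Suc j) (cell_chain (top_cells Y L (Suc j)) n) - cell_chain (top_cells Y L j) (\<lambda>d. \<Sum>e\<in>top_cells Y L (Suc j). inc d e * n e))"
proof -
  let ?T = "top_cells Y L (Suc j)"
  let ?m = "\<lambda>d. \<Sum>e\<in>?T. inc d e * n e"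
  have "d \<in> Y" if nz: "?m d \<noteq> 0" for d
  proof -
    obtain e where "e \<in> ?T" "inc d e * n e \<noteq> 0" using nz by (meson sum.neutral)
    then show ?thesis using inc_nz[of d e] Y by (auto simp: face_closed_def top_cells_def)
  qed
  from relboundary_add[OF boundary_cell_chain[where K="?T" and j=j and n=n] cell_chain_mod_skeleton[where m="?m", OF this]]
  show ?thesis by (auto simp: top_cells_def add_diff_eq)
qed

lemma sum_top_cells:
  assumes "\<And>b. b \<in> Y - L \<Longrightarrow> cell_dim b \<noteq> k \<Longrightarrow> f b = 0"
  shows "(\<Sum>b\<in>Y-L. f b) = (\<Sum>b\<in>top_cells Y L k. f b)"
  using assms finite_subset[OF face_closed_subset[OF Y] finite_C]
    by (intro sum.mono_neutral_right) (auto simp: top_cells_def)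

lemma inc_inc:
  assumes a: "a \<in> Y - L" and c: "c \<in> Y - L"
  shows "(\<Sum>b\<in>Y-L. inc a b * inc b c) = 0"
proof (cases "cell_dim c = Suc (Suc (cell_dim a))")
  case False
  have "inc a b * inc b c = 0" for b using inc_nz[of a b] inc_nz[of b c] False
    by (cases "inc a b = 0"; cases "inc b c = 0") auto
  then show ?thesis by (intro sum.neutral ballI)
next
  case True
  define j where "j = cell_dim a"
  let ?A = "\<lambda>k. \<Union>(skeleton Y L k)" and ?T = "top_cells Y L"
  let ?m = "\<lambda>d. \<Sum>e\<in>?T (Suc j). inc d e * inc e c"
  have finT: "finite (?T k)" for k
    using finite_subset[OF face_closed_subset[OF Y] finite_C] by (simp add: top_cells_def)
  have cT: "c \<in> ?T (Suc (Suc j))" using c True by (simp add: top_cells_def j_def)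
  have cell_gen_chain: "cell_chain (?T (Suc (Suc j))) (\<lambda>e. if e = c then 1 else 0) = cell_gen c"
    using finT cT by (simp add: cell_chain_def if_distrib[of "\<lambda>k. frag_cmul k _"] cong: if_cong)
  have inc_c: "(\<Sum>e\<in>?T (Suc (Suc j)). inc d e * (if e = c then 1 else 0)) = inc d c" for d
    using finT cT by (simp add: if_distrib cong: if_cong)
  obtain w w' where w: "chain_in X (Suc (Suc j)) (?A (Suc (Suc j))) w" "chain_in X (Suc j) (?A (Suc j)) w'"
    "chain_boundary (Suc j) (chain_boundary (Suc (Suc j)) (cell_gen c) - cell_chain (?T (Suc j)) (\<lambda>d. inc d c)) = chain_boundary (Suc j) w'"
    using relboundaryE[OF boundary_top_cells[where j="Suc j" and n="\<lambda>e. if e = c then 1 else 0"]]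
      unfolding cell_gen_chain inc_c by metis
  have "chain_in X (Suc (Suc j)) (X closure_of c) (cell_gen c)"
    using relcycle_cell_gen[of c] c face_closed_subset[OF Y] True by (auto simp: relcycle_def j_def)
  from w(3)[unfolded chain_boundary_diff chain_boundary_boundary_alt[OF this]]
  have "chain_boundary (Suc j) (cell_chain (?T (Suc j)) (\<lambda>d. inc d c)) = chain_boundary (Suc j) (- w')"
    unfolding chain_boundary_minus by (simp add: minus_equation_iff)
  then have "relboundary X j (?A (Suc j)) (?A j) (chain_boundary (Suc j) (cell_chain (?T (Suc j)) (\<lambda>d. inc d c)))"
    using relboundary_boundary singular_chain_cmul[OF w(2), of "-1"] by simp
  from relboundary_diff[OF this boundary_top_cells[where n="\<lambda>e. inc e c"]]
  have "relboundary X j (?A (Suc j)) (?A j) (cell_chain (?T j) ?m)" by simp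
  then have "?m a = 0" by (rule skeleton_cells(2)) (use a in \<open>simp add: top_cells_def j_def\<close>)
  moreover have "(\<Sum>b\<in>Y-L. inc a b * inc b c) = ?m a"
    using inc_nz[of a] by (intro sum_top_cells) (auto simp: j_def)
  ultimately show ?thesis by simp
qed

lemma incidence_cells: "incidence (Y - L) cell_dim inc"
proof
  show "finite (Y - L)" using finite_subset[OF face_closed_subset[OF Y] finite_C] by simp
qed (use inc_nz inc_inc in blast)+

lemma correct_to_relative_cycle:
  assumes "\<And>a. a \<in> Y - L \<Longrightarrow> (\<Sum>b\<in>top_cells Y L k. inc a b * n b) = 0"
  obtains w where "chain_in X k (\<Union>(skeleton Y L k)) w" "relcycle X k (\<Union>Y) (\<Union>L) (cell_chain (top_cells Y L k) n - w)"
proof -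
  let ?A = "\<lambda>k. \<Union>(skeleton Y L k)" and ?T = "top_cells Y L"
  let ?c = "cell_chain (?T k) n"
  have "chain_in X k (?A (Suc k)) ?c"
    by (rule chain_in_cell_chain[OF face_closed_skeleton]) (auto simp: top_cells_def skeleton_def)
  then have c: "chain_in X k (\<Union>Y) ?c" by (rule singular_chain_mono[OF _ skeleton_mono(3)])
  show ?thesis
  proof (cases k)
    case 0
    with c have "relcycle X k (\<Union>Y) (\<Union>L) (?c - 0)" by (simp add: relcycle_def chain_boundary_def)
    then show ?thesis by (rule that[rotated]) simp
  next
    case (Suc j)
    have "cell_chain (?T j) (\<lambda>d. \<Sum>e\<in>?T k. inc d e * n e) = 0"
      unfolding cell_chain_def using assms by (intro sum.neutral) (auto simp: top_cells_def)
    then have bound: "relboundary X j (?A k) (?A j) (chain_boundary k ?c)"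
      using boundary_top_cells[where j=j and n=n] Suc by simp
    have "chain_in X j (?A k) (chain_boundary k ?c)"
      by (rule relboundary_imp_chain_in[OF bound skeleton_mono(1)]) (simp add: Suc)
    then have "relcycle X j (?A k) (\<Union>L) (chain_boundary k ?c)"
      using chain_boundary_boundary_alt[where c="?c"] c Suc by (simp add: relcycle_def)
    moreover have "relboundary X j (?A j) (\<Union>L) e" if "relcycle X j (?A j) (\<Union>L) e" for e
      by (rule relboundary_if_no_cells[OF face_closed_skeleton L _ _ that]) (auto simp: skeleton_def)
    ultimately have "relboundary X j (?A k) (\<Union>L) (chain_boundary k ?c)"
      using relboundary_lift bound skeleton_mono(1)[of j k] Suc by (metis le_SucI order_refl)
    then obtain w l where w: "chain_in X k (?A k) w" "chain_in X j (\<Union>L) l"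
      "chain_boundary k ?c = chain_boundary k w + l"
      unfolding relboundary_def Suc by blast
    have "chain_in X k (\<Union>Y) (?c - w)"
      by (rule singular_chain_diff[OF c singular_chain_mono[OF w(1) skeleton_mono(3)]])
    then have "relcycle X k (\<Union>Y) (\<Union>L) (?c - w)"
      using w(2,3) Suc by (simp add: relcycle_def chain_boundary_diff)
    with w(1) show ?thesis by (rule that)
  qed
qed

lemma bound_by_top_cells:
  assumes c: "chain_in X k (\<Union>(skeleton Y L (Suc k))) c" "relboundary X k (\<Union>Y) (\<Union>(skeleton Y L k)) c"
  obtains m where "relboundary X k (\<Union>(skeleton Y L (Suc k))) (\<Union>(skeleton Y L k)) (c - chain_boundary (Suc k) (cell_chain (top_cells Y L (Suc k)) m))"
proof -
  let ?A = "\<lambda>k. \<Union>(skeleton Y L k)" and ?T = "top_cells Y L (Suc k)"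
  have vanish: "relboundary X (Suc k) (\<Union>Y) (?A (Suc (Suc k))) d"
    if "relcycle X (Suc k) (\<Union>Y) (?A (Suc (Suc k))) d" for d
    by (rule relboundary_if_no_cells[OF Y face_closed_skeleton _ _ that]) (use LY in \<open>auto simp: skeleton_def\<close>)
  have "?A k \<subseteq> ?A (Suc (Suc k))" by (rule skeleton_mono(1)) simp
  moreover have "chain_in X k (?A (Suc (Suc k))) c"
    by (rule singular_chain_mono[OF c(1) skeleton_mono(1)]) simp
  ultimately have "relboundary X k (?A (Suc (Suc k))) (?A k) c"
    using relboundary_restrict[OF vanish _ _ c(2)] by blast
  then obtain d e where d: "chain_in X (Suc k) (?A (Suc (Suc k))) d" and e: "chain_in X k (?A k) e"
    and c_eq: "c = chain_boundary (Suc k) d + e"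
    unfolding relboundary_def by blast
  have "chain_in X k (?A (Suc k)) (c - e)"
    by (rule singular_chain_diff[OF c(1) singular_chain_mono[OF e skeleton_mono(1)]]) simp
  then have "relcycle X (Suc k) (?A (Suc (Suc k))) (?A (Suc k)) d" using d c_eq by (simp add: relcycle_def)
  then obtain m where "relboundary X (Suc k) (?A (Suc (Suc k))) (?A (Suc k)) (d - cell_chain ?T m)"
    using skeleton_cells(1) by blast
  then obtain r where r: "chain_in X (Suc k) (?A (Suc k)) r"
    "chain_boundary (Suc k) (d - cell_chain ?T m) = chain_boundary (Suc k) r" by (metis relboundaryE)
  have "c - chain_boundary (Suc k) (cell_chain ?T m) = chain_boundary (Suc k) r + e"
    unfolding c_eq r(2)[symmetric] chain_boundary_diff by simp
  then have "relboundary X k (?A (Suc k)) (?A k) (c - chain_boundary (Suc k) (cell_chain ?T m))"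
    using relboundary_add[OF relboundary_boundary[OF r(1)] relboundary_chain_in[OF e]] by simp
  then show ?thesis by (rule that)
qed

theorem cellular_exact:
  assumes vanish: "\<And>k c. k < D \<Longrightarrow> relcycle X k (\<Union>Y) (\<Union>L) c \<Longrightarrow> relboundary X k (\<Union>Y) (\<Union>L) c"
  shows "exact_below D (Y - L) cell_dim inc"
proof (rule exact_below_I)
  let ?A = "\<lambda>k. \<Union>(skeleton Y L k)" and ?T = "top_cells Y L" and ?bd = "incidence_boundary (Y - L) inc"
  fix k z assume k: "k < D" and z: "z \<in> graded_functions (Y - L) cell_dim k" "?bd z = 0"
  have boundary_sum: "?bd f a = (\<Sum>b\<in>?T i. inc a b * f b)"
    if "f \<in> graded_functions (Y - L) cell_dim i" "a \<in> Y - L" for f a i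
    using that(2) sum_top_cells[of i "\<lambda>b. inc a b * f b"] graded_functions_D[OF that(1)]
      by (auto simp: incidence_boundary_def)
  let ?c = "cell_chain (?T k) z"
  have c: "chain_in X k (?A (Suc k)) ?c"
    by (rule chain_in_cell_chain[OF face_closed_skeleton]) (auto simp: top_cells_def skeleton_def)
  obtain w where w: "chain_in X k (?A k) w" "relcycle X k (\<Union>Y) (\<Union>L) (?c - w)"
    using correct_to_relative_cycle[where k=k and n=z] boundary_sum[OF z(1)] z(2) by (metis zero_fun_apply)
  have "relboundary X k (\<Union>Y) (?A k) (?c - w)"
    by (rule relboundary_mono[OF vanish[OF k w(2)] subset_refl skeleton_mono(2)])
  from relboundary_add[OF this relboundary_chain_in[OF w(1)]] have "relboundary X k (\<Union>Y) (?A k) ?c" by simp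
  then obtain m where m: "relboundary X k (?A (Suc k)) (?A k) (?c - chain_boundary (Suc k) (cell_chain (?T (Suc k)) m))"
    by (rule bound_by_top_cells[OF c])
  let ?cell_dim = "\<lambda>a. \<Sum>e\<in>?T (Suc k). inc a e * m e"
  have "cell_chain (?T k) (\<lambda>a. z a - ?cell_dim a) = ?c - cell_chain (?T k) ?cell_dim"
    unfolding cell_chain_def frag_cmul_diff_distrib sum_subtractf ..
  then have "relboundary X k (?A (Suc k)) (?A k) (cell_chain (?T k) (\<lambda>a. z a - ?cell_dim a))"
    using relboundary_add[OF m boundary_top_cells[where n=m]] by (simp add: add_diff_eq)
  from skeleton_cells(2)[OF this] have top: "?cell_dim a = z a" if "a \<in> ?T k" for a using that by force
  define y where "y = (\<lambda>b. if b \<in> ?T (Suc k) then m b else 0)"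
  have y: "y \<in> graded_functions (Y - L) cell_dim (Suc k)"
    by (rule graded_functions_I) (auto simp: y_def top_cells_def split: if_splits)
  have "?bd y a = z a" for a
  proof (cases "a \<in> Y - L")
    case a: True
    have eq: "?bd y a = ?cell_dim a" unfolding boundary_sum[OF y a] by (simp add: y_def)
    show ?thesis
    proof (cases "cell_dim a = k")
      case True
      then show ?thesis using eq top a by (simp add: top_cells_def)
    next
      case False
      then have "inc a e = 0" if "e \<in> ?T (Suc k)" for e
        using inc_nz[of a e] that by (auto simp: top_cells_def)
      moreover have "z a = 0" using graded_functions_D[OF z(1), of a] False by auto
      ultimately show ?thesis using eq by simp
    qed
  next
    case False
    then show ?thesis using graded_functions_D[OF z(1), of a] by (auto simp: incidence_boundary_def)
  qed
  with y show "\<exists>y\<in>graded_functions (Y - L) cell_dim (Suc k). ?bd y = z" by blast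
qed

end

lemma face_closed_C: "face_closed C" using boundary_cells_subset by (auto simp: face_closed_def)

lemma face_closed_empty: "face_closed {}" by (simp add: face_closed_def)

lemma euler_pair:
  assumes Y: "face_closed Y" "face_closed L" "L \<subseteq> Y" and vanish: "rel_acyclic X (\<Union>Y) (\<Union>L)"
  shows "(\<Sum>a\<in>Y-L. (-1) ^ cell_dim a) = (0::int)"
proof -
  define D where "D = Suc (Max (cell_dim ` Y))"
  have "exact_below D (Y - L) cell_dim inc" using rel_acyclicD[OF vanish] by (intro cellular_exact[OF Y])
  then obtain s where "contraction_below D (Y - L) cell_dim inc s"
    using incidence.contraction_if_exact[OF incidence_cells[OF Y]] by blast
  then show ?thesis
  proof (rule euler_zero_if_contraction)
    have "finite Y" using finite_subset[OF face_closed_subset[OF Y(1)] finite_C] .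
    then show "cell_dim a < D" if "a \<in> Y - L" for a using that by (simp add: D_def le_imp_less_Suc)
  qed
qed

end

definition augmentation :: "'a chain \<Rightarrow> int" where
  "augmentation c = poly_mapping.lookup (frag_extend (\<lambda>_. frag_of ()) c) ()"

lemma augmentation_add: "augmentation (a + b) = augmentation a + augmentation b"
  and augmentation_diff: "augmentation (a - b) = augmentation a - augmentation b"
  and augmentation_cmul: "augmentation (frag_cmul n a) = n * augmentation a"
    and augmentation_of: "augmentation (frag_of f) = 1" and augmentation_0: "augmentation 0 = 0"
  by (simp_all add: augmentation_def frag_extend_add frag_extend_diff frag_extend_cmul lookup_add lookup_minus)

lemma augmentation_sum: "augmentation (sum f I) = (\<Sum>i\<in>I. augmentation (f i))"
  by (induction I rule: infinite_finite_induct) (simp_all add: augmentation_add augmentation_0)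

lemma augmentation_boundary: "augmentation (chain_boundary (Suc 0) d) = 0"
proof (rule frag_induction[of d UNIV "\<lambda>d. augmentation (chain_boundary (Suc 0) d) = 0"])
  fix x show "augmentation (chain_boundary (Suc 0) (frag_of x)) = 0"
    by (simp add: chain_boundary_of augmentation_add augmentation_cmul augmentation_of augmentation_diff)
qed (simp_all add: augmentation_0 chain_boundary_diff augmentation_diff)

context regular_CW
begin

lemma finite_face_closed: "face_closed Y \<Longrightarrow> finite Y" using finite_subset[OF face_closed_subset finite_C] .

lemma face_closed_below: "face_closed {d. below d e}"
  unfolding face_closed_def
proof (intro conjI ballI subsetI)
  fix d assume "d \<in> {d. below d e}" then show "d \<in> C" by (simp add: below_def)
next
  fix d c assume dc: "d \<in> {d. below d e}" "c \<in> boundary_cells d"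
  then have "below c d" using boundary_cells_subset by (auto simp: below_def)
  then show "c \<in> {d. below d e}" using below_trans dc by blast
qed

lemma Union_below: "e \<in> C \<Longrightarrow> \<Union>{d. below d e} = X closure_of e"
  using closure_un[of e] boundary_cells_subset by (auto simp: below_def)

lemma vertex_below:
  assumes e: "e \<in> C"
  obtains v where "below v e" "cell_dim v = 0"
proof -
  have "finite {d. below d e}" "{d. below d e} \<noteq> {}"
    using finite_face_closed[OF face_closed_below] below_refl[OF e] by auto
  then obtain v where v: "below v e" "\<And>d. below d e \<Longrightarrow> cell_dim v \<le> cell_dim d"
    using arg_min_if_finite(1)[of "{d. below d e}" cell_dim] arg_min_least[of "{d. below d e}" _ cell_dim]
      by auto
  have vC: "v \<in> C" using v by (simp add: below_def)
  have "boundary_cells v = {}"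
  proof (rule ccontr)
    assume "boundary_cells v \<noteq> {}"
    then obtain d where d: "d \<in> boundary_cells v" by auto
    then have "below d v" using vC boundary_cells_subset by (auto simp: below_def)
    then have "cell_dim v \<le> cell_dim d" using v below_trans by blast
    then show False using boundary_cells_cell_dim[OF vC d] by simp
  qed
  moreover obtain \<Phi> where "cell X (cell_dim v) v \<Phi>" using cellI[OF vC] ..
  then interpret c: cell X "cell_dim v" v \<Phi> .
  have "c.fr = \<Union>(boundary_cells v)" unfolding c.fr_closure by (rule Union_boundary_cells[OF vC])
  ultimately have "cell_dim v = 0" using c.fr_nonempty by auto
  then show thesis using that v(1) by blast
qed

lemma vertex:
  assumes v: "v \<in> C" "cell_dim v = 0"
  obtains x where "v = {x}" "X closure_of v = {x}"
proof -
  obtain \<Phi> where "cell X (cell_dim v) v \<Phi>" using cellI[OF v(1)] ..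
  then interpret c: cell X 0 v \<Phi> using v(2) by simp
  have "unit_ball_interior 0 = {\<lambda>i. 0}" by (auto simp: unit_ball_interior_eq ball_set_def norm_sq_def)
  then have "v = {\<Phi> (\<lambda>i. 0)}" unfolding c.e_eq by simp
  moreover have "boundary_cells v = {}" using boundary_cells_cell_dim[OF v(1)] v(2) by auto
  then have "X closure_of v = v" using closure_un[OF v(1)] by simp
  ultimately show thesis using that by metis
qed

definition cell_rank :: "'a set \<Rightarrow> nat" where "cell_rank e = (if e = {} then 0 else Suc (cell_dim e))"

definition aug_inc :: "'a set \<Rightarrow> 'a set \<Rightarrow> int" where
  "aug_inc a b = (if a = {} then (if b \<in> cells_of_dim 0 then augmentation (cell_gen b) else 0) else inc a b)"

definition face_le :: "'a set \<Rightarrow> 'a set \<Rightarrow> bool" where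
  "face_le a b \<longleftrightarrow> (a = {} \<and> b \<in> insert {} C) \<or> below a b"

lemma empty_C: "{} \<notin> C" using cell_ne by blast

lemma inc_empty: "inc a {} = 0" "inc {} a = 0" using inc_nz[of a "{}"] inc_nz[of "{}" a] empty_C by blast+

lemma aug_inc_nz: "aug_inc a b \<noteq> 0 \<Longrightarrow> face_le a b \<and> cell_rank b = Suc (cell_rank a)"
  using inc_nz[of a b] empty_C
    by (auto simp: aug_inc_def face_le_def cell_rank_def cells_of_dim_def below_def split: if_splits)

lemma augmentation_inc: "(\<Sum>b\<in>cells_of_dim 0. augmentation (cell_gen b) * inc b c) = 0"
proof (cases "c \<in> C \<and> cell_dim c = Suc 0")
  case False
  then have "inc b c = 0" if "b \<in> cells_of_dim 0" for b
    using inc_nz[of b c] that by (auto simp: cells_of_dim_def)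
  then show ?thesis by simp
next
  case True
  then have c: "c \<in> C" "cell_dim c = Suc 0" by auto
  obtain d e where de: "chain_in X 0 (\<Union>{b \<in> boundary_cells c. cell_dim b < 0}) e"
    "chain_boundary (Suc 0) (cell_gen c) - cell_chain (cells_of_dim 0) (\<lambda>d. inc d c) = chain_boundary (Suc 0) d + e"
    using boundary_cell_gen[OF c] unfolding relboundary_def by blast
  have "e = 0" using de(1) singular_chain_empty[of "subtopology X {}" 0 e] by simp
  then have "augmentation (chain_boundary (Suc 0) (cell_gen c) - cell_chain (cells_of_dim 0) (\<lambda>d. inc d c)) = 0"
    unfolding de(2) by (simp add: augmentation_boundary)
  then have "augmentation (cell_chain (cells_of_dim 0) (\<lambda>d. inc d c)) = 0"
    by (simp add: augmentation_diff augmentation_boundary)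
  then show ?thesis by (simp add: cell_chain_def augmentation_sum augmentation_cmul mult.commute)
qed

lemma incidence_augmented:
  assumes Y: "face_closed Y"
  shows "incidence (insert {} Y) cell_rank aug_inc"
proof
  have YC: "Y \<subseteq> C" "{} \<notin> Y" using face_closed_subset[OF Y] empty_C by blast+
  show "finite (insert {} Y)" using finite_face_closed[OF Y] by simp
  show "cell_rank b = Suc (cell_rank a)" if "aug_inc a b \<noteq> 0" for a b using aug_inc_nz[OF that] by simp
  fix a c assume ac: "a \<in> insert {} Y" "c \<in> insert {} Y"
  have "aug_inc a {} = 0" by (simp add: aug_inc_def cells_of_dim_def empty_C inc_empty)
  then have "(\<Sum>b\<in>insert {} Y. aug_inc a b * aug_inc b c) = (\<Sum>b\<in>Y. aug_inc a b * aug_inc b c)"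
    using finite_face_closed[OF Y] YC(2) by simp
  also have "\<dots> = (\<Sum>b\<in>Y. aug_inc a b * inc b c)" using YC(2) by (intro sum.cong) (auto simp: aug_inc_def)
  also have "\<dots> = 0"
  proof (cases "a = {}")
    case True
    have "(\<Sum>b\<in>Y. aug_inc a b * inc b c) = (\<Sum>b\<in>cells_of_dim 0. augmentation (cell_gen b) * inc b c)"
    proof (rule sum.mono_neutral_cong)
      have "inc b c = 0" if "b \<notin> Y" for b
        using inc_nz[of b c] that ac(2) empty_C Y unfolding face_closed_def by blast
      then show "augmentation (cell_gen b) * inc b c = 0" if "b \<in> cells_of_dim 0 - Y" for b using that by simp
      show "aug_inc a b * inc b c = 0" if "b \<in> Y - cells_of_dim 0" for b
        using that True by (simp add: aug_inc_def)
      show "aug_inc a b * inc b c = augmentation (cell_gen b) * inc b c" if "b \<in> Y \<inter> cells_of_dim 0" for b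
        using that True by (simp add: aug_inc_def)
    qed (use finite_C finite_face_closed[OF Y] in \<open>simp_all add: cells_of_dim_def\<close>)
    then show ?thesis using augmentation_inc by simp
  next
    case False
    then have "(\<Sum>b\<in>Y. aug_inc a b * inc b c) = (\<Sum>b\<in>Y - {}. inc a b * inc b c)" by (simp add: aug_inc_def)
    also have "\<dots> = 0"
      using inc_inc[OF Y face_closed_empty empty_subsetI, of a c] ac False
        by (cases "c = {}") (auto simp: inc_empty)
    finally show ?thesis .
  qed
  finally show "(\<Sum>b\<in>insert {} Y. aug_inc a b * aug_inc b c) = 0" .
qed

lemma augmentation_unit:
  assumes v: "v \<in> C" "cell_dim v = 0"
  obtains m where "m * augmentation (cell_gen v) = 1"
proof -
  obtain x where x: "v = {x}" "X closure_of v = {x}" using vertex[OF v] .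
  define f where "f = restrict (\<lambda>_::nat \<Rightarrow> real. x) (standard_simplex 0)"
  have xX: "x \<in> topspace X" using closure_of_subset_topspace[of X v] x(2) by auto
  have "singular_simplex 0 (subtopology X {x}) f"
    unfolding singular_simplex_def f_def
      using xX by (auto simp: continuous_map_eq[OF continuous_map_const[THEN iffD2]])
  then have "relcycle X 0 {x} {} (frag_of f)" by (simp add: relcycle_def singular_chain_of chain_boundary_def)
  moreover have "rel_generator X 0 {x} {} (cell_gen v)" using rel_generator_cell_gen[OF v(1)] v(2) x by simp
  ultimately obtain m where "relboundary X 0 {x} {} (frag_of f - frag_cmul m (cell_gen v))"
    unfolding rel_generator_def by blast
  then obtain d e where de: "chain_in X 0 {} e" "frag_of f - frag_cmul m (cell_gen v) = chain_boundary (Suc 0) d + e"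
    unfolding relboundary_def by blast
  have "e = 0" using de(1) singular_chain_empty[of "subtopology X {}" 0 e] by simp
  then have "augmentation (frag_of f - frag_cmul m (cell_gen v)) = 0"
    unfolding de(2) by (simp add: augmentation_boundary)
  then have "m * augmentation (cell_gen v) = 1"
    by (simp add: augmentation_diff augmentation_cmul augmentation_of)
  then show thesis by (rule that)
qed

lemma interval_rel_acyclic:
  assumes "below x y" "x \<noteq> y"
  shows "rel_acyclic X (\<Union>{d. below d y}) (\<Union>{d \<in> {d. below d y}. \<not> below x d})"
proof -
  have xy: "x \<in> C" "y \<in> C" "x \<in> boundary_cells y" using assms by (auto simp: below_def)
  obtain p where p: "p \<in> x" using cell_ne[OF xy(1)] by auto
  obtain \<Phi> where "cell X (cell_dim y) y \<Phi>" using cellI[OF xy(2)] ..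
  then interpret c: cell X "cell_dim y" y \<Phi> .
  have "p \<in> c.fr" unfolding c.fr_closure using p xy(3) by (auto simp: boundary_cells_def)
  from c.rel_acyclic_cl_minus[OF this]
  have "rel_acyclic X (\<Union>{d. below d y}) (\<Union>{d. below d y} - {p})"
    unfolding c.cl_closure Union_below[OF xy(2)] .
  then show ?thesis
  proof (rule rel_acyclic_trans[OF _ rel_acyclic_minus_star[OF face_closed_below _ p]])
    show "x \<in> {d. below d y}" using assms by simp
    have "p \<notin> d" if "d \<in> C" "\<not> below x d" for d
      using cell_eq[OF that(1) xy(1) _ p] that(2) below_refl[OF xy(1)] by blast
    then show "\<Union>{d \<in> {d. below d y}. \<not> below x d} \<subseteq> \<Union>{d. below d y} - {p}"
      by (auto simp: below_def)
  qed auto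
qed

lemma augmented_vertex_exact:
  assumes v: "v \<in> C" "cell_dim v = 0"
  shows "exact_below D {{}, v} cell_rank aug_inc"
proof (rule exact_below_I)
  let ?bd = "incidence_boundary {{}, v} aug_inc"
  have v_ne: "v \<noteq> {}" using v(1) empty_C by blast
  obtain m where m: "m * augmentation (cell_gen v) = 1" using augmentation_unit[OF v] .
  have bd: "?bd z = (\<lambda>a. if a = {} then augmentation (cell_gen v) * z v else 0)" for z
    using v v_ne inc_nz[of v v]
      by (intro ext) (auto simp: incidence_boundary_def aug_inc_def cells_of_dim_def inc_empty empty_C)
  fix k z assume z: "z \<in> graded_functions {{}, v} cell_rank k" "?bd z = 0"
  have "augmentation (cell_gen v) * z v = 0" using fun_cong[OF z(2), of "{}"] by (simp add: bd)
  then have zv: "z v = 0" using m by auto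
  define y where "y = (\<lambda>a. if a = v then m * z {} else 0)"
  have "y \<in> graded_functions {{}, v} cell_rank (Suc k)"
    using graded_functions_D[OF z(1), of "{}"] v v_ne
      by (auto intro!: graded_functions_I simp: y_def cell_rank_def split: if_splits)
  moreover have "?bd y a = z a" for a
    using graded_functions_D[OF z(1), of a] m zv unfolding bd
    by (auto simp: y_def mult.left_commute mult.assoc[symmetric] mult.commute[of _ m])
  ultimately show "\<exists>y\<in>graded_functions {{}, v} cell_rank (Suc k). ?bd y = z" by blast
qed

lemma augmented_exact:
  assumes y: "y \<in> C"
  shows "exact_below D (insert {} {d. below d y}) cell_rank aug_inc"
proof -
  let ?Y = "{d. below d y}"
  have YC: "?Y \<subseteq> C" by (auto simp: below_def)
  obtain v where v: "below v y" "cell_dim v = 0" using vertex_below[OF y] .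
  have vC: "v \<in> C" "v \<noteq> {}" using v empty_C by (auto simp: below_def)
  obtain x where x: "v = {x}" using vertex[OF vC(1) v(2)] by blast
  have "boundary_cells v = {}" using boundary_cells_cell_dim[OF vC(1)] v(2) by auto
  then have L: "face_closed {v}" "{v} \<subseteq> ?Y" using vC v by (auto simp: face_closed_def)
  obtain \<Phi> where "cell X (cell_dim y) y \<Phi>" using cellI[OF y] ..
  then interpret c: cell X "cell_dim y" y \<Phi> .
  have "x \<in> c.cl" unfolding c.cl_closure Union_below[OF y, symmetric] using v(1) x by auto
  then have "rel_acyclic X (\<Union>?Y) (\<Union>{v})"
    using c.rel_acyclic_point unfolding Union_below[OF y] c.cl_closure x by simp
  from cellular_exact[OF face_closed_below L rel_acyclicD[OF this]] have "exact_below D (?Y - {v}) cell_dim inc" .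
  then have "exact_below (Suc D) (?Y - {v}) cell_rank aug_inc"
    by (rule exact_below_shift) (use YC empty_C in \<open>auto simp: cell_rank_def aug_inc_def\<close>)
  then have "exact_below D (?Y - {v}) cell_rank aug_inc" by (rule exact_below_mono) simp
  moreover have "insert {} ?Y - {{}, v} = ?Y - {v}" using YC empty_C by blast
  ultimately have cells: "exact_below D (insert {} ?Y - {{}, v}) cell_rank aug_inc" by simp
  interpret incidence_pair "insert {} ?Y" cell_rank aug_inc "{{}, v}"
  proof (intro incidence_pair.intro incidence_augmented[OF face_closed_below] incidence_pair_axioms.intro)
    show "aug_inc a b = 0" if "a \<in> insert {} ?Y - {{}, v}" "b \<in> {{}, v}" for a b
      using aug_inc_nz[of a b] that v(2) by (auto simp: cell_rank_def split: if_splits)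
  qed (use v(1) in auto)
  show ?thesis by (rule exact_extension[OF augmented_vertex_exact[OF vC(1) v(2)] cells])
qed

lemma interval_exact:
  assumes xy: "face_le x y" "x \<noteq> y"
  shows "incidence {c. face_le x c \<and> face_le c y} cell_rank aug_inc"
    "exact_below D {c. face_le x c \<and> face_le c y} cell_rank aug_inc"
proof -
  let ?Y = "{d. below d y}" and ?L = "{d \<in> {d. below d y}. \<not> below x d}"
  have y: "y \<in> C" using xy by (auto simp: face_le_def below_def)
  have "incidence {c. face_le x c \<and> face_le c y} cell_rank aug_inc
    \<and> exact_below D {c. face_le x c \<and> face_le c y} cell_rank aug_inc"
  proof (cases "x = {}")
    case True
    then have "{c. face_le x c \<and> face_le c y} = insert {} ?Y"
      using y empty_C by (auto simp: face_le_def below_def)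
    then show ?thesis using incidence_augmented[OF face_closed_below] augmented_exact[OF y] by simp
  next
    case False
    then have x: "below x y" using xy(1) by (simp add: face_le_def)
    note pair = face_closed_below face_closed_minus_star[OF face_closed_below]
    have I: "{c. face_le x c \<and> face_le c y} = ?Y - ?L"
      using False empty_C by (auto simp: face_le_def below_def)

    have cells: "cell_rank a = Suc (cell_dim a)" "aug_inc a b = inc a b" if "a \<in> ?Y - ?L" for a b
      using that empty_C by (auto simp: cell_rank_def aug_inc_def below_def)
    have "exact_below D (?Y - ?L) cell_dim inc"
      by (rule cellular_exact[OF pair _ rel_acyclicD[OF interval_rel_acyclic[OF x xy(2)]]]) auto
    then have "exact_below (Suc D) (?Y - ?L) cell_rank aug_inc"
      by (rule exact_below_shift) (use cells in auto)
    moreover have "incidence (?Y - ?L) cell_rank aug_inc"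
      by (rule incidence_shift[OF incidence_cells[OF pair]]) (use cells in auto)
    ultimately show ?thesis unfolding I using exact_below_mono le_SucI by blast
  qed
  then show "incidence {c. face_le x c \<and> face_le c y} cell_rank aug_inc"
    "exact_below D {c. face_le x c \<and> face_le c y} cell_rank aug_inc" by blast+
qed

theorem cell_poset: "cell_poset (insert {} C) face_le cell_rank (\<lambda>a b. real_of_int (aug_inc a b)) {}"
proof unfold_locales
  show "finite (insert {} C)" using finite_C by simp
  show "x \<in> insert {} C \<Longrightarrow> face_le x x" for x using below_refl by (auto simp: face_le_def)
  show "face_le x z" if "face_le x y" "face_le y z" for x y z
    using that below_trans[of x y z] empty_C by (auto simp: face_le_def below_def)
  show "face_le x y \<Longrightarrow> x \<in> insert {} C \<and> y \<in> insert {} C" for x y by (auto simp: face_le_def below_def)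
  show "cell_rank x < cell_rank y" if "face_le x y" "x \<noteq> y" for x y
    using that below_cell_dim[of x y] empty_C by (auto simp: face_le_def cell_rank_def below_def)
  show nz: "real_of_int (aug_inc x y) \<noteq> 0 \<Longrightarrow> face_le x y \<and> cell_rank y = Suc (cell_rank x)" for x y
    using aug_inc_nz by simp
  show "(\<Sum>y\<in>insert {} C. real_of_int (aug_inc x y) * real_of_int (aug_inc y z)) = 0" for x z
  proof (cases "x \<in> insert {} C \<and> z \<in> insert {} C")
    case True
    then have "real_of_int (\<Sum>y\<in>insert {} C. aug_inc x y * aug_inc y z) = 0"
      using incidence.eps_eps[OF incidence_augmented[OF face_closed_C]] by simp
    then show ?thesis by simp
  next
    case False
    then have "aug_inc x y = 0 \<or> aug_inc y z = 0" for y
      using aug_inc_nz[of x y] aug_inc_nz[of y z] by (auto simp: face_le_def below_def)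
    then show ?thesis by (intro sum.neutral) auto
  qed
  show "x \<in> insert {} C \<Longrightarrow> face_le {} x" for x by (simp add: face_le_def)
  show "\<exists>s. contraction_below (Suc (cell_rank y)) {c. face_le x c \<and> face_le c y} cell_rank (\<lambda>a b. real_of_int (aug_inc a b)) s"
    if "face_le x y" "x \<noteq> y" for x y
    by (rule contraction_of_int_if_exact[OF interval_exact[OF that]])
qed (auto simp: cell_rank_def)

end

section \<open>Closures of cells\<close>

lemma cell_dim_unique:
  assumes "cell X n e \<Phi>" "cell X m e \<Psi>" shows "n = m"
proof (rule ccontr)
  assume nm: "n \<noteq> m"
  interpret c: cell X n e \<Phi> by fact
  interpret d: cell X m e \<Psi> by fact
  obtain z where z: "rel_generator X n c.cl c.fr z" using c.rel_generator_cl ..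
  have eq: "c.cl = d.cl" "c.fr = d.fr"
    unfolding c.cl_closure d.cl_closure c.fr_closure d.fr_closure by simp_all
  show False
    using rel_generator_not_relboundary[OF z] d.relboundary_cl[OF nm] rel_generator_relcycle[OF z]
    unfolding eq by blast
qed

lemma connected_unit_ball_interior: "connected (unit_ball_interior n)"
proof -
  let ?s = "\<lambda>y::nat\<Rightarrow>real. (\<lambda>t i. t * y i) ` {0..1::real}"
  have in_int: "?s y \<subseteq> unit_ball_interior n" if "y \<in> unit_ball_interior n" for y
  proof
    fix w assume "w \<in> ?s y"
    then obtain t where t: "0 \<le> t" "t \<le> 1" "w = (\<lambda>i. t * y i)" by auto
    have "norm_sq n w = t\<^sup>2 * norm_sq n y" unfolding t(3) by (rule norm_sq_scale)
    also have "\<dots> \<le> 1 * norm_sq n y"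
      using t norm_sq_nonneg[of n y] by (intro mult_right_mono) (auto simp: power_le_one)
    finally show "w \<in> unit_ball_interior n" using that t(3) by (auto simp: unit_ball_interior_eq ball_set_def)
  qed
  have "connected (?s y)" for y
    by (rule connected_continuous_image, rule continuous_on_coordinatewise_then_product)
      (auto intro!: continuous_intros)
  moreover have "(\<lambda>i. 0) \<in> ?s y" for y by (rule image_eqI[of _ _ 0]) auto
  then have "(\<lambda>i. 0) \<in> \<Inter>(?s ` unit_ball_interior n)" by blast
  then have "\<Inter>(?s ` unit_ball_interior n) \<noteq> {}" by (rule ex_in_conv[THEN iffD1, OF exI])
  ultimately have "connected (\<Union>(?s ` unit_ball_interior n))" by (intro connected_Union) auto
  moreover have "y \<in> ?s y" for y by (rule image_eqI[of _ _ 1]) auto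
  then have "unit_ball_interior n \<subseteq> \<Union>(?s ` unit_ball_interior n)" by (intro subsetI UN_I)
  then have "\<Union>(?s ` unit_ball_interior n) = unit_ball_interior n" using in_int by (intro equalityI UN_least)
  ultimately show ?thesis by simp
qed

abbreviation coord_space :: "nat \<Rightarrow> (nat \<Rightarrow> real) set" where
  "coord_space n \<equiv> {x. \<forall>i\<ge>n. x i = 0}"

definition unit_vector :: "nat \<Rightarrow> (nat \<Rightarrow> real) \<Rightarrow> nat \<Rightarrow> real" where
  "unit_vector n v = (\<lambda>i. v i / sqrt (norm_sq n v))"

lemma norm_sq_pos: "v \<in> coord_space n - {\<lambda>i. 0} \<Longrightarrow> 0 < norm_sq n v"
  using norm_sq_eq_0[of v n] norm_sq_nonneg[of n v] by (auto simp: ball_set_def less_le)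

lemma unit_vector_boundary:
  assumes "v \<in> coord_space n - {\<lambda>i. 0}" shows "unit_vector n v \<in> unit_ball_boundary n"
proof -
  have "norm_sq n (unit_vector n v) = (1 / sqrt (norm_sq n v))\<^sup>2 * norm_sq n v"
    unfolding unit_vector_def using norm_sq_scale[of n "1 / sqrt (norm_sq n v)" v] by simp
  also have "\<dots> = 1" using norm_sq_pos[OF assms] by (simp add: power_divide)
  finally show ?thesis using assms by (simp add: unit_ball_boundary_eq ball_set_def unit_vector_def)
qed

lemma unit_vector_fixed: "y \<in> unit_ball_boundary n \<Longrightarrow> unit_vector n y = y"
  by (simp add: unit_vector_def unit_ball_boundary_eq)

lemma unit_vector_inj:
  assumes "w \<in> coord_space n - {\<lambda>i. 0}" "norm_sq n v = norm_sq n w" "unit_vector n v = unit_vector n w" shows "v = w"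
  using norm_sq_pos[OF assms(1)] fun_cong[OF assms(3)] unfolding unit_vector_def assms(2) by (intro ext) simp

lemma continuous_unit_vector: "continuous_on (coord_space n - {\<lambda>i. 0}) (unit_vector n)"
  unfolding unit_vector_def
proof (intro continuous_on_coordinatewise_then_product continuous_on_divide ballI)
  show "sqrt (norm_sq n v) \<noteq> 0" if "v \<in> coord_space n - {\<lambda>i. 0}" for v using norm_sq_pos[OF that] by simp
qed (rule continuous_coord continuous_on_real_sqrt continuous_norm_sq continuous_on_id)+

lemma continuous_on_fun_upd:
  fixes f :: "'a::topological_space \<Rightarrow> nat \<Rightarrow> real"
  assumes "continuous_on S f" "continuous_on S h" shows "continuous_on S (\<lambda>x. (f x)(m := h x))"
proof (rule continuous_on_coordinatewise_then_product)
  fix i show "continuous_on S (\<lambda>x. ((f x)(m := h x)) i)" using assms by (cases "i = m") (auto intro: continuous_coord)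
qed

definition open_cone :: "nat \<Rightarrow> (nat \<Rightarrow> real) set \<Rightarrow> (nat \<Rightarrow> real) set" where
  "open_cone n V = {v \<in> coord_space n - {\<lambda>i. 0}. unit_vector n v \<in> V}"

definition cone_map :: "nat \<Rightarrow> nat \<Rightarrow> ((nat \<Rightarrow> real) \<Rightarrow> nat \<Rightarrow> real) \<Rightarrow> (nat \<Rightarrow> real) \<Rightarrow> nat \<Rightarrow> real" where
  "cone_map m n g v = (g (unit_vector n v))(m := sqrt (norm_sq n v))"

lemma openin_open_cone:
  assumes "openin (top_of_set (unit_ball_boundary n)) V" shows "openin (Euclidean_space n) (open_cone n V)"
proof -
  have "openin (top_of_set (coord_space n - {\<lambda>i. 0})) (open_cone n V)"
    using continuous_openin_preimage[OF continuous_unit_vector _ assms] unit_vector_boundary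
    by (auto simp: open_cone_def vimage_def Int_def image_subset_iff)
  moreover have "openin (top_of_set (coord_space n)) (coord_space n - {\<lambda>i. 0})" by (intro openin_diff) auto
  ultimately show ?thesis unfolding Euclidean_top_of_set by (rule openin_trans)
qed

text \<open>Coning off reduces invariance of domain for open subsets of the sphere to the case of Euclidean space.\<close>

lemma openin_cone_map_image:
  assumes V: "openin (top_of_set (unit_ball_boundary n)) V"
    and g: "continuous_on V g" "inj_on g V" "g ` V \<subseteq> coord_space m" and mn: "m < n"
  shows "openin (Euclidean_space n) (cone_map m n g ` open_cone n V)"
proof (rule invariance_of_domain_Euclidean_space[OF openin_open_cone[OF V]])
  let ?T = "open_cone n V"
  have T: "?T \<subseteq> coord_space n - {\<lambda>i. 0}" "unit_vector n ` ?T \<subseteq> V" by (auto simp: open_cone_def)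
  have "continuous_on ?T (\<lambda>v. g (unit_vector n v))"
    by (rule continuous_on_compose2[OF g(1) continuous_on_subset[OF continuous_unit_vector T(1)] T(2)])
  then have "continuous_on ?T (cone_map m n g)"
    unfolding cone_map_def
      by (intro continuous_on_fun_upd continuous_on_real_sqrt continuous_norm_sq continuous_on_id)
  moreover have "cone_map m n g v \<in> coord_space n" if "v \<in> ?T" for v
    using g(3) T(2) that mn by (force simp: cone_map_def)
  moreover have "subtopology (top_of_set (coord_space n)) ?T = top_of_set ?T"
    unfolding subtopology_subtopology using T(1) by (simp add: inf.absorb2 subset_iff)
  ultimately show "continuous_map (subtopology (Euclidean_space n) ?T) (Euclidean_space n) (cone_map m n g)"
    unfolding Euclidean_top_of_set by auto
  show "inj_on (cone_map m n g) ?T"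
  proof (rule inj_onI)
    fix v w assume vw: "v \<in> ?T" "w \<in> ?T" "cone_map m n g v = cone_map m n g w"
    have V: "unit_vector n v \<in> V" "unit_vector n w \<in> V" using vw T(2) by auto
    have "g (unit_vector n v) m = 0" "g (unit_vector n w) m = 0" using g(3) V by blast+
    then have "g (unit_vector n v) i = g (unit_vector n w) i" for i
      using fun_cong[OF vw(3), of i] by (cases "i = m") (auto simp: cone_map_def)
    then have "unit_vector n v = unit_vector n w" using inj_onD[OF g(2) _ V] by blast
    moreover have "norm_sq n v = norm_sq n w" using fun_cong[OF vw(3), of m] by (simp add: cone_map_def)
    ultimately show "v = w" using unit_vector_inj vw(2) T(1) by blast
  qed
qed

lemma boundary_subset_open_cone: "V \<subseteq> unit_ball_boundary n \<Longrightarrow> V \<subseteq> open_cone n V"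
  by (auto simp: open_cone_def unit_vector_fixed) (auto simp: unit_ball_boundary_eq ball_set_def norm_sq_def)

lemma invariance_of_domain_sphere:
  assumes V: "openin (top_of_set (unit_ball_boundary n)) V"
    and g: "continuous_on V g" "inj_on g V" "g ` V \<subseteq> coord_space m" and mn: "m < n"
  shows "openin (top_of_set (coord_space m)) (g ` V)"
proof -
  let ?G = "cone_map m n g" and ?T = "open_cone n V"
  have VT: "V \<subseteq> ?T" by (rule boundary_subset_open_cone[OF openin_imp_subset[OF V]])
  obtain Q where Q: "open Q" "?G ` ?T = coord_space n \<inter> Q"
    using openin_cone_map_image[OF V g mn] unfolding Euclidean_top_of_set openin_open by auto
  have "g ` V = coord_space m \<inter> (\<lambda>w. w(m := 1)) -` Q"
  proof (intro equalityI subsetI)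
    fix w assume "w \<in> g ` V"
    then obtain y where y: "y \<in> V" "w = g y" by blast
    then have "w(m := 1) = ?G y"
      using openin_imp_subset[OF V] by (auto simp: cone_map_def unit_vector_fixed unit_ball_boundary_eq)
    moreover have "?G y \<in> Q" using imageI[of y ?T ?G] y(1) VT Q(2) by blast
    ultimately show "w \<in> coord_space m \<inter> (\<lambda>w. w(m := 1)) -` Q" using y g(3) by auto
  next
    fix w assume w: "w \<in> coord_space m \<inter> (\<lambda>w. w(m := 1)) -` Q"
    then have "w(m := 1) \<in> ?G ` ?T" using Q(2) mn by auto
    then obtain v where v: "v \<in> ?T" "w(m := 1) = ?G v" by blast
    have "unit_vector n v \<in> V" using v(1) by (simp add: open_cone_def)
    moreover have "g (unit_vector n v) m = 0" "w m = 0" using g(3) calculation w by blast+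
    then have "w i = g (unit_vector n v) i" for i
      using fun_cong[OF v(2), of i] by (cases "i = m") (auto simp: cone_map_def)
    ultimately show "w \<in> g ` V" by blast
  qed
  moreover have "open ((\<lambda>w::nat\<Rightarrow>real. w(m := 1)) -` Q)"
    by (rule open_vimage[OF Q(1)]) (intro continuous_on_fun_upd continuous_on_id continuous_on_const)
  ultimately show ?thesis by (auto simp: openin_open)
qed

lemma invariance_of_dimension_sphere:
  assumes V: "openin (top_of_set (unit_ball_boundary n)) V"
    and g: "continuous_on V g" "inj_on g V" "g ` V \<subseteq> coord_space m" and mn: "m < n" and ne: "V \<noteq> {}"
  shows "n = Suc m"
proof (rule ccontr)
  let ?G = "cone_map m n g" and ?T = "open_cone n V"
  have VT: "V \<subseteq> ?T" by (rule boundary_subset_open_cone[OF openin_imp_subset[OF V]])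
  obtain Q where Q: "open Q" "?G ` ?T = coord_space n \<inter> Q"
    using openin_cone_map_image[OF V g mn] unfolding Euclidean_top_of_set openin_open by auto
  obtain y where y: "y \<in> ?T" using VT ne by blast
  assume "n \<noteq> Suc m"
  then have n: "Suc m < n" using mn by simp
  have last: "?G v (n - 1) = 0" if "v \<in> ?T" for v
    using n g(3) that by (force simp: cone_map_def open_cone_def)
  let ?f = "\<lambda>t::real. (?G y)(n - 1 := t)"
  have G: "?G y \<in> coord_space n" using Q(2) y by blast
  have "open (?f -` Q)"
    by (rule open_vimage[OF Q(1)]) (intro continuous_on_fun_upd continuous_on_const continuous_on_id)
  moreover have "?f -` Q = {0}"
  proof (intro equalityI subsetI)
    fix t assume "t \<in> ?f -` Q"
    then have "?f t \<in> ?G ` ?T" using G n Q(2) by auto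
    then obtain v where v: "v \<in> ?T" "?f t = ?G v" by blast
    then have "t = ?G v (n - 1)" by (metis fun_upd_same)
    then show "t \<in> {0}" using last v(1) by simp
  next
    fix t :: real assume "t \<in> {0}"
    then have "?f t = ?G y" using last[OF y] by (auto simp: fun_eq_iff)
    then show "t \<in> ?f -` Q" using y Q(2) by auto
  qed
  ultimately show False using not_open_singleton[of "0::real"] by simp
qed

lemma
  assumes "cell X n e \<Phi>" "cell X m c \<Psi>" and mn: "m < n"
    and W: "openin (subtopology X (X closure_of e - e)) W" "W \<subseteq> c"
  shows open_piece_dim: "W \<noteq> {} \<Longrightarrow> n = Suc m"
    and open_piece_preimage: "openin (top_of_set (unit_ball_interior m)) {y \<in> unit_ball_interior m. \<Psi> y \<in> W}"
proof -
  interpret e: cell X n e \<Phi> by fact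
  interpret c: cell X m c \<Psi> by fact
  define V where "V = {y \<in> unit_ball_boundary n. \<Phi> y \<in> W}"
  let ?g = "\<lambda>y. c.inv\<Phi> (\<Phi> y)"
  have unit_ball_boundary: "unit_ball_boundary n \<subseteq> ball_set n" by (auto simp: unit_ball_boundary_eq)
  have WX: "W \<subseteq> e.fr" using openin_subset[OF W(1)] by (auto simp: e.fr_closure)
  have "continuous_map (top_of_set (unit_ball_boundary n)) (subtopology X (X closure_of e - e)) \<Phi>"
    using e.continuous_on_subset_ball[OF unit_ball_boundary]
      unfolding e.fr_closure[symmetric] by (auto simp: continuous_map_in_subtopology e.fr_def)
  from openin_continuous_map_preimage[OF this W(1)]
  have V: "openin (top_of_set (unit_ball_boundary n)) V" by (simp add: V_def)
  have \<Phi>V: "\<Phi> y \<in> c" "\<Phi> y \<in> c.cl" if "y \<in> V" for y using that W(2) c.e_cl by (auto simp: V_def)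
  have gV: "?g y \<in> unit_ball_interior m" if "y \<in> V" for y using \<Phi>V(1)[OF that] c.inv_e by blast
  have "continuous_map (top_of_set V) (subtopology X c.cl) \<Phi>"
    using e.continuous_on_subset_ball[of V] unit_ball_boundary \<Phi>V(2)
      by (auto simp: continuous_map_in_subtopology V_def)
  from continuous_map_compose[OF this c.continv] have cont: "continuous_on V ?g"
    by (simp add: comp_def unit_ball_top_of_set)
  have inj: "inj_on ?g V"
  proof (rule inj_onI)
    fix y z assume yz: "y \<in> V" "z \<in> V" "?g y = ?g z"
    then have "\<Phi> y = \<Phi> z" using \<Phi>V(2) c.\<Phi>_inv by metis
    then show "y = z" using inj_onD[OF e.inj] yz unit_ball_boundary by (auto simp: V_def)
  qed
  have image: "?g ` V \<subseteq> coord_space m" using gV by (auto simp: unit_ball_interior_eq ball_set_def)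
  have preimage: "{y \<in> unit_ball_interior m. \<Psi> y \<in> W} = ?g ` V"
  proof (intro equalityI subsetI)
    fix y assume y: "y \<in> {y \<in> unit_ball_interior m. \<Psi> y \<in> W}"
    then obtain z where z: "z \<in> V" "\<Psi> y = \<Phi> z" using WX by (auto simp: e.fr_def V_def)
    then have "?g z = y" using c.inv_\<Phi>[of y] y by (simp add: unit_ball_interior_eq)
    then show "y \<in> ?g ` V" using z(1) by blast
  qed (use gV \<Phi>V(2) c.\<Phi>_inv in \<open>auto simp: V_def\<close>)
  have "unit_ball_interior m \<subseteq> coord_space m" by (auto simp: unit_ball_interior_eq ball_set_def)
  then show "openin (top_of_set (unit_ball_interior m)) {y \<in> unit_ball_interior m. \<Psi> y \<in> W}"
    using invariance_of_domain_sphere[OF V cont inj image mn] gV unfolding preimage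
    by (auto intro: openin_subset_trans)
  show "n = Suc m" if "W \<noteq> {}"
  proof (rule invariance_of_dimension_sphere[OF V cont inj image mn])
    show "V \<noteq> {}" using that WX by (auto simp: e.fr_def V_def)
  qed
qed

locale pre_CW =
  fixes X :: "'a topology" and C :: "'a set set" and cell_dim :: "'a set \<Rightarrow> nat"
  assumes hausdorff: "Hausdorff_space X" and finite_C: "finite C" and disjoint_C: "disjoint C"
    and cells: "e \<in> C \<Longrightarrow> \<exists>\<Phi>. characteristic_map X (cell_dim e) e \<Phi>"
    and low: "e \<in> C \<Longrightarrow> X closure_of e - e \<subseteq> \<Union>{c \<in> C. cell_dim c < cell_dim e}"
begin

lemma cellI: "e \<in> C \<Longrightarrow> \<exists>\<Phi>. cell X (cell_dim e) e \<Phi>"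
  using cells[of e] hausdorff by (simp add: cell_def)

lemma cell_eq: "d \<in> C \<Longrightarrow> e \<in> C \<Longrightarrow> x \<in> d \<Longrightarrow> x \<in> e \<Longrightarrow> d = e"
  using disjoint_C by (auto simp: disjoint_def)

lemma e_closure: assumes "e \<in> C" shows "e \<subseteq> X closure_of e"
proof -
  obtain \<Phi> where "cell X (cell_dim e) e \<Phi>" using cellI[OF assms] ..
  then interpret c: cell X "cell_dim e" e \<Phi> .
  show ?thesis using c.e_cl unfolding c.cl_closure .
qed

lemma closed_skel: "closedin X (\<Union>{c \<in> C. cell_dim c \<le> k \<and> c \<noteq> c0})" if "c0 \<notin> C \<or> k \<le> cell_dim c0"
proof -
  have eq: "\<Union>{c \<in> C. cell_dim c \<le> k \<and> c \<noteq> c0} = (\<Union>c\<in>{c \<in> C. cell_dim c \<le> k \<and> c \<noteq> c0}. X closure_of c)"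
  proof (intro equalityI subsetI)
    fix x assume "x \<in> \<Union>{c \<in> C. cell_dim c \<le> k \<and> c \<noteq> c0}"
    then show "x \<in> (\<Union>c\<in>{c \<in> C. cell_dim c \<le> k \<and> c \<noteq> c0}. X closure_of c)" using e_closure by auto
  next
    fix x assume "x \<in> (\<Union>c\<in>{c \<in> C. cell_dim c \<le> k \<and> c \<noteq> c0}. X closure_of c)"
    then obtain c where c: "c \<in> C" "cell_dim c \<le> k" "c \<noteq> c0" "x \<in> X closure_of c" by auto
    show "x \<in> \<Union>{c \<in> C. cell_dim c \<le> k \<and> c \<noteq> c0}"
    proof (cases "x \<in> c")
      case False
      then obtain d where "d \<in> C" "cell_dim d < cell_dim c" "x \<in> d" using low[OF c(1)] c(4) by auto
      then show ?thesis using c(2) that by auto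
    qed (use c in auto)
  qed
  show ?thesis unfolding eq using finite_C by (intro closedin_Union) auto
qed

lemma open_top:
  assumes c: "c \<in> C" and W: "W \<subseteq> \<Union>{c' \<in> C. cell_dim c' \<le> cell_dim c}" and WS: "openin (subtopology X S) W"
  shows "openin (subtopology X S) (W \<inter> c)"
proof -
  let ?K = "\<Union>{c' \<in> C. cell_dim c' \<le> cell_dim c \<and> c' \<noteq> c}"
  have "W \<inter> c = W - ?K"
  proof (intro equalityI subsetI)
    fix x assume x: "x \<in> W \<inter> c"
    then show "x \<in> W - ?K" using cell_eq[OF c] by auto
  next
    fix x assume "x \<in> W - ?K" then show "x \<in> W \<inter> c" using W by auto
  qed
  also have "\<dots> = W - (?K \<inter> S)" using openin_subset[OF WS] by auto
  finally show ?thesis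
    using WS openin_diff[OF WS] closedin_subtopology[of X S "?K \<inter> S"] closed_skel[of c "cell_dim c"] by auto
qed

lemma boundary_dim: "e \<in> C \<Longrightarrow> c \<in> C \<Longrightarrow> x \<in> c \<Longrightarrow> x \<in> X closure_of e - e \<Longrightarrow> cell_dim c < cell_dim e"
  using low[of e] cell_eq[of c _ x] by blast

lemma facet_in_boundary:
  assumes e: "e \<in> C" and c: "c \<in> C" "Suc (cell_dim c) = cell_dim e" "c \<inter> (X closure_of e - e) \<noteq> {}"
  shows "c \<subseteq> X closure_of e - e"
proof -
  let ?S = "X closure_of e - e" and ?B = "unit_ball_interior (cell_dim c)"
  obtain \<Phi> where cell_e: "cell X (cell_dim e) e \<Phi>" using cellI[OF e] ..
  then interpret e: cell X "cell_dim e" e \<Phi> .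
  obtain \<Psi> where cell_c: "cell X (cell_dim c) c \<Psi>" using cellI[OF c(1)] ..
  then interpret c: cell X "cell_dim c" c \<Psi> .
  have closedS: "closedin X ?S" using e.closed_fr unfolding e.fr_closure .
  have image: "\<Psi> ` ?B = c" by (rule c.e_eq[symmetric])
  have "openin (subtopology X ?S) ?S"
    using openin_topspace[of "subtopology X ?S"] closedin_subset[OF closedS] by (simp add: inf.absorb2)
  moreover have "?S \<subseteq> \<Union>{d \<in> C. cell_dim d \<le> cell_dim c}"
    using low[OF e] unfolding c(2)[symmetric] less_Suc_eq_le .
  ultimately have "openin (subtopology X ?S) (?S \<inter> c)" using open_top[OF c(1)] by blast
  then have "openin (top_of_set ?B) {y \<in> ?B. \<Psi> y \<in> ?S \<inter> c}"
    using c(2) by (intro open_piece_preimage[OF cell_e cell_c]) auto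
  moreover have "{y \<in> ?B. \<Psi> y \<in> ?S \<inter> c} = {y \<in> ?B. \<Psi> y \<in> ?S}" using image by blast
  ultimately have opened: "openin (top_of_set ?B) {y \<in> ?B. \<Psi> y \<in> ?S}" by simp
  have "continuous_map (top_of_set ?B) X \<Psi>"
    by (rule c.continuous_on_subset_ball) (auto simp: unit_ball_interior_eq)
  from closedin_continuous_map_preimage[OF this closedS]
  have closed: "closedin (top_of_set ?B) {y \<in> ?B. \<Psi> y \<in> ?S}" by simp
  obtain x where "x \<in> \<Psi> ` ?B" "x \<in> ?S" using c(3) unfolding image by blast
  then have "{y \<in> ?B. \<Psi> y \<in> ?S} \<noteq> {}" by blast
  then have "{y \<in> ?B. \<Psi> y \<in> ?S} = ?B"
    using connected_unit_ball_interior[of "cell_dim c"] opened closed unfolding connected_clopen by blast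
  then have "\<Psi> ` ?B \<subseteq> ?S" by blast
  then show ?thesis unfolding image .
qed

lemma boundary_covered_by_facets:
  assumes e: "e \<in> C" and x: "x \<in> X closure_of e - e"
  obtains c where "c \<in> C" "Suc (cell_dim c) = cell_dim e" "c \<inter> (X closure_of e - e) \<noteq> {}" "x \<in> X closure_of c"
proof -
  let ?S = "X closure_of e - e"
  let ?facets = "{c \<in> C. Suc (cell_dim c) = cell_dim e \<and> c \<inter> ?S \<noteq> {}}"
  let ?A = "\<Union>c\<in>?facets. X closure_of c"
  have "x \<in> ?A"
  proof (rule ccontr)
    assume xA: "x \<notin> ?A"
    obtain \<Phi> where cell_e: "cell X (cell_dim e) e \<Phi>" using cellI[OF e] ..
    have "closedin X ?A" using finite_C by (intro closedin_Union) auto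
    then have "closedin (subtopology X ?S) (?S \<inter> ?A)" by (rule closedin_subtopology_Int_closed)
    moreover have "?S \<subseteq> topspace X" using closure_of_subset_topspace[of X e] by blast
    ultimately have open_rest: "openin (subtopology X ?S) (?S - ?A)"
      using openin_diff[OF openin_topspace[of "subtopology X ?S"], of "?S \<inter> ?A"]
        by (simp add: inf.absorb2 Diff_Int)
    let ?M = "{c \<in> C. c \<inter> (?S - ?A) \<noteq> {}}"
    obtain d where d: "d \<in> C" "x \<in> d" using low[OF e] x by blast
    then have "?M \<noteq> {}" using x xA by blast
    then obtain c where c: "c \<in> ?M" "\<And>d. d \<in> ?M \<Longrightarrow> cell_dim d \<le> cell_dim c"
      using finite_max_ex[of ?M cell_dim] finite_C by auto
    have "?S - ?A \<subseteq> \<Union>{d \<in> C. cell_dim d \<le> cell_dim c}"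
    proof
      fix y assume y: "y \<in> ?S - ?A"
      then obtain d where d: "d \<in> C" "y \<in> d" using low[OF e] by auto
      then have "d \<in> ?M" using y by auto
      then show "y \<in> \<Union>{d \<in> C. cell_dim d \<le> cell_dim c}" using c(2) d by auto
    qed
    then have opened: "openin (subtopology X ?S) ((?S - ?A) \<inter> c)"
      using open_top[OF _ _ open_rest] c(1) by blast
    obtain y where y: "y \<in> c" "y \<in> ?S" "y \<notin> ?A" "c \<in> C" using c(1) by auto
    obtain \<Psi> where cell_c: "cell X (cell_dim c) c \<Psi>" using cellI[OF y(4)] ..
    have "cell_dim e = Suc (cell_dim c)"
      by (rule open_piece_dim[OF cell_e cell_c boundary_dim[OF e y(4,1,2)] opened]) (use y in auto)
    then have "c \<in> ?facets" using y by auto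
    moreover have "y \<in> X closure_of c" using e_closure[OF y(4)] y(1) by auto
    ultimately show False using y(3) by auto
  qed
  then show ?thesis using that by blast
qed

lemma boundary_contains_cell:
  "e \<in> C \<Longrightarrow> c \<in> C \<Longrightarrow> c \<inter> (X closure_of e - e) \<noteq> {} \<Longrightarrow> c \<subseteq> X closure_of e - e"
proof (induction "cell_dim e" arbitrary: e c rule: less_induct)
  case less
  let ?S = "X closure_of e - e"
  obtain \<Phi> where "cell X (cell_dim e) e \<Phi>" using cellI[OF less.prems(1)] ..
  then interpret e: cell X "cell_dim e" e \<Phi> .
  obtain x where x: "x \<in> c" "x \<in> ?S" using less.prems(3) by auto
  obtain d where d: "d \<in> C" "Suc (cell_dim d) = cell_dim e" "d \<inter> ?S \<noteq> {}" "x \<in> X closure_of d"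
    by (rule boundary_covered_by_facets[OF less.prems(1) x(2)])
  have dS: "d \<subseteq> ?S" by (rule facet_in_boundary[OF less.prems(1) d(1-3)])
  show ?case
  proof (cases "x \<in> d")
    case True
    then show ?thesis using cell_eq[OF less.prems(2) d(1) x(1)] dS by simp
  next
    case False
    have "closedin X ?S" using e.closed_fr unfolding e.fr_closure .
    then have "X closure_of d \<subseteq> ?S" by (rule closure_of_minimal[OF dS])
    moreover have "c \<subseteq> X closure_of d - d"
      by (rule less.hyps[OF _ d(1) less.prems(2)]) (use d x False in auto)
    ultimately show ?thesis by blast
  qed
qed

theorem regular_CW: "regular_CW X C cell_dim"
proof
  show "\<exists>D\<subseteq>C. X closure_of e - e = \<Union>D \<and> (\<forall>d\<in>D. cell_dim d < cell_dim e)" if e: "e \<in> C" for e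
  proof (intro exI[of _ "{c \<in> C. c \<subseteq> X closure_of e - e \<and> c \<inter> (X closure_of e - e) \<noteq> {}}"] conjI ballI)
    show "X closure_of e - e = \<Union>{c \<in> C. c \<subseteq> X closure_of e - e \<and> c \<inter> (X closure_of e - e) \<noteq> {}}"
    proof (intro equalityI subsetI)
      fix x assume x: "x \<in> X closure_of e - e"
      then obtain c where c: "c \<in> C" "x \<in> c" using low[OF e] by auto
      then have "c \<inter> (X closure_of e - e) \<noteq> {}" using x by blast
      then show "x \<in> \<Union>{c \<in> C. c \<subseteq> X closure_of e - e \<and> c \<inter> (X closure_of e - e) \<noteq> {}}"
        using boundary_contains_cell[OF e c(1)] c by blast
    qed blast
  next
    fix d assume d: "d \<in> {c \<in> C. c \<subseteq> X closure_of e - e \<and> c \<inter> (X closure_of e - e) \<noteq> {}}"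
    then obtain x where x: "x \<in> d" "x \<in> X closure_of e - e" by blast
    then obtain c where c: "c \<in> C" "cell_dim c < cell_dim e" "x \<in> c" using low[OF e] by auto
    then have "c = d" using cell_eq[OF c(1) _ c(3) x(1)] d by simp
    then show "cell_dim d < cell_dim e" using c by simp
  qed blast
  show "Hausdorff_space X" by (rule hausdorff)
  show "finite C" by (rule finite_C)
  show "disjoint C" by (rule disjoint_C)
  show "\<exists>\<Phi>. characteristic_map X (cell_dim e) e \<Phi>" if "e \<in> C" for e by (rule cells[OF that])
qed

end

lemma finite_regular_CW_imp_regular_CW:
  assumes "finite_regular_CW X C"
  obtains cell_dim where "regular_CW X C cell_dim"
proof -
  have hausdorff: "Hausdorff_space X" and fin: "finite C" and disjoint_C: "disjoint C"
    and cells: "\<And>e. e \<in> C \<Longrightarrow> \<exists>n \<Phi>. characteristic_map X n e \<Phi> \<and>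
        \<Phi> ` unit_ball_boundary n \<subseteq> \<Union>{c \<in> C. \<exists>m<n. \<exists>\<Psi>. characteristic_map X m c \<Psi>}"
    using assms by (auto simp: finite_regular_CW_def)
  define cell_dim where "cell_dim = (\<lambda>e. SOME n. \<exists>\<Phi>. characteristic_map X n e \<Phi>)"
  have cell_dim: "cell_dim e = n" if "characteristic_map X n e \<Phi>" for n e \<Phi>
  proof -
    have "\<exists>\<Phi>. characteristic_map X (cell_dim e) e \<Phi>"
      unfolding cell_dim_def by (rule someI_ex) (use that in blast)
    then obtain \<Psi> where "cell X (cell_dim e) e \<Psi>" using hausdorff by (auto simp: cell_def)
    moreover have "cell X n e \<Phi>" using that hausdorff by (simp add: cell_def)
    ultimately show ?thesis by (rule cell_dim_unique)
  qed
  have "pre_CW X C cell_dim"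
  proof
    fix e assume e: "e \<in> C"
    obtain n \<Phi> where c: "characteristic_map X n e \<Phi>"
      "\<Phi> ` unit_ball_boundary n \<subseteq> \<Union>{c \<in> C. \<exists>m<n. \<exists>\<Psi>. characteristic_map X m c \<Psi>}" using cells[OF e] by blast
    then show "\<exists>\<Phi>. characteristic_map X (cell_dim e) e \<Phi>" using cell_dim[OF c(1)] by auto
    interpret c: cell X n e \<Phi> using c(1) hausdorff by (simp add: cell_def)
    have "\<Union>{c \<in> C. \<exists>m<n. \<exists>\<Psi>. characteristic_map X m c \<Psi>} \<subseteq> \<Union>{c \<in> C. cell_dim c < cell_dim e}"
      using cell_dim cell_dim[OF c(1)] by fastforce
    from subset_trans[OF c(2) this]
    show "X closure_of e - e \<subseteq> \<Union>{c \<in> C. cell_dim c < cell_dim e}"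
      unfolding c.fr_closure[symmetric] c.fr_def .
  qed (use hausdorff fin disjoint_C in auto)
  then show thesis by (rule that[OF pre_CW.regular_CW])
qed

section \<open>Families of lines\<close>

definition line :: "'p set \<Rightarrow> 'p \<Rightarrow> ('q list \<Rightarrow> real) set" where
  "line A a = (if a \<in> A then {f. \<forall>l. l \<noteq> [] \<longrightarrow> f l = 0} else {0})"

lemma line_entry: "f \<in> line A a \<Longrightarrow> l \<noteq> [] \<Longrightarrow> f l = 0" and line_outside: "f \<in> line A a \<Longrightarrow> a \<notin> A \<Longrightarrow> f = 0"
  by (auto simp: line_def split: if_splits)

lemma subspace_line: "subspace (line A a)"
  by (auto simp: line_def subspace_def scaleR_fun_def)

lemma dim_line: "dim (line A a :: ('q list \<Rightarrow> real) set) = (if a \<in> A then 1 else 0)"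
proof (cases "a \<in> A")
  case True
  let ?f = "(\<lambda>l. if l = [] then 1 else 0) :: 'q list \<Rightarrow> real"
  have "f = f [] *\<^sub>R ?f" if "f \<in> line A a" for f :: "'q list \<Rightarrow> real"
    using line_entry[OF that] by (auto simp: fun_eq_iff scaleR_fun_def)
  then have "line A a \<subseteq> span {?f}" by (metis span_base span_scale singletonI subsetI)
  moreover have "?f \<noteq> 0" using fun_cong[of ?f 0 "[]"] by auto
  moreover have "{?f} \<subseteq> line A a" using True by (auto simp: line_def)
  ultimately have "dim (line A a :: ('q list \<Rightarrow> real) set) = card {?f}"
    by (intro dim_unique[of "{?f}"]) (auto simp: dependent_single)
  then show ?thesis using True by simp
next
  case False
  then show ?thesis by (simp only: line_def dim_zero_space if_False)
qed

lemma (in cell_poset) cm_family_line: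
  assumes A: "A \<subseteq> P" "\<And>a b. a \<in> A \<Longrightarrow> a \<sqsubseteq> b \<Longrightarrow> b \<in> A" and rk_A: "\<And>a. a \<in> A \<Longrightarrow> rk a \<le> m"
    and exact: "\<And>x. x \<in> P \<Longrightarrow> exact_below m {a \<in> A. x \<sqsubseteq> a} rk eps"
  shows "cm_family P le rk eps bot (line A) A m {[] :: 'q list}"
proof unfold_locales
  show "line A a = {0}" if "a \<notin> A \<or> m < rk a" for a using that rk_A[of a] by (auto simp: line_def)
  show "line A b \<subseteq> line A a" if "a \<in> A" "a \<sqsubseteq> b" for a b using that A(2) by (simp add: line_def)
  fix k x and z :: "'p \<Rightarrow> 'q list \<Rightarrow> real"
  assume k: "k < m" and z: "z \<in> chains (line A) k x" and cycle: "boundary A x z = 0"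
  let ?S = "{a \<in> A. x \<sqsubseteq> a}"
  have z_line: "z a \<in> line A a" for a by (rule Pi0_mem[OF z subspace_line])
  have z_nz: "a \<in> ?S \<and> rk a = k" if "z a \<noteq> 0" for a
    using chains_zero[OF z, of a] line_outside[OF z_line, of a] that by auto
  show "\<exists>y\<in>chains (line A) (Suc k) x. boundary A x y = z"
  proof (cases "x \<in> P")
    case False
    then have "z a = 0" for a using z_nz[of a] le_P[of x a] by auto
    then have "z = 0" by auto
    then show ?thesis
      using z cycle unfolding \<open>z = 0\<close> by (intro bexI[of _ 0]) (auto intro: Pi0_I simp: line_def)
  next
    case True
    have boundary_eq: "boundary A x y a l = (if a \<in> ?S then \<Sum>b\<in>?S. eps a b * y b l else 0)"
      if "\<And>b. y b \<noteq> 0 \<Longrightarrow> b \<in> ?S" for y :: "'p \<Rightarrow> 'q list \<Rightarrow> real" and a l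
    proof -
      have "(\<Sum>b\<in>P. eps a b *\<^sub>R y b) = (\<Sum>b\<in>?S. eps a b *\<^sub>R y b)"
        using that A(1) fin by (intro sum.mono_neutral_right) auto
      then show ?thesis by (simp add: boundary_def sum_fun_apply scaleR_fun_def)
    qed
    define \<zeta> where "\<zeta> = (\<lambda>a. z a [])"
    have "\<zeta> \<in> graded_functions ?S rk k"
      using z_nz unfolding \<zeta>_def by (intro graded_functions_I) (metis zero_fun_apply)
    moreover have "incidence_boundary ?S eps \<zeta> = 0"
      using boundary_eq[of z _ "[]"] z_nz cycle by (auto simp: incidence_boundary_def \<zeta>_def fun_eq_iff)
    ultimately obtain \<eta> where \<eta>: "\<eta> \<in> graded_functions ?S rk (Suc k)" "incidence_boundary ?S eps \<eta> = \<zeta>"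
      by (rule exact_below_D[OF exact[OF True] k])
    define y where "y = (\<lambda>a l. if l = ([] :: 'q list) then \<eta> a else 0)"
    have y_nz: "a \<in> ?S \<and> rk a = Suc k" if "y a \<noteq> 0" for a
      using that graded_functions_D[OF \<eta>(1), of a] by (auto simp: y_def fun_eq_iff split: if_splits)
    have "y \<in> chains (line A) (Suc k) x"
      using y_nz by (intro Pi0_I) (auto simp: line_def y_def)
    moreover have "boundary A x y a l = z a l" for a l
      using boundary_eq[of y a l] y_nz fun_cong[OF \<eta>(2), of a] line_entry[OF z_line, of l a]
      by (cases "l = []") (auto simp: y_def incidence_boundary_def \<zeta>_def)
    ultimately show ?thesis by (intro bexI[of _ y] ext) auto
  qed
qed (use A subspace_line line_entry in auto)

lemma (in flag_poset) theta_indicator: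
  assumes A: "A \<subseteq> P" "\<And>a. a \<in> A \<Longrightarrow> rk a \<le> j" "\<And>a. a \<in> P - A \<Longrightarrow> rk a < j"
    and euler: "\<And>a. a \<in> P \<Longrightarrow> (\<Sum>b | b \<in> A \<and> a \<sqsubseteq> b. (-1) ^ (j - rk b)) = (1::int)"
  shows "theta (\<lambda>a. if a \<in> A then 1 else 0) j =
    (\<Sum>a\<in>A. u a * pY ^ (j - rk a)) - pX * (\<Sum>a\<in>P - A. u a * pY ^ (j - 1 - rk a))"
proof -
  let ?q = "\<lambda>a. if a \<in> A then 1 else (0::int)"
  have "dual ?q j a = (\<Sum>b | b \<in> A \<and> a \<sqsubseteq> b. (-1) ^ (j - rk b))" for a
    unfolding dual_def using A(2) finite_filter by (intro sum.mono_neutral_cong_right) auto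
  then have "dual ?q j a = 1" if "a \<in> P" for a using euler[OF that] by simp
  then have "defect ?q j = (\<Sum>a\<in>P - A. u a * pY ^ (j - 1 - rk a))"
    unfolding defect_def using A(3) fin by (intro sum.mono_neutral_cong_right) auto
  moreover have "flag_sum ?q j = (\<Sum>a\<in>A. u a * pY ^ (j - rk a))"
    unfolding flag_sum_def using A(1,2) fin by (intro sum.mono_neutral_cong_right) auto
  ultimately show ?thesis by (simp add: theta_def)
qed

section \<open>Balls\<close>

context regular_CW
begin

lemma euler_ball:
  assumes Y: "face_closed Y" and c: "cell X n b \<Phi>" and cl: "X closure_of b = \<Union>Y"
  shows "(\<Sum>a\<in>Y. (-1) ^ cell_dim a) = (1::int)"
proof -
  interpret c: cell X n b \<Phi> by fact
  have "\<Union>Y \<noteq> {}" using c.e_nonempty c.e_cl unfolding c.cl_closure cl by blast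
  then obtain e where e: "e \<in> Y" by blast
  then have eC: "e \<in> C" using face_closed_subset[OF Y] by blast
  obtain v where v: "below v e" "cell_dim v = 0" using vertex_below[OF eC] .
  have vC: "v \<in> C" using v by (simp add: below_def)
  have vY: "v \<in> Y" using v(1) e Y by (auto simp: below_def face_closed_def)
  obtain x where x: "v = {x}" "X closure_of v = {x}" using vertex[OF vC v(2)] .
  have "boundary_cells v = {}" using boundary_cells_cell_dim[OF vC] v(2) by auto
  then have L: "face_closed {v}" "{v} \<subseteq> Y" using vC vY by (auto simp: face_closed_def)
  have "x \<in> c.cl" unfolding c.cl_closure cl using vY x by auto
  from c.rel_acyclic_point[OF this] have "rel_acyclic X (\<Union>Y) (\<Union>{v})" unfolding c.cl_closure cl x by simp
  from euler_pair[OF Y L this] have "(\<Sum>a\<in>Y-{v}. (-1) ^ cell_dim a) = (0::int)" .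
  then show ?thesis
    using sum.remove[OF finite_face_closed[OF Y] vY, of "\<lambda>a. (-1) ^ cell_dim a :: int"] v(2) by simp
qed

end

locale ball_CW = regular_CW X C cell_dim + ball: cell X n b \<Phi>
  for X :: "'a topology" and C cell_dim n b \<Phi> +
  assumes cover: "ball.cl = \<Union>C"
begin

definition bd_cells :: "'a set set" where "bd_cells = {e \<in> C. e \<subseteq> ball.fr}"
definition int_cells :: "'a set set" where "int_cells = {e \<in> C. \<not> e \<subseteq> ball.fr}"

lemma C_split: "C = bd_cells \<union> int_cells" "bd_cells \<inter> int_cells = {}" "bd_cells \<subseteq> C" "int_cells \<subseteq> C"
  by (auto simp: bd_cells_def int_cells_def)

lemma finite_bd_cells: "finite bd_cells" and finite_int_cells: "finite int_cells"
  using finite_subset[OF _ finite_C] C_split by blast+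

lemma mem_star: "e \<in> C \<Longrightarrow> x \<in> e \<Longrightarrow> x \<notin> \<Union>{d \<in> C. \<not> below e d}"
proof
  assume e: "e \<in> C" "x \<in> e" and "x \<in> \<Union>{d \<in> C. \<not> below e d}"
  then obtain d where d: "d \<in> C" "\<not> below e d" "x \<in> d" by auto
  then have "d = e" using cell_eq[OF d(1) e(1) d(3) e(2)] by simp
  then show False using d(2) below_refl[OF e(1)] by simp
qed

lemma star_fr:
  assumes e: "e \<in> C" "x \<in> e"
  shows "x \<in> ball.fr \<longleftrightarrow> rel_acyclic X (\<Union>C) (\<Union>{d \<in> C. \<not> below e d})"
proof -
  let ?L = "\<Union>{d \<in> C. \<not> below e d}"
  have st: "rel_acyclic X (\<Union>C - {x}) ?L" by (rule rel_acyclic_minus_star[OF face_closed_C e])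
  have L: "?L \<subseteq> \<Union>C - {x}" using mem_star[OF e] by auto
  show ?thesis
  proof
    assume "x \<in> ball.fr"
    then have "rel_acyclic X (\<Union>C) (\<Union>C - {x})" using ball.rel_acyclic_cl_minus[of x] unfolding cover by blast
    then show "rel_acyclic X (\<Union>C) ?L" by (rule rel_acyclic_trans[OF _ st L]) auto
  next
    assume "rel_acyclic X (\<Union>C) ?L"
    from rel_acyclic_left[OF this st L] have h: "rel_acyclic X ball.cl (ball.cl - {x})"
      unfolding cover by auto
    show "x \<in> ball.fr"
    proof (rule ccontr)
      assume "x \<notin> ball.fr"
      moreover have "x \<in> ball.cl" unfolding cover using e by auto
      ultimately have "x \<in> b" unfolding ball.cl_eq by simp
      then show False using ball.not_rel_acyclic_minus_e[of x] h by simp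
    qed
  qed
qed

lemma bd_cells_iff: "e \<in> C \<Longrightarrow> x \<in> e \<Longrightarrow> e \<in> bd_cells \<longleftrightarrow> x \<in> ball.fr"
  using star_fr[of e] by (auto simp: bd_cells_def)

lemma Union_bd_cells: "\<Union>bd_cells = ball.fr"
proof
  show "\<Union>bd_cells \<subseteq> ball.fr" by (auto simp: bd_cells_def)
  show "ball.fr \<subseteq> \<Union>bd_cells"
  proof
    fix x assume x: "x \<in> ball.fr"
    then obtain e where e: "e \<in> C" "x \<in> e" using ball.fr_cl unfolding cover by auto
    then show "x \<in> \<Union>bd_cells" using bd_cells_iff[OF e] x by auto
  qed
qed

lemma face_closed_bd_cells: "face_closed bd_cells"
  unfolding face_closed_def
proof (intro conjI ballI subsetI)
  show "e \<in> bd_cells \<Longrightarrow> e \<in> C" for e by (simp add: bd_cells_def)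
  fix e d assume ed: "e \<in> bd_cells" "d \<in> boundary_cells e"
  then have "X closure_of e \<subseteq> ball.fr"
    using closure_of_minimal[OF _ ball.closed_fr, of e] by (simp add: bd_cells_def)
  then show "d \<in> bd_cells" using ed(2) by (auto simp: boundary_cells_def bd_cells_def)
qed

lemma int_cells_up: "e \<in> int_cells \<Longrightarrow> below e d \<Longrightarrow> d \<in> int_cells"
proof -
  assume e: "e \<in> int_cells" and d: "below e d"
  have "d \<in> C" using d by (simp add: below_def)
  moreover have "d \<notin> bd_cells"
  proof
    assume "d \<in> bd_cells"
    then have "e \<in> bd_cells" using d face_closed_bd_cells by (auto simp: below_def face_closed_def)
    then show False using e by (simp add: bd_cells_def int_cells_def)
  qed
  ultimately show "d \<in> int_cells" by (simp add: bd_cells_def int_cells_def)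
qed

lemma int_cells_point:
  assumes "e \<in> int_cells"
  obtains x where "x \<in> e" "x \<in> b" "e \<in> C"
proof -
  have e: "e \<in> C" "\<not> e \<subseteq> ball.fr" using assms by (auto simp: int_cells_def)
  then obtain x where x: "x \<in> e" "x \<notin> ball.fr" by auto
  have "x \<in> ball.cl" unfolding cover using e x by auto
  then have "x \<in> b" using x unfolding ball.cl_eq by simp
  then show thesis using that x e by blast
qed

lemma rel_acyclic_minus_b: "x \<in> b \<Longrightarrow> rel_acyclic X (\<Union>C - {x}) ball.fr"
proof -
  assume x: "x \<in> b"
  have "ball.fr \<union> b = \<Union>C" using ball.cl_eq cover by blast
  moreover have "ball.fr \<inter> b = {}" using ball.e_fr by blast
  ultimately show ?thesis using ball.rel_acyclic_minus_e[OF ball.closed_fr subset_refl _ x] by simp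
qed

lemma bd_cells_subset_minus_star: "e \<in> int_cells \<Longrightarrow> bd_cells \<subseteq> {d \<in> C. \<not> below e d}"
  using int_cells_up[of e] C_split by blast

lemma rel_acyclic_link:
  assumes "e \<in> int_cells" shows "rel_acyclic X (\<Union>{d \<in> C. \<not> below e d}) ball.fr"
proof -
  obtain x where x: "x \<in> e" "x \<in> b" "e \<in> C" using int_cells_point[OF assms] .
  show ?thesis
  proof (rule rel_acyclic_right[OF rel_acyclic_minus_star[OF face_closed_C x(3,1)] rel_acyclic_minus_b[OF x(2)]])
    show "ball.fr \<subseteq> \<Union>{d \<in> C. \<not> below e d}"
      unfolding Union_bd_cells[symmetric] by (rule Union_mono[OF bd_cells_subset_minus_star[OF assms]])
    show "\<Union>{d \<in> C. \<not> below e d} \<subseteq> \<Union>C - {x}" using mem_star[OF x(3,1)] by auto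
  qed
qed

lemma relboundary_star:
  assumes "e \<in> int_cells" "k \<noteq> n" "relcycle X k (\<Union>C) (\<Union>{d \<in> C. \<not> below e d}) c"
  shows "relboundary X k (\<Union>C) (\<Union>{d \<in> C. \<not> below e d}) c"
proof -
  let ?L = "\<Union>{d \<in> C. \<not> below e d}"
  have fL: "ball.fr \<subseteq> ?L"
    unfolding Union_bd_cells[symmetric] by (rule Union_mono[OF bd_cells_subset_minus_star[OF assms(1)]])
  have LC: "?L \<subseteq> \<Union>C" by auto
  obtain c' where c': "relcycle X k (\<Union>C) ball.fr c'" "relboundary X k (\<Union>C) ?L (c - c')"
    using relcycle_lift[OF rel_acyclic_link[OF assms(1)] fL LC assms(3)] .
  have "relboundary X k (\<Union>C) ball.fr c'" using ball.relboundary_cl[OF assms(2), unfolded cover, OF c'(1)] .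
  then have "relboundary X k (\<Union>C) ?L c'" by (rule relboundary_mono) (use fL in auto)
  from relboundary_add[OF c'(2) this] show ?thesis by simp
qed

lemma maximal_cell:
  assumes e: "e \<in> C" "\<And>d. d \<in> C \<Longrightarrow> cell_dim d \<le> cell_dim e"
  shows "{d \<in> C. \<not> below e d} = C - {e}" "rel_generator X (cell_dim e) (\<Union>C) (\<Union>(C - {e})) (cell_gen e)"
proof -
  have "d = e" if "d \<in> C" "below e d" for d
    using below_cell_dim[OF that(2)] e(2)[OF that(1)] by fastforce
  then show star: "{d \<in> C. \<not> below e d} = C - {e}" using below_refl[OF e(1)] by blast
  have "face_closed (C - {e})" using face_closed_minus_star[OF face_closed_C, of e] unfolding star .
  moreover have "boundary_cells e \<subseteq> C - {e}"
    using boundary_cells_cell_dim[OF e(1)] boundary_cells_subset[of e] by auto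
  moreover have "\<Union>(C - {e}) \<union> e = \<Union>C" using e(1) by auto
  ultimately show "rel_generator X (cell_dim e) (\<Union>C) (\<Union>(C - {e})) (cell_gen e)"
    using attach_rel_generator[OF _ e(1) _ _ rel_generator_cell_gen[OF e(1)]] by (metis DiffD2 insertI1)
qed

lemma
  assumes e: "e \<in> C" "\<And>d. d \<in> C \<Longrightarrow> cell_dim d \<le> cell_dim e"
  shows maximal_cell_interior: "e \<in> int_cells" and maximal_cell_dim: "cell_dim e = n"
proof -
  have star: "{d \<in> C. \<not> below e d} = C - {e}" using maximal_cell(1) e by blast
  have cycle: "relcycle X (cell_dim e) (\<Union>C) (\<Union>(C - {e})) (cell_gen e)"
    and not_bound: "\<not> relboundary X (cell_dim e) (\<Union>C) (\<Union>(C - {e})) (cell_gen e)"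
    using maximal_cell(2) e rel_generator_relcycle rel_generator_not_relboundary by blast+
  obtain x where x: "x \<in> e" using cell_ne[OF e(1)] by auto
  have "\<not> rel_acyclic X (\<Union>C) (\<Union>(C - {e}))" using rel_acyclicD[OF _ cycle] not_bound by blast
  then have "e \<notin> bd_cells" using bd_cells_iff[OF e(1) x] star_fr[OF e(1) x] unfolding star by blast
  then show int_cells: "e \<in> int_cells" using e(1) C_split(1) by blast
  show "cell_dim e = n"
    using relboundary_star[OF int_cells, of "cell_dim e", unfolded star, OF _ cycle] not_bound by blast
qed

lemma exists_top: "\<exists>e\<in>C. cell_dim e = n"
  and cell_dim_le: "e \<in> C \<Longrightarrow> cell_dim e \<le> n"
  and cell_dim_bd_cells: "e \<in> bd_cells \<Longrightarrow> cell_dim e < n"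
proof -
  have "\<Union>C \<noteq> {}" using ball.e_nonempty ball.e_cl unfolding cover by blast
  then have "C \<noteq> {}" by auto
  then obtain t where t: "t \<in> C" "\<And>d. d \<in> C \<Longrightarrow> cell_dim d \<le> cell_dim t"
    using finite_max_ex[OF finite_C, of cell_dim] by blast
  show "\<exists>e\<in>C. cell_dim e = n" using t(1) maximal_cell_dim[OF t] by blast
  show le: "cell_dim e \<le> n" if "e \<in> C" for e using t(2)[OF that] maximal_cell_dim[OF t] by simp
  show "cell_dim e < n" if "e \<in> bd_cells"
  proof (rule ccontr)
    assume "\<not> cell_dim e < n"
    moreover have e: "e \<in> C" using that by (simp add: bd_cells_def)
    ultimately have "cell_dim e = n" using le[OF e] by simp
    then have "e \<in> int_cells" using maximal_cell_interior[OF e] le by simp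
    then show False using that C_split by blast
  qed
qed

lemma b_notin_bd_cells: "b \<notin> bd_cells"
  using ball.e_nonempty ball.e_fr by (auto simp: bd_cells_def)

text \<open>Merging all interior cells turns the Euler characteristics of stars in the boundary into those of intervals.\<close>

lemma coarse: "regular_CW X (insert b bd_cells) (cell_dim(b := n))"
proof
  show "Hausdorff_space X" by (rule hausdorff)
  show "finite (insert b bd_cells)" using finite_bd_cells by simp
  have "b \<inter> e = {}" if "e \<in> bd_cells" for e using that ball.e_fr by (auto simp: bd_cells_def)
  moreover have "disjoint bd_cells" using disjoint_C C_split(3) by (auto simp: disjoint_def)
  ultimately show "disjoint (insert b bd_cells)" by (auto simp: disjoint_def)
  show "\<exists>\<Phi>. characteristic_map X ((cell_dim(b := n)) e) e \<Phi>" if "e \<in> insert b bd_cells" for e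
  proof (cases "e = b")
    case True then show ?thesis using ball.char by auto
  next
    case False
    then have "e \<in> C" using that C_split(3) by auto
    then show ?thesis using cells[of e] False by simp
  qed
  show "\<exists>D\<subseteq>insert b bd_cells. X closure_of e - e = \<Union>D \<and> (\<forall>d\<in>D. (cell_dim(b := n)) d < (cell_dim(b := n)) e)"
    if "e \<in> insert b bd_cells" for e
  proof (cases "e = b")
    case True
    have "X closure_of b - b = \<Union>bd_cells" using Union_bd_cells ball.fr_closure by simp
    moreover have "(cell_dim(b := n)) d < (cell_dim(b := n)) b" if "d \<in> bd_cells" for d
      using cell_dim_bd_cells[OF that] b_notin_bd_cells that by auto
    ultimately show ?thesis unfolding True by (intro exI[of _ bd_cells]) auto
  next
    case False
    then have e: "e \<in> bd_cells" "e \<in> C" using that C_split(3) by auto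
    have "boundary_cells e \<subseteq> bd_cells" using face_closed_bd_cells e(1) by (auto simp: face_closed_def)
    moreover have "(cell_dim(b := n)) d < (cell_dim(b := n)) e" if "d \<in> boundary_cells e" for d
      using boundary_cells_cell_dim[OF e(2) that] calculation b_notin_bd_cells that False by auto
    ultimately show ?thesis using Union_boundary_cells[OF e(2)] by (intro exI[of _ "boundary_cells e"]) auto
  qed
qed

lemma coarse_closure: "X closure_of b = \<Union>(insert b bd_cells)"
  using ball.cl_closure ball.cl_eq Union_bd_cells by auto

lemma coarse_sum: "S \<subseteq> bd_cells \<Longrightarrow> (\<Sum>d\<in>insert b S. (-1) ^ (cell_dim(b := n)) d)
  = (-1) ^ n + (\<Sum>d\<in>S. (-1) ^ cell_dim d :: int)"
  using b_notin_bd_cells finite_subset[OF _ finite_bd_cells, of S]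
    by (subst sum.insert) (auto intro!: sum.cong)

lemma euler_bd_cells: "(\<Sum>d\<in>bd_cells. (-1) ^ cell_dim d) = (1 - (-1) ^ n :: int)"
proof -
  interpret coarse: regular_CW X "insert b bd_cells" "cell_dim(b := n)" by (rule coarse)
  have "(\<Sum>a\<in>insert b bd_cells. (-1) ^ (cell_dim(b := n)) a) = (1::int)"
    by (rule coarse.euler_ball[OF coarse.face_closed_C ball.cell_axioms coarse_closure])
  then show ?thesis unfolding coarse_sum[OF subset_refl] by simp
qed

lemma euler_bd_cells_star:
  assumes a: "a \<in> bd_cells" shows "(\<Sum>d | d \<in> bd_cells \<and> below a d. (-1) ^ cell_dim d) = - ((-1) ^ n :: int)"
proof -
  interpret coarse: regular_CW X "insert b bd_cells" "cell_dim(b := n)" by (rule coarse)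
  have aC: "a \<in> C" "a \<in> insert b bd_cells" "b \<in> insert b bd_cells" using a C_split(3) by auto
  have ab: "a \<noteq> b" using a b_notin_bd_cells by auto
  have below_b: "coarse.below d b" if "d \<in> insert b bd_cells" for d
  proof -
    have "d \<subseteq> X closure_of b" unfolding coarse_closure using that by blast
    then have "X closure_of d \<subseteq> X closure_of b" using closure_of_minimal[of d "X closure_of b" X] by simp
    then show ?thesis using coarse.below_closure[OF that aC(3)] by simp
  qed
  have all: "{d. coarse.below d b} = insert b bd_cells" using below_b by (auto simp: coarse.below_def)
  have "(\<Sum>d\<in>insert b bd_cells - {d \<in> insert b bd_cells. \<not> coarse.below a d}. (-1) ^ (cell_dim(b := n)) d) = (0::int)"
    using coarse.euler_pair[OF coarse.face_closed_below coarse.face_closed_minus_star[OF coarse.face_closed_below] _ coarse.interval_rel_acyclic[OF below_b[OF aC(2)] ab]]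
    unfolding all by blast
  moreover have "insert b bd_cells - {d \<in> insert b bd_cells. \<not> coarse.below a d}
    = insert b {d. d \<in> bd_cells \<and> below a d}"
    using below_b[OF aC(2)] coarse.below_closure[OF aC(2)] below_closure[OF aC(1)] C_split(3) by auto
  moreover have "{d. d \<in> bd_cells \<and> below a d} \<subseteq> bd_cells" by blast
  ultimately show ?thesis using coarse_sum[of "{d. d \<in> bd_cells \<and> below a d}"] by simp
qed

lemma sum_C_split:
  fixes f :: "'a set \<Rightarrow> int"
  shows "(\<Sum>d | d \<in> C \<and> P d. f d) = (\<Sum>d | d \<in> bd_cells \<and> P d. f d) + (\<Sum>d | d \<in> int_cells \<and> P d. f d)"
proof -
  have "{d. d \<in> C \<and> P d} = {d. d \<in> bd_cells \<and> P d} \<union> {d. d \<in> int_cells \<and> P d}" using C_split by blast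
  then show ?thesis using finite_bd_cells finite_int_cells C_split(2)
    by (simp only:) (intro sum.union_disjoint, auto)
qed

lemma euler_int_cells: "(\<Sum>d\<in>int_cells. (-1) ^ cell_dim d) = ((-1) ^ n :: int)"
proof -
  have "(\<Sum>d\<in>C. (-1) ^ cell_dim d) = (1::int)"
    by (rule euler_ball[OF face_closed_C ball.cell_axioms]) (use ball.cl_closure cover in simp)
  then show ?thesis using sum_C_split[where P="\<lambda>_. True" and f="\<lambda>d. (-1) ^ cell_dim d"] euler_bd_cells by simp
qed

lemma euler_boundary_star:
  assumes a: "a \<in> bd_cells" shows "(\<Sum>d | d \<in> int_cells \<and> below a d. (-1) ^ cell_dim d) = ((-1) ^ n :: int)"
proof -
  have aC: "a \<in> C" using a C_split(3) by auto
  obtain x where x: "x \<in> a" using cell_ne[OF aC] by auto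
  have "rel_acyclic X (\<Union>C) (\<Union>{d \<in> C. \<not> below a d})" using bd_cells_iff[OF aC x] star_fr[OF aC x] a by simp
  from euler_pair[OF face_closed_C face_closed_minus_star[OF face_closed_C] _ this]
  have "(\<Sum>d\<in>C - {d \<in> C. \<not> below a d}. (-1) ^ cell_dim d) = (0::int)" by auto
  moreover have "C - {d \<in> C. \<not> below a d} = {d. d \<in> C \<and> below a d}" by auto
  ultimately show ?thesis
    using sum_C_split[where P="below a" and f="\<lambda>d. (-1) ^ cell_dim d"] euler_bd_cells_star[OF a] by simp
qed

lemma euler_interior_star:
  assumes a: "a \<in> int_cells" shows "(\<Sum>d | d \<in> int_cells \<and> below a d. (-1) ^ cell_dim d) = ((-1) ^ n :: int)"
proof -
  let ?L = "{d \<in> C. \<not> below a d}" and ?S = "{d. d \<in> int_cells \<and> below a d}"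
  have "rel_acyclic X (\<Union>?L) (\<Union>bd_cells)" using rel_acyclic_link[OF a] unfolding Union_bd_cells .
  then have "(\<Sum>d\<in>?L - bd_cells. (-1) ^ cell_dim d) = (0::int)"
    by (rule euler_pair[OF face_closed_minus_star[OF face_closed_C] face_closed_bd_cells bd_cells_subset_minus_star[OF a]])
  moreover have "(\<Sum>d\<in>?S \<union> (?L - bd_cells). (-1) ^ cell_dim d)
    = (\<Sum>d\<in>?S. (-1) ^ cell_dim d) + (\<Sum>d\<in>?L - bd_cells. (-1) ^ cell_dim d :: int)"
    by (rule sum.union_disjoint) (use finite_int_cells finite_C in auto)
  moreover have "?S \<union> (?L - bd_cells) = int_cells" using C_split by auto
  ultimately show ?thesis using euler_int_cells by simp
qed

lemma euler_interior:
  assumes "a \<in> insert {} C"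
  shows "(\<Sum>d | d \<in> int_cells \<and> face_le a d. (-1) ^ cell_dim d) = ((-1) ^ n :: int)"
proof (cases "a = {}")
  case True
  then have "{d. d \<in> int_cells \<and> face_le a d} = int_cells" using C_split(4) by (auto simp: face_le_def)
  then show ?thesis using euler_int_cells by simp
next
  case False
  then have "face_le a d \<longleftrightarrow> below a d" for d by (simp add: face_le_def)
  then show ?thesis using euler_boundary_star[of a] euler_interior_star[of a] assms False C_split(1) by auto
qed

lemma relboundary_fr: "k \<noteq> n \<Longrightarrow> relcycle X k (\<Union>C) (\<Union>bd_cells) c \<Longrightarrow> relboundary X k (\<Union>C) (\<Union>bd_cells) c"
  using ball.relboundary_cl[of k c] unfolding cover Union_bd_cells .

lemma relboundary_bd_cells_star:
  assumes a: "a \<in> bd_cells" and k: "Suc k < n"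
    and c: "relcycle X k (\<Union>bd_cells) (\<Union>{d \<in> bd_cells. \<not> below a d}) c"
  shows "relboundary X k (\<Union>bd_cells) (\<Union>{d \<in> bd_cells. \<not> below a d}) c"
proof -
  let ?L = "\<Union>{d \<in> bd_cells. \<not> below a d}"
  have aC: "a \<in> C" using a C_split(3) by auto
  obtain x where x: "x \<in> a" using cell_ne[OF aC] by auto
  have xf: "x \<in> ball.fr" using bd_cells_iff[OF aC x] a by simp
  have L: "?L \<subseteq> ball.fr - {x}" using mem_star[OF aC x] C_split(3) Union_bd_cells by auto
  note c_fr = c[unfolded Union_bd_cells]
  have c_punctured: "relcycle X k ball.fr (ball.fr - {x}) c" by (rule relcycle_mono[OF c_fr subset_refl L])
  have "rel_acyclic X (ball.cl - {x}) (ball.fr - {x})"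
    using ball.rel_acyclic_minus_fr[OF ball.closed_fr subset_refl _ xf] ball.e_fr
      unfolding ball.fr_Un_e by blast
  then have "rel_acyclic X ball.cl (ball.fr - {x})"
    by (rule rel_acyclic_trans[OF ball.rel_acyclic_cl_minus[OF xf]]) (use ball.fr_cl in auto)
  then have "relboundary X k ball.cl (ball.fr - {x}) c"
    by (rule rel_acyclicD) (rule relcycle_mono[OF c_punctured ball.fr_cl subset_refl])
  moreover have "relboundary X (Suc k) ball.cl ball.fr d" if "relcycle X (Suc k) ball.cl ball.fr d" for d
    by (rule ball.relboundary_cl[OF _ that]) (use k in simp)
  ultimately have "relboundary X k ball.fr (ball.fr - {x}) c"
    using relboundary_restrict[of X k ball.cl ball.fr "ball.fr - {x}" c] c_punctured
      unfolding relcycle_def by blast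
  moreover have "rel_acyclic X (ball.fr - {x}) ?L"
    using rel_acyclic_minus_star[OF face_closed_bd_cells a x] unfolding Union_bd_cells .
  ultimately have "relboundary X k ball.fr ?L c" using relboundary_lift[OF rel_acyclicD _ c_fr] by blast
  then show ?thesis unfolding Union_bd_cells .
qed

lemma face_closed_interior_star_complement: "face_closed (C - {a \<in> int_cells. face_le x a})"
proof -
  have "d \<notin> {a \<in> int_cells. face_le x a}" if e: "e \<in> C" "e \<notin> {a \<in> int_cells. face_le x a}"
    and d: "d \<in> boundary_cells e" for d e
  proof
    assume star: "d \<in> {a \<in> int_cells. face_le x a}"
    have de: "below d e" using d e(1) boundary_cells_subset by (auto simp: below_def)
    have "face_le x e" using star de below_trans[of x d e] e(1) by (auto simp: face_le_def)
    then show False using e int_cells_up[OF _ de] star by blast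
  qed
  then show ?thesis using boundary_cells_subset by (auto simp: face_closed_def)
qed

lemma incidence_interior_star: "incidence {a \<in> int_cells. face_le x a} cell_dim inc"
proof -
  have "C - (C - {a \<in> int_cells. face_le x a}) = {a \<in> int_cells. face_le x a}" using C_split(4) by blast
  then show ?thesis
    using incidence_cells[OF face_closed_C face_closed_interior_star_complement Diff_subset] by metis
qed

lemma exact_interior_boundary_star:
  assumes x: "x \<in> bd_cells" shows "exact_below n {a \<in> int_cells. below x a} cell_dim inc"
proof -
  let ?L = "{d \<in> C. \<not> below x d}" and ?M = "{d \<in> bd_cells. \<not> below x d}"
  have xC: "x \<in> C" using x C_split(3) by auto
  obtain p where p: "p \<in> x" using cell_ne[OF xC] by auto
  have "rel_acyclic X (\<Union>C) (\<Union>?L)" using star_fr[OF xC p] bd_cells_iff[OF xC p] x by simp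
  then have star: "exact_below n (C - ?L) cell_dim inc"
    by (intro cellular_exact[OF face_closed_C face_closed_minus_star[OF face_closed_C]] rel_acyclicD) auto
  have boundary_star: "exact_below (n - 1) (bd_cells - ?M) cell_dim inc"
    by (rule cellular_exact[OF face_closed_bd_cells face_closed_minus_star[OF face_closed_bd_cells]])
      (use relboundary_bd_cells_star[OF x] in auto)
  interpret incidence_pair "C - ?L" cell_dim inc "bd_cells - ?M"
  proof (intro incidence_pair.intro incidence_pair_axioms.intro)
    show "incidence (C - ?L) cell_dim inc"
      by (rule incidence_cells[OF face_closed_C face_closed_minus_star[OF face_closed_C]]) auto
    show "bd_cells - ?M \<subseteq> C - ?L" using C_split(3) by auto
    show "inc a d = 0" if "a \<in> C - ?L - (bd_cells - ?M)" "d \<in> bd_cells - ?M" for a d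
    proof (rule ccontr)
      assume "inc a d \<noteq> 0"
      then have "below a d" using inc_nz[of a d] by (auto simp: below_def)
      moreover have "a \<in> int_cells" using that(1) C_split(1) by auto
      ultimately show False using int_cells_up that(2) C_split(2) by blast
    qed
  qed
  have "C - ?L - (bd_cells - ?M) = {a \<in> int_cells. below x a}" using C_split by blast
  then show ?thesis using exact_quotient[OF star boundary_star] by simp
qed

lemma exact_interior_star:
  assumes "x \<in> insert {} C" shows "exact_below n {a \<in> int_cells. face_le x a} cell_dim inc"
proof -
  consider "x = {}" | "x \<in> bd_cells" | "x \<in> int_cells" using assms C_split by blast
  then show ?thesis
  proof cases
    case 1
    have "exact_below n (C - bd_cells) cell_dim inc"
      by (rule cellular_exact[OF face_closed_C face_closed_bd_cells C_split(3) relboundary_fr]) auto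
    moreover have "C - bd_cells = {a \<in> int_cells. face_le x a}" using C_split 1 by (auto simp: face_le_def)
    ultimately show ?thesis by simp
  next
    case 2
    then have "x \<noteq> {}" using C_split(3) empty_C by blast
    then show ?thesis using exact_interior_boundary_star[OF 2] by (simp add: face_le_def)
  next
    case 3
    then have "x \<noteq> {}" using C_split(4) empty_C by blast
    then have "C - {d \<in> C. \<not> below x d} = {a \<in> int_cells. face_le x a}"
      using int_cells_up[OF 3] C_split(4) by (auto simp: face_le_def)
    moreover have "exact_below n (C - {d \<in> C. \<not> below x d}) cell_dim inc"
      by (rule cellular_exact[OF face_closed_C face_closed_minus_star[OF face_closed_C] _ relboundary_star[OF 3]]) auto
    ultimately show ?thesis by simp
  qed
qed

lemma interior_rank: "a \<in> int_cells \<Longrightarrow> cell_rank a = Suc (cell_dim a)"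
  using C_split(4) empty_C by (auto simp: cell_rank_def)

theorem interior_cm_family:
  "cm_family (insert {} C) face_le cell_rank (\<lambda>a b. real_of_int (aug_inc a b)) {} (line int_cells) int_cells (Suc n) {[]}"
proof -
  interpret p: cell_poset "insert {} C" face_le cell_rank "\<lambda>a b. real_of_int (aug_inc a b)" "{}"
    by (rule cell_poset)
  show ?thesis
  proof (rule p.cm_family_line)
    show "int_cells \<subseteq> insert {} C" using C_split(4) by auto
    show "d \<in> int_cells" if "a \<in> int_cells" "face_le a d" for a d
      using that int_cells_up[of a d] C_split(4) empty_C by (auto simp: face_le_def)
    show "cell_rank a \<le> Suc n" if "a \<in> int_cells" for a
      using that cell_dim_le[of a] interior_rank C_split(4) by auto
    show "exact_below (Suc n) {a \<in> int_cells. face_le x a} cell_rank (\<lambda>a b. real_of_int (aug_inc a b))"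
      if x: "x \<in> insert {} C" for x
      by (rule exact_below_shift[OF exact_below_of_int[OF incidence_interior_star exact_interior_star[OF x]]])
        (use interior_rank C_split(4) empty_C in \<open>auto simp: aug_inc_def\<close>)
  qed
qed

theorem interior_gamma:
  fixes u :: "'a set \<Rightarrow> int poly"
  assumes u0: "u {} = 1"
    and u: "\<And>a. a \<in> C \<Longrightarrow> u a = pX * (\<Sum>d | face_le d a \<and> d \<noteq> a. u d * pY ^ (cell_rank a - 1 - cell_rank d))"
  shows "gamma_nonneg (Suc n) ((\<Sum>a\<in>int_cells. u a * pY ^ (Suc n - cell_rank a)) - pX * (\<Sum>a\<in>insert {} bd_cells. u a * pY ^ (n - cell_rank a)))"
proof -
  interpret p: flag_poset "insert {} C" face_le cell_rank "\<lambda>a b. real_of_int (aug_inc a b)" "{}" u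
    using cell_poset u0 u by (auto simp: flag_poset_def flag_poset_axioms_def)
  have "(\<Sum>d | d \<in> int_cells \<and> face_le a d. (-1) ^ (Suc n - cell_rank d)) = (1::int)" if a: "a \<in> insert {} C"
    for a
  proof -
    have "(-1::int) ^ (Suc n - cell_rank d) = (-1) ^ n * (-1) ^ cell_dim d" if "d \<in> int_cells" for d
      using that cell_dim_le[of d] C_split(4) interior_rank[OF that] neg_one_power_add_eq_neg_one_power_diff[of "cell_dim d" n, where 'a=int]
      by (auto simp: power_add)
    then have "(\<Sum>d | d \<in> int_cells \<and> face_le a d. (-1::int) ^ (Suc n - cell_rank d))
      = (-1) ^ n * (\<Sum>d | d \<in> int_cells \<and> face_le a d. (-1) ^ cell_dim d)"
      unfolding sum_distrib_left by (intro sum.cong) auto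
    then show ?thesis unfolding euler_interior[OF a] by (simp add: power_add[symmetric] mult_2[symmetric])
  qed
  then have "p.theta (\<lambda>a. if a \<in> int_cells then 1 else 0) (Suc n) =
      (\<Sum>a\<in>int_cells. u a * pY ^ (Suc n - cell_rank a)) - pX * (\<Sum>a\<in>insert {} C - int_cells. u a * pY ^ (Suc n - 1 - cell_rank a))"
  proof (rule p.theta_indicator[rotated 3])
    show "cell_rank a \<le> Suc n" if "a \<in> int_cells" for a
      using that cell_dim_le[of a] interior_rank C_split(4) by auto
    show "cell_rank a < Suc n" if "a \<in> insert {} C - int_cells" for a
      using that cell_dim_bd_cells[of a] C_split(1) by (auto simp: cell_rank_def)
  qed (use C_split(4) in auto)
  moreover have "insert {} C - int_cells = insert {} bd_cells" using C_split empty_C by auto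
  moreover have "int (dim (line int_cells a :: ('a set list \<Rightarrow> real) set)) = (if a \<in> int_cells then 1 else 0)"
    for a by (simp add: dim_line)
  ultimately show ?thesis using p.theta_gamma_nonneg[OF interior_cm_family] by simp
qed

end

section \<open>Barycentric subdivisions\<close>

lemma (in cell_poset) obtain_facet:
  assumes t: "t \<in> P" "t \<noteq> bot"
  obtains r where "r \<sqsubseteq> t" "rk t = Suc (rk r)"
proof -
  have "bot \<sqsubseteq> t" by (rule bot_le[OF t(1)])
  then obtain s where s: "contraction_below (Suc (rk t)) (interval bot t) rk eps s"
    using interval_contraction t(2) by metis
  have "t \<in> interval bot t" using \<open>bot \<sqsubseteq> t\<close> le_refl[OF t(1)] by simp
  from contraction_below_eq[OF s this this]
  have "(\<Sum>c\<in>interval bot t. s t c * eps c t + eps t c * s c t) \<noteq> 0" by simp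
  then obtain c where c: "c \<sqsubseteq> t" "s t c * eps c t + eps t c * s c t \<noteq> 0"
    by (metis (no_types, lifting) mem_Collect_eq sum.neutral)
  have "eps t c = 0" using eps_le[of t c] rk_mono[OF c(1)] by fastforce
  with c(2) have "eps c t \<noteq> 0" by auto
  then show ?thesis using that[of c] eps_le[of c t] by blast
qed

lemma chain_maxI:
  assumes "c \<in> sd X S" "t \<in> c" "\<And>r. r \<in> c \<Longrightarrow> r = t \<or> face_less X r t"
  shows "chain_max X c = t"
proof (rule ccontr)
  assume ne: "chain_max X c \<noteq> t"
  have "c \<noteq> {}" using assms(2) by auto
  note m = chain_max_works[OF assms(1) this]
  have "face_less X (chain_max X c) t" using assms(3)[of "chain_max X c"] m ne by auto
  moreover have "face_less X t (chain_max X c)" using m assms(2) ne by auto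
  ultimately show False by (auto simp: face_less_def)
qed

context regular_CW
begin

lemma face_less_iff: "a \<in> C \<Longrightarrow> d \<in> C \<Longrightarrow> face_less X a d \<longleftrightarrow> face_le a d \<and> a \<noteq> d"
proof -
  assume ad: "a \<in> C" "d \<in> C"
  have ne: "a \<noteq> {}" using ad empty_C by auto
  have "X closure_of a = X closure_of d \<Longrightarrow> a = d"
  proof (rule ccontr)
    assume "X closure_of a = X closure_of d" "a \<noteq> d"
    then have "below a d" "below d a" using below_closure ad by auto
    then show False using below_cell_dim[of a d] below_cell_dim[of d a] \<open>a \<noteq> d\<close> by auto
  qed
  then show ?thesis using below_closure[OF ad] ne by (auto simp: face_less_def face_le_def)
qed

definition chains_with_max :: "'a set \<Rightarrow> 'a set set set" where
  "chains_with_max t = {c \<in> sd X (insert {} C). chain_max X c = t}"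

definition flag_poly :: "'a set \<Rightarrow> int poly" where
  "flag_poly t = (\<Sum>c\<in>chains_with_max t. pX ^ card c * pY ^ (cell_rank t - card c))"

lemma sd_iff: "c \<in> sd X (insert {} C) \<longleftrightarrow>
  c \<subseteq> C \<and> (\<forall>a\<in>c. \<forall>d\<in>c. a \<noteq> d \<longrightarrow> face_le a d \<or> face_le d a)"
proof -
  have "insert {} C - {{}} = C" using empty_C by auto
  moreover have "finite c" if "c \<subseteq> C" using finite_subset[OF that finite_C] .
  moreover have "pairwise (\<lambda>a d. face_less X a d \<or> face_less X d a) c \<longleftrightarrow>
      (\<forall>a\<in>c. \<forall>d\<in>c. a \<noteq> d \<longrightarrow> face_le a d \<or> face_le d a)" if "c \<subseteq> C"
    unfolding pairwise_def
  proof (intro ball_cong refl)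
    fix a d assume "a \<in> c" "d \<in> c"
    then have "a \<in> C" "d \<in> C" using that by auto
    then show "(a \<noteq> d \<longrightarrow> face_less X a d \<or> face_less X d a) = (a \<noteq> d \<longrightarrow> face_le a d \<or> face_le d a)"
      using face_less_iff[of a d] face_less_iff[of d a] by auto
  qed
  ultimately show ?thesis unfolding sd_def by auto
qed

lemma finite_sd: "finite (sd X (insert {} C))"
  by (rule finite_subset[of _ "Pow C"]) (auto simp: sd_iff finite_C)

lemma finite_chains_with_max: "finite (chains_with_max t)"
  using finite_sd by (simp add: chains_with_max_def)

lemma chains_with_max_empty: "chains_with_max {} = {{}}"
proof -
  have A: "c = {}" if c: "c \<in> sd X (insert {} C)" "chain_max X c = {}" for c
  proof (rule ccontr)
    assume "c \<noteq> {}"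
    then have "{} \<in> c" using chain_max_works[OF c(1)] c(2) by auto
    then show False using c(1) empty_C by (auto simp: sd_iff)
  qed
  have "{} \<in> sd X (insert {} C)" "chain_max X {} = {}" by (simp_all add: sd_iff chain_max_def)
  then show ?thesis using A by (auto simp: chains_with_max_def)
qed

lemma chains_with_max_iff:
  assumes "t \<in> C"
  shows "c \<in> chains_with_max t \<longleftrightarrow> c \<in> sd X (insert {} C) \<and> t \<in> c \<and> (\<forall>r\<in>c. face_le r t)"
proof
  assume "c \<in> chains_with_max t"
  then have c: "c \<in> sd X (insert {} C)" "chain_max X c = t" by (auto simp: chains_with_max_def)
  have "c \<noteq> {}" using c(2) assms empty_C by (auto simp: chain_max_def)
  note m = chain_max_works[OF c(1) this, unfolded c(2)]
  have cC: "c \<subseteq> C" using c(1) by (simp add: sd_iff)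
  have "face_le r t" if "r \<in> c" for r
  proof (cases "r = t")
    case True then show ?thesis using below_refl[OF assms] by (simp add: face_le_def)
  next
    case False
    then have "face_less X r t" using m that by auto
    then show ?thesis using face_less_iff[of r t] that cC assms by auto
  qed
  then show "c \<in> sd X (insert {} C) \<and> t \<in> c \<and> (\<forall>r\<in>c. face_le r t)" using c m by auto
next
  assume c: "c \<in> sd X (insert {} C) \<and> t \<in> c \<and> (\<forall>r\<in>c. face_le r t)"
  then have cC: "c \<subseteq> C" by (simp add: sd_iff)
  have "chain_max X c = t"
  proof (rule chain_maxI)
    fix r assume "r \<in> c"
    then show "r = t \<or> face_less X r t" using face_less_iff[of r t] c cC assms by auto
  qed (use c in auto)
  then show "c \<in> chains_with_max t" using c by (simp add: chains_with_max_def)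
qed

lemma chains_with_max_P: "c \<in> sd X (insert {} C) \<Longrightarrow> chain_max X c \<in> insert {} C"
proof (cases "c = {}")
  case False
  assume c: "c \<in> sd X (insert {} C)"
  then show ?thesis using chain_max_works[OF c False] by (auto simp: sd_iff)
qed (simp add: chain_max_def)

lemma face_le_cell_rank: "face_le a d \<Longrightarrow> a \<noteq> d \<Longrightarrow> cell_rank a < cell_rank d"
  using cell_poset.rk_less[OF cell_poset] .

lemma face_le_trans: "face_le a d \<Longrightarrow> face_le d e \<Longrightarrow> face_le a e"
  using cell_poset.le_trans[OF cell_poset] .

lemma face_le_P: "face_le a d \<Longrightarrow> a \<in> insert {} C \<and> d \<in> insert {} C"
  using cell_poset.le_P[OF cell_poset] .

lemma chains_with_max_card: assumes "t \<in> insert {} C" "c \<in> chains_with_max t" shows "card c \<le> cell_rank t"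
proof (cases "t = {}")
  case True
  then show ?thesis using assms(2) chains_with_max_empty by simp
next
  case False
  then have t: "t \<in> C" using assms by simp
  note c = assms(2)[unfolded chains_with_max_iff[OF t]]
  have cC: "c \<subseteq> C" using c by (simp add: sd_iff)
  have "inj_on cell_rank c"
  proof (rule inj_onI, rule ccontr)
    fix a d assume ad: "a \<in> c" "d \<in> c" "cell_rank a = cell_rank d" "a \<noteq> d"
    then have "face_le a d \<or> face_le d a" using c by (auto simp: sd_iff)
    then show False using face_le_cell_rank[of a d] face_le_cell_rank[of d a] ad by auto
  qed
  moreover have "cell_rank ` c \<subseteq> {1..cell_rank t}"
  proof
    fix k assume "k \<in> cell_rank ` c"
    then obtain r where r: "r \<in> c" "k = cell_rank r" by auto
    then have "r \<noteq> {}" using cC empty_C by auto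
    moreover have "cell_rank r \<le> cell_rank t" using face_le_cell_rank[of r t] c r(1) by (cases "r = t") auto
    ultimately show "k \<in> {1..cell_rank t}" using r by (simp add: cell_rank_def)
  qed
  ultimately show ?thesis using card_inj_on_le[of cell_rank c "{1..cell_rank t}"] by simp
qed

lemma chains_with_max_insert:
  assumes t: "t \<in> C" and r: "face_le r t" "r \<noteq> t" and c: "c \<in> chains_with_max r"
  shows "t \<notin> c" "insert t c \<in> chains_with_max t"
proof -
  have sdc: "c \<in> sd X (insert {} C)" using c by (simp add: chains_with_max_def)
  have ct: "face_le s r" if "s \<in> c" for s
  proof (cases "r = {}")
    case True then show ?thesis using c chains_with_max_empty that by auto
  next
    case False
    then have "r \<in> C" using face_le_P[OF r(1)] by simp
    then show ?thesis using c that by (simp add: chains_with_max_iff)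
  qed
  show "t \<notin> c"
  proof
    assume "t \<in> c"
    then show False using face_le_cell_rank[OF r] ct[of t] face_le_cell_rank[of t r] r(2) by fastforce
  qed
  have "insert t c \<in> sd X (insert {} C)" using sdc t ct face_le_trans[OF _ r(1)] by (auto simp: sd_iff)
  moreover have "face_le t t" using below_refl[OF t] by (simp add: face_le_def)
  ultimately show "insert t c \<in> chains_with_max t"
    using ct face_le_trans[OF _ r(1)] by (auto simp: chains_with_max_iff[OF t])
qed

lemma chains_with_max_remove:
  assumes t: "t \<in> C" and c: "c \<in> chains_with_max t"
  obtains r where "face_le r t" "r \<noteq> t" "c - {t} \<in> chains_with_max r"
proof -
  note c' = c[unfolded chains_with_max_iff[OF t]]
  have sdc: "c - {t} \<in> sd X (insert {} C)" using c' by (auto simp: sd_iff)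
  let ?r = "chain_max X (c - {t})"
  have m: "c - {t} \<in> chains_with_max ?r" using sdc by (simp add: chains_with_max_def)
  show thesis
  proof (cases "c - {t} = {}")
    case True
    then have "?r = {}" unfolding True by (simp add: chain_max_def)
    then show thesis using that[of ?r] m t empty_C by (auto simp: face_le_def)
  next
    case False
    have "?r \<in> c - {t}" using chain_max_works[OF sdc False] by simp
    then show thesis using that[of ?r] m c' by auto
  qed
qed

lemma flag_poly_empty: "flag_poly {} = 1"
  by (simp add: flag_poly_def chains_with_max_empty cell_rank_def)

lemma chains_with_max_rec:
  assumes t: "t \<in> C"
  shows "chains_with_max t = insert t ` (\<Union>r\<in>{r. face_le r t \<and> r \<noteq> t}. chains_with_max r)"
    "inj_on (insert t) (\<Union>r\<in>{r. face_le r t \<and> r \<noteq> t}. chains_with_max r)"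
proof -
  let ?M = "\<Union>r\<in>{r. face_le r t \<and> r \<noteq> t}. chains_with_max r"
  show "chains_with_max t = insert t ` ?M"
  proof (intro equalityI subsetI)
    fix c assume c: "c \<in> chains_with_max t"
    obtain r where r: "face_le r t" "r \<noteq> t" "c - {t} \<in> chains_with_max r"
      using chains_with_max_remove[OF t c] .
    moreover have "t \<in> c" using c by (simp add: chains_with_max_iff[OF t])
    then have "c = insert t (c - {t})" by auto
    ultimately show "c \<in> insert t ` ?M" by blast
  qed (use chains_with_max_insert(2)[OF t] in auto)
  have "t \<notin> c" if "c \<in> ?M" for c using that chains_with_max_insert(1)[OF t] by auto
  then show "inj_on (insert t) ?M" by (intro inj_onI) (metis insert_ident)
qed

lemma flag_poly_insert_term:
  assumes t: "t \<in> C" and r: "face_le r t" "r \<noteq> t" and c: "c \<in> chains_with_max r"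
  shows "pX ^ card (insert t c) * pY ^ (cell_rank t - card (insert t c)) =
    pX * (pX ^ card c * pY ^ (cell_rank r - card c) * pY ^ (cell_rank t - 1 - cell_rank r))"
proof -
  have "c \<subseteq> C" using c by (simp add: chains_with_max_def sd_iff)
  then have "finite c" using finite_subset finite_C by blast
  then have card: "card (insert t c) = Suc (card c)" using chains_with_max_insert(1)[OF t r c] by simp
  have "card c \<le> cell_rank r" "cell_rank r < cell_rank t"
    using chains_with_max_card[OF _ c] face_le_P[OF r(1)] face_le_cell_rank[OF r] by auto
  then have rank: "cell_rank t - Suc (card c) = (cell_rank r - card c) + (cell_rank t - 1 - cell_rank r)"
    by simp
  show ?thesis unfolding card rank power_add power_Suc by (simp only: mult.assoc)
qed

lemma flag_poly_rec:
  assumes t: "t \<in> C"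
  shows "flag_poly t = pX * (\<Sum>r | face_le r t \<and> r \<noteq> t. flag_poly r * pY ^ (cell_rank t - 1 - cell_rank r))"
proof -
  let ?R = "{r. face_le r t \<and> r \<noteq> t}"
  have finR: "finite ?R" by (rule finite_subset[of _ "insert {} C"]) (use face_le_P finite_C in auto)
  have "flag_poly t = (\<Sum>c\<in>(\<Union>r\<in>?R. chains_with_max r). pX ^ card (insert t c) * pY ^ (cell_rank t - card (insert t c)))"
    unfolding flag_poly_def chains_with_max_rec(1)[OF t] sum.reindex[OF chains_with_max_rec(2)[OF t]]
      by (simp only: o_def)
  also have "\<dots> = (\<Sum>r\<in>?R. \<Sum>c\<in>chains_with_max r. pX ^ card (insert t c) * pY ^ (cell_rank t - card (insert t c)))"
    using finR finite_chains_with_max by (intro sum.UNION_disjoint) (auto simp: chains_with_max_def)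
  also have "\<dots> = (\<Sum>r\<in>?R. pX * (flag_poly r * pY ^ (cell_rank t - 1 - cell_rank r)))"
    unfolding flag_poly_def sum_distrib_left sum_distrib_right
      using flag_poly_insert_term[OF t] by (intro sum.cong refl) auto
  also have "\<dots> = pX * (\<Sum>r\<in>?R. flag_poly r * pY ^ (cell_rank t - 1 - cell_rank r))"
    by (rule sum_distrib_left[symmetric])
  finally show ?thesis .
qed

lemma full_chain: "t \<in> insert {} C \<Longrightarrow> \<exists>c\<in>chains_with_max t. card c = cell_rank t"
proof (induction "cell_rank t" arbitrary: t rule: less_induct)
  case less
  show ?case
  proof (cases "t = {}")
    case True then show ?thesis by (simp add: chains_with_max_empty cell_rank_def)
  next
    case False
    then have t: "t \<in> C" using less.prems by simp
    obtain r where r: "face_le r t" "cell_rank t = Suc (cell_rank r)"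
      using cell_poset.obtain_facet[OF cell_poset less.prems False] .
    have rt: "r \<noteq> t" using r(2) by auto
    obtain c where c: "c \<in> chains_with_max r" "card c = cell_rank r"
      using less.hyps[of r] r face_le_P[OF r(1)] by auto
    have "c \<subseteq> C" using c by (simp add: chains_with_max_def sd_iff)
    then have "finite c" using finite_subset finite_C by blast
    then have "card (insert t c) = cell_rank t"
      using chains_with_max_insert(1)[OF t r(1) rt c(1)] c(2) r(2) by simp
    then show ?thesis using chains_with_max_insert(2)[OF t r(1) rt c(1)] by blast
  qed
qed

end

lemma
  assumes "Hausdorff_space X" "B \<subseteq> topspace X" and \<Phi>: "homeomorphic_map (unit_ball n) (subtopology X B) \<Phi>"
  shows cell_of_ball: "cell X n (\<Phi> ` unit_ball_interior n) \<Phi>" and cl_of_ball: "cell.cl n \<Phi> = B"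
    and ball_boundary_eq_fr: "ball_boundary n (subtopology X B) = cell.fr n \<Phi>"
proof -
  have cell: "cell X n (h ` unit_ball_interior n) h" and cl: "cell.cl n h = B"
    if h: "homeomorphic_map (unit_ball n) (subtopology X B) h" for h
  proof -
    have im: "h ` ball_set n = B" using homeomorphic_imp_surjective_map[OF h] assms(2) by auto
    then show c: "cell X n (h ` unit_ball_interior n) h"
      using h assms(1) by (simp add: cell_def characteristic_map_def embedding_map_def)
    show "cell.cl n h = B" unfolding cell.cl_def[OF c] im ..
  qed
  show "cell X n (\<Phi> ` unit_ball_interior n) \<Phi>" "cell.cl n \<Phi> = B" by (rule cell[OF \<Phi>], rule cl[OF \<Phi>])
  interpret c: cell X n "\<Phi> ` unit_ball_interior n" \<Phi> by (rule cell[OF \<Phi>])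
  show "ball_boundary n (subtopology X B) = c.fr"
  proof (intro equalityI subsetI)
    fix x assume "x \<in> ball_boundary n (subtopology X B)"
    then obtain h where h: "homeomorphic_map (unit_ball n) (subtopology X B) h" "x \<in> h ` unit_ball_boundary n"
      unfolding ball_boundary_def by blast
    interpret d: cell X n "h ` unit_ball_interior n" h by (rule cell[OF h(1)])
    have eq: "d.cl = c.cl" using cl[OF h(1)] cl[OF \<Phi>] by simp
    have x: "x \<in> d.fr" using h(2) by (simp add: d.fr_def)
    then have "x \<in> c.cl" "\<not> x \<in> \<Phi> ` unit_ball_interior n"
      using d.fr_cl d.rel_acyclic_cl_minus[OF x] c.not_rel_acyclic_minus_e[of x] unfolding eq by blast+
    then show "x \<in> c.fr" unfolding c.cl_eq by blast
  next
    fix x assume "x \<in> c.fr"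
    then show "x \<in> ball_boundary n (subtopology X B)" using \<Phi> unfolding ball_boundary_def c.fr_def by blast
  qed
qed

lemma h_poly_sum_faces:
  assumes fin: "finite D" and max: "Max (card ` D) = n"
  shows "h_poly D = (\<Sum>c\<in>D. pX ^ card c * pY ^ (n - card c))"
proof -
  have "h_poly D = (\<Sum>i=0..n. \<Sum>c | c \<in> D \<and> card c = i. pX ^ card c * pY ^ (n - card c))"
    unfolding h_poly_def Let_def max
  proof (rule sum.cong[OF refl])
    fix i
    have "(\<Sum>c | c \<in> D \<and> card c = i. pX ^ card c * pY ^ (n - card c)) = (\<Sum>c | c \<in> D \<and> card c = i. pX ^ i * pY ^ (n - i))"
      by (rule sum.cong) auto
    then show "of_nat (card {G \<in> D. card G = i}) * pX ^ i * pY ^ (n - i) =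
      (\<Sum>c | c \<in> D \<and> card c = i. pX ^ card c * pY ^ (n - card c))"
      by (simp only: sum_constant mult.assoc)
  qed
  also have "\<dots> = (\<Sum>c\<in>D. pX ^ card c * pY ^ (n - card c))"
    using fin by (intro sum.group) (auto simp flip: max)
  finally show ?thesis .
qed

locale subdivision = regular_CW X C cell_dim
  for X :: "'a topology" and C cell_dim +
  fixes V :: "'v set" and \<sigma> :: "'a set \<Rightarrow> 'v set"
  assumes subdiv: "CW_regular_subdivision V X C \<sigma>" and finV: "finite V"
begin

definition cells_over :: "'v set \<Rightarrow> 'a set set" where "cells_over F = {e \<in> C. \<sigma> e \<subseteq> F}"

lemma R_eq: "F \<subseteq> V \<Longrightarrow> restriction C \<sigma> F = insert {} (cells_over F)"
  and R_closed: "F \<subseteq> V \<Longrightarrow> e \<in> cells_over F \<Longrightarrow> X closure_of e \<subseteq> \<Union>(cells_over F)"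
  and sigma_empty: "\<sigma> {} = {}"
proof -
  have sc: "subcomplex X C (restriction C \<sigma> F)" if "F \<subseteq> V" for F
    using subdiv that by (simp add: CW_regular_subdivision_def)
  have "{} \<in> restriction C \<sigma> {}" using sc[of "{}"] by (simp add: subcomplex_def)
  then show s: "\<sigma> {} = {}" by (simp add: restriction_def)
  show R: "restriction C \<sigma> F = insert {} (cells_over F)" if "F \<subseteq> V" for F
    using s empty_C by (auto simp: restriction_def face_poset_def cells_over_def)
  show "X closure_of e \<subseteq> \<Union>(cells_over F)" if "F \<subseteq> V" "e \<in> cells_over F"
  proof -
    have "\<forall>t\<in>insert {} (cells_over F). X closure_of t \<subseteq> \<Union>(insert {} (cells_over F))"
      using sc[OF that(1)] unfolding R[OF that(1)] subcomplex_def by (elim conjE)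
    then show ?thesis using that(2) by simp
  qed
qed

lemma boundary_cells_cells_over: assumes F: "F \<subseteq> V"
  and e: "e \<in> cells_over F" shows "boundary_cells e \<subseteq> cells_over F"
proof
  fix d assume d: "d \<in> boundary_cells e"
  have dC: "d \<in> C" using d boundary_cells_subset by blast
  obtain x where x: "x \<in> d" using cell_ne[OF dC] by auto
  then have "x \<in> \<Union>(cells_over F)" using d R_closed[OF F e] by (auto simp: boundary_cells_def)
  then obtain e' where e': "e' \<in> cells_over F" "x \<in> e'" by auto
  then have "e' = d" using cell_eq[of e' d x] dC x by (simp add: cells_over_def)
  then show "d \<in> cells_over F" using e' by simp
qed

lemma regular_CW_cells_over: assumes F: "F \<subseteq> V" shows "regular_CW X (cells_over F) cell_dim"
proof
  have CC: "cells_over F \<subseteq> C" by (auto simp: cells_over_def)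
  show "Hausdorff_space X" by (rule hausdorff)
  show "finite (cells_over F)" by (rule finite_subset[OF CC finite_C])
  show "disjoint (cells_over F)" using disjoint_C CC by (auto simp: disjoint_def)
  show "\<exists>\<Phi>. characteristic_map X (cell_dim e) e \<Phi>" if "e \<in> cells_over F" for e
    using cells[of e] that CC by blast
  show "\<exists>D\<subseteq>cells_over F. X closure_of e - e = \<Union>D \<and> (\<forall>d\<in>D. cell_dim d < cell_dim e)" if "e \<in> cells_over F"
    for e
  proof -
    have eC: "e \<in> C" using that CC by blast
    show ?thesis
      using boundary_cells_cells_over[OF F that] Union_boundary_cells[OF eC] boundary_cells_cell_dim[OF eC]
      by (intro exI[of _ "boundary_cells e"]) simp
  qed
qed

lemma face_le_cells_over:
  assumes F: "F \<subseteq> V" and a: "a \<in> insert {} (cells_over F)"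
  shows "regular_CW.face_le X (cells_over F) d a \<longleftrightarrow> face_le d a"
proof -
  interpret r: regular_CW X "cells_over F" cell_dim by (rule regular_CW_cells_over[OF F])
  have CC: "cells_over F \<subseteq> C" by (auto simp: cells_over_def)
  have dn: "d \<in> cells_over F" if "below d a"
    using that a boundary_cells_cells_over[OF F, of a] empty_C by (auto simp: below_def)
  have "r.below d a \<longleftrightarrow> below d a"
  proof (cases "d \<in> cells_over F \<and> a \<in> cells_over F")
    case True
    then show ?thesis using r.below_closure[of d a] below_closure[of d a] CC by auto
  next
    case False
    then show ?thesis using dn a empty_C by (auto simp: r.below_def below_def)
  qed
  then show ?thesis using a CC by (auto simp: r.face_le_def face_le_def)
qed

lemma cells_over_empty: "cells_over {} = {}"
proof -
  have "is_ball (int (card ({}::'v set)) - 1) (subtopology X (\<Union>(restriction C \<sigma> {})))"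
    using subdiv unfolding CW_regular_subdivision_def by blast
  then have "topspace (subtopology X (\<Union>(insert {} (cells_over {})))) = {}"
    using R_eq[of "{}"] by (simp add: is_ball_def)
  moreover have "\<Union>(cells_over {}) \<subseteq> topspace X"
  proof -
    interpret r: regular_CW X "cells_over {}" cell_dim by (rule regular_CW_cells_over) simp
    show ?thesis by (rule r.face_closed_topspace[OF r.face_closed_C])
  qed
  ultimately have "\<Union>(cells_over {}) = {}" by auto
  then show ?thesis using cell_ne by (auto simp: cells_over_def)
qed

lemma ball_cells_over:
  assumes F: "F \<subseteq> V" "F \<noteq> {}"
  obtains b \<Phi> where "ball_CW X (cells_over F) cell_dim (card F - 1) b \<Phi>"
    "ball_CW.bd_cells (cells_over F) (card F - 1) \<Phi> = {e \<in> C. \<sigma> e \<subset> F}" "ball_CW.int_cells (cells_over F) (card F - 1) \<Phi> = {e \<in> C. \<sigma> e = F}"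
proof -
  interpret r: regular_CW X "cells_over F" cell_dim by (rule regular_CW_cells_over[OF F(1)])
  define n where "n = card F - 1"
  let ?B = "\<Union>(cells_over F)"
  have finF: "finite F" using finite_subset[OF F(1) finV] .
  then have cF: "0 < card F" using F(2) by (simp add: card_gt_0_iff)
  then have int_n: "int (card F) - 1 = int n" by (simp add: n_def)
  have BX: "?B \<subseteq> topspace X" by (rule r.face_closed_topspace[OF r.face_closed_C])
  have UR: "\<Union>(restriction C \<sigma> F) = ?B" using R_eq[OF F(1)] by simp
  have "is_ball (int (card F) - 1) (subtopology X (\<Union>(restriction C \<sigma> F)))"
    using subdiv F(1) unfolding CW_regular_subdivision_def by blast
  then have "unit_ball n homeomorphic_space subtopology X ?B" unfolding UR int_n by (simp add: is_ball_def)
  then obtain \<Phi> where \<Phi>: "homeomorphic_map (unit_ball n) (subtopology X ?B) \<Phi>"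
    unfolding homeomorphic_space_def homeomorphic_map_maps by blast
  let ?b = "\<Phi> ` unit_ball_interior n"
  note ball = cell_of_ball[OF hausdorff BX \<Phi>] cl_of_ball[OF hausdorff BX \<Phi>] ball_boundary_eq_fr[OF hausdorff BX \<Phi>]
  have w: "ball_CW X (cells_over F) cell_dim n ?b \<Phi>"
    by (intro ball_CW.intro ball_CW_axioms.intro regular_CW_cells_over[OF F(1)] ball(1,2))
  interpret w: ball_CW X "cells_over F" cell_dim n ?b \<Phi> by (rule w)
  have "{e \<in> C. \<sigma> e = F} = {\<tau> \<in> face_poset C. \<sigma> \<tau> = F}" using sigma_empty F(2) by (auto simp: face_poset_def)
  also have "\<dots> = interior_cells X (int (card F) - 1) (restriction C \<sigma> F)"
    using subdiv F(1) unfolding CW_regular_subdivision_def by blast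
  also have "\<dots> = {\<tau> \<in> insert {} (cells_over F). \<not> \<tau> \<subseteq> w.ball.fr}"
    unfolding interior_cells_def int_n UR R_eq[OF F(1)] nat_int by (simp add: ball(3))
  also have "\<dots> = w.int_cells" unfolding w.int_cells_def by auto
  finally have int_cells: "w.int_cells = {e \<in> C. \<sigma> e = F}" ..
  have "w.bd_cells = cells_over F - w.int_cells" using w.C_split by auto
  then have bd_cells: "w.bd_cells = {e \<in> C. \<sigma> e \<subset> F}" unfolding int_cells by (auto simp: cells_over_def)
  show thesis by (rule that[OF w[unfolded n_def] bd_cells[unfolded n_def] int_cells[unfolded n_def]])
qed

lemma ball_cells_over_ex:
  assumes F: "F \<subseteq> V" "F \<noteq> {}"
  shows "\<exists>b \<Phi>. ball_CW X (cells_over F) cell_dim (card F - 1) b \<Phi>"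
proof -
  obtain b \<Phi> where "ball_CW X (cells_over F) cell_dim (card F - 1) b \<Phi>"
    and "ball_CW.bd_cells (cells_over F) (card F - 1) \<Phi> = {e \<in> C. \<sigma> e \<subset> F}"
      and "ball_CW.int_cells (cells_over F) (card F - 1) \<Phi> = {e \<in> C. \<sigma> e = F}"
    using ball_cells_over[OF F] .
  then show ?thesis by (intro exI)
qed

lemma cell_rank_le: assumes "t \<in> insert {} C" shows "cell_rank t \<le> card (\<sigma> t)"
proof (cases "t = {}")
  case False
  then have t: "t \<in> C" using assms by simp
  have sV: "\<sigma> t \<subseteq> V" using subdiv t unfolding CW_regular_subdivision_def face_poset_def by blast
  have tF: "t \<in> cells_over (\<sigma> t)" using t by (simp add: cells_over_def)
  then have ne: "\<sigma> t \<noteq> {}" using cells_over_empty by auto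
  obtain b \<Phi> where "ball_CW X (cells_over (\<sigma> t)) cell_dim (card (\<sigma> t) - 1) b \<Phi>"
    using ball_cells_over_ex[OF sV ne] by (elim exE)
  from ball_CW.cell_dim_le[OF this tF] have "cell_dim t \<le> card (\<sigma> t) - 1" .
  moreover have "0 < card (\<sigma> t)" using finite_subset[OF sV finV] ne by (simp add: card_gt_0_iff)
  ultimately show ?thesis using False by (simp add: cell_rank_def)
qed (simp add: cell_rank_def)

definition interior_poly :: "'v set \<Rightarrow> int poly" where
  "interior_poly F = (\<Sum>t | t \<in> insert {} C \<and> \<sigma> t = F. flag_poly t * pY ^ (card F - cell_rank t))"

lemma sum_interior_poly:
  assumes F: "F \<subseteq> V" and A: "A \<subseteq> Pow F" and k: "\<And>G. G \<in> A \<Longrightarrow> card G \<le> k"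
  shows "(\<Sum>G\<in>A. interior_poly G * pY ^ (k - card G))
    = (\<Sum>t | t \<in> insert {} C \<and> \<sigma> t \<in> A. flag_poly t * pY ^ (k - cell_rank t))"
proof -
  have "interior_poly G * pY ^ (k - card G) = (\<Sum>t | t \<in> insert {} C \<and> \<sigma> t = G. flag_poly t * pY ^ (k - cell_rank t))" if G: "G \<in> A" for G
    unfolding interior_poly_def sum_distrib_right
  proof (rule sum.cong[OF refl])
    fix t assume t: "t \<in> {t. t \<in> insert {} C \<and> \<sigma> t = G}"
    then have "k - cell_rank t = (card G - cell_rank t) + (k - card G)"
      using cell_rank_le[of t] k[OF G] by auto
    then show "flag_poly t * pY ^ (card G - cell_rank t) * pY ^ (k - card G) = flag_poly t * pY ^ (k - cell_rank t)"
      by (simp only: power_add mult.assoc)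
  qed
  then have "(\<Sum>G\<in>A. interior_poly G * pY ^ (k - card G))
    = (\<Sum>G\<in>A. \<Sum>t | t \<in> insert {} C \<and> \<sigma> t = G. flag_poly t * pY ^ (k - cell_rank t))"
    by (rule sum.cong[OF refl])
  also have "\<dots> = (\<Sum>G\<in>A. \<Sum>t | t \<in> {t \<in> insert {} C. \<sigma> t \<in> A} \<and> \<sigma> t = G. flag_poly t * pY ^ (k - cell_rank t))"
    by (intro sum.cong refl) auto
  also have "\<dots> = (\<Sum>t | t \<in> insert {} C \<and> \<sigma> t \<in> A. flag_poly t * pY ^ (k - cell_rank t))"
  proof (rule sum.group)
    show "finite {t. t \<in> insert {} C \<and> \<sigma> t \<in> A}" using finite_C by simp
    have "finite F" using finite_subset[OF F finV] .
    then show "finite A" using finite_subset[OF A] by simp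
  qed auto
  finally show ?thesis .
qed

lemma carrier_gamma:
  assumes F: "F \<subseteq> V" "F \<noteq> {}"
  shows "gamma_nonneg (card F) ((\<Sum>a | a \<in> C \<and> \<sigma> a = F. flag_poly a * pY ^ (card F - cell_rank a))
    - pX * (\<Sum>a\<in>insert {} {a \<in> C. \<sigma> a \<subset> F}. flag_poly a * pY ^ (card F - 1 - cell_rank a)))"
proof -
  have card_F: "0 < card F" using F finite_subset[OF F(1) finV] by (simp add: card_gt_0_iff)
  obtain b \<Phi> where w: "ball_CW X (cells_over F) cell_dim (card F - 1) b \<Phi>"
    and bd_cells: "ball_CW.bd_cells (cells_over F) (card F - 1) \<Phi> = {e \<in> C. \<sigma> e \<subset> F}"
      and int_cells: "ball_CW.int_cells (cells_over F) (card F - 1) \<Phi> = {e \<in> C. \<sigma> e = F}"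
    using ball_cells_over[OF F] .
  interpret w: ball_CW X "cells_over F" cell_dim "card F - 1" b \<Phi> by (rule w)
  have "gamma_nonneg (Suc (card F - 1)) ((\<Sum>a\<in>w.int_cells. flag_poly a * pY ^ (Suc (card F - 1) - cell_rank a))
    - pX * (\<Sum>a\<in>insert {} w.bd_cells. flag_poly a * pY ^ (card F - 1 - cell_rank a)))"
  proof (rule w.interior_gamma[of flag_poly, OF flag_poly_empty])
    fix a assume a: "a \<in> cells_over F"
    then have aC: "a \<in> C" by (simp add: cells_over_def)
    have "{d. w.face_le d a \<and> d \<noteq> a} = {d. face_le d a \<and> d \<noteq> a}"
      using face_le_cells_over[OF F(1), of a] a by auto
    then show "flag_poly a = pX * (\<Sum>d | w.face_le d a \<and> d \<noteq> a. flag_poly d * pY ^ (cell_rank a - 1 - cell_rank d))"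
      using flag_poly_rec[OF aC] by (simp only:)
  qed
  then show ?thesis unfolding bd_cells int_cells using card_F by simp
qed

theorem theta_gamma:
  assumes F: "F \<subseteq> V"
  shows "gamma_nonneg (card F) (interior_poly F - pX * (\<Sum>G | G \<subset> F. interior_poly G * pY ^ (card F - card G - 1)))"
proof (cases "F = {}")
  case True
  have "{t. t \<in> insert {} C \<and> \<sigma> t = {}} = {{}}"
    using cells_over_empty sigma_empty by (auto simp: cells_over_def)
  then have "interior_poly {} = 1" by (simp add: interior_poly_def flag_poly_empty cell_rank_def)
  then show ?thesis using True gamma_nonneg_1 by simp
next
  case False
  have "{t. t \<in> insert {} C \<and> \<sigma> t = F} = {a. a \<in> C \<and> \<sigma> a = F}" using sigma_empty False by auto
  then have "interior_poly F = (\<Sum>a | a \<in> C \<and> \<sigma> a = F. flag_poly a * pY ^ (card F - cell_rank a))"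
    by (simp add: interior_poly_def)
  moreover have "(\<Sum>G | G \<subset> F. interior_poly G * pY ^ (card F - card G - 1)) =
    (\<Sum>a\<in>insert {} {a \<in> C. \<sigma> a \<subset> F}. flag_poly a * pY ^ (card F - 1 - cell_rank a))"
  proof -
    have card_le: "card G \<le> card F - 1" if "G \<in> {G. G \<subset> F}" for G
      using psubset_card_mono[OF finite_subset[OF F finV], of G] that by auto
    have "(\<Sum>G | G \<subset> F. interior_poly G * pY ^ (card F - 1 - card G)) =
      (\<Sum>t | t \<in> insert {} C \<and> \<sigma> t \<in> {G. G \<subset> F}. flag_poly t * pY ^ (card F - 1 - cell_rank t))"
      by (rule sum_interior_poly[OF F _ card_le]) auto
    moreover have "{t. t \<in> insert {} C \<and> \<sigma> t \<in> {G. G \<subset> F}} = insert {} {a \<in> C. \<sigma> a \<subset> F}"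
      using sigma_empty False by auto
    ultimately show ?thesis by (simp only: diff_commute)
  qed
  ultimately show ?thesis using carrier_gamma[OF F False] by simp
qed

lemma sd_restriction_eq: "F \<subseteq> V \<Longrightarrow> sd X (restriction C \<sigma> F) = {c \<in> sd X (insert {} C). \<sigma> (chain_max X c) \<subseteq> F}"
  using sd_restriction[OF subdiv] by (simp add: face_poset_def sd_carrier_def)

lemma card_le_cell_rank_chain_max: "c \<in> sd X (insert {} C) \<Longrightarrow> card c \<le> cell_rank (chain_max X c)"
  using chains_with_max_card[OF chains_with_max_P] by (simp add: chains_with_max_def)

lemma full_chain_restriction:
  assumes F: "F \<subseteq> V" shows "\<exists>c\<in>sd X (restriction C \<sigma> F). card c = card F"
proof (cases "F = {}")
  case True
  have "{} \<in> sd X (restriction C \<sigma> F)"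
    unfolding sd_restriction_eq[OF F] by (simp add: sd_iff chain_max_def sigma_empty)
  then show ?thesis using True by (intro bexI[of _ "{}"]) auto
next
  case False
  then have card_F: "0 < card F" using finite_subset[OF F finV] by (simp add: card_gt_0_iff)
  obtain b \<Phi> where "ball_CW X (cells_over F) cell_dim (card F - 1) b \<Phi>"
    using ball_cells_over_ex[OF F False] by (elim exE)
  from ball_CW.exists_top[OF this] obtain e where e: "e \<in> cells_over F" "cell_dim e = card F - 1" ..
  have eC: "e \<in> C" "\<sigma> e \<subseteq> F" using e by (auto simp: cells_over_def)
  then have "cell_rank e = card F" using e(2) empty_C card_F by (auto simp: cell_rank_def)
  moreover obtain c where c: "c \<in> chains_with_max e" "card c = cell_rank e" using full_chain[of e] eC by auto
  moreover have "c \<in> sd X (restriction C \<sigma> F)"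
    unfolding sd_restriction_eq[OF F] using c(1) eC by (simp add: chains_with_max_def)
  ultimately show ?thesis by auto
qed

lemma Max_card_sd_restriction:
  assumes F: "F \<subseteq> V" shows "Max (card ` sd X (restriction C \<sigma> F)) = card F"
proof (rule Max_eqI)
  have finF: "finite F" using finite_subset[OF F finV] .
  show "finite (card ` sd X (restriction C \<sigma> F))" unfolding sd_restriction_eq[OF F] using finite_sd by simp
  show "card F \<in> card ` sd X (restriction C \<sigma> F)" using full_chain_restriction[OF F] by force
  fix k assume "k \<in> card ` sd X (restriction C \<sigma> F)"
  then obtain c where k: "k = card c" and c: "c \<in> sd X (insert {} C)" "\<sigma> (chain_max X c) \<subseteq> F"
    unfolding sd_restriction_eq[OF F] by blast
  have "k \<le> card (\<sigma> (chain_max X c))"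
    using k card_le_cell_rank_chain_max[OF c(1)] cell_rank_le[OF chains_with_max_P[OF c(1)]] by simp
  also have "\<dots> \<le> card F" by (rule card_mono[OF finF c(2)])
  finally show "k \<le> card F" .
qed

lemma h_poly_cells_over:
  assumes F: "F \<subseteq> V"
  shows "h_poly (sd X (restriction C \<sigma> F)) = (\<Sum>G\<in>Pow F. interior_poly G * pY ^ (card F - card G))"
proof -
  let ?D = "sd X (restriction C \<sigma> F)" and ?R = "{t. t \<in> insert {} C \<and> \<sigma> t \<in> Pow F}"
  have finF: "finite F" using finite_subset[OF F finV] .
  note D = sd_restriction_eq[OF F]
  have finD: "finite ?D" unfolding D using finite_sd by simp
  have "h_poly ?D = (\<Sum>c\<in>?D. pX ^ card c * pY ^ (card F - card c))"
    by (rule h_poly_sum_faces[OF finD Max_card_sd_restriction[OF F]])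
  also have "\<dots> = (\<Sum>t\<in>?R. \<Sum>c | c \<in> ?D \<and> chain_max X c = t. pX ^ card c * pY ^ (card F - card c))"
    by (rule sum.group[OF finD, symmetric]) (use finite_C chains_with_max_P in \<open>auto simp: D\<close>)
  also have "\<dots> = (\<Sum>t\<in>?R. flag_poly t * pY ^ (card F - cell_rank t))"
  proof (rule sum.cong[OF refl])
    fix t assume t: "t \<in> ?R"
    have fibre: "{c. c \<in> ?D \<and> chain_max X c = t} = chains_with_max t"
      using t unfolding D chains_with_max_def by auto
    have rank: "cell_rank t \<le> card F" using cell_rank_le[of t] card_mono[OF finF, of "\<sigma> t"] t by auto
    show "(\<Sum>c | c \<in> ?D \<and> chain_max X c = t. pX ^ card c * pY ^ (card F - card c))
      = flag_poly t * pY ^ (card F - cell_rank t)"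
      unfolding fibre flag_poly_def sum_distrib_right
    proof (rule sum.cong[OF refl])
      fix c assume c: "c \<in> chains_with_max t"
      have "card c \<le> cell_rank t" using chains_with_max_card[OF _ c] t by simp
      then have "card F - card c = (cell_rank t - card c) + (card F - cell_rank t)" using rank by simp
      then show "pX ^ card c * pY ^ (card F - card c)
        = pX ^ card c * pY ^ (cell_rank t - card c) * pY ^ (card F - cell_rank t)"
        by (simp only: power_add mult.assoc)
    qed
  qed
  also have "\<dots> = (\<Sum>G\<in>Pow F. interior_poly G * pY ^ (card F - card G))"
    by (rule sum_interior_poly[OF F subset_refl, symmetric]) (use finF in \<open>auto intro: card_mono\<close>)
  finally show ?thesis .
qed

theorem local_h_gamma_nonneg:
  "gamma_nonneg (card V) (local_h_poly V (sd X (face_poset C)) (sd_carrier X \<sigma>))"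
proof -
  have "local_h_poly V (sd X (face_poset C)) (sd_carrier X \<sigma>) =
    (\<Sum>F\<in>Pow V. (-1) ^ (card V - card F) * (\<Sum>G\<in>Pow F. interior_poly G * pY ^ (card F - card G)))"
    unfolding local_h_poly_sd[OF subdiv] using h_poly_cells_over by (intro sum.cong refl) simp
  then show ?thesis using alternating_sum_gamma_nonneg[OF finV theta_gamma] by simp
qed

end

theorem theorem1p3:
  fixes V :: "'v set" and d :: nat
    and X :: "'a topology" and C :: "'a set set" and \<sigma> :: "'a set \<Rightarrow> 'v set"
  assumes "finite V" and "V \<noteq> {}" and "card V = d"
    and "CW_regular_subdivision V X C \<sigma>"
  shows "(\<exists>\<xi>. is_local_gamma_vector d
                 (local_h_poly V (sd X (face_poset C)) (sd_carrier X \<sigma>)) \<xi>) \<and>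
         (\<forall>\<xi>. is_local_gamma_vector d
                 (local_h_poly V (sd X (face_poset C)) (sd_carrier X \<sigma>)) \<xi> \<longrightarrow>
               (\<forall>k\<le>d div 2. 0 \<le> \<xi> k))"
proof -
  let ?l = "local_h_poly V (sd X (face_poset C)) (sd_carrier X \<sigma>)"
  have "finite_regular_CW X C" using assms(4) by (simp add: CW_regular_subdivision_def)
  then obtain cell_dim where cell_dim: "regular_CW X C cell_dim" by (rule finite_regular_CW_imp_regular_CW)
  have "subdivision X C cell_dim V \<sigma>"
    by (intro subdivision.intro subdivision_axioms.intro cell_dim assms(1,4))
  from subdivision.local_h_gamma_nonneg[OF this]
  have gamma: "gamma_nonneg d ?l" using assms(3) by simp
  obtain \<xi> where \<xi>: "\<forall>k. 0 \<le> \<xi> k" "?l = (\<Sum>k=0..d div 2. of_int (\<xi> k) * pX ^ k * pZ ^ (d - 2 * k))"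
    using gamma_nonneg_imp_coeffs[OF gamma] by blast
  show ?thesis
  proof (intro conjI allI impI)
    show "\<exists>\<xi>. is_local_gamma_vector d ?l \<xi>" unfolding is_local_gamma_vector_def using \<xi>(2) by blast
    fix \<eta> k assume \<eta>: "is_local_gamma_vector d ?l \<eta>" and k: "k \<le> d div 2"
    have "\<eta> k = \<xi> k"
      by (rule gamma_coeffs_unique[OF _ k]) (use \<eta> \<xi>(2) in \<open>simp add: is_local_gamma_vector_def\<close>)
    then show "0 \<le> \<eta> k" using \<xi>(1) by simp
  qed
qed

end
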